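(* Let $\alpha>1$, $N\ge0$ an integer and $[\nu]=(\nu_1,\dots,\nu_H)$ a partition of $N$. There exists $p_0>0$ such that for every $p\ge p_0$ there is a unique purely real and normalised solution $Q$ of the BAE (with parameters $\alpha,p$) whose set of hole-numbers equals $\mathbb{H}_{[\nu]}$. Moreover, let $\omega_H=A\left(p-\frac{H}{\sqrt{2(1+\alpha)}}\right)^{\frac{2\alpha}{1+\alpha}}$, $l(x)=l(x;\omega_H,p)$, and for $k\in\mathbb{Z}_p\setminus\mathbb{H}_{[\nu]}$ let $\hat x_k=\hat x_k(p)\ge\omega_H$ satisfy $l(\hat x_k)=k+\frac12$. Then the roots $x_k=x_k(p)$, $k\in\mathbb{Z}_p\setminus\mathbb{H}_{[\nu]}$, of $Q$ satisfy: (i) there is a bounded function $C:[0,+\infty)\to[0,+\infty)$ with $C(y)=O(y^{-2+\varepsilon})$ as $y\to+\infty$ for every $\varepsilon>0$, and a constant $M>0$, such that $\left|\frac{x_k(p)}{\hat x_k(p)}-1\right|\le M\,C(k/p)\,p^{-2}$ for all $p\ge p_0$ and $k\in\mathbb{Z}_p\setminus\mathbb{H}_{[\nu]}$; (ii) for each fixed $k$, $\left|x_k(p)\,p^{-\frac{2\alpha}{1+\alpha}}-A\left[1+\frac{\sqrt2\,\alpha}{(1+\alpha)^{3/2}}\left(k+\frac12\right)p^{-1}\right]\right|\le C_kp^{-2}$ for some constant $C_k$ and all $p\ge p_0$.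
   Context: Fix $\alpha>1$, $p\ge0$. A solution of the BAE is an entire function $Q$ of order $\frac{1+\alpha}{2\alpha}$ with simple zeros such that $e^{-4\pi ip}Q(xe^{-\frac{2\pi i}{1+\alpha}})/Q(xe^{\frac{2\pi i}{1+\alpha}})=-1$ whenever $Q(x)=0$; purely real if all zeros are real positive; normalised if $Q(0)=1$ and $\lim_{x\to\infty}x^{-\frac{1+\alpha}{2\alpha}}n_Q(x)=1$ ($n_Q(x)$ = number of zeros in $[0,x]$). Associated function $z(x)=-2p+\frac1{2\pi i}\log\frac{Q(xe^{-2\pi i/(1+\alpha)})}{Q(xe^{2\pi i/(1+\alpha)})}$, branch with $z(0)=-2p$ (strictly increasing, $\to+\infty$). $\mathbb{Z}_p=\{k\in\mathbb{Z}:k\ge-2p-\frac12\}$; $x_k$ is the unique point with $z(x_k)=k+\frac12$; hole-numbers $\mathbb{H}=\{k\in\mathbb{Z}_p:Q(x_k)\ne0\}$; the roots of $Q$ are exactly the $x_k$, $k\in\mathbb{Z}_p\setminus\mathbb{H}$. For a partition $[\nu]$ of $N$ with parts written in nondecreasing order $1\le\nu_1\le\dots\le\nu_H$, $\mathbb{H}_{[\nu]}=\{k\in\mathbb{Z}_p:k<-H\}\cup\{-H+\nu_l+(l-1):l=1,\dots,H\}$. Let $\rho=\frac{\alpha+1}\alpha\alpha^{\frac1{\alpha+1}}$, $V(u;x)=xu^2-u^{2\alpha+2}-1$, $S(x)=\frac1\pi\int_{u_1(x)}^{u_2(x)}\sqrt{V(u;x)}\frac{du}u$ for $x>\rho$ with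 $0<u_1<u_2$ the positive zeros of $V(\cdot;x)$, $S=0$ on $[0,\rho]$; $\tau(\xi)=2(1+\alpha)S(\rho\xi)$; $D=\xi\frac d{d\xi}$; $A=(1+\alpha)\left(\frac1{\sqrt{\pi\alpha}}\frac{\Gamma(\frac1{2\alpha})}{\Gamma(\frac{1+\alpha}{2\alpha})}\right)^{\frac{2\alpha}{\alpha+1}}$; $l(x;\omega,p)=p\tau(\frac x\omega)-\frac{2\alpha}{1+\alpha}\left[p-(\frac\omega A)^{\frac{1+\alpha}{2\alpha}}\right](D\tau)(\frac x\omega)$, $x\ge\omega$, the unique solution of $l(x)=-2p+\int_\omega^\infty K_\alpha(\frac xy)l(y)\frac{dy}y$ with $x^{-\frac{1+\alpha}{2\alpha}}l(x)\to1$, where $K_\alpha(x)=\frac{\sin(\frac{2\pi}{1+\alpha})}\pi\frac{x}{1+x^2-2x\cos(\frac{2\pi}{1+\alpha})}$. *)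

theory Defs
  imports "HOL-Complex_Analysis.Complex_Analysis" "HOL-Library.Landau_Symbols"
begin

definition entire_of_order :: "(complex \<Rightarrow> complex) \<Rightarrow> real \<Rightarrow> bool" where
  "entire_of_order Q \<rho> \<longleftrightarrow> Q holomorphic_on UNIV \<and>
     (\<forall>\<mu>>\<rho>. eventually (\<lambda>r. \<forall>z. norm z = r \<longrightarrow> norm (Q z) \<le> exp (r powr \<mu>)) at_top) \<and>
     (\<forall>\<mu><\<rho>. \<not> eventually (\<lambda>r. \<forall>z. norm z = r \<longrightarrow> norm (Q z) \<le> exp (r powr \<mu>)) at_top)"

definition rot :: "real \<Rightarrow> complex" where
  "rot \<alpha> = exp (\<i> * complex_of_real (2 * pi / (1 + \<alpha>)))"

definition bae_solution :: "real \<Rightarrow> real \<Rightarrow> (complex \<Rightarrow> complex) \<Rightarrow> bool" where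
  "bae_solution \<alpha> p Q \<longleftrightarrow> entire_of_order Q ((1 + \<alpha>) / (2 * \<alpha>)) \<and>
     (\<forall>z. Q z = 0 \<longrightarrow> deriv Q z \<noteq> 0) \<and>
     (\<forall>x. Q x = 0 \<longrightarrow>
        exp (- complex_of_real (4 * pi * p) * \<i>) * Q (x * cnj (rot \<alpha>)) / Q (x * rot \<alpha>) = -1)"

definition purely_real :: "(complex \<Rightarrow> complex) \<Rightarrow> bool" where
  "purely_real Q \<longleftrightarrow> (\<forall>z. Q z = 0 \<longrightarrow> Im z = 0 \<and> Re z > 0)"

definition nzeros :: "(complex \<Rightarrow> complex) \<Rightarrow> real \<Rightarrow> nat" where
  "nzeros Q x = card {t::real. 0 \<le> t \<and> t \<le> x \<and> Q (complex_of_real t) = 0}"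

definition normalised :: "real \<Rightarrow> (complex \<Rightarrow> complex) \<Rightarrow> bool" where
  "normalised \<alpha> Q \<longleftrightarrow> Q 0 = 1 \<and>
     ((\<lambda>x. x powr (- ((1 + \<alpha>) / (2 * \<alpha>))) * real (nzeros Q x)) \<longlongrightarrow> 1) at_top"

text \<open>The associated function z on [0,\<infinity>): the continuous branch with z(0) = -2p
  (extended by 0 on negative reals, to make it unique).\<close>
definition zfun :: "real \<Rightarrow> real \<Rightarrow> (complex \<Rightarrow> complex) \<Rightarrow> real \<Rightarrow> real" where
  "zfun \<alpha> p Q = (THE z. continuous_on {0..} z \<and> z 0 = - 2 * p \<and> (\<forall>x<0. z x = 0) \<and>
      (\<forall>x\<ge>0. Q (complex_of_real x * rot \<alpha>) \<noteq> 0 \<and>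
         exp (2 * pi * \<i> * complex_of_real (z x + 2 * p)) =
           Q (complex_of_real x * cnj (rot \<alpha>)) / Q (complex_of_real x * rot \<alpha>)))"

definition Zp :: "real \<Rightarrow> int set" where
  "Zp p = {k. real_of_int k \<ge> - 2 * p - 1 / 2}"

definition xk :: "real \<Rightarrow> real \<Rightarrow> (complex \<Rightarrow> complex) \<Rightarrow> int \<Rightarrow> real" where
  "xk \<alpha> p Q k = (THE x. 0 \<le> x \<and> zfun \<alpha> p Q x = real_of_int k + 1 / 2)"

definition holes :: "real \<Rightarrow> real \<Rightarrow> (complex \<Rightarrow> complex) \<Rightarrow> int set" where
  "holes \<alpha> p Q = {k \<in> Zp p. Q (complex_of_real (xk \<alpha> p Q k)) \<noteq> 0}"

definition is_partition :: "nat \<Rightarrow> nat list \<Rightarrow> bool" where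
  "is_partition N \<nu> \<longleftrightarrow> sorted \<nu> \<and> (\<forall>x\<in>set \<nu>. 1 \<le> x) \<and> sum_list \<nu> = N"

definition Hnu :: "real \<Rightarrow> nat list \<Rightarrow> int set" where
  "Hnu p \<nu> = {k \<in> Zp p. k < - int (length \<nu>)} \<union>
     {- int (length \<nu>) + int (\<nu> ! i) + int i | i. i < length \<nu>}"

definition rho :: "real \<Rightarrow> real" where
  "rho \<alpha> = (\<alpha> + 1) / \<alpha> * \<alpha> powr (1 / (\<alpha> + 1))"

definition Vpot :: "real \<Rightarrow> real \<Rightarrow> real \<Rightarrow> real" where
  "Vpot \<alpha> u x = x * u\<^sup>2 - u powr (2 * \<alpha> + 2) - 1"

definition Sfun :: "real \<Rightarrow> real \<Rightarrow> real" where
  "Sfun \<alpha> x = (if x \<le> rho \<alpha> then 0 else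
     (let Z = {u. 0 < u \<and> Vpot \<alpha> u x = 0}
      in 1 / pi * integral {Inf Z..Sup Z} (\<lambda>u. sqrt (Vpot \<alpha> u x) / u)))"

definition tau :: "real \<Rightarrow> real \<Rightarrow> real" where
  "tau \<alpha> \<xi> = 2 * (1 + \<alpha>) * Sfun \<alpha> (rho \<alpha> * \<xi>)"

definition Dtau :: "real \<Rightarrow> real \<Rightarrow> real" where
  "Dtau \<alpha> \<xi> = \<xi> * (THE d. (tau \<alpha> has_real_derivative d) (at \<xi> within {1..}))"

definition Aconst :: "real \<Rightarrow> real" where
  "Aconst \<alpha> = (1 + \<alpha>) *
     (1 / sqrt (pi * \<alpha>) * Gamma (1 / (2 * \<alpha>)) / Gamma ((1 + \<alpha>) / (2 * \<alpha>)))
       powr (2 * \<alpha> / (\<alpha> + 1))"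

definition lfun :: "real \<Rightarrow> real \<Rightarrow> real \<Rightarrow> real \<Rightarrow> real" where
  "lfun \<alpha> \<omega> p x = p * tau \<alpha> (x / \<omega>)
     - 2 * \<alpha> / (1 + \<alpha>) * (p - (\<omega> / Aconst \<alpha>) powr ((1 + \<alpha>) / (2 * \<alpha>))) * Dtau \<alpha> (x / \<omega>)"

definition omegaH :: "real \<Rightarrow> real \<Rightarrow> nat \<Rightarrow> real" where
  "omegaH \<alpha> p H = Aconst \<alpha> * (p - real H / sqrt (2 * (1 + \<alpha>))) powr (2 * \<alpha> / (1 + \<alpha>))"

definition xhat :: "real \<Rightarrow> real \<Rightarrow> nat \<Rightarrow> int \<Rightarrow> real" where
  "xhat \<alpha> p H k = (THE x. omegaH \<alpha> p H \<le> x \<and>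
      lfun \<alpha> (omegaH \<alpha> p H) p x = real_of_int k + 1 / 2)"

end

theory Submission
  imports Defs "HOL-Real_Asymp.Real_Asymp"
begin

text \<open>
  In the variable \<open>t = ln x\<close> each root \<open>x_n\<close> of \<open>Q\<close> contributes \<open>ff (t - t_n)\<close> to the associated
  function, where \<open>ff\<close> is increasing and its derivative \<open>kk\<close> is the kernel \<open>K\<close> of the integral equation;
  so the BAE read \<open>- 2p + (\<Sum>n. ff (t_m - t_n)) = k_m + 1/2\<close>.

  Uniqueness is a maximum principle. If two solutions have the same hole-numbers, the differences
  \<open>t_n - t'_n\<close> tend to 0 by normalisation, and where they are maximal the equations force them to be
  constant. Hadamard factorisation for order \<open>< 1\<close> recovers \<open>Q\<close> from its roots.

  Existence and the estimates come together from Perron's method. The points \<open>s_n\<close> with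
  \<open>l (\<omega> e^(s_n)) = k_n + 1/2\<close> are the mass midpoints of cells on which \<open>l\<close> grows by 1, and \<open>l\<close>
  solves the integral equation, so by the midpoint rule they satisfy the BAE up to
  \<open>O(e^(-a s_n) / p)\<close>, \<open>a = (1 + \<alpha>) / (2\<alpha>)\<close>. The barrier \<open>h r = e^(-a r) (b + r)\<close> exceeds its convolution with
  \<open>K\<close> on the half line by a multiple of \<open>e^(-a r)\<close>; hence \<open>s_n \<plusminus> (B/p) (h/l') (s_n)\<close> are a super- and a
  sub-solution, and the supremum of all sub-solutions in between is a solution.

  The integral equation for \<open>\<tau>\<close>, on which all this rests, is obtained by moving the contour of
  \<open>\<pi> S(x) = \<integral> e^s sqrt (x - e^(2\<alpha>s) - e^(-2s)) ds\<close> to the line \<open>Im s = \<pi> / (1 + \<alpha>)\<close>.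
\<close>

section \<open>The kernel\<close>

text \<open>Shifting the roots by \<open>e\<close> changes the equations to first order by
  \<open>\<Sum>n. kk (t_m - t_n) * (e_m - e_n)\<close>. The roots have density \<open>l'\<close>, so
  for \<open>e = h / l'\<close> this is close to \<open>h\<close> minus its convolution with the
  kernel. The obstacle is that the decay \<open>e^(-a r)\<close> is marginal: the exponential moment
  of the kernel at \<open>a\<close> equals 1, so a pure exponential leaves no margin to absorb an
  error of the same decay. The factor \<open>b + r\<close> creates that margin; its size is a first
  moment of the kernel, positive because the kernel is even. The same factor is the origin of the
  logarithm behind the \<open>\<epsilon>\<close> in the bound for \<open>C\<close>. Positivity of
  the kernel, which makes the system monotone, rests on \<open>\<alpha> > 1\<close>: the angle of
  rotation stays below \<open>pi\<close>. The profile is built as if the \<open>H\<close> holes all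
  sat at \<open>\<omega>_H\<close>, that is \<open>l(\<omega>_H) = - H\<close>; this fixes
  \<open>\<omega>_H\<close> through the one-sided slope of \<open>\<tau>\<close> at 1. The true
  holes lie within \<open>O(1 / p)\<close> of that point, so moving them costs no more than the
  midpoint rule. All constants of the estimates are independent of \<open>p\<close>, hence one
  threshold serves all \<open>p\<close>.\<close>

locale bae_kernel =
  fixes \<theta> :: real
  assumes \<theta>_pos: "0 < \<theta>" and \<theta>_less: "\<theta> < pi"
begin

text \<open>With \<open>\<theta> = 2\<pi> / (1 + \<alpha>)\<close>, \<open>kk t\<close> is \<open>K (e^t)\<close>; all its derivatives are polynomials in \<open>qk\<close>, \<open>yk\<close> times \<open>kk\<close>.\<close>

definition yk :: "real \<Rightarrow> real" where "yk t = 1 / (cosh t - cos \<theta>)"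
definition qk :: "real \<Rightarrow> real" where "qk t = sinh t * yk t"
definition kk :: "real \<Rightarrow> real" where "kk t = sin \<theta> / (2 * pi) * yk t"
definition kk1 :: "real \<Rightarrow> real" where "kk1 t = - qk t * kk t"
definition kk2 :: "real \<Rightarrow> real" where
  "kk2 t = (1 + 3 * cos \<theta> * yk t - 2 * (sin \<theta>)\<^sup>2 * (yk t)\<^sup>2) * kk t"
definition kk3 :: "real \<Rightarrow> real" where
  "kk3 t = - qk t * (1 + 6 * cos \<theta> * yk t - 6 * (sin \<theta>)\<^sup>2 * (yk t)\<^sup>2) * kk t"
definition kk4 :: "real \<Rightarrow> real" where
  "kk4 t = ((1 + 3 * cos \<theta> * yk t - 2 * (sin \<theta>)\<^sup>2 * (yk t)\<^sup>2)
              * (1 + 6 * cos \<theta> * yk t - 6 * (sin \<theta>)\<^sup>2 * (yk t)\<^sup>2)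
            + (qk t)\<^sup>2 * yk t * (6 * cos \<theta> - 12 * (sin \<theta>)\<^sup>2 * yk t)) * kk t"

text \<open>The argument of \<open>Ln\<close> stays in the upper half plane, so \<open>ff\<close> is
  a smooth argument divided by \<open>pi\<close>, rising from 0 to \<open>1 - \<theta> / pi\<close>.
  It is the phase that one root contributes to the quotient of rotated values of
  \<open>Q\<close>.\<close>

definition ff :: "real \<Rightarrow> real" where
  "ff t = Im (Ln (1 - of_real (exp t) * cis (- \<theta>))) / pi"

lemma sin_pos: "sin \<theta> > 0"
  using \<theta>_pos \<theta>_less by (simp add: sin_gt_zero)

lemma cos_less_1: "cos \<theta> < 1"
  using \<theta>_pos \<theta>_less by (metis cos_monotone_0_pi cos_zero less_le_not_le linorder_not_le order.refl)

lemma denom_pos: "cosh t - cos \<theta> > 0"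
  using cos_less_1 cosh_real_ge_1[of t] by linarith

lemma yk_pos: "yk t > 0"
  unfolding yk_def using denom_pos by simp

lemma kk_pos: "kk t > 0"
  unfolding kk_def using yk_pos sin_pos by simp

lemma kk_even: "kk (- t) = kk t"
  by (simp add: kk_def yk_def)

text \<open>Substituting \<open>cosh t = 1 / yk t + cos \<theta>\<close> into
  \<open>sinh^2 = cosh^2 - 1\<close>. A bound on \<open>yk\<close> thereby controls
  \<open>qk\<close>, and with it all derivatives of \<open>kk\<close>.\<close>

lemma qk_eq: "qk t ^ 2 = 1 + 2 * cos \<theta> * yk t - (sin \<theta>)\<^sup>2 * (yk t)\<^sup>2"
proof -
  have "cosh t = 1 / yk t + cos \<theta>"
    using denom_pos[of t] by (simp add: yk_def)
  moreover have "(sinh t)\<^sup>2 = (cosh t)\<^sup>2 - 1"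
    by (simp add: cosh_square_eq)
  ultimately have "qk t ^ 2 = ((1 / yk t + cos \<theta>)\<^sup>2 - 1) * (yk t)\<^sup>2"
    by (simp add: qk_def power_mult_distrib)
  also have "\<dots> = 1 + 2 * cos \<theta> * yk t - (1 - (cos \<theta>)\<^sup>2) * (yk t)\<^sup>2"
    using yk_pos[of t] by (simp add: field_simps power2_eq_square)
  finally show ?thesis by (simp add: sin_squared_eq)
qed

lemma yk_deriv: "(yk has_real_derivative - yk t * qk t) (at t)"
  unfolding yk_def [abs_def] qk_def
  by (auto intro!: derivative_eq_intros simp: field_simps power2_eq_square)
     (use denom_pos[of t] in auto)

lemma qk_deriv: "(qk has_real_derivative (sin \<theta>)\<^sup>2 * (yk t)\<^sup>2 - cos \<theta> * yk t) (at t)"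
proof -
  have "(qk has_real_derivative cosh t * yk t - sinh t * yk t * qk t) (at t)"
    unfolding qk_def [abs_def]
    by (auto intro!: derivative_eq_intros yk_deriv simp: qk_def)
  moreover have "cosh t * yk t = 1 + cos \<theta> * yk t"
    using denom_pos[of t] by (simp add: yk_def field_simps)
  ultimately show ?thesis
    using qk_eq[of t] unfolding qk_def[symmetric]
    by (elim DERIV_cong) (simp add: power2_eq_square)
qed

lemma kk_deriv: "(kk has_real_derivative kk1 t) (at t)"
  unfolding kk_def [abs_def] kk1_def
  by (auto intro!: derivative_eq_intros yk_deriv simp: kk_def)

lemma kk1_deriv: "(kk1 has_real_derivative kk2 t) (at t)"
proof -
  have "(kk1 has_real_derivative - ((sin \<theta>)\<^sup>2 * (yk t)\<^sup>2 - cos \<theta> * yk t) * kk t + qk t ^ 2 * kk t) (at t)"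
    unfolding kk1_def [abs_def]
    by (auto intro!: derivative_eq_intros qk_deriv kk_deriv simp: kk1_def power2_eq_square algebra_simps)
  then show ?thesis
    unfolding qk_eq kk2_def by (simp add: algebra_simps)
qed

lemma kk2_deriv: "(kk2 has_real_derivative kk3 t) (at t)"
  unfolding kk2_def [abs_def] kk3_def
  by (auto intro!: derivative_eq_intros yk_deriv kk_deriv simp: kk1_def power2_eq_square algebra_simps)

lemma kk3_deriv: "(kk3 has_real_derivative kk4 t) (at t)"
proof -
  have eq: "kk3 = (\<lambda>t. kk1 t * (1 + 6 * cos \<theta> * yk t - 6 * (sin \<theta>)\<^sup>2 * (yk t)\<^sup>2))"
    by (auto simp: kk3_def kk1_def)
  have "((\<lambda>t. 1 + 6 * cos \<theta> * yk t - 6 * (sin \<theta>)\<^sup>2 * (yk t)\<^sup>2) has_real_derivative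
      (6 * cos \<theta> - 12 * (sin \<theta>)\<^sup>2 * yk t) * (- yk t * qk t)) (at t)"
    by (auto intro!: derivative_eq_intros yk_deriv simp: algebra_simps)
  from DERIV_mult[OF kk1_deriv this] show ?thesis
    unfolding eq by (rule DERIV_cong)
      (simp add: kk4_def kk2_def kk1_def power2_eq_square, simp add: algebra_simps)
qed

lemma exp_abs_cosh: "exp \<bar>t\<bar> / 2 \<le> cosh (t::real)" "cosh t \<le> exp \<bar>t\<bar>"
proof -
  have "exp (- \<bar>t\<bar>) \<le> exp \<bar>t\<bar>" by simp
  then show "exp \<bar>t\<bar> / 2 \<le> cosh (t::real)" "cosh t \<le> exp \<bar>t\<bar>"
    unfolding cosh_def by (auto simp: abs_if)
qed

lemma ex_yk_le: "\<exists>C>0. \<forall>t. yk t \<le> C * exp (- \<bar>t\<bar>)"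
proof -
  \<comment> \<open>The estimate \<open>m * cosh t \<le> cosh t - cos \<theta>\<close> needs
    \<open>m \<le> 1 - cos \<theta>\<close> at \<open>t = 0\<close>; the cap
    \<open>m \<le> 1\<close> is for negative \<open>cos \<theta>\<close>.\<close>
  define m where "m = min 1 (1 - cos \<theta>)"
  have m: "m > 0" "m \<le> 1" "m \<le> 1 - cos \<theta>" using cos_less_1 by (auto simp: m_def)
  have "yk t \<le> 2 / m * exp (- \<bar>t\<bar>)" for t
  proof -
    have "m * (exp \<bar>t\<bar> / 2) \<le> m * cosh t"
      using m exp_abs_cosh(1)[of t] by (intro mult_left_mono) auto
    also have "m * cosh t \<le> cosh t - cos \<theta>"
    proof -
      have "(1 - m) * 1 \<le> (1 - m) * cosh t"
        using m cosh_real_ge_1[of t] by (intro mult_left_mono) auto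
      then show ?thesis using m by (simp add: algebra_simps)
    qed
    finally have "m * exp \<bar>t\<bar> / 2 \<le> cosh t - cos \<theta>" by simp
    then have "yk t \<le> 1 / (m * exp \<bar>t\<bar> / 2)"
      unfolding yk_def using m denom_pos[of t] by (intro divide_left_mono) (auto intro!: mult_pos_pos)
    then show ?thesis by (simp add: exp_minus field_simps)
  qed
  then show ?thesis using m by (intro exI[of _ "2 / m"]) auto
qed

lemma yk_ge: "exp (- \<bar>t\<bar>) / 2 \<le> yk t"
proof -
  have "cosh t - cos \<theta> \<le> 2 * exp \<bar>t\<bar>"
    using exp_abs_cosh(2)[of t] cos_ge_minus_one[of \<theta>] one_le_exp_iff[of "\<bar>t\<bar>"] abs_ge_zero[of t] by linarith
  then have "1 / (2 * exp \<bar>t\<bar>) \<le> yk t"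
    unfolding yk_def using denom_pos[of t] by (intro divide_left_mono) auto
  then show ?thesis by (simp add: exp_minus field_simps)
qed

lemma ex_kk_le: "\<exists>C>0. \<forall>t. kk t \<le> C * exp (- \<bar>t\<bar>)"
proof -
  obtain C where C: "C > 0" "\<And>t. yk t \<le> C * exp (- \<bar>t\<bar>)" using ex_yk_le by blast
  have "kk t \<le> (sin \<theta> / (2 * pi) * C) * exp (- \<bar>t\<bar>)" for t
    unfolding kk_def using C(2)[of t] sin_pos by (simp add: mult_left_mono divide_right_mono mult.assoc)
  then show ?thesis using C sin_pos by (intro exI[of _ "sin \<theta> / (2 * pi) * C"]) auto
qed

lemma ex_kk_ge: "\<exists>c>0. \<forall>t. c * exp (- \<bar>t\<bar>) \<le> kk t"
proof (intro exI[of _ "sin \<theta> / (4 * pi)"] conjI allI)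
  fix t show "sin \<theta> / (4 * pi) * exp (- \<bar>t\<bar>) \<le> kk t"
    unfolding kk_def using yk_ge[of t] sin_pos
    by (simp add: field_simps)
qed (use sin_pos in auto)

text \<open>The constants are chosen once and for all, so that later ones are explicit terms in
  which \<open>p\<close> does not occur.\<close>

definition kC :: real where "kC = (SOME C. C > 0 \<and> (\<forall>t. kk t \<le> C * exp (- \<bar>t\<bar>)))"
definition kc :: real where "kc = (SOME c. c > 0 \<and> (\<forall>t. c * exp (- \<bar>t\<bar>) \<le> kk t))"

lemma kC: "kC > 0" "kk t \<le> kC * exp (- \<bar>t\<bar>)"
  using someI_ex[OF ex_kk_le, folded kC_def] by auto

lemma kc: "kc > 0" "kc * exp (- \<bar>t\<bar>) \<le> kk t"
  using someI_ex[OF ex_kk_ge, folded kc_def] by auto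

definition kM :: real where "kM = kC / kc * exp 1"

lemma kM_ge1: "kM \<ge> 1"
proof -
  have "kc * 1 \<le> kC * 1" using kC(2)[of 0] kc(2)[of 0] by simp
  then have "kC / kc \<ge> 1" using kc(1) by (simp add: field_simps)
  moreover have "exp 1 \<ge> (1::real)" by simp
  ultimately show ?thesis unfolding kM_def
    by (metis mult_mono' mult_1 zero_le_one)
qed

text \<open>Upper and lower bound have the same exponential rate, so \<open>kk\<close> changes by at
  most a fixed factor over unit distance. This lets node values and integrals over cells replace
  each other.\<close>

lemma kk_harnack: assumes "\<bar>s - t\<bar> \<le> 1" shows "kk s \<le> kM * kk t"
proof -
  have "kk s \<le> kC * exp (- \<bar>s\<bar>)" by (rule kC)
  also have "\<dots> \<le> kC * (exp 1 * exp (- \<bar>t\<bar>))"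
    using kC(1) assms by (intro mult_left_mono) (auto simp flip: exp_add)
  also have "\<dots> \<le> kC * (exp 1 * (kk t / kc))"
    using kc(2)[of t] kc(1) kC(1) by (intro mult_left_mono) (auto simp: field_simps)
  finally show ?thesis by (simp add: kM_def field_simps)
qed

lemma yk_le: "yk t \<le> 1 / (1 - cos \<theta>)"
  unfolding yk_def using cos_less_1 cosh_real_ge_1[of t]
  by (intro divide_left_mono) auto

text \<open>Each derivative is \<open>kk\<close> times a polynomial in the bounded functions
  \<open>yk\<close> and \<open>qk\<close>. A bound by \<open>kk\<close> itself, rather than by a
  constant, is what survives convolution.\<close>

lemma ex_kk_derivs_le:
  "\<exists>C>0. \<forall>t. \<bar>kk1 t\<bar> \<le> C * kk t \<and> \<bar>kk2 t\<bar> \<le> C * kk t \<and> \<bar>kk3 t\<bar> \<le> C * kk t \<and> \<bar>kk4 t\<bar> \<le> C * kk t"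
proof -
  define Y where "Y = 1 / (1 - cos \<theta>)"
  have y: "\<bar>yk t\<bar> \<le> Y" for t using yk_le[of t] yk_pos[of t] by (simp add: Y_def)
  have Y0: "Y > 0" using cos_less_1 by (simp add: Y_def)
  have y2: "\<bar>(yk t)\<^sup>2\<bar> \<le> Y\<^sup>2" for t using y[of t] by (simp add: abs_le_square_iff[symmetric] Y0 less_imp_le)
  have s2: "\<bar>(sin \<theta>)\<^sup>2\<bar> \<le> 1" by (simp add: abs_square_le_1)
  have c1: "\<bar>cos \<theta>\<bar> \<le> 1" by simp
  have cy: "\<bar>cos \<theta> * yk t\<bar> \<le> Y" for t
    using mult_mono[OF c1 y[of t]] Y0 by (simp add: abs_mult)
  have sy: "\<bar>(sin \<theta>)\<^sup>2 * (yk t)\<^sup>2\<bar> \<le> Y\<^sup>2" for t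
    using mult_mono[OF s2 y2[of t]] by (simp add: abs_mult)
  have sy0: "0 \<le> (sin \<theta>)\<^sup>2 * (yk t)\<^sup>2" for t by simp
  have syy: "\<bar>(sin \<theta>)\<^sup>2 * yk t\<bar> \<le> Y" for t
    using mult_mono[OF s2 y[of t]] Y0 by (simp add: abs_mult)
  define Z where "Z = 1 + 6 * Y + 6 * Y\<^sup>2"
  have Z1: "Z \<ge> 1" using Y0 by (simp add: Z_def)
  have q2: "(qk t)\<^sup>2 \<le> Z" for t
  proof -
    have "0 \<le> (sin \<theta>)\<^sup>2 * (yk t)\<^sup>2" by simp
    then have "2 * (cos \<theta> * yk t) - (sin \<theta>)\<^sup>2 * (yk t)\<^sup>2 \<le> 6 * Y + 6 * Y\<^sup>2"
      using cy[of t] Y0 zero_le_power2[of Y] by linarith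
    then show ?thesis unfolding qk_eq Z_def by (simp add: mult.assoc)
  qed
  have q: "\<bar>qk t\<bar> \<le> Z" for t
  proof -
    have "(qk t)\<^sup>2 \<le> Z\<^sup>2" using q2[of t] Z1 by (smt (verit) power2_eq_square mult_le_cancel_left1)
    then show ?thesis using Z1 by (simp add: abs_le_square_iff[symmetric])
  qed
  have m1: "\<bar>1 + 3 * cos \<theta> * yk t - 2 * (sin \<theta>)\<^sup>2 * (yk t)\<^sup>2\<bar> \<le> Z" for t
    unfolding Z_def mult.assoc abs_le_iff using cy[of t, unfolded abs_le_iff] sy[of t, unfolded abs_le_iff] sy0[of t] Y0 zero_le_power2[of Y] by linarith
  have m2: "\<bar>1 + 6 * cos \<theta> * yk t - 6 * (sin \<theta>)\<^sup>2 * (yk t)\<^sup>2\<bar> \<le> Z" for t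
    unfolding Z_def mult.assoc abs_le_iff using cy[of t, unfolded abs_le_iff] sy[of t, unfolded abs_le_iff] sy0[of t] Y0 zero_le_power2[of Y] by linarith
  have m3: "\<bar>6 * cos \<theta> - 12 * (sin \<theta>)\<^sup>2 * yk t\<bar> \<le> 6 + 12 * Y" for t
    unfolding mult.assoc abs_le_iff using c1[unfolded abs_le_iff] syy[of t, unfolded abs_le_iff] Y0 by linarith
  have m4: "\<bar>(qk t)\<^sup>2 * yk t * (6 * cos \<theta> - 12 * (sin \<theta>)\<^sup>2 * yk t)\<bar> \<le> Z * Y * (6 + 12 * Y)" for t
    unfolding abs_mult using q2[of t] y[of t] m3[of t] Z1 Y0
    by (intro mult_mono) (auto intro!: mult_nonneg_nonneg)
  have m5: "\<bar>(1 + 3 * cos \<theta> * yk t - 2 * (sin \<theta>)\<^sup>2 * (yk t)\<^sup>2) *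
        (1 + 6 * cos \<theta> * yk t - 6 * (sin \<theta>)\<^sup>2 * (yk t)\<^sup>2)\<bar> \<le> Z * Z" for t
    unfolding abs_mult using m1[of t] m2[of t] Z1 by (intro mult_mono) auto
  define C where "C = Z + Z * Z + Z * Y * (6 + 12 * Y)"
  have C: "Z \<le> C" "Z * Z \<le> C" "Z * Z + Z * Y * (6 + 12 * Y) \<le> C"
    using Z1 Y0 by (auto simp: C_def)
  have K: "0 \<le> kk t" for t using kk_pos[of t] by simp
  have "\<bar>kk1 t\<bar> \<le> C * kk t" for t
    unfolding kk1_def abs_mult using q[of t] C K[of t] by (intro mult_mono) auto
  moreover have "\<bar>kk2 t\<bar> \<le> C * kk t" for t
    unfolding kk2_def abs_mult using m1[of t] C K[of t] by (intro mult_mono) auto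
  moreover have "\<bar>kk3 t\<bar> \<le> C * kk t" for t
  proof -
    have "\<bar>- qk t * (1 + 6 * cos \<theta> * yk t - 6 * (sin \<theta>)\<^sup>2 * (yk t)\<^sup>2)\<bar> \<le> Z * Z"
      unfolding abs_mult using q[of t] m2[of t] Z1 by (intro mult_mono) auto
    then show ?thesis
      unfolding kk3_def abs_mult[of _ "kk t"] using C K[of t] by (intro mult_mono) auto
  qed
  moreover have "\<bar>kk4 t\<bar> \<le> C * kk t" for t
  proof -
    have "\<bar>(1 + 3 * cos \<theta> * yk t - 2 * (sin \<theta>)\<^sup>2 * (yk t)\<^sup>2)
              * (1 + 6 * cos \<theta> * yk t - 6 * (sin \<theta>)\<^sup>2 * (yk t)\<^sup>2)
            + (qk t)\<^sup>2 * yk t * (6 * cos \<theta> - 12 * (sin \<theta>)\<^sup>2 * yk t)\<bar> \<le> Z * Z + Z * Y * (6 + 12 * Y)"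
      by (rule order_trans[OF abs_triangle_ineq add_mono[OF m5 m4]])
    then show ?thesis
      unfolding kk4_def abs_mult[of _ "kk t"] using C K[of t] by (intro mult_mono) auto
  qed
  moreover have "C > 0" using C Z1 by linarith
  ultimately show ?thesis by (intro exI[of _ C]) auto
qed

definition kD :: real where
  "kD = (SOME C. C > 0 \<and> (\<forall>t. \<bar>kk1 t\<bar> \<le> C * kk t \<and> \<bar>kk2 t\<bar> \<le> C * kk t \<and> \<bar>kk3 t\<bar> \<le> C * kk t \<and> \<bar>kk4 t\<bar> \<le> C * kk t))"

lemma kD: "kD > 0" "\<bar>kk1 t\<bar> \<le> kD * kk t" "\<bar>kk2 t\<bar> \<le> kD * kk t"
    "\<bar>kk3 t\<bar> \<le> kD * kk t" "\<bar>kk4 t\<bar> \<le> kD * kk t"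
  using someI_ex[OF ex_kk_derivs_le, folded kD_def] by auto

text \<open>\<open>|1 - e^t cis (- \<theta>)|^2 = 2 e^t (cosh t - cos \<theta>)\<close> turns the
  imaginary part of the logarithmic derivative into the kernel.\<close>

lemma ff_deriv: "(ff has_real_derivative kk t) (at t)"
proof -
  have nr: "1 - of_real (exp t) * cis (- \<theta>) \<notin> \<real>\<^sub>\<le>\<^sub>0" for t
    using sin_pos by (auto simp: complex_nonpos_Reals_iff)
  have d: "((\<lambda>t. 1 - of_real (exp t) * cis (- \<theta>)) has_vector_derivative - (of_real (exp t) * cis (- \<theta>))) (at t)"
    by (auto intro!: derivative_eq_intros simp: has_real_derivative_iff_has_vector_derivative[symmetric])
  have "((\<lambda>t. Ln (1 - of_real (exp t) * cis (- \<theta>))) has_vector_derivative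
      - (of_real (exp t) * cis (- \<theta>)) * inverse (1 - of_real (exp t) * cis (- \<theta>))) (at t)"
    using field_vector_diff_chain_at[OF d has_field_derivative_Ln[OF nr[of t]]] unfolding o_def .
  then have "((\<lambda>t. Im (Ln (1 - of_real (exp t) * cis (- \<theta>)))) has_real_derivative
      Im (- (of_real (exp t) * cis (- \<theta>)) * inverse (1 - of_real (exp t) * cis (- \<theta>)))) (at t)"
    unfolding has_real_derivative_iff_has_vector_derivative
    by (rule bounded_linear.has_vector_derivative[OF bounded_linear_Im])
  then have "(ff has_real_derivative
      Im (- (of_real (exp t) * cis (- \<theta>)) * inverse (1 - of_real (exp t) * cis (- \<theta>))) / pi) (at t)"
    unfolding ff_def [abs_def] by (rule DERIV_cdivide)
  moreover have "Im (- (of_real (exp t) * cis (- \<theta>)) * inverse (1 - of_real (exp t) * cis (- \<theta>))) / pi = kk t"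
  proof -
    define e where "e = exp t"
    have e: "e > 0" by (simp add: e_def)
    have D: "(1 - e * cos \<theta>)\<^sup>2 + (e * sin \<theta>)\<^sup>2 = 2 * e * (cosh t - cos \<theta>)"
    proof -
      have "cosh t = (e + 1 / e) / 2" by (simp add: cosh_def e_def exp_minus field_simps)
      moreover have "(1 - e * cos \<theta>)\<^sup>2 + (e * sin \<theta>)\<^sup>2 = 1 - 2 * e * cos \<theta> + e\<^sup>2"
        using sin_cos_squared_add[of \<theta>] by algebra
      ultimately show ?thesis using e by (simp add: field_simps power2_eq_square)
    qed
    have "Im (- (of_real e * cis (- \<theta>)) * inverse (1 - of_real e * cis (- \<theta>)))
        = e * sin \<theta> / ((1 - e * cos \<theta>)\<^sup>2 + (e * sin \<theta>)\<^sup>2)"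
      using e by (simp add: add_divide_distrib[symmetric] diff_divide_distrib[symmetric] algebra_simps)
    also have "\<dots> = sin \<theta> / (2 * (cosh t - cos \<theta>))"
      unfolding D using e by simp
    finally show ?thesis by (simp add: e_def kk_def yk_def)
  qed
  ultimately show ?thesis by simp
qed

end

section \<open>Convolution with the kernel over the half line\<close>

lemma integrable_exp_neg_abs:
  fixes c :: real assumes "c > 0"
  shows "integrable lborel (\<lambda>t::real. exp (- c * \<bar>t\<bar>))"
proof -
  have "(\<lambda>x::real. exp (- c * x)) absolutely_integrable_on {0..}"
    using integrable_on_exp_minus_to_infinity[OF assms, of 0]
    by (intro nonnegative_absolutely_integrable_1) auto
  then have 1: "set_integrable lborel {0..} (\<lambda>x::real. exp (- c * x))"
    unfolding set_integrable_def by (subst (asm) integrable_completion) auto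
  have 1: "integrable lborel (\<lambda>x::real. indicator {0..} x * exp (- c * x))"
    using 1 by (simp add: set_integrable_def)
  have "integrable lborel (\<lambda>x::real. indicator {0..} (0 + (-1) * x) * exp (- c * (0 + (-1) * x)))"
    by (rule lborel_integrable_real_affine[OF 1]) auto
  from Bochner_Integration.integrable_add[OF 1 this] show ?thesis
    by (rule Bochner_Integration.integrable_bound) (auto simp: indicator_def abs_if)
qed

lemma abs_le_exp: assumes "e > 0" shows "\<bar>x\<bar> \<le> exp (e * \<bar>x\<bar>) / (e::real)"
proof -
  have "e * \<bar>x\<bar> \<le> exp (e * \<bar>x\<bar>)" using exp_ge_add_one_self[of "e * \<bar>x\<bar>"] by linarith
  then show ?thesis using assms by (simp add: field_simps)
qed

context bae_kernel
begin

lemma kk_meas [measurable]: "kk \<in> borel_measurable borel"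
  "kk1 \<in> borel_measurable borel" "kk2 \<in> borel_measurable borel" "kk3 \<in> borel_measurable borel"
  by (auto intro!: borel_measurable_continuous_onI DERIV_continuous_on[of UNIV] kk_deriv kk1_deriv kk2_deriv kk3_deriv)

lemma ff_meas [measurable]: "ff \<in> borel_measurable borel"
  by (auto intro!: borel_measurable_continuous_onI DERIV_continuous_on[of UNIV] ff_deriv)

lemma kk_exp_bound: "kk (\<sigma> - r) * exp (b * r) \<le> kC * exp \<bar>\<sigma>\<bar> * exp (- (1 - \<bar>b\<bar>) * \<bar>r\<bar>)"
proof -
  have b: "b * r \<le> \<bar>b\<bar> * \<bar>r\<bar>" using abs_ge_self[of "b * r"] by (simp only: abs_mult)
  have "kk (\<sigma> - r) * exp (b * r) \<le> kC * exp (- \<bar>\<sigma> - r\<bar>) * exp (b * r)"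
    using kC(2)[of "\<sigma> - r"] by (simp add: mult_right_mono)
  also have "\<dots> = kC * exp (- \<bar>\<sigma> - r\<bar> + b * r)"
    by (simp add: exp_add exp_minus exp_diff field_simps)
  also have "\<dots> \<le> kC * exp (\<bar>\<sigma>\<bar> + - (1 - \<bar>b\<bar>) * \<bar>r\<bar>)"
  proof -
    have "- \<bar>\<sigma> - r\<bar> + b * r \<le> \<bar>\<sigma>\<bar> - \<bar>r\<bar> + \<bar>b\<bar> * \<bar>r\<bar>" using b by linarith
    then have "- \<bar>\<sigma> - r\<bar> + b * r \<le> \<bar>\<sigma>\<bar> + - (1 - \<bar>b\<bar>) * \<bar>r\<bar>" by (simp add: algebra_simps)
    then show ?thesis using kC(1) by (intro mult_left_mono) auto
  qed
  finally show ?thesis by (simp only: exp_add mult.assoc)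
qed

lemma kk_exp_integrable:
  assumes "\<bar>b\<bar> < 1" shows "integrable lborel (\<lambda>r. kk (\<sigma> - r) * exp (b * r))"
proof (rule Bochner_Integration.integrable_bound)
  show "integrable lborel (\<lambda>r. kC * exp \<bar>\<sigma>\<bar> * exp (- (1 - \<bar>b\<bar>) * \<bar>r\<bar>))"
    using assms by (intro integrable_mult_right integrable_exp_neg_abs) auto
  show "AE x in lborel. norm (kk (\<sigma> - x) * exp (b * x)) \<le> norm (kC * exp \<bar>\<sigma>\<bar> * exp (- (1 - \<bar>b\<bar>) * \<bar>x\<bar>))"
    using kk_exp_bound[of \<sigma> _ b] kk_pos kC(1) by (auto simp: abs_mult less_imp_le)
qed measurable

lemma kk_lin_exp_integrable:
  assumes "\<bar>b\<bar> < 1" shows "integrable lborel (\<lambda>r. kk (\<sigma> - r) * (r * exp (b * r)))"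
proof -
  \<comment> \<open>Half of the gap \<open>1 - |b|\<close> is spent on
    \<open>|r| \<le> (e^(e r) + e^(- e r)) / e\<close>; both exponents \<open>b + e\<close> and
    \<open>b - e\<close> stay admissible.\<close>
  define e where "e = (1 - \<bar>b\<bar>) / 2"
  have e: "e > 0" "\<bar>b + e\<bar> < 1" "\<bar>b - e\<bar> < 1" using assms by (auto simp: e_def abs_if field_simps)
  have "integrable lborel (\<lambda>r. (kk (\<sigma> - r) * exp ((b + e) * r) + kk (\<sigma> - r) * exp ((b - e) * r)) / e)"
    using e by (intro integrable_divide Bochner_Integration.integrable_add kk_exp_integrable)
  then show ?thesis
  proof (rule Bochner_Integration.integrable_bound)
    have "\<bar>kk (\<sigma> - x) * (x * exp (b * x))\<bar> \<le> (kk (\<sigma> - x) * exp ((b + e) * x) + kk (\<sigma> - x) * exp ((b - e) * x)) / e" for x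
    proof -
      have "\<bar>x\<bar> \<le> (exp (e * x) + exp (- (e * x))) / e"
      proof (rule order_trans[OF abs_le_exp[OF e(1)]])
        show "exp (e * \<bar>x\<bar>) / e \<le> (exp (e * x) + exp (- (e * x))) / e"
          using e(1) by (auto simp: abs_if divide_right_mono)
      qed
      then have "kk (\<sigma> - x) * exp (b * x) * \<bar>x\<bar> \<le> kk (\<sigma> - x) * exp (b * x) * ((exp (e * x) + exp (- (e * x))) / e)"
        using kk_pos[of "\<sigma> - x"] by (intro mult_left_mono) auto
      then show ?thesis using kk_pos[of "\<sigma> - x"]
        by (simp add: abs_mult distrib_right left_diff_distrib exp_add exp_diff exp_minus field_simps)
    qed
    moreover have "\<bar>(kk (\<sigma> - x) * exp ((b + e) * x) + kk (\<sigma> - x) * exp ((b - e) * x)) / e\<bar>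
       = (kk (\<sigma> - x) * exp ((b + e) * x) + kk (\<sigma> - x) * exp ((b - e) * x)) / e" for x
      using e(1) kk_pos[of "\<sigma> - x"] by (auto simp: abs_of_nonneg)
    ultimately show "AE x in lborel. norm (kk (\<sigma> - x) * (x * exp (b * x))) \<le>
      norm ((kk (\<sigma> - x) * exp ((b + e) * x) + kk (\<sigma> - x) * exp ((b - e) * x)) / e)"
      by auto
  qed measurable
qed

lemma integral_reflect:
  fixes g :: "real \<Rightarrow> real"
  shows "(LINT r|lborel. g (\<sigma> - r)) = (LINT t|lborel. g t)"
  using lborel_integral_real_affine[of "-1" g \<sigma>] by simp

text \<open>With \<open>r = ln (y / \<omega>)\<close> this is the integral from
  \<open>\<omega>\<close> to infinity against \<open>dy / y\<close>. The kernel \<open>u\<close> is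
  left free, so that derivatives of \<open>kk\<close> fit the same estimates.\<close>

definition conv :: "(real \<Rightarrow> real) \<Rightarrow> (real \<Rightarrow> real) \<Rightarrow> real \<Rightarrow> real" where
  "conv u \<phi> \<sigma> = (LINT r:{0..}|lborel. u (\<sigma> - r) * \<phi> r)"

lemma conv_scale: "conv (\<lambda>t. c * u t) \<phi> \<sigma> = c * conv u \<phi> \<sigma>"
  unfolding conv_def by (simp only: mult.assoc set_integral_mult_right)

definition grows :: "real \<Rightarrow> (real \<Rightarrow> real) \<Rightarrow> bool" where
  "grows b \<phi> \<longleftrightarrow> \<phi> \<in> borel_measurable borel \<and> (\<exists>C>0. \<forall>r\<ge>0. \<bar>\<phi> r\<bar> \<le> C * exp (b * r))"

lemma conv_integrable:
  assumes "grows b \<phi>" "\<bar>b\<bar> < 1" and [measurable]: "u \<in> borel_measurable borel" and u: "\<And>t. \<bar>u t\<bar> \<le> D * kk t"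
  shows "set_integrable lborel {0..} (\<lambda>r. u (\<sigma> - r) * \<phi> r)"
proof -
  obtain C where [measurable]: "\<phi> \<in> borel_measurable borel" and C: "C > 0" "\<And>r. r \<ge> 0 \<Longrightarrow> \<bar>\<phi> r\<bar> \<le> C * exp (b * r)"
    using assms(1) unfolding grows_def by blast
  have D: "D \<ge> 0" using order_trans[OF abs_ge_zero u[of 0]] kk_pos[of 0] by (simp add: zero_le_mult_iff)
  have "integrable lborel (\<lambda>r. D * C * (kk (\<sigma> - r) * exp (b * r)))"
    by (intro integrable_mult_right kk_exp_integrable assms)
  then show ?thesis unfolding set_integrable_def
  proof (rule Bochner_Integration.integrable_bound)
    have "\<bar>u (\<sigma> - x) * \<phi> x\<bar> \<le> D * C * (kk (\<sigma> - x) * exp (b * x))" if "x \<ge> 0" for x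
    proof -
      have "\<bar>u (\<sigma> - x)\<bar> * \<bar>\<phi> x\<bar> \<le> (D * kk (\<sigma> - x)) * (C * exp (b * x))"
        using u[of "\<sigma> - x"] C(2)[OF that] D kk_pos[of "\<sigma> - x"] by (intro mult_mono) auto
      then show ?thesis by (simp add: abs_mult mult_ac)
    qed
    then show "AE x in lborel. norm (indicat_real {0..} x *\<^sub>R (u (\<sigma> - x) * \<phi> x)) \<le> norm (D * C * (kk (\<sigma> - x) * exp (b * x)))"
      using D C(1) kk_pos[of "\<sigma> - _"] by (intro AE_I2) (auto simp: indicator_def abs_mult mult_ac less_imp_le intro: order_trans[OF _ abs_ge_self])
  qed measurable
qed

lemma conv_mono:
  assumes "grows b \<phi>" "grows b' \<psi>" "\<bar>b\<bar> < 1" "\<bar>b'\<bar> < 1"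
    and "u \<in> borel_measurable borel" "\<And>t. \<bar>u t\<bar> \<le> D * kk t"
    and "v \<in> borel_measurable borel" "\<And>t. \<bar>v t\<bar> \<le> D' * kk t"
    and "\<And>r. r \<ge> 0 \<Longrightarrow> u (\<sigma> - r) * \<phi> r \<le> v (\<sigma> - r) * \<psi> r"
  shows "conv u \<phi> \<sigma> \<le> conv v \<psi> \<sigma>"
  unfolding conv_def
  by (intro set_integral_mono conv_integrable[OF assms(1,3,5,6)] conv_integrable[OF assms(2,4,7,8)]) (use assms(9) in auto)

lemma conv_abs_le:
  assumes "grows b \<phi>" "grows b' \<psi>" "\<bar>b\<bar> < 1" "\<bar>b'\<bar> < 1"
    and "u \<in> borel_measurable borel" "\<And>t. \<bar>u t\<bar> \<le> D * kk t"
    and "v \<in> borel_measurable borel" "\<And>t. \<bar>v t\<bar> \<le> D' * kk t"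
    and le: "\<And>r. r \<ge> 0 \<Longrightarrow> \<bar>u (\<sigma> - r) * \<phi> r\<bar> \<le> v (\<sigma> - r) * \<psi> r"
  shows "\<bar>conv u \<phi> \<sigma>\<bar> \<le> conv v \<psi> \<sigma>"
proof -
  have "conv u \<phi> \<sigma> \<le> conv v \<psi> \<sigma>"
    using le by (intro conv_mono[OF assms(1-8)]) (auto simp: abs_le_iff)
  moreover have "conv (\<lambda>t. - u t) \<phi> \<sigma> \<le> conv v \<psi> \<sigma>"
    using le assms by (intro conv_mono[OF assms(1-4) _ _ assms(7,8)]) (auto simp: abs_le_iff)
  moreover have "conv (\<lambda>t. - u t) \<phi> \<sigma> = - conv u \<phi> \<sigma>"
    by (simp add: conv_def set_lebesgue_integral_def)
  ultimately show ?thesis by linarith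
qed

lemma grows_abs: "grows b \<phi> \<Longrightarrow> grows b (\<lambda>r. \<bar>\<phi> r\<bar>)"
  by (auto simp: grows_def)

text \<open>Differentiation under the integral by Taylor's formula: the Harnack inequality bounds
  the remainder by a multiple of \<open>h^2 * kk\<close>, which is integrable against
  \<open>\<phi>\<close>.\<close>

lemma conv_deriv:
  assumes g: "grows b \<phi>" and b: "\<bar>b\<bar> < 1"
    and d1: "\<And>t. (u has_real_derivative u' t) (at t)" and d2: "\<And>t. (u' has_real_derivative u'' t) (at t)"
    and u: "\<And>t. \<bar>u t\<bar> \<le> D * kk t" and u': "\<And>t. \<bar>u' t\<bar> \<le> D * kk t" and u'': "\<And>t. \<bar>u'' t\<bar> \<le> D * kk t"
  shows "(conv u \<phi> has_real_derivative conv u' \<phi> \<sigma>) (at \<sigma>)"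
proof -
  have [measurable]: "u \<in> borel_measurable borel" "u' \<in> borel_measurable borel"
    using d1 d2 by (auto intro!: borel_measurable_continuous_onI DERIV_continuous_on[of UNIV])
  have D: "D \<ge> 0" using order_trans[OF abs_ge_zero u[of 0]] kk_pos[of 0] by (simp add: zero_le_mult_iff)
  note ci = conv_integrable[OF g b]
  have taylor: "\<bar>u (t + h) - u t - h * u' t\<bar> \<le> D * kM * h\<^sup>2 * kk t" if h: "\<bar>h\<bar> \<le> 1" for t h
  proof -
    have "\<exists>x. \<bar>x - t\<bar> \<le> \<bar>h\<bar> \<and> u (t + h) = u t + u' t * h + u'' x / 2 * h\<^sup>2"
    proof (cases "h = 0")
      case False
      define diff where "diff = (\<lambda>n::nat. if n = 0 then u else if n = 1 then u' else u'')"
      have "\<exists>x. (if t + h < t then t + h < x \<and> x < t else t < x \<and> x < t + h) \<and>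
          u (t + h) = (\<Sum>m<2. (diff m t / fact m) * (t + h - t)^m) + (diff 2 x / fact 2) * (t + h - t)^2"
        using False d1 d2
        by (intro Taylor[where a = "t - \<bar>h\<bar>" and b = "t + \<bar>h\<bar>"])
          (auto simp: diff_def less_2_cases_iff)
      then obtain x where x: "if t + h < t then t + h < x \<and> x < t else t < x \<and> x < t + h"
        "u (t + h) = (\<Sum>m<2. (diff m t / fact m) * (t + h - t)^m) + (diff 2 x / fact 2) * (t + h - t)^2" by blast
      have "u (t + h) = u t + u' t * h + u'' x / 2 * h\<^sup>2"
        using x(2) by (simp add: diff_def numeral_2_eq_2)
      then show ?thesis using x(1) by (intro exI[of _ x]) (auto split: if_splits)
    qed (auto intro!: exI[of _ t])
    then obtain x where x: "\<bar>x - t\<bar> \<le> \<bar>h\<bar>" "u (t + h) = u t + u' t * h + u'' x / 2 * h\<^sup>2" by blast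
    have "\<bar>u'' x\<bar> \<le> D * (kM * kk t)"
      using order_trans[OF u''[of x] mult_left_mono[OF kk_harnack D]] x(1) h by auto
    then have "\<bar>u'' x / 2 * h\<^sup>2\<bar> \<le> D * (kM * kk t) * h\<^sup>2"
      unfolding abs_mult by (intro mult_mono) auto
    then show ?thesis using x(2) by (simp add: mult_ac)
  qed
  define M where "M = D * kM * conv kk (\<lambda>r. \<bar>\<phi> r\<bar>) \<sigma>"
  have est: "\<bar>conv u \<phi> (\<sigma> + h) - conv u \<phi> \<sigma> - h * conv u' \<phi> \<sigma>\<bar> \<le> M * h\<^sup>2" if h: "\<bar>h\<bar> \<le> 1" for h
  proof -
    let ?w = "\<lambda>t. u (t + h) - u t - h * u' t"
    have i1: "set_integrable lborel {0..} (\<lambda>r. u (\<sigma> + h - r) * \<phi> r)" by (rule ci[of u D]) (use u in auto)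
    have i2: "set_integrable lborel {0..} (\<lambda>r. u (\<sigma> - r) * \<phi> r)" by (rule ci[of u D]) (use u in auto)
    have i3: "set_integrable lborel {0..} (\<lambda>r. h * (u' (\<sigma> - r) * \<phi> r))"
      by (rule set_integrable_mult_right) (rule ci[of u' D], use u' in auto)
    have "conv ?w \<phi> \<sigma> = (LINT r:{0..}|lborel. u (\<sigma> + h - r) * \<phi> r - u (\<sigma> - r) * \<phi> r - h * (u' (\<sigma> - r) * \<phi> r))"
      unfolding conv_def by (simp add: algebra_simps)
    also have "\<dots> = conv u \<phi> (\<sigma> + h) - conv u \<phi> \<sigma> - h * conv u' \<phi> \<sigma>"
      unfolding conv_def by (subst set_integral_diff set_integral_mult_right; (intro set_integral_diff i1 i2 i3)?)+ simp
    finally have eq: "conv ?w \<phi> \<sigma> = conv u \<phi> (\<sigma> + h) - conv u \<phi> \<sigma> - h * conv u' \<phi> \<sigma>" .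
    have "\<bar>conv ?w \<phi> \<sigma>\<bar> \<le> conv (\<lambda>t. D * kM * h\<^sup>2 * kk t) (\<lambda>r. \<bar>\<phi> r\<bar>) \<sigma>"
    proof (rule conv_abs_le[OF g grows_abs[OF g] b b])
      show "\<bar>?w t\<bar> \<le> D * kM * h\<^sup>2 * kk t" for t by (rule taylor[OF h])
      show "\<bar>D * kM * h\<^sup>2 * kk t\<bar> \<le> D * kM * h\<^sup>2 * kk t" for t using D kM_ge1 kk_pos[of t] by (simp add: abs_mult)
      show "\<bar>?w (\<sigma> - r) * \<phi> r\<bar> \<le> D * kM * h\<^sup>2 * kk (\<sigma> - r) * \<bar>\<phi> r\<bar>" for r
        unfolding abs_mult[of _ "\<phi> r"] by (intro mult_right_mono taylor[OF h]) auto
    qed auto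
    also have "\<dots> = M * h\<^sup>2"
      unfolding conv_scale M_def by simp
    finally show ?thesis unfolding eq .
  qed
  have "((\<lambda>h. (conv u \<phi> (\<sigma> + h) - conv u \<phi> \<sigma>) / h - conv u' \<phi> \<sigma>) \<longlongrightarrow> 0) (at 0)"
  proof (rule Lim_null_comparison)
    show "\<forall>\<^sub>F h in at 0. norm ((conv u \<phi> (\<sigma> + h) - conv u \<phi> \<sigma>) / h - conv u' \<phi> \<sigma>) \<le> M * \<bar>h\<bar>"
      unfolding eventually_at
    proof (intro exI[of _ 1] conjI ballI impI)
      fix h :: real assume h: "h \<noteq> 0 \<and> dist h 0 < 1"
      have "(conv u \<phi> (\<sigma> + h) - conv u \<phi> \<sigma>) / h - conv u' \<phi> \<sigma> = (conv u \<phi> (\<sigma> + h) - conv u \<phi> \<sigma> - h * conv u' \<phi> \<sigma>) / h"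
        using h by (simp add: field_simps)
      then have "norm ((conv u \<phi> (\<sigma> + h) - conv u \<phi> \<sigma>) / h - conv u' \<phi> \<sigma>) = \<bar>conv u \<phi> (\<sigma> + h) - conv u \<phi> \<sigma> - h * conv u' \<phi> \<sigma>\<bar> / \<bar>h\<bar>"
        by simp
      also have "\<dots> \<le> M * h\<^sup>2 / \<bar>h\<bar>" using est[of h] h by (intro divide_right_mono) auto
      also have "\<dots> = M * \<bar>h\<bar>" using h by (simp add: power2_eq_square abs_if)
      finally show "norm ((conv u \<phi> (\<sigma> + h) - conv u \<phi> \<sigma>) / h - conv u' \<phi> \<sigma>) \<le> M * \<bar>h\<bar>" .
    qed auto
    show "((\<lambda>h. M * \<bar>h\<bar>) \<longlongrightarrow> 0) (at 0)"
      by (auto intro!: tendsto_eq_intros)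
  qed
  then show ?thesis by (simp add: DERIV_def LIM_zero_iff)
qed

end

section \<open>The action integral \<open>S\<close>\<close>

locale bae =
  fixes \<alpha> :: real
  assumes \<alpha>_gt1: "1 < \<alpha>"
begin

definition th :: real where "th = 2 * pi / (1 + \<alpha>)"
definition ex :: real where "ex = (1 + \<alpha>) / (2 * \<alpha>)"
text \<open>After \<open>u = e^s\<close>, the integrand of \<open>\<pi> S(x)\<close> is \<open>W x s\<close>, supported in the well \<open>X \<le> x\<close>; \<open>s0\<close> is the bottom of the well.\<close>

definition X :: "real \<Rightarrow> real" where "X s = exp (2 * \<alpha> * s) + exp (- 2 * s)"
definition s0 :: real where "s0 = - ln \<alpha> / (2 * \<alpha> + 2)"
definition W :: "real \<Rightarrow> real \<Rightarrow> real" where "W x s = exp s * sqrt (max 0 (x - X s))"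

lemma th_pos: "0 < th" and th_less: "th < pi"
  using \<alpha>_gt1 by (auto simp: th_def field_simps)

sublocale bae_kernel th
  by unfold_locales (rule th_pos th_less)+

lemma rho_eq: "rho \<alpha> = X s0"
proof -
  have e: "exp (- 2 * s0) = \<alpha> powr (1 / (\<alpha> + 1))"
    using \<alpha>_gt1 by (auto simp: powr_def s0_def field_simps)
  have "exp (2 * \<alpha> * s0) = exp (- 2 * s0) * exp ((2 * \<alpha> + 2) * s0)"
    by (simp add: exp_add[symmetric] algebra_simps)
  also have "(2 * \<alpha> + 2) * s0 = - ln \<alpha>" using \<alpha>_gt1 by (simp add: s0_def)
  also have "exp (- ln \<alpha>) = 1 / \<alpha>" using \<alpha>_gt1 by (simp add: exp_minus field_simps)
  finally have "X s0 = exp (- 2 * s0) * (1 + 1 / \<alpha>)" by (simp add: X_def algebra_simps)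
  then show ?thesis unfolding e rho_def using \<alpha>_gt1 by (simp add: field_simps)
qed

lemma X_deriv: "(X has_real_derivative 2 * \<alpha> * exp (2 * \<alpha> * s) - 2 * exp (- 2 * s)) (at s)"
  unfolding X_def [abs_def] by (auto intro!: derivative_eq_intros)

lemma X_cont [continuous_intros]: "continuous_on A g \<Longrightarrow> continuous_on A (\<lambda>t. X (g t))"
  unfolding X_def by (intro continuous_intros)

lemma X_meas [measurable]: "X \<in> borel_measurable borel"
  by (intro borel_measurable_continuous_onI continuous_intros)

lemma X_pos: "X s > 0" unfolding X_def by (simp add: add_pos_pos)

lemma s0_crit: "2 * \<alpha> * exp (2 * \<alpha> * s0) - 2 * exp (- 2 * s0) = 0"
proof -
  have "exp (2 * \<alpha> * s0) = exp (- 2 * s0) * exp ((2 * \<alpha> + 2) * s0)"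
    by (simp add: exp_add[symmetric] algebra_simps)
  also have "(2 * \<alpha> + 2) * s0 = - ln \<alpha>" using \<alpha>_gt1 by (simp add: s0_def)
  also have "exp (- ln \<alpha>) = 1 / \<alpha>" using \<alpha>_gt1 by (simp add: exp_minus field_simps)
  finally show ?thesis using \<alpha>_gt1 by simp
qed

lemma X_deriv2: "((\<lambda>s. 2 * \<alpha> * exp (2 * \<alpha> * s) - 2 * exp (- 2 * s)) has_real_derivative
    4 * \<alpha>\<^sup>2 * exp (2 * \<alpha> * s) + 4 * exp (- 2 * s)) (at s)"
  by (auto intro!: derivative_eq_intros simp: power2_eq_square)

text \<open>One exponential serves each half line; on \<open>s \<ge> 0\<close> the first one
  suffices because \<open>\<alpha> > 1\<close>.\<close>

lemma X_deriv2_ge: "4 * \<alpha>\<^sup>2 * exp (2 * \<alpha> * s) + 4 * exp (- 2 * s) \<ge> 4"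
proof (cases "s \<ge> 0")
  case True
  then have "1 * 1 \<le> \<alpha>\<^sup>2 * exp (2 * \<alpha> * s)" using \<alpha>_gt1 by (intro mult_mono) auto
  then show ?thesis by (simp add: add_increasing2)
next
  case False
  then have "1 \<le> exp (- 2 * s)" by simp
  moreover have "0 \<le> 4 * \<alpha>\<^sup>2 * exp (2 * \<alpha> * s)" by simp
  ultimately show ?thesis by linarith
qed

lemma X_taylor:
  "\<exists>t. \<bar>t - s0\<bar> \<le> \<bar>s - s0\<bar> \<and> X s = rho \<alpha> + (4 * \<alpha>\<^sup>2 * exp (2 * \<alpha> * t) + 4 * exp (- 2 * t)) / 2 * (s - s0)\<^sup>2"
proof (cases "s = s0")
  case False
  define diff where "diff = (\<lambda>n::nat. if n = 0 then X else if n = 1 then (\<lambda>s. 2 * \<alpha> * exp (2 * \<alpha> * s) - 2 * exp (- 2 * s))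
     else (\<lambda>s. 4 * \<alpha>\<^sup>2 * exp (2 * \<alpha> * s) + 4 * exp (- 2 * s)))"
  have "\<exists>t. (if s < s0 then s < t \<and> t < s0 else s0 < t \<and> t < s) \<and>
      X s = (\<Sum>m<2. (diff m s0 / fact m) * (s - s0)^m) + (diff 2 t / fact 2) * (s - s0)^2"
    using False X_deriv X_deriv2
    by (intro Taylor[where a = "min s s0" and b = "max s s0"])
      (auto simp: diff_def less_2_cases_iff)
  then obtain t where t: "if s < s0 then s < t \<and> t < s0 else s0 < t \<and> t < s"
      "X s = (\<Sum>m<2. (diff m s0 / fact m) * (s - s0)^m) + (diff 2 t / fact 2) * (s - s0)^2" by blast
  have "X s = X s0 + (4 * \<alpha>\<^sup>2 * exp (2 * \<alpha> * t) + 4 * exp (- 2 * t)) / 2 * (s - s0)\<^sup>2"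
    using t(2) s0_crit by (simp add: diff_def numeral_2_eq_2)
  then show ?thesis using t(1) rho_eq by (intro exI[of _ t]) (auto split: if_splits)
qed (auto simp: rho_eq intro!: exI[of _ s0])

text \<open>The quadratic bound confines the well to a bounded interval and, near its bottom,
  dominates the rescaled integrands.\<close>

lemma X_ge: "X s \<ge> rho \<alpha> + 2 * (s - s0)\<^sup>2"
proof -
  obtain t where t: "X s = rho \<alpha> + (4 * \<alpha>\<^sup>2 * exp (2 * \<alpha> * t) + 4 * exp (- 2 * t)) / 2 * (s - s0)\<^sup>2"
    using X_taylor by blast
  have "2 * (s - s0)\<^sup>2 \<le> (4 * \<alpha>\<^sup>2 * exp (2 * \<alpha> * t) + 4 * exp (- 2 * t)) / 2 * (s - s0)\<^sup>2"
    using X_deriv2_ge[of t] by (intro mult_right_mono) auto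
  then show ?thesis using t by simp
qed

lemma rho_pos: "rho \<alpha> > 0" using rho_eq X_pos by simp

lemma dX_pos: assumes "s > s0" shows "2 * \<alpha> * exp (2 * \<alpha> * s) - 2 * exp (- 2 * s) > 0"
proof -
  have "exp (2 * \<alpha> * s0) < exp (2 * \<alpha> * s)" "exp (- 2 * s) < exp (- 2 * s0)"
    using assms \<alpha>_gt1 by auto
  then have "2 * \<alpha> * exp (2 * \<alpha> * s0) < 2 * \<alpha> * exp (2 * \<alpha> * s)" "2 * exp (- 2 * s) < 2 * exp (- 2 * s0)" using \<alpha>_gt1 by auto
  then show ?thesis using s0_crit by linarith
qed

lemma dX_neg: assumes "s < s0" shows "2 * \<alpha> * exp (2 * \<alpha> * s) - 2 * exp (- 2 * s) < 0"
proof -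
  have "exp (2 * \<alpha> * s0) > exp (2 * \<alpha> * s)" "exp (- 2 * s) > exp (- 2 * s0)"
    using assms \<alpha>_gt1 by auto
  then have "2 * \<alpha> * exp (2 * \<alpha> * s0) > 2 * \<alpha> * exp (2 * \<alpha> * s)" "2 * exp (- 2 * s) > 2 * exp (- 2 * s0)" using \<alpha>_gt1 by auto
  then show ?thesis using s0_crit by linarith
qed

lemma X_strict_up: assumes "s0 \<le> s" "s < t" shows "X s < X t"
proof -
  obtain z where z: "s < z" "z < t" "X t - X s = (t - s) * (2 * \<alpha> * exp (2 * \<alpha> * z) - 2 * exp (- 2 * z))"
    using MVT2[of s t X "\<lambda>s. 2 * \<alpha> * exp (2 * \<alpha> * s) - 2 * exp (- 2 * s)"] assms X_deriv by auto
  then show ?thesis using dX_pos[of z] assms by (smt (verit) mult_pos_pos)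
qed

lemma X_strict_down: assumes "t \<le> s0" "s < t" shows "X t < X s"
proof -
  obtain z where z: "s < z" "z < t" "X t - X s = (t - s) * (2 * \<alpha> * exp (2 * \<alpha> * z) - 2 * exp (- 2 * z))"
    using MVT2[of s t X "\<lambda>s. 2 * \<alpha> * exp (2 * \<alpha> * s) - 2 * exp (- 2 * s)"] assms X_deriv by auto
  then show ?thesis using dX_neg[of z] assms by (smt (verit) mult_pos_neg)
qed

text \<open>\<open>X\<close> is strictly monotone on either side of \<open>s0\<close>, so
  \<open>V\<close> has exactly two positive zeros, at \<open>e^s1\<close> and
  \<open>e^s2\<close>.\<close>

lemma X_roots:
  assumes "x > rho \<alpha>"
  obtains s1 s2 where "s1 < s0" "s0 < s2" "X s1 = x" "X s2 = x"
    "\<And>s. X s = x \<longleftrightarrow> s = s1 \<or> s = s2" "\<And>s. X s \<le> x \<longleftrightarrow> s1 \<le> s \<and> s \<le> s2"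
proof -
  define d where "d = sqrt ((x - rho \<alpha>) / 2)"
  have d: "d > 0" "2 * d\<^sup>2 = x - rho \<alpha>" using assms by (auto simp: d_def)
  have c: "continuous_on A X" for A using X_cont[of A "\<lambda>s. s"] by simp
  have "X (s0 + d) \<ge> x" "X (s0 - d) \<ge> x" using X_ge[of "s0 + d"] X_ge[of "s0 - d"] d by auto
  moreover have "X s0 \<le> x" using assms rho_eq by simp
  ultimately obtain s1 s2 where s: "s0 - d \<le> s1" "s1 \<le> s0" "X s1 = x" "s0 \<le> s2" "s2 \<le> s0 + d" "X s2 = x"
    using IVT2'[OF _ _ _ c, of s0 x "s0 - d"] IVT'[OF _ _ _ c, of s0 x "s0 + d"] d(1) by auto
  have s': "s1 < s0" "s0 < s2" using s assms rho_eq by (auto simp: less_le)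
  have 1: "X s = x \<longleftrightarrow> s = s1 \<or> s = s2" for s
    using X_strict_up[of s s2] X_strict_up[of s2 s] X_strict_down[of s s1] X_strict_down[of s1 s] s s'
    by (smt (verit))
  have 2: "X s \<le> x \<longleftrightarrow> s1 \<le> s \<and> s \<le> s2" for s
    using X_strict_up[of s s2] X_strict_up[of s2 s] X_strict_down[of s s1] X_strict_down[of s1 s] s s'
    by (smt (verit))
  show ?thesis by (rule that[OF s' s(3) s(6) 1 2])
qed

lemma W_cont [continuous_intros]: "continuous_on A (W x)"
  unfolding W_def [abs_def] by (intro continuous_intros)

lemma W_nonneg: "W x s \<ge> 0" by (simp add: W_def)

lemma W_eq_0: "x \<le> rho \<alpha> \<Longrightarrow> W x s = 0"
proof -
  assume "x \<le> rho \<alpha>"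
  moreover have "rho \<alpha> \<le> X s" using X_ge[of s] zero_le_power2[of "s - s0"] by linarith
  ultimately show ?thesis by (simp add: W_def)
qed

lemma W_integrable: "integrable lborel (W x)"
proof -
  define d where "d = sqrt (max 0 (x - rho \<alpha>) / 2)"
  have "W x s = 0" if "s \<notin> {s0 - d .. s0 + d}" for s
  proof -
    have "\<bar>s - s0\<bar> > d" using that by auto
    then have "d\<^sup>2 < (s - s0)\<^sup>2"
      unfolding abs_le_square_iff[symmetric] linorder_not_le[symmetric] by (auto simp: d_def)
    then have "X s > x" using X_ge[of s] by (auto simp: d_def field_simps)
    then show ?thesis by (simp add: W_def)
  qed
  then have "W x = (\<lambda>s. indicator {s0 - d .. s0 + d} s *\<^sub>R W x s)"
    by (auto simp: indicator_def fun_eq_iff)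
  moreover have "set_integrable lborel {s0 - d .. s0 + d} (W x)"
    by (intro borel_integrable_atLeastAtMost' continuous_intros)
  ultimately show ?thesis by (simp add: set_integrable_def)
qed

lemma Vpot_exp: "Vpot \<alpha> (exp s) x = (exp s)\<^sup>2 * (x - X s)"
proof -
  have "exp s powr (2 * \<alpha> + 2) = (exp s)\<^sup>2 * exp (2 * \<alpha> * s)"
    by (simp add: powr_def power2_eq_square exp_add[symmetric] algebra_simps)
  moreover have "(exp s)\<^sup>2 * exp (- 2 * s) = 1"
    by (simp add: power2_eq_square exp_add[symmetric])
  ultimately show ?thesis unfolding Vpot_def X_def by (simp add: algebra_simps)
qed

text \<open>Substitution \<open>u = e^s\<close>. Because of the truncation in \<open>W\<close> the
  domain no longer depends on \<open>x\<close>, which makes monotonicity in \<open>x\<close> and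
  Tonelli's theorem directly available.\<close>

lemma Sfun_eq: "Sfun \<alpha> x = (1 / pi) * (LINT s|lborel. W x s)"
proof (cases "x \<le> rho \<alpha>")
  case True
  then show ?thesis by (simp add: Sfun_def W_eq_0)
next
  case False
  then have "x > rho \<alpha>" by simp
  from X_roots[OF this] obtain s1 s2 where s: "s1 < s0" "s0 < s2" "X s1 = x" "X s2 = x"
    "\<And>s. X s = x \<longleftrightarrow> s = s1 \<or> s = s2" "\<And>s. X s \<le> x \<longleftrightarrow> s1 \<le> s \<and> s \<le> s2" by blast
  have Z: "{u. 0 < u \<and> Vpot \<alpha> u x = 0} = {exp s1, exp s2}"
  proof (intro equalityI subsetI)
    fix u assume "u \<in> {u. 0 < u \<and> Vpot \<alpha> u x = 0}"
    then have "u > 0" "Vpot \<alpha> (exp (ln u)) x = 0" by auto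
    then have "ln u = s1 \<or> ln u = s2" unfolding Vpot_exp using s(5)[of "ln u"] by auto
    then show "u \<in> {exp s1, exp s2}" using \<open>u > 0\<close> by auto
  qed (use s(3,4) in \<open>auto simp: Vpot_exp\<close>)
  have IS: "Inf {exp s1, exp s2} = exp s1" "Sup {exp s1, exp s2} = exp s2"
    using s by (auto simp: cInf_insert_If cSup_insert_If inf_real_def sup_real_def)
  have W0: "W x u = 0" if "u \<notin> {s1..s2}" for u
    using that s(6)[of u] by (auto simp: W_def)
  have g: "((\<lambda>t. exp t *\<^sub>R (sqrt (Vpot \<alpha> (exp t) x) / exp t)) has_integral
       integral {exp s1..exp s2} (\<lambda>u. sqrt (Vpot \<alpha> u x) / u)) {s1..s2}"
  proof (rule has_integral_substitution[where c = "exp s1" and d = "exp s2"])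
    show "continuous_on {exp s1..exp s2} (\<lambda>u. sqrt (Vpot \<alpha> u x) / u)"
      unfolding Vpot_def by (intro continuous_intros) (auto simp: not_le intro: less_le_trans[OF exp_gt_zero])
  qed (use s in \<open>auto intro!: derivative_eq_intros\<close>)
  have "(W x has_integral integral {exp s1..exp s2} (\<lambda>u. sqrt (Vpot \<alpha> u x) / u)) {s1..s2}"
  proof (rule has_integral_eq[OF _ g])
    fix t assume "t \<in> {s1..s2}"
    then have "X t \<le> x" using s(6) by auto
    then show "exp t *\<^sub>R (sqrt (Vpot \<alpha> (exp t) x) / exp t) = W x t"
      by (simp add: Vpot_exp W_def real_sqrt_mult)
  qed
  then have "(W x has_integral integral {exp s1..exp s2} (\<lambda>u. sqrt (Vpot \<alpha> u x) / u)) UNIV"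
    by (rule has_integral_on_superset) (use W0 in auto)
  moreover have "(W x has_integral (LINT s|lborel. W x s)) UNIV"
    by (rule has_integral_integral_lborel[OF W_integrable])
  ultimately have "integral {exp s1..exp s2} (\<lambda>u. sqrt (Vpot \<alpha> u x) / u) = (LINT s|lborel. W x s)"
    by (rule has_integral_unique)
  then show ?thesis using False by (simp add: Sfun_def Let_def Z IS)
qed

lemma Sfun_nonneg: "Sfun \<alpha> x \<ge> 0"
  unfolding Sfun_eq by (auto intro!: integral_nonneg_AE simp: W_nonneg)

lemma Sfun_mono: "x \<le> y \<Longrightarrow> Sfun \<alpha> x \<le> Sfun \<alpha> y"
  unfolding Sfun_eq
  by (intro mult_left_mono integral_mono W_integrable) (auto simp: W_def intro!: mult_left_mono)

lemma Sfun_0: "x \<le> rho \<alpha> \<Longrightarrow> Sfun \<alpha> x = 0" by (simp add: Sfun_def)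

end

section \<open>Rotation of the contour\<close>

text \<open>\<open>sin x / x\<close> decreases on \<open>(0, pi)\<close>, since the numerator
  \<open>x * cos x - sin x\<close> of its derivative is negative there.\<close>

lemma sin_over_decreasing:
  assumes "0 < u" "u < v" "v < pi" shows "u * sin v < v * sin (u::real)"
proof -
  have d: "((\<lambda>x. sin x / x) has_real_derivative (x * cos x - sin x) / (x * x)) (at x)" if "x \<noteq> 0" for x :: real
    using that by (auto intro!: derivative_eq_intros simp: field_simps)
  have pos: "x * cos x - sin x < 0" if "0 < x" "x < pi" for x :: real
  proof -
    have "(\<lambda>x. x * cos x - sin x) x < (\<lambda>x. x * cos x - sin x) (0::real)"
    proof (rule DERIV_neg_imp_decreasing_open[OF that(1)])
      fix y :: real assume y: "0 < y" "y < x"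
      have "((\<lambda>x. x * cos x - sin x) has_real_derivative - (y * sin y)) (at y)"
        by (auto intro!: derivative_eq_intros)
      moreover have "- (y * sin y) < 0" using y that by (simp add: sin_gt_zero)
      ultimately show "\<exists>z. ((\<lambda>x. x * cos x - sin x) has_real_derivative z) (at y) \<and> z < 0" by blast
    qed (intro continuous_intros)
    then show ?thesis by simp
  qed
  have "sin v / v < sin u / u"
  proof (rule DERIV_neg_imp_decreasing_open[OF assms(2)])
    fix x assume x: "u < x" "x < v"
    show "\<exists>y. ((\<lambda>x. sin x / x) has_real_derivative y) (at x) \<and> y < 0"
      using d[of x] pos[of x] x assms by (intro exI[of _ "(x * cos x - sin x) / (x * x)"]) (auto simp: divide_neg_pos)
  next
    show "continuous_on {u..v} (\<lambda>x. sin x / x)" using assms by (intro continuous_intros) auto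
  qed
  then show ?thesis using assms by (simp add: field_simps)
qed

text \<open>Serves to carry the sign of a branch from the top of the strip downwards. The interval
  is open at \<open>a\<close> because the square root need not extend continuously to the real
  axis.\<close>

lemma continuous_nonzero_same_sign:
  fixes g :: "real \<Rightarrow> real"
  assumes "continuous_on {a<..b} g" "\<And>x. a < x \<Longrightarrow> x \<le> b \<Longrightarrow> g x \<noteq> 0" "g b > 0" "a < x" "x \<le> b"
  shows "g x > 0"
proof (rule ccontr)
  assume "\<not> g x > 0"
  then have "g x \<le> 0" by simp
  moreover have "continuous_on {x..b} g" by (rule continuous_on_subset[OF assms(1)]) (use assms in auto)
  ultimately obtain y where "x \<le> y" "y \<le> b" "g y = 0"
    using IVT'[of g x 0 b] assms by auto
  then show False using assms(2)[of y] assms by auto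
qed

lemma tendsto_integral_symmetric_interval:
  fixes f :: "real \<Rightarrow> real"
  assumes f: "integrable lborel f"
  shows "((\<lambda>R. LINT s:{-R..R}|lborel. f s) \<longlongrightarrow> (LINT s|lborel. f s)) at_top"
  unfolding set_lebesgue_integral_def
proof (rule integral_dominated_convergence_at_top[where w = "\<lambda>s. \<bar>f s\<bar>"])
  show "AE s in lborel. ((\<lambda>R. indicator {-R..R} s *\<^sub>R f s) \<longlongrightarrow> f s) at_top"
  proof (intro AE_I2 tendsto_eventually)
    fix s :: real
    show "\<forall>\<^sub>F R in at_top. indicator {-R..R} s *\<^sub>R f s = f s"
      using eventually_ge_at_top[of "\<bar>s\<bar>"] by eventually_elim (auto simp: indicator_def)
  qed
qed (use f in \<open>auto simp: indicator_def intro!: borel_measurable_integrable\<close>)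

context bae
begin

text \<open>\<open>Im (HH x)\<close> has boundary values \<open>W x\<close> on the real axis; \<open>E\<close> avoids the ray \<open>[rho \<alpha>, \<infinity>)\<close> in the strip, so \<open>HH x\<close> never meets the branch cut of the square root.\<close>

definition E :: "complex \<Rightarrow> complex" where
  "E \<zeta> = exp (of_real (2 * \<alpha>) * \<zeta>) + exp (- 2 * \<zeta>)"

definition HH :: "real \<Rightarrow> complex \<Rightarrow> complex" where
  "HH x \<zeta> = \<i> * exp \<zeta> * csqrt (of_real x - E \<zeta>)"

definition strip :: "complex set" where "strip = {\<zeta>. 0 < Im \<zeta> \<and> Im \<zeta> \<le> th / 2}"

lemma E_Complex:
  "Re (E (Complex s p)) = exp (2 * \<alpha> * s) * cos (2 * \<alpha> * p) + exp (- 2 * s) * cos (2 * p)"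
  "Im (E (Complex s p)) = exp (2 * \<alpha> * s) * sin (2 * \<alpha> * p) - exp (- 2 * s) * sin (2 * p)"
  by (auto simp: E_def Re_exp Im_exp)

lemma th_mult: "(1 + \<alpha>) * th = 2 * pi" using \<alpha>_gt1 by (simp add: th_def)

text \<open>If \<open>E\<close> is real, eliminating one exponential gives \<open>Re E * sin
  (\<alpha> * b) = e^(-2 s) * sin ((1 + \<alpha>) * b)\<close> with
  \<open>b = 2 * Im \<zeta>\<close>. Two comparisons of \<open>sin x / x\<close> then place
  \<open>s\<close> to the right of \<open>s0\<close> and \<open>Re E\<close> strictly below
  \<open>rho \<alpha>\<close>.\<close>

lemma E_avoids_ray:
  assumes "\<zeta> \<in> strip" "x \<ge> rho \<alpha>" shows "of_real x - E \<zeta> \<notin> \<real>\<^sub>\<le>\<^sub>0"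
proof
  assume "of_real x - E \<zeta> \<in> \<real>\<^sub>\<le>\<^sub>0"
  then have im: "Im (E \<zeta>) = 0" and re: "x \<le> Re (E \<zeta>)" by (auto simp: complex_nonpos_Reals_iff)
  define s b where "s = Re \<zeta>" and "b = 2 * Im \<zeta>"
  have \<zeta>: "\<zeta> = Complex s (b / 2)" by (simp add: s_def b_def)
  have b: "0 < b" "b \<le> th" using assms(1) by (auto simp: strip_def b_def)
  have bb: "(1 + \<alpha>) * b \<le> 2 * pi" using b th_mult \<alpha>_gt1 by (smt (verit) mult_left_mono)
  have sb: "sin b > 0" using b th_less by (intro sin_gt_zero) auto
  have im': "exp (2 * \<alpha> * s) * sin (\<alpha> * b) = exp (- 2 * s) * sin b" using im unfolding \<zeta> E_Complex by simp
  then have "exp (2 * \<alpha> * s) * sin (\<alpha> * b) > 0" using sb by simp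
  then have sab: "sin (\<alpha> * b) > 0" by (simp add: zero_less_mult_iff)
  have "Re (E \<zeta>) * sin (\<alpha> * b) = exp (2 * \<alpha> * s) * sin (\<alpha> * b) * cos (\<alpha> * b) + exp (- 2 * s) * (cos b * sin (\<alpha> * b))"
    unfolding \<zeta> E_Complex by (simp add: algebra_simps)
  also have "\<dots> = exp (- 2 * s) * sin ((1 + \<alpha>) * b)"
    unfolding im' by (simp add: sin_add distrib_right algebra_simps)
  finally have R: "Re (E \<zeta>) * sin (\<alpha> * b) = exp (- 2 * s) * sin ((1 + \<alpha>) * b)" .
  have "Re (E \<zeta>) > 0" using re rho_pos assms(2) by linarith
  then have "Re (E \<zeta>) * sin (\<alpha> * b) > 0" using sab by simp
  then have s1: "sin ((1 + \<alpha>) * b) > 0" unfolding R by (simp add: zero_less_mult_iff)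
  \<comment> \<open>\<open>(1 + \<alpha>) * b\<close> lies in \<open>(0, 2 pi]\<close>, and the
    positive sine leaves only the first half.\<close>
  have bpi: "(1 + \<alpha>) * b < pi"
  proof (rule ccontr)
    assume "\<not> (1 + \<alpha>) * b < pi"
    then have "sin ((1 + \<alpha>) * b) \<le> 0" using bb
      by (cases "(1 + \<alpha>) * b = 2 * pi") (auto intro: sin_le_zero)
    then show False using s1 by simp
  qed
  have lt1: "(\<alpha> * b) * sin ((1 + \<alpha>) * b) < ((1 + \<alpha>) * b) * sin (\<alpha> * b)"
    using b \<alpha>_gt1 bpi by (intro sin_over_decreasing) (auto intro!: mult_strict_right_mono mult_pos_pos)
  have lt2: "b * sin (\<alpha> * b) < (\<alpha> * b) * sin b"
    using b \<alpha>_gt1 bpi by (intro sin_over_decreasing) (auto simp: algebra_simps)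
  have "b * (\<alpha> * sin ((1 + \<alpha>) * b)) < b * ((1 + \<alpha>) * sin (\<alpha> * b))" using lt1 by (simp only: mult_ac)
  then have r1: "\<alpha> * sin ((1 + \<alpha>) * b) < (1 + \<alpha>) * sin (\<alpha> * b)" using b by simp
  have "b * (sin (\<alpha> * b)) < b * (\<alpha> * sin b)" using lt2 by (simp only: mult_ac)
  then have r2: "sin (\<alpha> * b) < \<alpha> * sin b" using b by simp
  define A where "A = exp (- 2 * s)"
  have A: "A > 0" by (simp add: A_def)
  have "sin (\<alpha> * b) = exp (- 2 * \<alpha> * s) * (exp (2 * \<alpha> * s) * sin (\<alpha> * b))"
    by (simp add: mult.assoc[symmetric] exp_add[symmetric])
  also have "\<dots> = exp (- (2 * \<alpha> + 2) * s) * sin b"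
  proof -
    have "exp (- 2 * \<alpha> * s) * exp (- 2 * s) = exp (- (2 * \<alpha> + 2) * s)"
      by (simp add: exp_add[symmetric] algebra_simps)
    then show ?thesis unfolding im' by (simp only: mult.assoc[symmetric])
  qed
  finally have "sin (\<alpha> * b) = exp (- (2 * \<alpha> + 2) * s) * sin b" .
  then have "exp (- (2 * \<alpha> + 2) * s) * sin b < \<alpha> * sin b" using r2 by simp
  then have "exp (- (2 * \<alpha> + 2) * s) < \<alpha>" using sb by simp
  then have "- (2 * \<alpha> + 2) * s < ln \<alpha>" by (metis exp_less_cancel_iff exp_ln exp_gt_zero order_less_trans)
  then have "- 2 * s < - 2 * s0" using \<alpha>_gt1 by (auto simp: s0_def field_simps)
  then have A2: "A < exp (- 2 * s0)" by (simp add: A_def)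
  have "Re (E \<zeta>) * sin (\<alpha> * b) = A * sin ((1 + \<alpha>) * b)" using R A_def by simp
  also have "\<dots> < A * ((1 + \<alpha>) / \<alpha> * sin (\<alpha> * b))"
    using r1 A \<alpha>_gt1 by (intro mult_strict_left_mono) (auto simp: field_simps)
  also have "\<dots> < exp (- 2 * s0) * ((1 + \<alpha>) / \<alpha> * sin (\<alpha> * b))"
    using A2 sab \<alpha>_gt1 by (intro mult_strict_right_mono) auto
  finally have "Re (E \<zeta>) * sin (\<alpha> * b) < exp (- 2 * s0) * ((1 + \<alpha>) / \<alpha>) * sin (\<alpha> * b)" by (simp only: mult.assoc)
  then have "Re (E \<zeta>) < exp (- 2 * s0) * ((1 + \<alpha>) / \<alpha>)" using sab by (rule mult_right_less_imp_less[OF _ less_imp_le])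
  also have "\<dots> = rho \<alpha>"
    using s0_crit \<alpha>_gt1 unfolding rho_eq X_def by (simp add: field_simps)
  finally show False using re assms(2) by linarith
qed

lemma HH_differentiable: assumes "x \<ge> rho \<alpha>" "\<zeta> \<in> strip" shows "HH x field_differentiable at \<zeta>"
proof -
  have "(\<lambda>\<zeta>. of_real x - E \<zeta>) field_differentiable at \<zeta>"
    unfolding E_def by (rule holomorphic_on_imp_differentiable_at[of _ UNIV]) (auto intro!: holomorphic_intros)
  moreover have "csqrt field_differentiable at (of_real x - E \<zeta>)"
    by (rule field_differentiable_at_csqrt[OF E_avoids_ray[OF assms(2,1)]])
  ultimately have "(csqrt \<circ> (\<lambda>\<zeta>. of_real x - E \<zeta>)) field_differentiable at \<zeta>"
    by (rule field_differentiable_compose)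
  then show ?thesis
    unfolding HH_def o_def
    by (intro field_differentiable_mult field_differentiable_const field_differentiable_within_exp)
qed

text \<open>The square is entire, namely minus \<open>V\<close> at \<open>u = e^\<zeta>\<close>.
  Towards either end of the strip one term dominates, so there \<open>HH\<close> is known up to its
  sign.\<close>

lemma HH_square: "(HH x \<zeta>)\<^sup>2 = 1 + exp (of_real (2 * \<alpha> + 2) * \<zeta>) - of_real x * exp (2 * \<zeta>)"
proof -
  have "(HH x \<zeta>)\<^sup>2 = - ((exp \<zeta>)\<^sup>2 * (of_real x - E \<zeta>))" by (simp add: HH_def power_mult_distrib)
  also have "(exp \<zeta>)\<^sup>2 = exp (2 * \<zeta>)" by (simp add: exp_double)
  also have "- (exp (2 * \<zeta>) * (of_real x - E \<zeta>)) = 1 + exp (of_real (2 * \<alpha> + 2) * \<zeta>) - of_real x * exp (2 * \<zeta>)"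
    unfolding E_def by (simp add: algebra_simps exp_add[symmetric])
  finally show ?thesis .
qed

text \<open>On the top line \<open>E\<close> has constant argument \<open>- th\<close>, and
  \<open>cis (th / 2)\<close> can be moved under the root. Following the quadrants of
  \<open>v\<close> and \<open>u\<close> shows that the result is again the principal root. The sign
  of the real part fixes the branch at both ends of the strip.\<close>

lemma HH_top:
  assumes "x > 0"
  shows "HH x (Complex s (th / 2)) = \<i> * exp s * csqrt (of_real x * cis th - of_real (X s))"
    and "Re (HH x (Complex s (th / 2))) < 0"
proof -
  define v where "v = csqrt (of_real x - cis (- th) * of_real (X s))"
  have E: "E (Complex s (th / 2)) = cis (- th) * of_real (X s)"
  proof -
    have "\<alpha> * th = 2 * pi - th" using th_mult by (simp add: algebra_simps)
    then have "sin (\<alpha> * th) = - sin th" "cos (\<alpha> * th) = cos th"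
      by (simp_all add: sin_diff cos_diff)
    then show ?thesis
      by (intro complex_eqI) (simp_all add: E_Complex X_def algebra_simps)
  qed
  have "Im (v\<^sup>2) = sin th * X s" by (simp add: v_def)
  then have imv: "2 * (Re v * Im v) > 0" using sin_pos X_pos[of s] by (simp add: power2_eq_square mult_ac)
  have "Re v \<ge> 0" using csqrt_principal[of "of_real x - cis (- th) * of_real (X s)"] by (auto simp: v_def)
  then have v: "Re v > 0" "Im v > 0" using imv by (auto simp: zero_less_mult_iff)
  define u where "u = cis (th / 2) * v"
  have u2: "u\<^sup>2 = of_real x * cis th - of_real (X s)"
  proof -
    have c2: "cis (th / 2) * cis (th / 2) = cis th" by (simp add: cis_mult)
    have c0: "cis th * cis (- th) = 1" by (simp add: cis_mult)
    have "u\<^sup>2 = cis th * (of_real x - cis (- th) * of_real (X s))"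
      unfolding u_def power_mult_distrib v_def power2_csqrt by (simp add: power2_eq_square c2)
    also have "\<dots> = of_real x * cis th - (cis th * cis (- th)) * of_real (X s)"
      by (simp add: algebra_simps)
    finally show ?thesis by (simp add: c0)
  qed
  have s2: "sin (th / 2) > 0" "cos (th / 2) > 0"
    using th_pos th_less by (auto intro!: sin_gt_zero cos_gt_zero)
  have "Im u = sin (th / 2) * Re v + cos (th / 2) * Im v" by (simp add: u_def)
  then have imu: "Im u > 0" using v s2 by (simp add: add_pos_pos)
  have "Im (u\<^sup>2) = x * sin th" unfolding u2 by simp
  then have "2 * (Re u * Im u) > 0" using assms sin_pos by (simp add: power2_eq_square mult_ac)
  then have reu: "Re u > 0" using imu by (auto simp: zero_less_mult_iff)
  have cu: "csqrt (of_real x * cis th - of_real (X s)) = u"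
    using u2 reu by (intro csqrt_unique) auto
  have ec: "exp (Complex s (th / 2)) = of_real (exp s) * cis (th / 2)"
    by (simp add: exp_eq_polar)
  show H: "HH x (Complex s (th / 2)) = \<i> * exp s * csqrt (of_real x * cis th - of_real (X s))"
    unfolding cu HH_def E v_def[symmetric] ec u_def by simp
  show "Re (HH x (Complex s (th / 2))) < 0"
    unfolding H cu using imu by simp
qed

text \<open>\<open>HH^2\<close> is within distance 1 of 1, so \<open>Re HH\<close> cannot vanish and
  keeps the negative sign of the top line: the root is near \<open>-1\<close>. Then
  \<open>|HH - 1| \<ge> 1\<close>, so \<open>|HH + 1|\<close> is at most
  \<open>|HH^2 - 1|\<close>.\<close>

lemma HH_left:
  assumes x: "x \<ge> rho \<alpha>" and p: "0 < p" "p \<le> th / 2"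
    and sm: "exp (- (2 * \<alpha> + 2) * R) + x * exp (- 2 * R) < 1"
  shows "norm (HH x (Complex (- R) p) + 1) \<le> exp (- (2 * \<alpha> + 2) * R) + x * exp (- 2 * R)"
proof -
  have x0: "x > 0" using x rho_pos by linarith
  define e where "e = (\<lambda>q. exp (of_real (2 * \<alpha> + 2) * Complex (- R) q) - of_real x * exp (2 * Complex (- R) q))"
  have e: "norm (e q) \<le> exp (- (2 * \<alpha> + 2) * R) + x * exp (- 2 * R)" for q
    unfolding e_def using x0 by (intro norm_triangle_le_diff) (simp add: norm_mult algebra_simps)
  have sq: "(HH x (Complex (- R) q))\<^sup>2 = 1 + e q" for q by (simp add: HH_square e_def)
  have nz: "Re (HH x (Complex (- R) q)) \<noteq> 0" for q
  proof
    assume "Re (HH x (Complex (- R) q)) = 0"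
    then have "Re (1 + e q) \<le> 0" unfolding sq[symmetric] by (simp add: power2_eq_square)
    moreover have "\<bar>Re (e q)\<bar> < 1" using e[of q] sm abs_Re_le_cmod[of "e q"] by linarith
    ultimately show False by simp
  qed
  have "0 < - Re (HH x (Complex (- R) p))"
  proof (rule continuous_nonzero_same_sign[where a = 0 and b = "th / 2" and g = "\<lambda>q. - Re (HH x (Complex (- R) q))" and x = p])
    have "continuous_on strip (HH x)"
      using HH_differentiable[OF x] by (intro continuous_at_imp_continuous_on ballI field_differentiable_imp_continuous_at) auto
    then have "continuous_on {0<..th / 2} (\<lambda>q. HH x (Complex (- R) q))"
      by (rule continuous_on_compose2) (auto simp: strip_def intro!: continuous_intros)
    then show "continuous_on {0<..th / 2} (\<lambda>q. - Re (HH x (Complex (- R) q)))"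
      by (intro continuous_intros)
  qed (use nz HH_top(2)[OF x0] p in auto)
  then have "norm (HH x (Complex (- R) p) - 1) \<ge> 1"
    using abs_Re_le_cmod[of "HH x (Complex (- R) p) - 1"] by simp
  then have "norm (HH x (Complex (- R) p) + 1) * 1 \<le> norm (HH x (Complex (- R) p) + 1) * norm (HH x (Complex (- R) p) - 1)"
    by (intro mult_left_mono) auto
  also have "\<dots> = norm (e p)"
    using sq[of p] by (simp add: norm_mult[symmetric] algebra_simps power2_eq_square)
  finally show ?thesis using e[of p] by simp
qed

text \<open>The argument for the left end, applied after division by
  \<open>e^((1 + \<alpha>) \<zeta>)\<close>. On the top line
  \<open>(1 + \<alpha>) * th / 2 = pi\<close> makes this exponential negative, which reverses the
  sign: here the root is near the positive multiple.\<close>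

lemma HH_right:
  assumes x: "x \<ge> rho \<alpha>" and p: "0 < p" "p \<le> th / 2"
    and sm: "exp (- (2 * \<alpha> + 2) * R) + x * exp (- 2 * \<alpha> * R) < 1"
  shows "norm (HH x (Complex R p) - exp (of_real (1 + \<alpha>) * Complex R p))
    \<le> exp ((1 + \<alpha>) * R) * (exp (- (2 * \<alpha> + 2) * R) + x * exp (- 2 * \<alpha> * R))"
proof -
  have x0: "x > 0" using x rho_pos by linarith
  define e where "e = (\<lambda>q. exp (- of_real (2 * \<alpha> + 2) * Complex R q) - of_real x * exp (- of_real (2 * \<alpha>) * Complex R q))"
  define u where "u = (\<lambda>q. HH x (Complex R q) * exp (- of_real (1 + \<alpha>) * Complex R q))"
  have e: "norm (e q) \<le> exp (- (2 * \<alpha> + 2) * R) + x * exp (- 2 * \<alpha> * R)" for q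
    unfolding e_def using x0 by (intro norm_triangle_le_diff) (simp add: norm_mult algebra_simps)
  have sq: "(u q)\<^sup>2 = 1 + e q" for q
  proof -
    have "(exp (- of_real (1 + \<alpha>) * Complex R q))\<^sup>2 = exp (- of_real (2 * \<alpha> + 2) * Complex R q)"
      by (simp add: power2_eq_square exp_add[symmetric] algebra_simps)
    then have "(u q)\<^sup>2 = (1 + exp (of_real (2 * \<alpha> + 2) * Complex R q) - of_real x * exp (2 * Complex R q)) * exp (- of_real (2 * \<alpha> + 2) * Complex R q)"
      by (simp add: u_def power_mult_distrib HH_square)
    also have "\<dots> = 1 + e q"
      unfolding e_def by (simp add: algebra_simps exp_add[symmetric])
    finally show ?thesis .
  qed
  have nz: "Re (u q) \<noteq> 0" for q
  proof
    assume "Re (u q) = 0"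
    then have "Re (1 + e q) \<le> 0" unfolding sq[symmetric] by (simp add: power2_eq_square)
    moreover have "\<bar>Re (e q)\<bar> < 1" using e[of q] sm abs_Re_le_cmod[of "e q"] by linarith
    ultimately show False by simp
  qed
  have "exp (- of_real (1 + \<alpha>) * Complex R (th / 2)) = - of_real (exp (- (1 + \<alpha>) * R))"
  proof -
    have "(1 + \<alpha>) * (th / 2) = pi" using th_mult by simp
    then have "- of_real (1 + \<alpha>) * Complex R (th / 2) = Complex (- (1 + \<alpha>) * R) (- pi)"
      by (intro complex_eqI) (auto simp: algebra_simps)
    then show ?thesis by (simp add: exp_eq_polar complex_eq_iff)
  qed
  then have top: "Re (u (th / 2)) > 0"
    using HH_top(2)[OF x0, of R] by (simp add: u_def mult_neg_pos)
  have "0 < Re (u p)"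
  proof (rule continuous_nonzero_same_sign[where a = 0 and b = "th / 2" and g = "\<lambda>q. Re (u q)" and x = p])
    have "continuous_on strip (HH x)"
      using HH_differentiable[OF x] by (intro continuous_at_imp_continuous_on ballI field_differentiable_imp_continuous_at) auto
    then have "continuous_on {0<..th / 2} (\<lambda>q. HH x (Complex R q))"
      by (rule continuous_on_compose2) (auto simp: strip_def intro!: continuous_intros)
    then show "continuous_on {0<..th / 2} (\<lambda>q. Re (u q))"
      unfolding u_def by (intro continuous_intros)
  qed (use nz top p in auto)
  then have "norm (u p + 1) \<ge> 1"
    using abs_Re_le_cmod[of "u p + 1"] by simp
  then have "norm (u p - 1) * 1 \<le> norm (u p - 1) * norm (u p + 1)"
    by (intro mult_left_mono) auto
  also have "\<dots> = norm (e p)"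
    using sq[of p] by (simp add: norm_mult[symmetric] algebra_simps power2_eq_square)
  finally have up: "norm (u p - 1) \<le> exp (- (2 * \<alpha> + 2) * R) + x * exp (- 2 * \<alpha> * R)" using e[of p] by simp
  have "HH x (Complex R p) - exp (of_real (1 + \<alpha>) * Complex R p) = exp (of_real (1 + \<alpha>) * Complex R p) * (u p - 1)"
    by (simp add: u_def algebra_simps exp_add[symmetric] exp_minus)
  then have "norm (HH x (Complex R p) - exp (of_real (1 + \<alpha>) * Complex R p)) = exp ((1 + \<alpha>) * R) * norm (u p - 1)"
    by (simp add: norm_mult)
  then show ?thesis using up by simp
qed

definition JJ :: "real \<Rightarrow> real \<Rightarrow> real \<Rightarrow> complex" where
  "JJ x R p = integral {-R..R} (\<lambda>s. HH x (Complex s p))"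

text \<open>Cauchy's theorem for a rectangle, by way of a primitive on the convex strip. The left
  edge yields \<open>th / 2 - p\<close>. The right edge yields the term with
  \<open>sin ((1 + \<alpha>) * p)\<close>, which is huge in \<open>R\<close> but disappears for
  \<open>p\<close> tending to 0 at fixed \<open>R\<close>.\<close>

lemma contour_shift:
  assumes x: "x \<ge> rho \<alpha>" and R: "R > 0" and p: "0 < p" "p \<le> th / 2"
    and sm1: "exp (- (2 * \<alpha> + 2) * R) + x * exp (- 2 * R) < 1"
    and sm2: "exp (- (2 * \<alpha> + 2) * R) + x * exp (- 2 * \<alpha> * R) < 1"
  shows "\<bar>Im (JJ x R (th / 2)) - Im (JJ x R p) - (th / 2 - p) + exp ((1 + \<alpha>) * R) * sin ((1 + \<alpha>) * p) / (1 + \<alpha>)\<bar>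
     \<le> th / 2 * (exp (- (2 * \<alpha> + 2) * R) + x * exp (- 2 * R)
        + exp ((1 + \<alpha>) * R) * (exp (- (2 * \<alpha> + 2) * R) + x * exp (- 2 * \<alpha> * R)))"
proof -
  define e1 where "e1 = exp (- (2 * \<alpha> + 2) * R) + x * exp (- 2 * R)"
  define e2 where "e2 = exp ((1 + \<alpha>) * R) * (exp (- (2 * \<alpha> + 2) * R) + x * exp (- 2 * \<alpha> * R))"
  have "x > 0" using x rho_pos by linarith
  then have e0: "e1 \<ge> 0" "e2 \<ge> 0" by (auto simp: e1_def e2_def)
  have cs: "convex strip"
  proof -
    have "strip = {\<zeta>. Im \<zeta> > 0} \<inter> {\<zeta>. Im \<zeta> \<le> th / 2}" by (auto simp: strip_def)
    then show ?thesis using convex_Int[OF convex_halfspace_Im_gt[of 0] convex_halfspace_Im_le[of "th / 2"]] by simp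
  qed
  have "continuous_on strip (HH x)"
    using HH_differentiable[OF x] by (intro continuous_at_imp_continuous_on ballI field_differentiable_imp_continuous_at) auto
  moreover have "HH x field_differentiable at z" if "z \<in> interior strip - {}" for z
    using HH_differentiable[OF x] that interior_subset[of strip] by blast
  ultimately obtain F where F: "\<And>z. z \<in> strip \<Longrightarrow> (F has_field_derivative HH x z) (at z within strip)"
    using holomorphic_convex_primitive[OF cs finite.emptyI, of "HH x"] by blast
  have J: "JJ x R q = F (Complex R q) - F (Complex (- R) q)" if q: "0 < q" "q \<le> th / 2" for q
  proof -
    have "((\<lambda>s. HH x (Complex s q)) has_integral (F (Complex R q) - F (Complex (- R) q))) {-R..R}"
    proof (rule fundamental_theorem_of_calculus)
      fix s assume "s \<in> {-R..R}"
      have "((\<lambda>s. Complex s q) has_vector_derivative 1) (at s within {-R..R})"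
        unfolding Complex_eq by (auto intro!: derivative_eq_intros)
      moreover have "(F has_field_derivative HH x (Complex s q)) (at (Complex s q) within (\<lambda>s. Complex s q) ` {-R..R})"
        by (rule has_field_derivative_subset[OF F]) (use q in \<open>auto simp: strip_def\<close>)
      ultimately show "((\<lambda>s. F (Complex s q)) has_vector_derivative HH x (Complex s q)) (at s within {-R..R})"
        using field_vector_diff_chain_within[of "\<lambda>s. Complex s q" 1 s "{-R..R}" F] by (simp add: o_def)
    qed (use R in auto)
    then show ?thesis unfolding JJ_def by (rule integral_unique)
  qed
  define seg where "seg = (\<lambda>c. {z. Re z = c \<and> p \<le> Im z \<and> Im z \<le> th / 2})"
  have segc: "convex (seg c)" for c
  proof -
    have "seg c = ({z. Re z \<ge> c} \<inter> {z. Re z \<le> c}) \<inter> ({z. Im z \<ge> p} \<inter> {z. Im z \<le> th / 2})" by (auto simp: seg_def)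
    then show ?thesis using convex_Int[OF convex_Int[OF convex_halfspace_Re_ge[of c] convex_halfspace_Re_le[of c]] convex_Int[OF convex_halfspace_Im_ge[of p] convex_halfspace_Im_le[of "th / 2"]]] by simp
  qed
  have segs: "seg c \<subseteq> strip" for c using p by (auto simp: seg_def strip_def)
  have L: "norm ((F (Complex (-R) (th / 2)) + Complex (-R) (th / 2)) - (F (Complex (-R) p) + Complex (-R) p))
      \<le> e1 * norm (Complex (-R) (th / 2) - Complex (-R) p)"
  proof (rule field_differentiable_bound[OF segc[of "-R"]])
    fix z assume z: "z \<in> seg (-R)"
    show "((\<lambda>z. F z + z) has_field_derivative HH x z + 1) (at z within seg (-R))"
      using z segs by (auto intro!: derivative_eq_intros has_field_derivative_subset[OF F])
    have "z = Complex (-R) (Im z)" "0 < Im z" "Im z \<le> th / 2" using z p by (auto simp: seg_def complex_eq_iff)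
    then show "norm (HH x z + 1) \<le> e1"
      using HH_left[OF x _ _ sm1, of "Im z"] by (simp add: e1_def)
  qed (use p in \<open>auto simp: seg_def\<close>)
  have Rr: "norm ((F (Complex R (th / 2)) - exp (of_real (1 + \<alpha>) * Complex R (th / 2)) / of_real (1 + \<alpha>))
        - (F (Complex R p) - exp (of_real (1 + \<alpha>) * Complex R p) / of_real (1 + \<alpha>)))
      \<le> e2 * norm (Complex R (th / 2) - Complex R p)"
  proof (rule field_differentiable_bound[OF segc[of R]])
    fix z assume z: "z \<in> seg R"
    have a0: "of_real (1 + \<alpha>) \<noteq> (0 :: complex)" using \<alpha>_gt1 by (simp only: of_real_eq_0_iff)
    show "((\<lambda>z. F z - exp (of_real (1 + \<alpha>) * z) / of_real (1 + \<alpha>)) has_field_derivative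
        HH x z - exp (of_real (1 + \<alpha>) * z)) (at z within seg R)"
    proof -
      have "(F has_field_derivative HH x z) (at z within seg R)"
        using z segs by (blast intro: has_field_derivative_subset[OF F])
      then have "((\<lambda>z. F z - exp (b * z) / b) has_field_derivative HH x z - exp (b * z)) (at z within seg R)"
        if "b \<noteq> 0" for b using that by (auto intro!: derivative_eq_intros)
      from this[OF a0] show ?thesis .
    qed
    have "z = Complex R (Im z)" "0 < Im z" "Im z \<le> th / 2" using z p by (auto simp: seg_def complex_eq_iff)
    then show "norm (HH x z - exp (of_real (1 + \<alpha>) * z)) \<le> e2"
      using HH_right[OF x _ _ sm2, of "Im z"] by (simp add: e2_def)
  qed (use p in \<open>auto simp: seg_def\<close>)
  have n: "norm (Complex c (th / 2) - Complex c p) \<le> th / 2" for c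
    using p by (simp add: cmod_def)
  define DL where "DL = F (Complex (-R) (th / 2)) - F (Complex (-R) p)"
  define DR where "DR = F (Complex R (th / 2)) - F (Complex R p)"
  have imexp: "Im (exp (of_real (1 + \<alpha>) * Complex R q) / of_real (1 + \<alpha>)) = exp ((1 + \<alpha>) * R) * sin ((1 + \<alpha>) * q) / (1 + \<alpha>)" for q
    unfolding Im_divide_of_real Im_exp by simp
  have s0': "sin ((1 + \<alpha>) * (th / 2)) = 0" using th_mult by (simp add: algebra_simps)
  have k1: "\<bar>Im DL + (th / 2 - p)\<bar> \<le> e1 * (th / 2)"
  proof -
    have "\<bar>Im ((F (Complex (-R) (th / 2)) + Complex (-R) (th / 2)) - (F (Complex (-R) p) + Complex (-R) p))\<bar> \<le> e1 * (th / 2)"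
      by (rule order_trans[OF abs_Im_le_cmod order_trans[OF L]]) (rule mult_left_mono[OF n e0(1)])
    moreover have "Im ((F (Complex (-R) (th / 2)) + Complex (-R) (th / 2)) - (F (Complex (-R) p) + Complex (-R) p)) = Im DL + (th / 2 - p)"
      by (simp add: DL_def)
    ultimately show ?thesis by (simp only:)
  qed
  have k2: "\<bar>Im DR + exp ((1 + \<alpha>) * R) * sin ((1 + \<alpha>) * p) / (1 + \<alpha>)\<bar> \<le> e2 * (th / 2)"
  proof -
    have "\<bar>Im ((F (Complex R (th / 2)) - exp (of_real (1 + \<alpha>) * Complex R (th / 2)) / of_real (1 + \<alpha>))
        - (F (Complex R p) - exp (of_real (1 + \<alpha>) * Complex R p) / of_real (1 + \<alpha>)))\<bar> \<le> e2 * (th / 2)"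
      by (rule order_trans[OF abs_Im_le_cmod order_trans[OF Rr]]) (rule mult_left_mono[OF n e0(2)])
    moreover have "Im ((F (Complex R (th / 2)) - exp (of_real (1 + \<alpha>) * Complex R (th / 2)) / of_real (1 + \<alpha>))
        - (F (Complex R p) - exp (of_real (1 + \<alpha>) * Complex R p) / of_real (1 + \<alpha>)))
        = Im DR + exp ((1 + \<alpha>) * R) * sin ((1 + \<alpha>) * p) / (1 + \<alpha>)"
      unfolding minus_complex.sel imexp s0' DR_def by (simp only: mult_zero_right div_0 diff_0 diff_0_right diff_diff_eq2 diff_minus_eq_add)
    ultimately show ?thesis by (simp only:)
  qed
  have k3: "Im (JJ x R (th / 2)) - Im (JJ x R p) = Im DR - Im DL"
    using J[of "th / 2"] J[of p] p th_pos by (simp add: DR_def DL_def)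
  have gen: "\<bar>g - b + d\<bar> \<le> u + v" if "\<bar>a + b\<bar> \<le> u" "\<bar>c + d\<bar> \<le> v" "g = c - a" for a b c d g u v :: real
    using that by linarith
  have "\<bar>Im (JJ x R (th / 2)) - Im (JJ x R p) - (th / 2 - p) + exp ((1 + \<alpha>) * R) * sin ((1 + \<alpha>) * p) / (1 + \<alpha>)\<bar>
     \<le> e1 * (th / 2) + e2 * (th / 2)" by (rule gen[OF k1 k2 k3])
  also have "e1 * (th / 2) + e2 * (th / 2) = th / 2 * (e1 + e2)" by algebra
  finally show ?thesis unfolding e1_def e2_def .
qed

lemma HH_line_cont:
  assumes "x \<ge> rho \<alpha>" "0 < p" "p \<le> th / 2"
  shows "continuous_on A (\<lambda>s. HH x (Complex s p))"
proof -
  have "continuous_on strip (HH x)"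
    using HH_differentiable[OF assms(1)] by (intro continuous_at_imp_continuous_on ballI field_differentiable_imp_continuous_at) auto
  then show ?thesis
    by (rule continuous_on_compose2) (use assms in \<open>auto simp: strip_def intro!: continuous_intros\<close>)
qed

lemma Im_JJ_eq:
  assumes "x \<ge> rho \<alpha>" "0 < p" "p \<le> th / 2"
  shows "Im (JJ x R p) = (LINT s:{-R..R}|lborel. Im (HH x (Complex s p)))"
proof -
  have i: "set_integrable lborel {-R..R} (\<lambda>s. HH x (Complex s p))"
    by (intro borel_integrable_atLeastAtMost' HH_line_cont assms)
  have "JJ x R p = (LINT s:{-R..R}|lborel. HH x (Complex s p))"
    unfolding JJ_def by (rule set_borel_integral_eq_integral(2)[OF i, symmetric])
  then show ?thesis
    using integral_Im[OF i[unfolded set_integrable_def]] by (simp add: set_lebesgue_integral_def)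
qed

text \<open>At the cut only \<open>Re csqrt\<close> has a limit. \<open>Im csqrt\<close> may change
  sign, but its modulus is bounded and it enters with the factor \<open>sin (q n)\<close>, which
  tends to 0.\<close>

lemma Im_JJ_tendsto:
  assumes x: "x \<ge> rho \<alpha>"
  defines "q \<equiv> \<lambda>n::nat. th / 2 * inverse (real (Suc n))"
  shows "(\<lambda>n. Im (JJ x R (q n))) \<longlonglongrightarrow> (LINT s:{-R..R}|lborel. W x s)"
proof -
  have x0: "x > 0" using x rho_pos by linarith
  have q: "0 < q n" "q n \<le> th / 2" for n
    using th_pos by (auto simp: q_def field_simps)
  have q0: "q \<longlonglongrightarrow> 0"
    unfolding q_def using tendsto_mult_right[OF LIMSEQ_inverse_real_of_nat, of "th / 2"] by (simp add: mult.commute)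
  have ptw: "(\<lambda>n. Im (HH x (Complex s (q n)))) \<longlonglongrightarrow> W x s" for s
  proof -
    define z where "z = (\<lambda>n. of_real x - E (Complex s (q n)))"
    have lims: "(\<lambda>n. Complex s (q n)) \<longlonglongrightarrow> Complex s 0"
      by (intro tendsto_Complex tendsto_const q0)
    then have "z \<longlonglongrightarrow> of_real x - E (Complex s 0)"
      unfolding z_def E_def by (intro tendsto_diff tendsto_const tendsto_add tendsto_exp tendsto_mult lims)
    also have "E (Complex s 0) = of_real (X s)" by (intro complex_eqI) (simp_all add: E_Complex X_def)
    finally have z: "z \<longlonglongrightarrow> of_real (x - X s)" by simp
    have nz: "(\<lambda>n. cmod (z n)) \<longlonglongrightarrow> \<bar>x - X s\<bar>" using tendsto_norm[OF z] by (simp only: norm_of_real)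
    have rz: "(\<lambda>n. Re (z n)) \<longlonglongrightarrow> x - X s" using tendsto_Re[OF z] by simp
    have "(\<lambda>n. Re (csqrt (z n))) \<longlonglongrightarrow> sqrt ((\<bar>x - X s\<bar> + (x - X s)) / 2)"
      unfolding csqrt.sel by (intro tendsto_intros nz rz) auto
    moreover have "(\<bar>x - X s\<bar> + (x - X s)) / 2 = max 0 (x - X s)" by (auto simp: max_def)
    ultimately have re: "(\<lambda>n. Re (csqrt (z n))) \<longlonglongrightarrow> sqrt (max 0 (x - X s))" by simp
    have "(\<lambda>n. \<bar>sin (q n) * Im (csqrt (z n))\<bar>) \<longlonglongrightarrow> 0"
    proof -
      have "\<bar>sin (q n) * Im (csqrt (z n))\<bar> = \<bar>sin (q n)\<bar> * sqrt ((cmod (z n) - Re (z n)) / 2)" for n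
      proof -
        have "cmod (z n) - Re (z n) \<ge> 0" using complex_Re_le_cmod[of "z n"] by simp
        then show ?thesis by (simp add: abs_mult sgn_if)
      qed
      moreover have "(\<lambda>n. \<bar>sin (q n)\<bar> * sqrt ((cmod (z n) - Re (z n)) / 2)) \<longlonglongrightarrow> \<bar>sin 0\<bar> * sqrt ((\<bar>x - X s\<bar> - (x - X s)) / 2)"
        by (intro tendsto_intros nz rz q0) auto
      ultimately show ?thesis by simp
    qed
    then have im: "(\<lambda>n. sin (q n) * Im (csqrt (z n))) \<longlonglongrightarrow> 0" by (rule tendsto_rabs_zero_cancel)
    have "Im (HH x (Complex s (q n))) = exp s * (cos (q n) * Re (csqrt (z n)) - sin (q n) * Im (csqrt (z n)))" for n
      unfolding HH_def z_def by (simp add: Re_exp Im_exp algebra_simps del: csqrt.simps)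
    moreover have "(\<lambda>n. exp s * (cos (q n) * Re (csqrt (z n)) - sin (q n) * Im (csqrt (z n)))) \<longlonglongrightarrow> exp s * (cos 0 * sqrt (max 0 (x - X s)) - 0)"
      by (intro tendsto_intros re im q0)
    ultimately show ?thesis by (simp add: W_def)
  qed
  define C where "C = exp R * sqrt (x + (exp (2 * \<alpha> * R) + exp (2 * R)))"
  have bd: "\<bar>Im (HH x (Complex s (q n)))\<bar> \<le> C" if "s \<in> {-R..R}" for s n
  proof -
    have "cmod (of_real x - E (Complex s (q n))) \<le> x + (exp (2 * \<alpha> * s) + exp (- 2 * s))"
      unfolding E_def by (intro norm_triangle_le_diff add_mono norm_triangle_le) (use x0 in auto)
    also have "\<dots> \<le> x + (exp (2 * \<alpha> * R) + exp (2 * R))" using that \<alpha>_gt1 by (auto intro!: add_mono)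
    finally have "cmod (csqrt (of_real x - E (Complex s (q n)))) \<le> sqrt (x + (exp (2 * \<alpha> * R) + exp (2 * R)))"
      by (simp add: real_sqrt_le_mono del: csqrt.simps)
    then have "exp s * cmod (csqrt (of_real x - E (Complex s (q n)))) \<le> C"
      unfolding C_def using that by (intro mult_mono) auto
    then have "cmod (HH x (Complex s (q n))) \<le> C"
      by (simp add: HH_def norm_mult del: csqrt.simps)
    then show ?thesis using abs_Im_le_cmod order_trans by blast
  qed
  have "(\<lambda>n. LINT s:{-R..R}|lborel. Im (HH x (Complex s (q n)))) \<longlonglongrightarrow> (LINT s:{-R..R}|lborel. W x s)"
    unfolding set_lebesgue_integral_def
  proof (rule integral_dominated_convergence[where w = "\<lambda>s. indicator {-R..R} s *\<^sub>R C"])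
    show "(\<lambda>s. indicator {-R..R} s *\<^sub>R W x s) \<in> borel_measurable lborel"
      using W_integrable[of x] by (auto dest: borel_measurable_integrable)
    have [measurable]: "(\<lambda>s. HH x (Complex s (q n))) \<in> borel_measurable borel" for n
      using HH_line_cont[OF x q, of UNIV] by (rule borel_measurable_continuous_onI)
    show "(\<lambda>s. indicator {-R..R} s *\<^sub>R Im (HH x (Complex s (q n)))) \<in> borel_measurable lborel" for n
      by measurable
    show "integrable lborel (\<lambda>s. indicator {-R..R} s *\<^sub>R C)"
      using borel_integrable_atLeastAtMost'[of "-R" R "\<lambda>_. C"] by (simp add: set_integrable_def)
    show "AE s in lborel. (\<lambda>n. indicator {-R..R} s *\<^sub>R Im (HH x (Complex s (q n)))) \<longlonglongrightarrow> indicator {-R..R} s *\<^sub>R W x s"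
      by (intro AE_I2 tendsto_scaleR tendsto_const ptw)
    show "AE s in lborel. norm (indicator {-R..R} s *\<^sub>R Im (HH x (Complex s (q n)))) \<le> indicator {-R..R} s *\<^sub>R C" for n
      using bd by (intro AE_I2) (auto simp: indicator_def)
  qed
  then show ?thesis by (simp add: Im_JJ_eq[OF x q])
qed

lemma contour_value:
  assumes x: "x \<ge> rho \<alpha>" and R: "R > 0"
    and sm1: "exp (- (2 * \<alpha> + 2) * R) + x * exp (- 2 * R) < 1"
    and sm2: "exp (- (2 * \<alpha> + 2) * R) + x * exp (- 2 * \<alpha> * R) < 1"
  shows "\<bar>Im (JJ x R (th / 2)) - (LINT s:{-R..R}|lborel. W x s) - th / 2\<bar>
     \<le> th / 2 * (exp (- (2 * \<alpha> + 2) * R) + x * exp (- 2 * R)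
        + exp ((1 + \<alpha>) * R) * (exp (- (2 * \<alpha> + 2) * R) + x * exp (- 2 * \<alpha> * R)))"
    (is "_ \<le> ?B")
proof -
  define q where "q = (\<lambda>n::nat. th / 2 * inverse (real (Suc n)))"
  have q: "0 < q n" "q n \<le> th / 2" for n
    using th_pos by (auto simp: q_def field_simps)
  have q0: "q \<longlonglongrightarrow> 0"
    unfolding q_def using tendsto_mult_right[OF LIMSEQ_inverse_real_of_nat, of "th / 2"] by (simp add: mult.commute)
  have t: "(\<lambda>n. Im (JJ x R (q n))) \<longlonglongrightarrow> (LINT s:{-R..R}|lborel. W x s)"
    unfolding q_def by (rule Im_JJ_tendsto[OF x])
  have "(\<lambda>n. \<bar>Im (JJ x R (th / 2)) - Im (JJ x R (q n)) - (th / 2 - q n) + exp ((1 + \<alpha>) * R) * sin ((1 + \<alpha>) * q n) / (1 + \<alpha>)\<bar>)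
     \<longlonglongrightarrow> \<bar>Im (JJ x R (th / 2)) - (LINT s:{-R..R}|lborel. W x s) - (th / 2 - 0) + exp ((1 + \<alpha>) * R) * sin ((1 + \<alpha>) * 0) / (1 + \<alpha>)\<bar>"
    using \<alpha>_gt1 by (intro tendsto_intros q0 t) auto
  moreover have "\<bar>Im (JJ x R (th / 2)) - Im (JJ x R (q n)) - (th / 2 - q n) + exp ((1 + \<alpha>) * R) * sin ((1 + \<alpha>) * q n) / (1 + \<alpha>)\<bar> \<le> ?B" for n
    by (rule contour_shift[OF x R q sm1 sm2])
  ultimately show ?thesis
    by (intro Lim_bounded[where M = 0 and f = "\<lambda>n. \<bar>Im (JJ x R (th / 2)) - Im (JJ x R (q n)) - (th / 2 - q n) + exp ((1 + \<alpha>) * R) * sin ((1 + \<alpha>) * q n) / (1 + \<alpha>)\<bar>"]) auto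
qed

text \<open>Limit of large \<open>R\<close> in \<open>contour_value\<close>. The right edge leaves
  \<open>e^(- (\<alpha> - 1) R)\<close>, which vanishes because \<open>\<alpha> > 1\<close>. The
  integrand is nonnegative, so convergence of the truncated integrals also gives
  integrability.\<close>

lemma shifted_integral:
  assumes x: "x \<ge> rho \<alpha>"
  shows "integrable lborel (\<lambda>s. exp s * Re (csqrt (of_real x * cis th - of_real (X s))))" (is "integrable _ ?f")
    and "(LINT s|lborel. exp s * Re (csqrt (of_real x * cis th - of_real (X s)))) = pi * Sfun \<alpha> x + th / 2"
proof -
  have x0: "x > 0" using x rho_pos by linarith
  have f: "Im (HH x (Complex s (th / 2))) = ?f s" for s
    unfolding HH_top(1)[OF x0] by (simp del: csqrt.simps)
  have fc: "continuous_on A ?f" for A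
    unfolding f[symmetric] by (intro continuous_intros HH_line_cont[OF x]) (use th_pos in auto)
  have f0: "0 \<le> Re (csqrt (of_real x * cis th - of_real (X s)))" for s
    using csqrt_principal[of "of_real x * cis th - of_real (X s)"] by (auto simp del: csqrt.simps)
  have J: "Im (JJ x R (th / 2)) = (LINT s:{-R..R}|lborel. ?f s)" for R
    using Im_JJ_eq[OF x, of "th / 2" R] th_pos by (simp add: f)
  define e where "e = (\<lambda>R. exp (- (2 * \<alpha> + 2) * R) + x * exp (- 2 * R))"
  define e' where "e' = (\<lambda>R. exp (- (2 * \<alpha> + 2) * R) + x * exp (- 2 * \<alpha> * R))"
  define e'' where "e'' = (\<lambda>R. exp (- (\<alpha> + 1) * R) + x * exp (- (\<alpha> - 1) * R))"
  have ex0: "((\<lambda>R. exp (- c * R)) \<longlongrightarrow> 0) at_top" if "c > 0" for c :: real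
    using that by real_asymp
  have elim: "(e \<longlongrightarrow> 0) at_top" "(e' \<longlongrightarrow> 0) at_top" "(e'' \<longlongrightarrow> 0) at_top"
  proof -
    have "((\<lambda>R. exp (- (2 * \<alpha> + 2) * R) + x * exp (- 2 * R)) \<longlongrightarrow> 0 + x * 0) at_top"
      using \<alpha>_gt1 by (intro tendsto_add tendsto_mult tendsto_const ex0) auto
    then show "(e \<longlongrightarrow> 0) at_top" by (simp add: e_def)
    have "((\<lambda>R. exp (- (2 * \<alpha> + 2) * R) + x * exp (- (2 * \<alpha>) * R)) \<longlongrightarrow> 0 + x * 0) at_top"
      using \<alpha>_gt1 by (intro tendsto_add tendsto_mult tendsto_const ex0) auto
    then show "(e' \<longlongrightarrow> 0) at_top" by (simp add: e'_def)
    have "((\<lambda>R. exp (- (\<alpha> + 1) * R) + x * exp (- (\<alpha> - 1) * R)) \<longlongrightarrow> 0 + x * 0) at_top"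
      using \<alpha>_gt1 by (intro tendsto_add tendsto_mult tendsto_const ex0) auto
    then show "(e'' \<longlongrightarrow> 0) at_top" by (simp add: e''_def)
  qed
  have wl: "((\<lambda>R. LINT s:{-R..R}|lborel. W x s) \<longlongrightarrow> (LINT s|lborel. W x s)) at_top"
    by (rule tendsto_integral_symmetric_interval[OF W_integrable])
  have "((\<lambda>R. Im (JJ x R (th / 2)) - (LINT s:{-R..R}|lborel. W x s) - th / 2) \<longlongrightarrow> 0) at_top"
  proof (rule Lim_null_comparison)
    have "\<forall>\<^sub>F R in at_top. R > 0 \<and> e R < 1 \<and> e' R < 1"
      using order_tendstoD(2)[OF elim(1), of 1] order_tendstoD(2)[OF elim(2), of 1] eventually_gt_at_top[of 0]
      by (simp add: eventually_conj_iff)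
    then show "\<forall>\<^sub>F R in at_top. norm (Im (JJ x R (th / 2)) - (LINT s:{-R..R}|lborel. W x s) - th / 2) \<le> th / 2 * (e R + e'' R)"
    proof eventually_elim
      case (elim R)
      have "exp ((1 + \<alpha>) * R) * e' R = e'' R"
        by (simp add: e'_def e''_def distrib_left exp_add[symmetric] algebra_simps)
      then show ?case using contour_value[OF x, of R] elim by (simp add: e_def e'_def)
    qed
    show "((\<lambda>R. th / 2 * (e R + e'' R)) \<longlongrightarrow> 0) at_top"
      by (rule tendsto_eq_intros elim refl)+ simp
  qed
  from tendsto_add[OF this tendsto_add[OF wl tendsto_const[of "th / 2"]]]
  have lim: "((\<lambda>R. LINT s:{-R..R}|lborel. ?f s) \<longlongrightarrow> (LINT s|lborel. W x s) + th / 2) at_top"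
    by (simp add: J algebra_simps)
  have limn: "(\<lambda>n. LINT s:{-real n..real n}|lborel. ?f s) \<longlonglongrightarrow> (LINT s|lborel. W x s) + th / 2"
    using filterlim_compose[OF lim filterlim_real_sequentially] .
  note mc = integral_monotone_convergence_nonneg[where f = "\<lambda>n s. indicator {-real n..real n} s *\<^sub>R ?f s" and u = ?f and M = lborel]
  have 1: "integrable lborel (\<lambda>s. indicator {-real n..real n} s *\<^sub>R ?f s)" for n
    using borel_integrable_atLeastAtMost'[OF fc] unfolding set_integrable_def .
  have 2: "AE s in lborel. mono (\<lambda>n. indicator {-real n..real n} s *\<^sub>R ?f s)"
    using f0 by (intro AE_I2 monoI) (auto simp: indicator_def simp del: csqrt.simps)
  have 0: "AE s in lborel. 0 \<le> indicator {-real n..real n} s *\<^sub>R ?f s" for n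
    using f0 by (intro AE_I2) (auto simp: indicator_def simp del: csqrt.simps)
  have 3: "AE s in lborel. (\<lambda>n. indicator {-real n..real n} s *\<^sub>R ?f s) \<longlonglongrightarrow> ?f s"
  proof (intro AE_I2 tendsto_eventually)
    fix s :: real
    show "\<forall>\<^sub>F n in sequentially. indicator {-real n..real n} s *\<^sub>R ?f s = ?f s"
      using eventually_ge_at_top[of "nat \<lceil>\<bar>s\<bar>\<rceil>"] by eventually_elim (auto simp: indicator_def nat_le_iff ceiling_le_iff simp del: csqrt.simps)
  qed
  have 4: "?f \<in> borel_measurable lborel" using borel_measurable_continuous_onI[OF fc] by simp
  note limn' = limn[unfolded set_lebesgue_integral_def]
  show "integrable lborel ?f" by (rule mc(1)[OF 1 2 0 3 limn' 4])
  show "(LINT s|lborel. ?f s) = pi * Sfun \<alpha> x + th / 2"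
    using mc(2)[OF 1 2 0 3 limn' 4] by (simp add: Sfun_eq)
qed

section \<open>The integral equation for \<open>\<tau>\<close>\<close>

text \<open>On the original scale the kernel is the imaginary part of a Cauchy kernel with pole at
  \<open>x * cis th\<close>; convolution with it evaluates suitable functions on the rotated
  ray.\<close>

lemma kk_eq_Im:
  assumes "x > 0" "y > 0"
  shows "kk (ln x - ln y) = y * Im (1 / (of_real y - of_real x * cis th)) / pi"
proof -
  have ch: "cosh (ln x - ln y) = (x / y + y / x) / 2"
    using assms by (simp add: cosh_def exp_diff exp_minus)
  have n: "(y - x * cos th)\<^sup>2 + (x * sin th)\<^sup>2 = 2 * (x * y) * (cosh (ln x - ln y) - cos th)"
  proof -
    have "(y - x * cos th)\<^sup>2 + (x * sin th)\<^sup>2 = y\<^sup>2 - 2 * x * y * cos th + x\<^sup>2"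
      using sin_cos_squared_add[of th] by algebra
    then show ?thesis unfolding ch using assms by (simp add: field_simps power2_eq_square)
  qed
  have "Im (1 / (of_real y - of_real x * cis th)) = x * sin th / ((y - x * cos th)\<^sup>2 + (x * sin th)\<^sup>2)"
    by (simp add: Im_divide)
  also have "\<dots> = sin th / (2 * y * (cosh (ln x - ln y) - cos th))"
    unfolding n using assms by simp
  finally have "Im (1 / (of_real y - of_real x * cis th)) = sin th / (2 * y * (cosh (ln x - ln y) - cos th))" .
  then show ?thesis using assms by (simp add: kk_def yk_def)
qed

text \<open>With \<open>t = sqrt (A e^r - c)\<close> and \<open>z^2 = w - c\<close> the integrand
  becomes the imaginary part of \<open>2 z^2 / (t^2 - z^2) / pi\<close>, whose primitive
  \<open>L\<close> is logarithmic. It vanishes at infinity and equals \<open>- \<i> * pi * z\<close>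
  at \<open>t = 0\<close>.\<close>

lemma kernel_sqrt_integral:
  fixes A c \<sigma> :: real
  assumes A: "A > 0" and c: "c > 0"
  defines "w \<equiv> of_real (A * exp \<sigma>) * cis th"
  shows "has_bochner_integral lborel (\<lambda>r. kk (\<sigma> - r) * sqrt (max 0 (A * exp r - c))) (Re (csqrt (w - of_real c)))"
proof -
  define z where "z = csqrt (w - of_real c)"
  define r0 where "r0 = ln (c / A)"
  define q where "q = (\<lambda>r. sqrt (A * exp r - c))"
  define L where "L = (\<lambda>t::real. z * (Ln (of_real t - z) - Ln (of_real t + z)))"
  define F where "F = (\<lambda>r. Im (L (q r)) / pi)"
  define f where "f = (\<lambda>r. kk (\<sigma> - r) * q r)"
  have x: "A * exp \<sigma> > 0" using A by simp
  have z2: "z\<^sup>2 = w - of_real c" by (simp add: z_def del: csqrt.simps)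
  have "Im (z\<^sup>2) = A * exp \<sigma> * sin th" unfolding z2 w_def by simp
  moreover have "0 < A * exp \<sigma> * sin th" by (rule mult_pos_pos[OF x sin_pos])
  moreover have "Im (z\<^sup>2) = 2 * (Re z * Im z)" by (simp add: power2_eq_square)
  ultimately have "2 * (Re z * Im z) > 0" by linarith
  moreover have "Re z \<ge> 0" using csqrt_principal[of "w - of_real c"] by (auto simp: z_def simp del: csqrt.simps)
  ultimately have z: "Re z > 0" "Im z > 0" by (auto simp: zero_less_mult_iff)
  have gt: "A * exp r > c \<longleftrightarrow> r > r0" for r
  proof -
    have "r > r0 \<longleftrightarrow> exp r > exp r0" by simp
    also have "exp r0 = c / A" using A c by (simp add: r0_def)
    finally show ?thesis using A by (simp add: field_simps)
  qed
  have nr: "of_real t - z \<notin> \<real>\<^sub>\<le>\<^sub>0" "of_real t + z \<notin> \<real>\<^sub>\<le>\<^sub>0" for t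
    using z by (auto simp: complex_nonpos_Reals_iff)
  have nz: "of_real t - z \<noteq> 0" "of_real t + z \<noteq> 0" for t
    using z by (auto simp: complex_eq_iff)
  have dL: "(L has_vector_derivative 2 * z\<^sup>2 / (of_real t ^ 2 - z\<^sup>2)) (at t)" for t
  proof -
    have "((\<lambda>v. z * (Ln (v - z) - Ln (v + z))) has_field_derivative z * (inverse (of_real t - z) - inverse (of_real t + z))) (at (of_real t))"
      using nr[of t] by (auto intro!: derivative_eq_intros)
    moreover have "((\<lambda>t. of_real t :: complex) has_vector_derivative 1) (at t)"
      by (auto intro!: derivative_eq_intros)
    ultimately have "(L has_vector_derivative 1 * (z * (inverse (of_real t - z) - inverse (of_real t + z)))) (at t)"
      using field_vector_diff_chain_at[of "of_real" 1 t "\<lambda>v. z * (Ln (v - z) - Ln (v + z))"] by (simp add: L_def o_def)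
    moreover have "1 * (z * (inverse (of_real t - z) - inverse (of_real t + z))) = 2 * z\<^sup>2 / (of_real t ^ 2 - z\<^sup>2)"
    proof -
      have "of_real t ^ 2 - z\<^sup>2 = (of_real t - z) * (of_real t + z)" by (simp add: power2_eq_square algebra_simps)
      then show ?thesis using nz[of t] by (simp add: field_simps power2_eq_square)
    qed
    ultimately show ?thesis by simp
  qed
  have dq: "(q has_real_derivative A * exp r / (2 * q r)) (at r)" if "r > r0" for r
    unfolding q_def using gt[of r] that by (auto intro!: derivative_eq_intros simp: field_simps)
  have dF: "(F has_real_derivative f r) (at r)" if r: "r > r0" for r
  proof -
    define y where "y = A * exp r"
    have y: "y > c" "y > 0" using gt[of r] r c by (auto simp: y_def)
    have q2: "(q r)\<^sup>2 = y - c" "q r > 0" using y by (auto simp: q_def y_def)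
    have "((L \<circ> q) has_vector_derivative (A * exp r / (2 * q r)) *\<^sub>R (2 * z\<^sup>2 / (of_real (q r) ^ 2 - z\<^sup>2))) (at r)"
      using dq[OF r] by (intro vector_diff_chain_at dL) (simp add: has_real_derivative_iff_has_vector_derivative)
    then have "((\<lambda>r. Im ((L \<circ> q) r)) has_vector_derivative Im ((A * exp r / (2 * q r)) *\<^sub>R (2 * z\<^sup>2 / (of_real (q r) ^ 2 - z\<^sup>2)))) (at r)"
      by (rule bounded_linear.has_vector_derivative[OF bounded_linear_Im])
    then have "(F has_real_derivative Im ((A * exp r / (2 * q r)) *\<^sub>R (2 * z\<^sup>2 / (of_real (q r) ^ 2 - z\<^sup>2))) / pi) (at r)"
      unfolding F_def o_def has_real_derivative_iff_has_vector_derivative[symmetric] by (rule DERIV_cdivide)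
    moreover have "Im ((A * exp r / (2 * q r)) *\<^sub>R (2 * z\<^sup>2 / (of_real (q r) ^ 2 - z\<^sup>2))) / pi = f r"
    proof -
      have d: "of_real (q r) ^ 2 - z\<^sup>2 = of_real y - w" unfolding z2 of_real_power[symmetric] q2 by simp
      have nw: "of_real y - w \<noteq> 0" using x sin_pos by (auto simp: w_def complex_eq_iff)
      have "z\<^sup>2 / (of_real y - w) = of_real (y - c) * (1 / (of_real y - w)) - 1"
        unfolding z2 using nw by (simp add: field_simps)
      moreover have "Im (of_real a * v - 1) = a * Im v" for a v by simp
      ultimately have "Im (z\<^sup>2 / (of_real y - w)) = (y - c) * Im (1 / (of_real y - w))"
        by (simp only:)
      moreover have "Im (b *\<^sub>R (2 * v / u)) = 2 * b * Im (v / u)" for b v u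
      proof -
        have "Im (b *\<^sub>R (2 * t)) = 2 * b * Im t" for t by simp
        from this[of "v / u"] show ?thesis by (simp only: times_divide_eq_right)
      qed
      ultimately have "Im ((A * exp r / (2 * q r)) *\<^sub>R (2 * z\<^sup>2 / (of_real (q r) ^ 2 - z\<^sup>2))) = y / q r * ((q r)\<^sup>2 * Im (1 / (of_real y - w)))"
        unfolding d q2 using y_def by (simp only: )
      also have "\<dots> = q r * (y * Im (1 / (of_real y - w)))"
        using q2(2) by (simp add: power2_eq_square)
      also have "y * Im (1 / (of_real y - w)) = pi * kk (\<sigma> - r)"
        using kk_eq_Im[OF x y(2)] A by (simp add: w_def y_def ln_mult)
      finally show ?thesis by (simp add: f_def)
    qed
    ultimately show ?thesis by simp
  qed
  have limR: "((\<lambda>r. F r) \<longlongrightarrow> 0) at_top"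
  proof -
    have qlim: "filterlim q at_top at_top"
      unfolding q_def using A by real_asymp
    have "((\<lambda>t. L t) \<longlongrightarrow> 0) at_top"
    proof -
      have iv: "((\<lambda>t::real. complex_of_real (inverse t)) \<longlongrightarrow> 0) at_top"
        using tendsto_of_real[OF tendsto_inverse_0_at_top[OF filterlim_ident]] by (simp only: of_real_0)
      have "((\<lambda>t::real. z * (Ln (1 - z * of_real (inverse t)) - Ln (1 + z * of_real (inverse t)))) \<longlongrightarrow> z * (Ln (1 - z * 0) - Ln (1 + z * 0))) at_top"
        by (intro tendsto_intros iv) (auto simp: complex_nonpos_Reals_iff)
      moreover have "\<forall>\<^sub>F t in at_top. z * (Ln (1 - z * of_real (inverse t)) - Ln (1 + z * of_real (inverse t))) = L t"
        using eventually_gt_at_top[of 0]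
      proof eventually_elim
        case (elim t)
        have "of_real t - z = of_real t * (1 - z * of_real (inverse t))" "of_real t + z = of_real t * (1 + z * of_real (inverse t))"
          using elim by (simp_all add: field_simps)
        moreover from this have "1 - z * of_real (inverse t) \<noteq> 0" "1 + z * of_real (inverse t) \<noteq> 0" using nz[of t] by auto
        ultimately show ?case using elim by (simp add: L_def Ln_times_of_real)
      qed
      ultimately show ?thesis by (simp add: filterlim_cong)
    qed
    from filterlim_compose[OF this qlim] have "((\<lambda>r. L (q r)) \<longlongrightarrow> 0) at_top" .
    from tendsto_divide[OF tendsto_Im[OF this] tendsto_const[of pi]] show ?thesis by (simp add: F_def)
  qed
  have limL: "((\<lambda>r. F r) \<longlongrightarrow> - Re z) (at_right r0)"
  proof -
    have "isCont q r0" unfolding q_def by (intro continuous_intros)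
    moreover have q0: "q r0 = 0" using A c by (simp add: q_def r0_def)
    moreover have "isCont L 0" using has_vector_derivative_continuous[OF dL[of 0]] by simp
    ultimately have "isCont (\<lambda>r. L (q r)) r0" by (intro isCont_o2[where f = q and g = L]) auto
    then have "isCont F r0" unfolding F_def by (intro continuous_intros) auto
    then have "(F \<longlongrightarrow> F r0) (at_right r0)"
      by (simp add: isCont_def filterlim_at_split)
    moreover have "F r0 = - Re z"
    proof -
      have "z \<noteq> 0" using z by auto
      then have "Ln (- z) = Ln z - \<i> * pi" using z by (simp add: Ln_minus)
      then have "L 0 = - (z * (\<i> * pi))" by (simp add: L_def)
      then show ?thesis unfolding F_def q0 by simp
    qed
    ultimately show ?thesis by simp
  qed
  have fc: "isCont f r" for r
    unfolding f_def q_def by (intro continuous_intros isCont_o2[where f = "\<lambda>r. \<sigma> - r" and g = kk] DERIV_isCont[OF kk_deriv])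
  have fn: "f r \<ge> 0" if "r > r0" for r
    using kk_pos[of "\<sigma> - r"] gt[of r] that by (simp add: f_def q_def)
  have ftc: "set_integrable lborel (einterval r0 \<infinity>) f" "(LBINT r=r0..\<infinity>. f r) = 0 - (- Re z)"
  proof -
    have *: "ereal r0 < \<infinity>" "\<And>x. ereal r0 < ereal x \<Longrightarrow> ereal x < \<infinity> \<Longrightarrow> (F has_real_derivative f x) (at x)"
      "\<And>x. ereal r0 < ereal x \<Longrightarrow> ereal x < \<infinity> \<Longrightarrow> isCont f x"
      "AE x in lborel. ereal r0 < ereal x \<longrightarrow> ereal x < \<infinity> \<longrightarrow> 0 \<le> f x"
      "((F \<circ> real_of_ereal) \<longlongrightarrow> - Re z) (at_right (ereal r0))" "((F \<circ> real_of_ereal) \<longlongrightarrow> 0) (at_left \<infinity>)"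
      using dF fc fn limL limR by (auto simp: ereal_tendsto_simps1)
    show "set_integrable lborel (einterval r0 \<infinity>) f" "(LBINT r=r0..\<infinity>. f r) = 0 - (- Re z)"
      using interval_integral_FTC_nonneg[OF *] by auto
  qed
  have eq: "indicator (einterval (ereal r0) \<infinity>) r *\<^sub>R f r = kk (\<sigma> - r) * sqrt (max 0 (A * exp r - c))" for r
    using gt[of r] by (auto simp: einterval_def indicator_def f_def q_def max_def)
  have eq': "indicator {r0<..} r * f r = kk (\<sigma> - r) * sqrt (max 0 (A * exp r - c))" for r
    using gt[of r] by (auto simp: indicator_def f_def q_def max_def)
  have "integrable lborel (\<lambda>r. kk (\<sigma> - r) * sqrt (max 0 (A * exp r - c)))"
    using ftc(1) unfolding set_integrable_def eq .
  moreover have "(LINT r|lborel. kk (\<sigma> - r) * sqrt (max 0 (A * exp r - c))) = Re z"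
    using ftc(2) by (simp add: interval_lebesgue_integral_def set_lebesgue_integral_def eq')
  ultimately show ?thesis by (simp add: has_bochner_integral_iff z_def del: csqrt.simps)
qed

definition TT :: "real \<Rightarrow> real" where "TT \<sigma> = 2 * (1 + \<alpha>) * Sfun \<alpha> (rho \<alpha> * exp \<sigma>)"

lemma TT_nonneg: "TT \<sigma> \<ge> 0" unfolding TT_def using Sfun_nonneg \<alpha>_gt1 by simp

lemma TT_mono: "\<sigma> \<le> \<sigma>' \<Longrightarrow> TT \<sigma> \<le> TT \<sigma>'"
  unfolding TT_def using \<alpha>_gt1 rho_pos by (intro mult_left_mono Sfun_mono) auto

lemma TT_meas [measurable]: "TT \<in> borel_measurable borel"
  by (rule borel_measurable_mono) (auto simp: mono_def TT_mono)

lemma TT_0: "\<sigma> \<le> 0 \<Longrightarrow> TT \<sigma> = 0"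
  unfolding TT_def using rho_pos by (subst Sfun_0) auto

lemma Sfun_nn: "ennreal (pi * Sfun \<alpha> x) = (\<integral>\<^sup>+ s. ennreal (W x s) \<partial>lborel)"
  unfolding Sfun_eq using nn_integral_eq_integral[OF W_integrable[of x]] W_nonneg by simp

text \<open>Tonelli exchanges the convolution with the integral over \<open>s\<close> that defines
  \<open>S\<close>. The inner integral is the rotated square root, so the outer one runs along the
  shifted contour. Its surplus \<open>th / 2\<close> becomes the constant 2 because
  \<open>(1 + \<alpha>) * th = 2 * pi\<close>.\<close>

lemma tau_equation:
  assumes "\<sigma> \<ge> 0"
  shows "TT \<sigma> = - 2 + conv kk TT \<sigma>"
proof -
  define x where "x = rho \<alpha> * exp \<sigma>"
  have x: "x \<ge> rho \<alpha>" using assms rho_pos by (simp add: x_def)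
  let ?g = "\<lambda>s. exp s * Re (csqrt (of_real x * cis th - of_real (X s)))"
  have g0: "?g s \<ge> 0" for s
    using csqrt_principal[of "of_real x * cis th - of_real (X s)"] by (auto simp del: csqrt.simps)
  have [measurable]: "(\<lambda>p. W (rho \<alpha> * exp (fst p)) (snd p)) \<in> borel_measurable (lborel \<Otimes>\<^sub>M lborel)"
  proof -
    have "(\<lambda>p. W (rho \<alpha> * exp (fst p)) (snd p)) \<in> borel_measurable borel"
      unfolding W_def by (intro borel_measurable_continuous_onI continuous_intros)
    then show ?thesis by (simp add: lborel_prod)
  qed
  have "(\<integral>\<^sup>+ r. ennreal (kk (\<sigma> - r) * (pi * Sfun \<alpha> (rho \<alpha> * exp r))) \<partial>lborel)
      = (\<integral>\<^sup>+ r. \<integral>\<^sup>+ s. ennreal (kk (\<sigma> - r) * W (rho \<alpha> * exp r) s) \<partial>lborel \<partial>lborel)"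
  proof (intro nn_integral_cong)
    fix r
    have "ennreal (kk (\<sigma> - r) * (pi * Sfun \<alpha> (rho \<alpha> * exp r))) = ennreal (kk (\<sigma> - r)) * (\<integral>\<^sup>+ s. ennreal (W (rho \<alpha> * exp r) s) \<partial>lborel)"
      using kk_pos[of "\<sigma> - r"] by (simp add: ennreal_mult' Sfun_nn[symmetric])
    also have "\<dots> = (\<integral>\<^sup>+ s. ennreal (kk (\<sigma> - r)) * ennreal (W (rho \<alpha> * exp r) s) \<partial>lborel)"
      using W_integrable[of "rho \<alpha> * exp r"] by (intro nn_integral_cmult[symmetric]) (auto dest: borel_measurable_integrable)
    finally show "ennreal (kk (\<sigma> - r) * (pi * Sfun \<alpha> (rho \<alpha> * exp r))) = (\<integral>\<^sup>+ s. ennreal (kk (\<sigma> - r) * W (rho \<alpha> * exp r) s) \<partial>lborel)"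
      using kk_pos[of "\<sigma> - r"] by (simp add: ennreal_mult')
  qed
  also have "\<dots> = (\<integral>\<^sup>+ s. \<integral>\<^sup>+ r. ennreal (kk (\<sigma> - r) * W (rho \<alpha> * exp r) s) \<partial>lborel \<partial>lborel)"
    by (rule lborel_pair.Fubini'[symmetric]) measurable
  also have "\<dots> = (\<integral>\<^sup>+ s. ennreal (?g s) \<partial>lborel)"
  proof (intro nn_integral_cong)
    fix s
    note ii = kernel_sqrt_integral[OF rho_pos X_pos[of s], of \<sigma>, folded x_def]
    have "has_bochner_integral lborel (\<lambda>r. exp s * (kk (\<sigma> - r) * sqrt (max 0 (rho \<alpha> * exp r - X s)))) (?g s)"
      by (rule has_bochner_integral_mult_right) (use ii in \<open>simp del: csqrt.simps\<close>)
    then have "has_bochner_integral lborel (\<lambda>r. kk (\<sigma> - r) * W (rho \<alpha> * exp r) s) (?g s)"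
      by (simp add: W_def mult_ac del: csqrt.simps)
    then show "(\<integral>\<^sup>+ r. ennreal (kk (\<sigma> - r) * W (rho \<alpha> * exp r) s) \<partial>lborel) = ennreal (?g s)"
      using kk_pos W_nonneg by (auto simp: has_bochner_integral_iff less_imp_le simp del: csqrt.simps intro!: nn_integral_eq_integral[THEN trans])
  qed
  also have "\<dots> = ennreal (pi * Sfun \<alpha> x + th / 2)"
    using nn_integral_eq_integral[OF shifted_integral(1)[OF x]] g0 shifted_integral(2)[OF x] by simp
  finally have *: "(\<integral>\<^sup>+ r. ennreal (kk (\<sigma> - r) * (pi * Sfun \<alpha> (rho \<alpha> * exp r))) \<partial>lborel) = ennreal (pi * Sfun \<alpha> x + th / 2)" .
  have [measurable]: "(\<lambda>r. Sfun \<alpha> (rho \<alpha> * exp r)) \<in> borel_measurable borel"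
    using rho_pos by (intro borel_measurable_mono) (auto simp: mono_def intro!: Sfun_mono)
  have hb: "has_bochner_integral lborel (\<lambda>r. kk (\<sigma> - r) * (pi * Sfun \<alpha> (rho \<alpha> * exp r))) (pi * Sfun \<alpha> x + th / 2)"
    using Sfun_nonneg kk_pos th_pos * by (intro has_bochner_integral_nn_integral) (auto simp: less_imp_le)
  have hb2: "has_bochner_integral lborel (\<lambda>r. 2 * (1 + \<alpha>) / pi * (kk (\<sigma> - r) * (pi * Sfun \<alpha> (rho \<alpha> * exp r)))) (2 * (1 + \<alpha>) / pi * (pi * Sfun \<alpha> x + th / 2))"
    by (rule has_bochner_integral_mult_right) (use hb in auto)
  have e1: "2 * (1 + \<alpha>) / pi * (kk (\<sigma> - r) * (pi * Sfun \<alpha> (rho \<alpha> * exp r))) = indicator {0..} r *\<^sub>R (kk (\<sigma> - r) * TT r)" for r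
    using TT_0[of r] by (auto simp: TT_def indicator_def)
  have e2: "2 * (1 + \<alpha>) / pi * (pi * Sfun \<alpha> x + th / 2) = TT \<sigma> + 2"
  proof -
    have "2 * (1 + \<alpha>) / pi * (pi * Sfun \<alpha> x + th / 2) = 2 * (1 + \<alpha>) * Sfun \<alpha> x + (1 + \<alpha>) * th / pi"
      by (simp add: field_simps)
    then show ?thesis unfolding th_mult by (simp add: TT_def x_def)
  qed
  show ?thesis
    using hb2[unfolded e1 e2, THEN has_bochner_integral_integral_eq]
    unfolding conv_def set_lebesgue_integral_def by simp
qed

end

section \<open>Integration by parts and limits for half-line convolutions\<close>

lemma half_line_FTC:
  fixes F f :: "real \<Rightarrow> real"
  assumes F: "\<And>r. r \<ge> 0 \<Longrightarrow> (F has_real_derivative f r) (at r)"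
    and f: "set_integrable lborel {0..} f" and L: "(F \<longlongrightarrow> L) at_top"
  shows "(LINT r:{0..}|lborel. f r) = L - F 0"
proof -
  have "((\<lambda>b. LINT r:{0..b}|lborel. f r) \<longlongrightarrow> (LINT r:{0..}|lborel. f r)) at_top"
    by (rule tendsto_set_lebesgue_integral_at_top[OF _ f]) auto
  moreover have "((\<lambda>b. LINT r:{0..b}|lborel. f r) \<longlongrightarrow> L - F 0) at_top"
  proof (rule Lim_transform_eventually)
    show "((\<lambda>b. F b - F 0) \<longlongrightarrow> L - F 0) at_top" by (intro tendsto_intros L)
    show "\<forall>\<^sub>F b in at_top. F b - F 0 = (LINT r:{0..b}|lborel. f r)"
      using eventually_ge_at_top[of 0]
    proof eventually_elim
      case (elim b)
      have "(f has_integral (F b - F 0)) {0..b}"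
        using elim F by (intro fundamental_theorem_of_calculus)
          (auto simp: has_real_derivative_iff_has_vector_derivative[symmetric] intro: has_field_derivative_at_within)
      moreover have "set_integrable lborel {0..b} f" by (rule set_integrable_subset[OF f]) auto
      ultimately show ?case by (simp add: set_borel_integral_eq_integral integral_unique)
    qed
  qed
  ultimately show ?thesis by (rule tendsto_unique[OF trivial_limit_at_top_linorder])
qed

context bae_kernel
begin

lemma conv_parts:
  assumes g: "grows b \<phi>" "grows b \<phi>'" and b: "\<bar>b\<bar> < 1"
    and d: "\<And>r. (\<phi> has_real_derivative \<phi>' r) (at r)"
    and du: "\<And>t. (u has_real_derivative u' t) (at t)"
    and m: "u \<in> borel_measurable borel" "u' \<in> borel_measurable borel"
    and bd: "\<And>t. \<bar>u t\<bar> \<le> D * kk t" "\<And>t. \<bar>u' t\<bar> \<le> D * kk t"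
  shows "conv u' \<phi> \<sigma> = conv u \<phi>' \<sigma> + u \<sigma> * \<phi> 0"
proof -
  obtain C where C: "C > 0" "\<And>r. r \<ge> 0 \<Longrightarrow> \<bar>\<phi> r\<bar> \<le> C * exp (b * r)"
    using g(1) unfolding grows_def by blast
  have D: "D \<ge> 0" using order_trans[OF abs_ge_zero bd(1)[of 0]] kk_pos[of 0] by (simp add: zero_le_mult_iff)
  define F where "F = (\<lambda>r. - (u (\<sigma> - r) * \<phi> r))"
  have i1: "set_integrable lborel {0..} (\<lambda>r. u' (\<sigma> - r) * \<phi> r)" by (rule conv_integrable[OF g(1) b m(2) bd(2)])
  have i2: "set_integrable lborel {0..} (\<lambda>r. u (\<sigma> - r) * \<phi>' r)" by (rule conv_integrable[OF g(2) b m(1) bd(1)])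
  have "(LINT r:{0..}|lborel. u' (\<sigma> - r) * \<phi> r - u (\<sigma> - r) * \<phi>' r) = 0 - F 0"
  proof (rule half_line_FTC)
    fix r :: real
    have "((\<lambda>r. u (\<sigma> - r)) has_real_derivative u' (\<sigma> - r) * (0 - 1)) (at r)"
      by (rule DERIV_chain'[OF _ du]) (auto intro!: derivative_eq_intros)
    then show "(F has_real_derivative u' (\<sigma> - r) * \<phi> r - u (\<sigma> - r) * \<phi>' r) (at r)"
      unfolding F_def by (auto intro!: derivative_eq_intros d)
  next
    show "(F \<longlongrightarrow> 0) at_top"
    proof (rule Lim_null_comparison)
      show "\<forall>\<^sub>F r in at_top. norm (F r) \<le> D * C * (kC * exp \<bar>\<sigma>\<bar> * exp (- (1 - \<bar>b\<bar>) * r))"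
        using eventually_ge_at_top[of 0]
      proof eventually_elim
        case (elim r)
        have "\<bar>u (\<sigma> - r)\<bar> * \<bar>\<phi> r\<bar> \<le> (D * kk (\<sigma> - r)) * (C * exp (b * r))"
          using bd(1)[of "\<sigma> - r"] C(2)[OF elim] D kk_pos[of "\<sigma> - r"] by (intro mult_mono) auto
        also have "\<dots> = D * C * (kk (\<sigma> - r) * exp (b * r))" by simp
        also have "\<dots> \<le> D * C * (kC * exp \<bar>\<sigma>\<bar> * exp (- (1 - \<bar>b\<bar>) * \<bar>r\<bar>))"
          using D C(1) by (intro mult_left_mono kk_exp_bound) auto
        finally show ?case using elim by (simp add: F_def abs_mult)
      qed
      have "((\<lambda>r. exp (- (1 - \<bar>b\<bar>) * r)) \<longlongrightarrow> 0) at_top" using b by real_asymp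
      then show "((\<lambda>r. D * C * (kC * exp \<bar>\<sigma>\<bar> * exp (- (1 - \<bar>b\<bar>) * r))) \<longlongrightarrow> 0) at_top"
        by (intro tendsto_mult_right_zero)
    qed
  qed (rule set_integral_diff(1)[OF i1 i2])
  then show ?thesis
    using set_integral_diff(2)[OF i1 i2] by (simp add: conv_def F_def)
qed

text \<open>After reflection \<open>u t * e^(- b t)\<close> is integrated against a factor that
  stays bounded and tends to \<open>c\<close>, so dominated convergence leaves an exponential moment
  of \<open>u\<close>.\<close>

lemma conv_limit:
  assumes [measurable]: "\<phi> \<in> borel_measurable borel" "u \<in> borel_measurable borel"
    and b: "\<bar>b\<bar> < 1"
    and C: "\<And>r. r \<ge> 0 \<Longrightarrow> \<bar>\<phi> r\<bar> \<le> C * exp (b * r)"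
    and D: "\<And>t. \<bar>u t\<bar> \<le> D * kk t"
    and lim: "((\<lambda>r. \<phi> r * exp (- b * r)) \<longlongrightarrow> c) at_top"
  shows "((\<lambda>\<sigma>. conv u \<phi> \<sigma> * exp (- b * \<sigma>)) \<longlongrightarrow> c * (LINT t|lborel. u t * exp (- b * t))) at_top"
proof -
  have C0: "C \<ge> 0" using order_trans[OF abs_ge_zero C[of 0]] by simp
  have D0: "D \<ge> 0" using order_trans[OF abs_ge_zero D[of 0]] kk_pos[of 0] by (simp add: zero_le_mult_iff)
  have eq: "conv u \<phi> \<sigma> * exp (- b * \<sigma>) = (LINT t|lborel. indicator {..\<sigma>} t * (u t * exp (- b * t)) * (\<phi> (\<sigma> - t) * exp (- b * (\<sigma> - t))))" for \<sigma>
  proof -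
    have "conv u \<phi> \<sigma> = (LINT r|lborel. indicator {..\<sigma>} (\<sigma> - r) * u (\<sigma> - r) * \<phi> (\<sigma> - (\<sigma> - r)))"
      unfolding conv_def set_lebesgue_integral_def by (intro Bochner_Integration.integral_cong) (auto simp: indicator_def)
    also have "\<dots> = (LINT t|lborel. indicator {..\<sigma>} t * u t * \<phi> (\<sigma> - t))"
      by (rule integral_reflect[of "\<lambda>t. indicator {..\<sigma>} t * u t * \<phi> (\<sigma> - t)"])
    also have "\<dots> * exp (- b * \<sigma>) = (LINT t|lborel. indicator {..\<sigma>} t * u t * \<phi> (\<sigma> - t) * exp (- b * \<sigma>))"
      by simp
    also have "\<dots> = (LINT t|lborel. indicator {..\<sigma>} t * (u t * exp (- b * t)) * (\<phi> (\<sigma> - t) * exp (- b * (\<sigma> - t))))"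
    proof (intro Bochner_Integration.integral_cong refl)
      fix t
      have "exp (- b * \<sigma>) = exp (- b * t) * exp (- b * (\<sigma> - t))" by (simp add: exp_add[symmetric] algebra_simps)
      then show "indicator {..\<sigma>} t * u t * \<phi> (\<sigma> - t) * exp (- b * \<sigma>) = indicator {..\<sigma>} t * (u t * exp (- b * t)) * (\<phi> (\<sigma> - t) * exp (- b * (\<sigma> - t)))"
        by (simp only: mult_ac)
    qed
    finally show ?thesis .
  qed
  have "((\<lambda>\<sigma>. LINT t|lborel. indicator {..\<sigma>} t * (u t * exp (- b * t)) * (\<phi> (\<sigma> - t) * exp (- b * (\<sigma> - t))))
      \<longlongrightarrow> (LINT t|lborel. u t * exp (- b * t) * c)) at_top"
  proof (rule integral_dominated_convergence_at_top[where w = "\<lambda>t. D * C * (kk t * exp (- b * t))"])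
    have "integrable lborel (\<lambda>r. kk (0 - r) * exp (b * r))" by (rule kk_exp_integrable[OF b])
    from lborel_integrable_real_affine[OF this, of "-1" 0]
    have "integrable lborel (\<lambda>t. kk t * exp (- b * t))" by simp
    then show "integrable lborel (\<lambda>t. D * C * (kk t * exp (- b * t)))" by simp
    show "AE t in lborel. ((\<lambda>\<sigma>. indicator {..\<sigma>} t * (u t * exp (- b * t)) * (\<phi> (\<sigma> - t) * exp (- b * (\<sigma> - t)))) \<longlongrightarrow> u t * exp (- b * t) * c) at_top"
    proof (intro AE_I2)
      fix t
      have "((\<lambda>\<sigma>. \<phi> (\<sigma> - t) * exp (- b * (\<sigma> - t))) \<longlongrightarrow> c) at_top"
        by (rule filterlim_compose[OF lim]) real_asymp
      then have l: "((\<lambda>\<sigma>. 1 * (u t * exp (- b * t)) * (\<phi> (\<sigma> - t) * exp (- b * (\<sigma> - t)))) \<longlongrightarrow> 1 * (u t * exp (- b * t)) * c) at_top"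
        by (intro tendsto_intros)
      have "\<forall>\<^sub>F \<sigma> in at_top. 1 * (u t * exp (- b * t)) * (\<phi> (\<sigma> - t) * exp (- b * (\<sigma> - t))) = indicator {..\<sigma>} t * (u t * exp (- b * t)) * (\<phi> (\<sigma> - t) * exp (- b * (\<sigma> - t)))"
        using eventually_ge_at_top[of t] by eventually_elim auto
      from Lim_transform_eventually[OF l this]
      show "((\<lambda>\<sigma>. indicator {..\<sigma>} t * (u t * exp (- b * t)) * (\<phi> (\<sigma> - t) * exp (- b * (\<sigma> - t)))) \<longlongrightarrow> u t * exp (- b * t) * c) at_top"
        by simp
    qed
    show "\<forall>\<^sub>F \<sigma> in at_top. AE t in lborel. norm (indicator {..\<sigma>} t * (u t * exp (- b * t)) * (\<phi> (\<sigma> - t) * exp (- b * (\<sigma> - t)))) \<le> D * C * (kk t * exp (- b * t))"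
    proof (intro always_eventually allI AE_I2)
      fix \<sigma> t :: real
      show "norm (indicator {..\<sigma>} t * (u t * exp (- b * t)) * (\<phi> (\<sigma> - t) * exp (- b * (\<sigma> - t)))) \<le> D * C * (kk t * exp (- b * t))"
      proof (cases "t \<le> \<sigma>")
        case True
        have "\<bar>\<phi> (\<sigma> - t)\<bar> * exp (- b * (\<sigma> - t)) \<le> C * exp (b * (\<sigma> - t)) * exp (- b * (\<sigma> - t))"
          using C[of "\<sigma> - t"] True by (intro mult_right_mono) auto
        also have "\<dots> = C" by (simp add: exp_add[symmetric])
        finally have "(\<bar>u t\<bar> * exp (- b * t)) * (\<bar>\<phi> (\<sigma> - t)\<bar> * exp (- b * (\<sigma> - t))) \<le> (D * kk t * exp (- b * t)) * C"
          using D[of t] D0 kk_pos[of t] by (intro mult_mono) auto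
        then show ?thesis using True by (simp add: abs_mult mult_ac)
      next
        case False
        then show ?thesis using D0 C0 kk_pos[of t] by simp
      qed
    qed
  qed measurable
  then show ?thesis unfolding eq by (simp add: mult.commute)
qed

end

context bae
begin

section \<open>Growth of \<open>\<tau>\<close> and the constant \<open>A\<close>\<close>

lemma ex_bounds: "1 / 2 < ex" "ex < 1" "\<bar>ex\<bar> < 1" "0 < ex"
  using \<alpha>_gt1 by (auto simp: ex_def field_simps)

lemma ex_alt: "ex = 1 / 2 + 1 / (2 * \<alpha>)" using \<alpha>_gt1 by (simp add: ex_def field_simps)

text \<open>What remains of \<open>pi * S(x)\<close> once the growth \<open>x^ex\<close> is scaled
  out; \<open>\<epsilon> = x^(-2 ex)\<close> weighs the left wall of the well.\<close>

definition IW :: "real \<Rightarrow> real" where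
  "IW \<epsilon> = (LINT s|lborel. exp s * sqrt (max 0 (1 - exp (2 * \<alpha> * s) - \<epsilon> * exp (- 2 * s))))"

lemma W_scale: "(LINT s|lborel. W (exp l) s) = exp (ex * l) * IW (exp (- 2 * ex * l))"
proof -
  define m where "m = l / (2 * \<alpha>)"
  have "(LINT s|lborel. W (exp l) s) = (LINT s|lborel. W (exp l) (m + s))"
    using lborel_integral_real_affine[of 1 "W (exp l)" m] by simp
  also have "\<dots> = (LINT s|lborel. exp (ex * l) * (exp s * sqrt (max 0 (1 - exp (2 * \<alpha> * s) - exp (- 2 * ex * l) * exp (- 2 * s)))))"
  proof (intro Bochner_Integration.integral_cong refl)
    fix s
    have 1: "2 * \<alpha> * (m + s) = l + 2 * \<alpha> * s" using \<alpha>_gt1 by (simp add: m_def field_simps)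
    have 2: "- 2 * (m + s) = l + (- 2 * ex * l + - 2 * s)" using \<alpha>_gt1 by (simp add: m_def ex_alt field_simps)
    have 3: "ex * l = m + l / 2" using \<alpha>_gt1 by (simp add: m_def ex_alt field_simps)
    have "exp l - X (m + s) = exp l * (1 - exp (2 * \<alpha> * s) - exp (- 2 * ex * l) * exp (- 2 * s))"
      unfolding X_def 1 2 exp_add by (simp add: algebra_simps)
    then have "max 0 (exp l - X (m + s)) = exp l * max 0 (1 - exp (2 * \<alpha> * s) - exp (- 2 * ex * l) * exp (- 2 * s))"
      by (simp add: max_mult_distrib_left)
    moreover have "sqrt (exp l) = exp (l / 2)"
      by (rule real_sqrt_unique) (auto simp: power2_eq_square exp_add[symmetric])
    ultimately show "W (exp l) (m + s) = exp (ex * l) * (exp s * sqrt (max 0 (1 - exp (2 * \<alpha> * s) - exp (- 2 * ex * l) * exp (- 2 * s))))"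
      unfolding W_def 3 by (simp add: real_sqrt_mult exp_add)
  qed
  also have "\<dots> = exp (ex * l) * IW (exp (- 2 * ex * l))" unfolding IW_def by simp
  finally show ?thesis .
qed

lemma IW_le: assumes "s \<in> UNIV" "\<epsilon> \<ge> 0"
  shows "\<bar>exp s * sqrt (max 0 (1 - exp (2 * \<alpha> * s) - \<epsilon> * exp (- 2 * s)))\<bar> \<le> exp (- 1 * \<bar>s\<bar>)"
proof (cases "s \<le> 0")
  case True
  have "sqrt (max 0 (1 - exp (2 * \<alpha> * s) - \<epsilon> * exp (- 2 * s))) \<le> sqrt 1"
    using mult_nonneg_nonneg[OF assms(2) exp_ge_zero[of "- 2 * s"]] exp_ge_zero[of "2 * \<alpha> * s"]
    by (intro real_sqrt_le_mono max.boundedI) linarith+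
  then show ?thesis using True by (simp add: abs_mult)
next
  case False
  then have "1 \<le> exp (2 * \<alpha> * s)" using \<alpha>_gt1 by simp
  then have "1 - exp (2 * \<alpha> * s) - \<epsilon> * exp (- 2 * s) \<le> 0"
    using mult_nonneg_nonneg[OF assms(2) exp_ge_zero[of "- 2 * s"]] by linarith
  then show ?thesis by simp
qed

lemma IW_integrable: "\<epsilon> \<ge> 0 \<Longrightarrow> integrable lborel (\<lambda>s. exp s * sqrt (max 0 (1 - exp (2 * \<alpha> * s) - \<epsilon> * exp (- 2 * s))))"
  by (rule Bochner_Integration.integrable_bound[OF integrable_exp_neg_abs[of 1]])
    (use IW_le in auto)

lemma IW_mono: "\<epsilon> \<ge> 0 \<Longrightarrow> IW \<epsilon> \<le> IW 0"
  unfolding IW_def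
proof (intro integral_mono IW_integrable)
  fix s assume "\<epsilon> \<ge> 0"
  then have "0 \<le> \<epsilon> * exp (- 2 * s)" by simp
  then show "exp s * sqrt (max 0 (1 - exp (2 * \<alpha> * s) - \<epsilon> * exp (- 2 * s))) \<le> exp s * sqrt (max 0 (1 - exp (2 * \<alpha> * s) - 0 * exp (- 2 * s)))"
    by (intro mult_left_mono real_sqrt_le_mono max.mono) auto
qed auto

lemma IW_tendsto: "((\<lambda>l. IW (exp (- 2 * ex * l))) \<longlongrightarrow> IW 0) at_top"
  unfolding IW_def
proof (rule integral_dominated_convergence_at_top[where w = "\<lambda>s. exp (- 1 * \<bar>s\<bar>)"])
  have "((\<lambda>l. exp (- 2 * ex * l)) \<longlongrightarrow> 0) at_top" using ex_bounds by real_asymp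
  then show "AE s in lborel. ((\<lambda>l. exp s * sqrt (max 0 (1 - exp (2 * \<alpha> * s) - exp (- 2 * ex * l) * exp (- 2 * s)))) \<longlongrightarrow>
       exp s * sqrt (max 0 (1 - exp (2 * \<alpha> * s) - 0 * exp (- 2 * s)))) at_top"
    by (intro AE_I2 tendsto_intros)
qed (use IW_le integrable_exp_neg_abs[of 1] in auto)

text \<open>Without the left wall, \<open>t = e^(2 \<alpha> s)\<close> maps the well
  \<open>s < 0\<close> onto \<open>(0, 1)\<close> and gives a Beta integral.\<close>

lemma IW_0: "IW 0 = Beta (1 / (2 * \<alpha>)) (3 / 2) / (2 * \<alpha>)"
proof -
  define f where "f = (\<lambda>t. t powr (1 / (2 * \<alpha>) - 1) * (1 - t) powr (3 / 2 - 1))"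
  have hb: "(f has_integral Beta (1 / (2 * \<alpha>)) (3 / 2)) {0..1}"
    unfolding f_def using \<alpha>_gt1 by (intro has_integral_Beta_real) auto
  then have hb': "(f has_integral Beta (1 / (2 * \<alpha>)) (3 / 2)) {0<..<1}" by (simp add: has_integral_Icc_iff_Ioo)
  have "f absolutely_integrable_on {0<..<1}"
    using hb' by (intro nonnegative_absolutely_integrable_1) (auto simp: f_def integrable_on_def)
  then have si: "set_integrable lborel {0<..<1} f"
    unfolding set_integrable_def f_def by (subst (asm) integrable_completion) auto
  have e01: "einterval (ereal 0) (ereal 1) = {0<..<1}" by (simp add: einterval_def set_eq_iff)
  have en: "einterval (- \<infinity>) (ereal 0) = {..<0}" by (simp add: einterval_def set_eq_iff)
  have fg: "(2 * \<alpha> * exp (2 * \<alpha> * s)) *\<^sub>R f (exp (2 * \<alpha> * s)) = 2 * \<alpha> * (exp s * sqrt (max 0 (1 - exp (2 * \<alpha> * s) - 0 * exp (- 2 * s))))"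
    if "s < 0" for s
  proof -
    have "exp (2 * \<alpha> * s) * exp (2 * \<alpha> * s) powr (1 / (2 * \<alpha>) - 1) = exp s"
      using \<alpha>_gt1 by (simp add: powr_def exp_add[symmetric] field_simps)
    moreover have "(1 - exp (2 * \<alpha> * s)) powr (3 / 2 - 1) = sqrt (max 0 (1 - exp (2 * \<alpha> * s)))"
      using that \<alpha>_gt1 by (simp add: powr_half_sqrt mult_nonneg_nonpos)
    ultimately show ?thesis by (simp add: f_def mult.assoc[symmetric])
  qed
  have int: "integrable lborel (\<lambda>s. 2 * \<alpha> * (exp s * sqrt (max 0 (1 - exp (2 * \<alpha> * s) - 0 * exp (- 2 * s)))))"
    by (intro integrable_mult_right IW_integrable) auto
  have ind: "indicator {..<0} s *\<^sub>R ((2 * \<alpha> * exp (2 * \<alpha> * s)) *\<^sub>R f (exp (2 * \<alpha> * s))) = 2 * \<alpha> * (exp s * sqrt (max 0 (1 - exp (2 * \<alpha> * s) - 0 * exp (- 2 * s))))" for s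
  proof (cases "s < 0")
    case False
    then have "1 - exp (2 * \<alpha> * s) \<le> 0" using \<alpha>_gt1 by simp
    then show ?thesis using False by simp
  qed (use fg in simp)
  have si2: "set_integrable lborel {..<0} (\<lambda>s. (2 * \<alpha> * exp (2 * \<alpha> * s)) *\<^sub>R f (exp (2 * \<alpha> * s)))"
    unfolding set_integrable_def ind by (rule int)
  have "(LBINT x=ereal 0..ereal 1. f x) = (LBINT s=-\<infinity>..ereal 0. (2 * \<alpha> * exp (2 * \<alpha> * s)) *\<^sub>R f (exp (2 * \<alpha> * s)))"
  proof (rule interval_integral_substitution_integrable)
    show "((ereal \<circ> (\<lambda>s. exp (2 * \<alpha> * s)) \<circ> real_of_ereal) \<longlongrightarrow> ereal 0) (at_right (- \<infinity>))"
    proof -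
      have "((\<lambda>s. exp (2 * \<alpha> * s)) \<longlongrightarrow> 0) at_bot" using \<alpha>_gt1 by real_asymp
      then show ?thesis by (simp add: ereal_tendsto_simps)
    qed
    show "((ereal \<circ> (\<lambda>s. exp (2 * \<alpha> * s)) \<circ> real_of_ereal) \<longlongrightarrow> ereal 1) (at_left (ereal 0))"
    proof -
      have "((\<lambda>s::real. exp (2 * \<alpha> * s)) \<longlongrightarrow> exp (2 * \<alpha> * 0)) (at_left 0)" by (intro tendsto_intros)
      then show ?thesis by (simp add: ereal_tendsto_simps)
    qed
    show "isCont f (exp (2 * \<alpha> * s))" if "- \<infinity> < ereal s" "ereal s < ereal 0" for s
      unfolding f_def using that \<alpha>_gt1 by (intro continuous_intros) (auto simp: mult_pos_neg)
  qed (use \<alpha>_gt1 si si2 in \<open>auto simp: e01 en intro!: derivative_eq_intros\<close>)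
  moreover have "(LBINT x=ereal 0..ereal 1. f x) = Beta (1 / (2 * \<alpha>)) (3 / 2)"
    using set_borel_integral_eq_integral(2)[OF si] hb' by (simp add: interval_lebesgue_integral_def e01 integral_unique)
  moreover have "(LBINT s=-\<infinity>..ereal 0. (2 * \<alpha> * exp (2 * \<alpha> * s)) *\<^sub>R f (exp (2 * \<alpha> * s))) = 2 * \<alpha> * IW 0"
  proof -
    have "(LBINT s=-\<infinity>..ereal 0. (2 * \<alpha> * exp (2 * \<alpha> * s)) *\<^sub>R f (exp (2 * \<alpha> * s))) = (LINT s|lborel. 2 * \<alpha> * (exp s * sqrt (max 0 (1 - exp (2 * \<alpha> * s) - 0 * exp (- 2 * s)))))"
      unfolding interval_lebesgue_integral_def en set_lebesgue_integral_def ind by simp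
    then show ?thesis unfolding IW_def by simp
  qed
  ultimately show ?thesis using \<alpha>_gt1 by (simp add: field_simps)
qed

definition cT :: real where "cT = Aconst \<alpha> powr ex"

text \<open>Matches the Beta integral with the Gamma quotient in \<open>A\<close>; the powers of
  \<open>\<alpha>\<close> inside \<open>rho\<close> collect to the exponent
  \<open>- ex + 1 / (2 \<alpha>) = - 1 / 2\<close>.\<close>

lemma cT_eq: "cT = 2 * (1 + \<alpha>) / pi * rho \<alpha> powr ex * IW 0"
proof -
  define G where "G = Gamma (1 / (2 * \<alpha>))"
  define G' where "G' = Gamma ex"
  have G: "G > 0" "G' > 0" using \<alpha>_gt1 ex_bounds by (auto simp: G_def G'_def intro!: Gamma_real_pos)
  have ex': "(1 + \<alpha>) / (2 * \<alpha>) = ex" by (simp add: ex_def)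
  have tae: "2 * \<alpha> * ex = \<alpha> + 1" using \<alpha>_gt1 by (simp add: ex_def)
  have "2 * \<alpha> / (\<alpha> + 1) * ex = (2 * \<alpha> * ex) / (\<alpha> + 1)" by simp
  also have "\<dots> = 1" unfolding tae using \<alpha>_gt1 by simp
  finally have tae': "2 * \<alpha> / (\<alpha> + 1) * ex = 1" .
  define B where "B = 1 / sqrt (pi * \<alpha>) * G / G'"
  have B: "B > 0" unfolding B_def using \<alpha>_gt1 by (intro divide_pos_pos mult_pos_pos G) auto
  have "cT = ((1 + \<alpha>) * B powr (2 * \<alpha> / (\<alpha> + 1))) powr ex"
    by (simp only: cT_def Aconst_def B_def G_def G'_def ex')
  also have "\<dots> = (1 + \<alpha>) powr ex * (B powr (2 * \<alpha> / (\<alpha> + 1))) powr ex"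
    using \<alpha>_gt1 by (simp add: powr_mult)
  also have "(B powr (2 * \<alpha> / (\<alpha> + 1))) powr ex = B"
    unfolding powr_powr tae' using B by simp
  finally have c1: "cT = (1 + \<alpha>) powr ex * (1 / sqrt (pi * \<alpha>) * G / G')" unfolding B_def .
  have r: "rho \<alpha> powr ex = (1 + \<alpha>) powr ex / sqrt \<alpha>"
  proof -
    have "1 / (\<alpha> + 1) * ex = 1 / (2 * \<alpha>)" using \<alpha>_gt1 tae ex_bounds by (simp add: field_simps)
    then have "rho \<alpha> powr ex = (1 + \<alpha>) powr ex * (\<alpha> powr (- ex) * \<alpha> powr (1 / (2 * \<alpha>)))"
      unfolding rho_def using \<alpha>_gt1 by (simp add: powr_mult powr_divide powr_powr powr_minus field_simps)
    also have "\<alpha> powr (- ex) * \<alpha> powr (1 / (2 * \<alpha>)) = \<alpha> powr (- (1 / 2))"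
      by (simp add: powr_add[symmetric] ex_alt)
    finally show ?thesis using \<alpha>_gt1 by (simp add: powr_minus powr_half_sqrt field_simps)
  qed
  have g1: "1 / (2 * \<alpha>) + 3 / 2 = ex + 1" by (simp add: ex_alt)
  have g2: "Gamma (ex + 1) = ex * G'" unfolding G'_def using ex_bounds by (intro Gamma_plus1) (auto dest: nonpos_Ints_nonpos)
  have g3: "Gamma (3 / 2 :: real) = sqrt pi / 2"
    using Gamma_plus1[of "1 / 2 :: real"] nonpos_Ints_nonpos[of "1 / 2 :: real"] by (auto simp add: Gamma_one_half_real)
  have b: "IW 0 = G * (sqrt pi / 2) / (ex * G') / (2 * \<alpha>)"
    unfolding IW_0 Beta_def g1 g2 g3 G_def ..
  have "2 * \<alpha> * ex = 1 + \<alpha>" using \<alpha>_gt1 by (simp add: ex_def)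
  then have b': "IW 0 = G * (sqrt pi / 2) / ((1 + \<alpha>) * G')" unfolding b by (simp add: mult_ac)
  have sp: "sqrt pi / pi = 1 / sqrt pi" by (simp add: field_simps)
  have "2 * (1 + \<alpha>) / pi * ((1 + \<alpha>) powr ex / sqrt \<alpha>) * (G * (sqrt pi / 2) / ((1 + \<alpha>) * G'))
      = (1 + \<alpha>) powr ex * (G / (sqrt \<alpha> * G')) * (sqrt pi / pi)"
    using \<alpha>_gt1 G by (simp add: divide_simps)
  then show ?thesis
    unfolding c1 r b' real_sqrt_mult sp by simp
qed

lemma TT_scale: "TT \<sigma> * exp (- ex * \<sigma>) = 2 * (1 + \<alpha>) / pi * rho \<alpha> powr ex * IW (exp (- 2 * ex * (ln (rho \<alpha>) + \<sigma>)))"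
proof -
  have "rho \<alpha> * exp \<sigma> = exp (ln (rho \<alpha>) + \<sigma>)" using rho_pos by (simp add: exp_add)
  then have "TT \<sigma> = 2 * (1 + \<alpha>) / pi * (exp (ex * (ln (rho \<alpha>) + \<sigma>)) * IW (exp (- 2 * ex * (ln (rho \<alpha>) + \<sigma>))))"
    unfolding TT_def Sfun_eq by (simp add: W_scale)
  moreover have "exp (ex * (ln (rho \<alpha>) + \<sigma>)) * exp (- ex * \<sigma>) = rho \<alpha> powr ex"
    using rho_pos by (simp add: powr_def exp_add[symmetric] algebra_simps)
  ultimately show ?thesis by (simp add: mult_ac)
qed

lemma TT_tendsto: "((\<lambda>\<sigma>. TT \<sigma> * exp (- ex * \<sigma>)) \<longlongrightarrow> cT) at_top"
proof -
  have "filterlim (\<lambda>\<sigma>. ln (rho \<alpha>) + \<sigma>) at_top at_top" by real_asymp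
  from filterlim_compose[OF IW_tendsto this] show ?thesis
    unfolding TT_scale cT_eq by (intro tendsto_intros)
qed

lemma TT_le: "TT \<sigma> \<le> cT * exp (ex * \<sigma>)"
proof -
  have "TT \<sigma> * exp (- ex * \<sigma>) \<le> cT"
    unfolding TT_scale cT_eq using \<alpha>_gt1 by (intro mult_left_mono IW_mono) auto
  then have "TT \<sigma> * exp (- ex * \<sigma>) * exp (ex * \<sigma>) \<le> cT * exp (ex * \<sigma>)" by (intro mult_right_mono) auto
  then show ?thesis by (simp add: mult.assoc exp_add[symmetric])
qed

lemma Aconst_pos: "Aconst \<alpha> > 0"
proof -
  have g: "Gamma (1 / (2 * \<alpha>)) > 0" "Gamma ((1 + \<alpha>) / (2 * \<alpha>)) > 0"
    using \<alpha>_gt1 by (intro Gamma_real_pos; simp)+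
  have "1 / sqrt (pi * \<alpha>) * Gamma (1 / (2 * \<alpha>)) / Gamma ((1 + \<alpha>) / (2 * \<alpha>)) > 0"
    using g \<alpha>_gt1 by (intro divide_pos_pos mult_pos_pos) auto
  then show "Aconst \<alpha> > 0" unfolding Aconst_def using \<alpha>_gt1
    by (intro mult_pos_pos powr_gt_zero[THEN iffD2]) linarith+
qed

lemma cT_pos: "cT > 0"
  using Aconst_pos by (simp add: cT_def)

end

section \<open>Derivatives and asymptotics of \<open>\<tau>\<close>\<close>

text \<open>The area of a half disc, wanted for the harmonic approximation at the bottom of the
  well.\<close>

lemma integral_semicircle: "has_bochner_integral lborel (\<lambda>r::real. sqrt (max 0 (1 - r\<^sup>2))) (pi / 2)"
proof (rule has_bochner_integral_nn_integral)
  have "Beta (1 / 2) (real 1 / 2 + 1) = pi / 2"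
  proof -
    have g3: "Gamma (3 / 2 :: real) = sqrt pi / 2"
      using Gamma_plus1[of "1 / 2 :: real"] nonpos_Ints_nonpos[of "1 / 2 :: real"] by (auto simp add: Gamma_one_half_real)
    have g2: "Gamma (2 :: real) = 1" using Gamma_fact[of 1] by simp
    have e: "real 1 / 2 + 1 = 3 / 2" "1 / 2 + 3 / 2 = (2 :: real)" by auto
    show ?thesis unfolding Beta_def e g2 g3 Gamma_one_half_real by simp
  qed
  moreover have "sqrt (max 0 (1 - r\<^sup>2)) = indicator {-1..1} r * sqrt (1 - r\<^sup>2) ^ 1" for r :: real
  proof (cases "r \<in> {-1..1}")
    case True
    then have "r\<^sup>2 \<le> 1" by (simp add: abs_square_le_1 abs_le_iff)
    then show ?thesis using True by simp
  next
    case False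
    then have "1 < \<bar>r\<bar>" by auto
    then have "1 - r\<^sup>2 \<le> 0" using abs_square_le_1[of r] by linarith
    then show ?thesis using False by simp
  qed
  ultimately show "(\<integral>\<^sup>+ r. ennreal (sqrt (max 0 (1 - r\<^sup>2))) \<partial>lborel) = ennreal (pi / 2)"
    using emeasure_cball_aux_integral[of 1] by (simp only:)
qed auto

context bae
begin

lemma TT_grows: "grows ex TT"
  unfolding grows_def using TT_le TT_nonneg cT_pos by (auto intro!: exI[of _ cT])

text \<open>\<open>PP\<close> extends \<open>TT\<close> smoothly across 0, where \<open>TT\<close> itself has a kink.\<close>

definition PP :: "real \<Rightarrow> real" where "PP \<sigma> = - 2 + conv kk TT \<sigma>"
definition T1 :: "real \<Rightarrow> real" where "T1 = conv kk1 TT"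
definition T2 :: "real \<Rightarrow> real" where "T2 = conv kk2 TT"
definition T3 :: "real \<Rightarrow> real" where "T3 = conv kk3 TT"

lemma PP_eq: "\<sigma> \<ge> 0 \<Longrightarrow> PP \<sigma> = TT \<sigma>"
  unfolding PP_def using tau_equation by simp

lemma kk_self: "\<bar>kk t\<bar> \<le> (1 + kD) * kk t" "\<bar>kk1 t\<bar> \<le> (1 + kD) * kk t" "\<bar>kk2 t\<bar> \<le> (1 + kD) * kk t"
  "\<bar>kk3 t\<bar> \<le> (1 + kD) * kk t" "\<bar>kk4 t\<bar> \<le> (1 + kD) * kk t"
  using kD(2-5)[of t] kk_pos[of t] by (auto simp: distrib_right)

lemma PP_deriv: "(PP has_real_derivative T1 \<sigma>) (at \<sigma>)"
  unfolding PP_def [abs_def] T1_def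
  by (auto intro!: derivative_eq_intros conv_deriv[OF TT_grows ex_bounds(3) kk_deriv kk1_deriv kk_self(1,2,3)])

lemma T1_deriv: "(T1 has_real_derivative T2 \<sigma>) (at \<sigma>)"
  unfolding T1_def T2_def
  by (rule conv_deriv[OF TT_grows ex_bounds(3) kk1_deriv kk2_deriv kk_self(2,3,4)])

lemma T2_deriv: "(T2 has_real_derivative T3 \<sigma>) (at \<sigma>)"
  unfolding T2_def T3_def
  by (rule conv_deriv[OF TT_grows ex_bounds(3) kk2_deriv kk3_deriv kk_self(3,4,5)])

lemma PP_meas [measurable]: "PP \<in> borel_measurable borel"
  and T1_meas [measurable]: "T1 \<in> borel_measurable borel"
  and T2_meas [measurable]: "T2 \<in> borel_measurable borel"
  by (auto intro!: borel_measurable_continuous_onI DERIV_continuous_on[of UNIV] PP_deriv T1_deriv T2_deriv)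

definition Tb :: real where "Tb = (1 + kD) * (cT + 2)"

lemma Tb_pos: "Tb > 0" using kD(1) cT_pos by (simp add: Tb_def)

lemma conv_TT_bound:
  assumes [measurable]: "u \<in> borel_measurable borel" and u: "\<And>t. \<bar>u t\<bar> \<le> (1 + kD) * kk t" and s: "\<sigma> \<ge> 0"
  shows "\<bar>conv u TT \<sigma>\<bar> \<le> Tb * exp (ex * \<sigma>)"
proof -
  have "\<bar>conv u TT \<sigma>\<bar> \<le> conv (\<lambda>t. (1 + kD) * kk t) TT \<sigma>"
  proof (rule conv_abs_le[OF TT_grows TT_grows ex_bounds(3,3) assms(1) u])
    show "\<bar>(1 + kD) * kk t\<bar> \<le> (1 + kD) * kk t" for t using kk_pos[of t] kD(1) by simp
    show "\<bar>u (\<sigma> - r) * TT r\<bar> \<le> (1 + kD) * kk (\<sigma> - r) * TT r" for r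
      unfolding abs_mult using u[of "\<sigma> - r"] TT_nonneg[of r] by (simp add: mult_right_mono)
  qed measurable
  also have "\<dots> = (1 + kD) * (TT \<sigma> + 2)" unfolding conv_scale using tau_equation[OF s] by simp
  also have "\<dots> \<le> (1 + kD) * (cT * exp (ex * \<sigma>) + 2 * exp (ex * \<sigma>))"
    using TT_le[of \<sigma>] kD(1) s ex_bounds by (intro mult_left_mono add_mono) auto
  finally show ?thesis by (simp add: Tb_def algebra_simps)
qed

lemma T_bounds:
  assumes "\<sigma> \<ge> 0"
  shows "\<bar>T1 \<sigma>\<bar> \<le> Tb * exp (ex * \<sigma>)" "\<bar>T2 \<sigma>\<bar> \<le> Tb * exp (ex * \<sigma>)" "\<bar>T3 \<sigma>\<bar> \<le> Tb * exp (ex * \<sigma>)"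
  unfolding T1_def T2_def T3_def using assms kk_self by (auto intro!: conv_TT_bound)

lemma PP_grows: "grows ex PP" and T1_grows: "grows ex T1" and T2_grows: "grows ex T2"
proof -
  show "grows ex PP" unfolding grows_def using TT_le TT_nonneg cT_pos by (auto simp: PP_eq intro!: exI[of _ cT])
  show "grows ex T1" "grows ex T2" unfolding grows_def using T_bounds Tb_pos by (auto intro!: exI[of _ Tb])
qed

lemma conv_cong: "(\<And>r. r \<ge> 0 \<Longrightarrow> \<phi> r = \<psi> r) \<Longrightarrow> conv u \<phi> \<sigma> = conv u \<psi> \<sigma>"
  unfolding conv_def by (intro set_lebesgue_integral_cong) auto

lemma PP_0: "PP 0 = 0" by (simp add: PP_eq TT_0)

lemma T1_conv: "T1 \<sigma> = conv kk T1 \<sigma>"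
proof -
  have "T1 \<sigma> = conv kk1 PP \<sigma>" unfolding T1_def by (rule conv_cong) (simp add: PP_eq)
  also have "\<dots> = conv kk T1 \<sigma> + kk \<sigma> * PP 0"
    by (rule conv_parts[OF PP_grows T1_grows ex_bounds(3) PP_deriv kk_deriv _ _ kk_self(1,2)]) measurable
  finally show ?thesis by (simp add: PP_0)
qed

text \<open>Integration by parts left no boundary term for \<open>T1\<close>, because
  \<open>PP 0 = 0\<close>. Here \<open>T1 0\<close> survives; with the right coefficient this term
  accounts for the \<open>H\<close> holes.\<close>

lemma T2_conv: "T2 \<sigma> = conv kk T2 \<sigma> + kk \<sigma> * T1 0"
proof -
  have "(conv kk T1 has_real_derivative conv kk1 T1 \<sigma>) (at \<sigma>)"
    by (rule conv_deriv[OF T1_grows ex_bounds(3) kk_deriv kk1_deriv kk_self(1,2,3)])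
  moreover have "conv kk T1 = T1" using T1_conv by auto
  ultimately have "T2 \<sigma> = conv kk1 T1 \<sigma>" using DERIV_unique[OF T1_deriv[of \<sigma>]] by auto
  also have "\<dots> = conv kk T2 \<sigma> + kk \<sigma> * T1 0"
    by (rule conv_parts[OF T1_grows T2_grows ex_bounds(3) T1_deriv kk_deriv _ _ kk_self(1,2)]) measurable
  finally show ?thesis .
qed

lemma T1_nonneg: assumes "\<sigma> \<ge> 0" shows "T1 \<sigma> \<ge> 0"
proof (rule tendsto_lowerbound)
  have "((\<lambda>h. (PP (\<sigma> + h) - PP \<sigma>) / h) \<longlongrightarrow> T1 \<sigma>) (at 0)"
    using PP_deriv[of \<sigma>] by (simp add: DERIV_def)
  then show "((\<lambda>h. (PP (\<sigma> + h) - PP \<sigma>) / h) \<longlongrightarrow> T1 \<sigma>) (at_right 0)" by (simp add: filterlim_at_split)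
  show "\<forall>\<^sub>F h in at_right 0. 0 \<le> (PP (\<sigma> + h) - PP \<sigma>) / h"
    using eventually_at_right_less[of "0 :: real"]
  proof eventually_elim
    case (elim h)
    then show ?case using assms TT_mono[of \<sigma> "\<sigma> + h"] by (simp add: PP_eq)
  qed
qed auto

text \<open>\<open>T1\<close> is nonnegative and equal to its own convolution with
  \<open>kk\<close>, so the part of the integral within distance \<open>m\<close> of
  \<open>\<sigma>\<close> is already a lower bound.\<close>

lemma T1_ge_increment:
  assumes "\<sigma> \<ge> 0" "m > 0"
  shows "T1 \<sigma> \<ge> kc * exp (- m) * (TT (\<sigma> + m) - TT (max 0 (\<sigma> - m)))"
proof -
  define A B where "A = max 0 (\<sigma> - m)" and "B = \<sigma> + m"
  have AB: "0 \<le> A" "A \<le> B" using assms by (auto simp: A_def B_def)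
  have "(T1 has_integral (PP B - PP A)) {A..B}"
    using AB PP_deriv by (intro fundamental_theorem_of_calculus)
      (auto simp: has_real_derivative_iff_has_vector_derivative[symmetric] intro: has_field_derivative_at_within)
  moreover have si: "set_integrable lborel {A..B} T1"
    by (intro borel_integrable_atLeastAtMost' DERIV_continuous_on) (auto intro: has_field_derivative_at_within[OF T1_deriv])
  ultimately have "(LINT r:{A..B}|lborel. T1 r) = TT B - TT A"
    using AB by (simp add: set_borel_integral_eq_integral integral_unique PP_eq)
  then have "kc * exp (- m) * (TT B - TT A) = (LINT r|lborel. indicator {A..B} r * (kc * exp (- m) * T1 r))"
  proof -
    have "indicator {A..B} r * (b * T1 r) = b * (indicator {A..B} r *\<^sub>R T1 r)" for b r by simp
    then have "(LINT r|lborel. indicator {A..B} r * (b * T1 r)) = b * (LINT r:{A..B}|lborel. T1 r)" for b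
      unfolding set_lebesgue_integral_def by (simp only: integral_mult_right_zero)
    then show ?thesis using \<open>(LINT r:{A..B}|lborel. T1 r) = TT B - TT A\<close> by simp
  qed
  also have "\<dots> \<le> (LINT r|lborel. indicator {0..} r *\<^sub>R (kk (\<sigma> - r) * T1 r))"
  proof (rule integral_mono)
    show "integrable lborel (\<lambda>r. indicator {A..B} r * (kc * exp (- m) * T1 r))"
      using set_integrable_mult_right[OF si, of "kc * exp (- m)"] by (simp add: set_integrable_def)
    show "integrable lborel (\<lambda>r. indicator {0..} r *\<^sub>R (kk (\<sigma> - r) * T1 r))"
      using conv_integrable[OF T1_grows ex_bounds(3) kk_meas(1) kk_self(1)] by (simp add: set_integrable_def)
    fix r
    show "indicator {A..B} r * (kc * exp (- m) * T1 r) \<le> indicator {0..} r *\<^sub>R (kk (\<sigma> - r) * T1 r)"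
    proof (cases "r \<in> {A..B}")
      case True
      then have r: "r \<ge> 0" "\<bar>\<sigma> - r\<bar> \<le> m" using AB by (auto simp: A_def B_def)
      then have "kc * exp (- m) \<le> kc * exp (- \<bar>\<sigma> - r\<bar>)" using kc(1) by simp
      also have "\<dots> \<le> kk (\<sigma> - r)" by (rule kc)
      finally show ?thesis using True r T1_nonneg[OF r(1)] by (simp add: mult_right_mono)
    next
      case False
      then show ?thesis using T1_nonneg[of r] kk_pos[of "\<sigma> - r"] by (auto simp: indicator_def)
    qed
  qed
  also have "\<dots> = T1 \<sigma>" by (subst T1_conv) (simp add: conv_def set_lebesgue_integral_def)
  finally show ?thesis by (simp add: A_def B_def)
qed

text \<open>The growth of \<open>TT\<close> passes to its derivative, since \<open>T1\<close>
  dominates increments of \<open>TT\<close> over a fixed window.\<close>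

lemma ex_T1_lower: "\<exists>c>0. \<forall>\<sigma>\<ge>0. c * exp (ex * \<sigma>) \<le> T1 \<sigma>"
proof -
  have "\<forall>\<^sub>F \<sigma> in at_top. TT \<sigma> * exp (- ex * \<sigma>) > cT / 2"
    using order_tendstoD(1)[OF TT_tendsto, of "cT / 2"] cT_pos by simp
  then obtain s1 where s1: "\<And>\<sigma>. \<sigma> \<ge> s1 \<Longrightarrow> TT \<sigma> * exp (- ex * \<sigma>) > cT / 2"
    unfolding eventually_at_top_linorder by blast
  \<comment> \<open>\<open>m \<ge> s1\<close> brings \<open>\<sigma> + m\<close> into the asymptotic
    range. With \<open>ex > 1 / 2\<close>, \<open>m \<ge> 2\<close> gives
    \<open>e^(2 ex m) \<ge> e^2 \<ge> 4\<close>, so the upper bound at the left end uses up at most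
    half of the lower bound at the right end.\<close>
  define m where "m = max s1 2"
  have m: "m > 0" "m \<ge> s1" "m \<ge> 2" by (auto simp: m_def)
  have lo: "TT \<sigma> \<ge> cT / 2 * exp (ex * \<sigma>)" if "\<sigma> \<ge> s1" for \<sigma>
  proof -
    have "cT / 2 * exp (ex * \<sigma>) \<le> TT \<sigma> * exp (- ex * \<sigma>) * exp (ex * \<sigma>)"
      using s1[OF that] by (intro mult_right_mono) auto
    then show ?thesis by (simp add: mult.assoc exp_add[symmetric])
  qed
  have em: "exp (- (ex * m)) * 4 \<le> exp (ex * m)"
  proof -
    have "ex * m \<ge> 1" using m ex_bounds mult_mono[of "1/2" ex 2 m] by auto
    then have e2: "exp 2 \<le> exp (2 * (ex * m))" by simp
    have e4: "4 \<le> exp (2::real)"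
    proof -
      have "exp (1::real) \<ge> 2" using exp_ge_add_one_self[of "1::real"] by simp
      then have "exp (1::real) * exp 1 \<ge> 2 * 2" by (intro mult_mono) auto
      then show ?thesis by (simp add: exp_add[symmetric])
    qed
    have "exp (- (ex * m)) * 4 \<le> exp (- (ex * m)) * exp (2 * (ex * m))"
      by (intro mult_left_mono order_trans[OF e4 e2]) auto
    then show ?thesis by (simp add: exp_add[symmetric] mult.commute)
  qed
  define c where "c = kc * exp (- m) * (cT / 4 * exp (ex * m))"
  have "c * exp (ex * \<sigma>) \<le> T1 \<sigma>" if s: "\<sigma> \<ge> 0" for \<sigma>
  proof -
    have 1: "TT (\<sigma> + m) \<ge> cT / 2 * exp (ex * m) * exp (ex * \<sigma>)"
      using lo[of "\<sigma> + m"] s m by (simp add: exp_add[symmetric] algebra_simps)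
    have 2: "TT (max 0 (\<sigma> - m)) \<le> cT / 4 * exp (ex * m) * exp (ex * \<sigma>)"
    proof (cases "\<sigma> \<ge> m")
      case True
      have "TT (\<sigma> - m) \<le> cT * exp (ex * (\<sigma> - m))" by (rule TT_le)
      also have "\<dots> = cT * exp (- (ex * m)) * exp (ex * \<sigma>)" by (simp add: exp_add[symmetric] algebra_simps)
      also have "\<dots> \<le> cT * (exp (ex * m) / 4) * exp (ex * \<sigma>)"
        using em cT_pos by (intro mult_right_mono mult_left_mono) auto
      finally show ?thesis using True by simp
    next
      case False
      then show ?thesis using cT_pos by (simp add: TT_0)
    qed
    have "kc * exp (- m) * (cT / 4 * exp (ex * m) * exp (ex * \<sigma>)) \<le> kc * exp (- m) * (TT (\<sigma> + m) - TT (max 0 (\<sigma> - m)))"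
      using 1 2 kc(1) by (intro mult_left_mono) auto
    also have "\<dots> \<le> T1 \<sigma>" by (rule T1_ge_increment[OF s m(1)])
    finally show ?thesis by (simp add: c_def mult_ac)
  qed
  moreover have "c > 0" using kc(1) cT_pos by (simp add: c_def)
  ultimately show ?thesis by blast
qed

definition tc :: real where "tc = (SOME c. c > 0 \<and> (\<forall>\<sigma>\<ge>0. c * exp (ex * \<sigma>) \<le> T1 \<sigma>))"

lemma tc: "tc > 0" "\<sigma> \<ge> 0 \<Longrightarrow> tc * exp (ex * \<sigma>) \<le> T1 \<sigma>"
  using someI_ex[OF ex_T1_lower, folded tc_def] by auto

lemma TT_abs: "r \<ge> 0 \<Longrightarrow> \<bar>TT r\<bar> \<le> cT * exp (ex * r)"
  using TT_le TT_nonneg by simp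

text \<open>Divide the equation of \<open>\<tau>\<close> by \<open>e^(ex \<sigma>)\<close> and let
  \<open>\<sigma>\<close> tend to infinity: the constant disappears, and both sides have leading
  coefficient \<open>cT\<close>. This takes the place of a residue computation.\<close>

lemma kk_laplace: "(LINT t|lborel. kk t * exp (- ex * t)) = 1"
proof -
  have "((\<lambda>\<sigma>. conv kk TT \<sigma> * exp (- ex * \<sigma>)) \<longlongrightarrow> cT * (LINT t|lborel. kk t * exp (- ex * t))) at_top"
    by (rule conv_limit[OF _ _ ex_bounds(3) TT_abs kk_self(1) TT_tendsto]) auto
  moreover have "((\<lambda>\<sigma>. conv kk TT \<sigma> * exp (- ex * \<sigma>)) \<longlongrightarrow> cT) at_top"
  proof (rule Lim_transform_eventually)
    have "((\<lambda>\<sigma>. exp (- ex * \<sigma>)) \<longlongrightarrow> 0) at_top" using ex_bounds by real_asymp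
    then have "((\<lambda>\<sigma>. TT \<sigma> * exp (- ex * \<sigma>) + 2 * exp (- ex * \<sigma>)) \<longlongrightarrow> cT + 2 * 0) at_top"
      by (intro tendsto_intros TT_tendsto)
    then show "((\<lambda>\<sigma>. TT \<sigma> * exp (- ex * \<sigma>) + 2 * exp (- ex * \<sigma>)) \<longlongrightarrow> cT) at_top" by simp
    show "\<forall>\<^sub>F \<sigma> in at_top. TT \<sigma> * exp (- ex * \<sigma>) + 2 * exp (- ex * \<sigma>) = conv kk TT \<sigma> * exp (- ex * \<sigma>)"
      using eventually_ge_at_top[of 0]
    proof eventually_elim
      case (elim \<sigma>)
      then have "conv kk TT \<sigma> = TT \<sigma> + 2" using tau_equation[of \<sigma>] by simp
      then show ?case by (simp add: distrib_right)
    qed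
  qed
  ultimately have "cT * (LINT t|lborel. kk t * exp (- ex * t)) = cT"
    using tendsto_unique[OF trivial_limit_at_top_linorder] by blast
  then show ?thesis using cT_pos by simp
qed

text \<open>\<open>conv_limit\<close> shows that the limit exists; l'Hospital for
  \<open>PP / e^(ex \<sigma>)\<close> identifies it.\<close>

lemma T1_tendsto: "((\<lambda>\<sigma>. T1 \<sigma> * exp (- ex * \<sigma>)) \<longlongrightarrow> ex * cT) at_top"
proof -
  define d where "d = cT * (LINT t|lborel. kk1 t * exp (- ex * t))"
  have d: "((\<lambda>\<sigma>. T1 \<sigma> * exp (- ex * \<sigma>)) \<longlongrightarrow> d) at_top"
    unfolding T1_def d_def by (rule conv_limit[OF _ _ ex_bounds(3) TT_abs kk_self(2) TT_tendsto]) auto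
  have "((\<lambda>\<sigma>. PP \<sigma> / exp (ex * \<sigma>)) \<longlongrightarrow> d / ex) at_top"
  proof (rule lhospital_at_top_at_top)
    show "filterlim (\<lambda>\<sigma>. exp (ex * \<sigma>)) at_top at_top" using ex_bounds by real_asymp
    show "\<forall>\<^sub>F \<sigma> in at_top. ex * exp (ex * \<sigma>) \<noteq> 0" using ex_bounds by simp
    show "\<forall>\<^sub>F \<sigma> in at_top. (PP has_real_derivative T1 \<sigma>) (at \<sigma>)" using PP_deriv by simp
    show "\<forall>\<^sub>F \<sigma> in at_top. ((\<lambda>\<sigma>. exp (ex * \<sigma>)) has_real_derivative ex * exp (ex * \<sigma>)) (at \<sigma>)"
      by (intro always_eventually allI) (auto intro!: derivative_eq_intros)
    have "((\<lambda>\<sigma>. T1 \<sigma> * exp (- ex * \<sigma>) / ex) \<longlongrightarrow> d / ex) at_top" using ex_bounds by (intro tendsto_intros d) auto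
    then show "((\<lambda>\<sigma>. T1 \<sigma> / (ex * exp (ex * \<sigma>))) \<longlongrightarrow> d / ex) at_top"
      by (simp add: exp_minus field_simps)
  qed
  moreover have "((\<lambda>\<sigma>. PP \<sigma> / exp (ex * \<sigma>)) \<longlongrightarrow> cT) at_top"
  proof (rule Lim_transform_eventually[OF TT_tendsto])
    show "\<forall>\<^sub>F \<sigma> in at_top. TT \<sigma> * exp (- ex * \<sigma>) = PP \<sigma> / exp (ex * \<sigma>)"
      using eventually_ge_at_top[of 0] by eventually_elim (simp add: PP_eq exp_minus field_simps)
  qed
  ultimately have "d / ex = cT" using tendsto_unique[OF trivial_limit_at_top_linorder] by blast
  then have "d = ex * cT" using ex_bounds by (simp add: field_simps)
  then show ?thesis using d by simp
qed

text \<open>Harmonic approximation: for \<open>x = rho \<alpha> + \<delta>^2\<close> the well has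
  width of order \<open>\<delta>\<close>, and under \<open>s = s0 + \<delta> r\<close> the integrand
  tends to a semicircle with curvature \<open>\<mu> = X''(s0) / 2\<close>.\<close>

lemma T1_0: "T1 0 = (1 + \<alpha>) * sqrt (1 + \<alpha>) / (sqrt 2 * \<alpha>)"
proof -
  define \<delta> where "\<delta> = (\<lambda>n::nat. inverse (real (Suc n)))"
  have \<delta>: "\<delta> n > 0" "\<delta> n \<le> 1" for n by (auto simp: \<delta>_def field_simps)
  have \<delta>0: "\<delta> \<longlonglongrightarrow> 0" unfolding \<delta>_def by (rule LIMSEQ_inverse_real_of_nat)
  define X2 where "X2 = (\<lambda>s. 4 * \<alpha>\<^sup>2 * exp (2 * \<alpha> * s) + 4 * exp (- 2 * s))"
  define \<mu> where "\<mu> = X2 s0 / 2"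
  have \<mu>: "\<mu> = 2 * (1 + \<alpha>) * exp (- 2 * s0)"
  proof -
    have "\<alpha> * exp (2 * \<alpha> * s0) = exp (- 2 * s0)" using s0_crit by simp
    then have "4 * \<alpha>\<^sup>2 * exp (2 * \<alpha> * s0) = 4 * \<alpha> * exp (- 2 * s0)" by (simp add: power2_eq_square)
    then show ?thesis by (simp add: \<mu>_def X2_def algebra_simps)
  qed
  have \<mu>0: "\<mu> > 0" unfolding \<mu> using \<alpha>_gt1 by simp
  define G where "G = (\<lambda>n r. exp (s0 + \<delta> n * r) * sqrt (max 0 (1 - (X (s0 + \<delta> n * r) - rho \<alpha>) / (\<delta> n)\<^sup>2)))"
  have scale: "pi * Sfun \<alpha> (rho \<alpha> + (\<delta> n)\<^sup>2) = (\<delta> n)\<^sup>2 * (LINT r|lborel. G n r)" for n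
  proof -
    have "pi * Sfun \<alpha> (rho \<alpha> + (\<delta> n)\<^sup>2) = (LINT s|lborel. W (rho \<alpha> + (\<delta> n)\<^sup>2) s)" by (simp add: Sfun_eq)
    also have "\<dots> = \<delta> n * (LINT r|lborel. W (rho \<alpha> + (\<delta> n)\<^sup>2) (s0 + \<delta> n * r))"
      using lborel_integral_real_affine[of "\<delta> n" "W (rho \<alpha> + (\<delta> n)\<^sup>2)" s0] \<delta>(1)[of n] by simp
    also have "(LINT r|lborel. W (rho \<alpha> + (\<delta> n)\<^sup>2) (s0 + \<delta> n * r)) = (LINT r|lborel. \<delta> n * G n r)"
    proof (intro Bochner_Integration.integral_cong refl)
      fix r
      have "max 0 (rho \<alpha> + (\<delta> n)\<^sup>2 - X (s0 + \<delta> n * r)) = (\<delta> n)\<^sup>2 * max 0 (1 - (X (s0 + \<delta> n * r) - rho \<alpha>) / (\<delta> n)\<^sup>2)"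
      proof -
        have "rho \<alpha> + (\<delta> n)\<^sup>2 - X (s0 + \<delta> n * r) = (\<delta> n)\<^sup>2 * (1 - (X (s0 + \<delta> n * r) - rho \<alpha>) / (\<delta> n)\<^sup>2)"
        proof -
          have "a + d - x = d * (1 - (x - a) / d)" if "d > 0" for a d x :: real
            using that by (simp add: field_simps)
          then show ?thesis using \<delta>(1)[of n] by simp
        qed
        then show ?thesis by (simp only: max_mult_distrib_left) simp
      qed
      then show "W (rho \<alpha> + (\<delta> n)\<^sup>2) (s0 + \<delta> n * r) = \<delta> n * G n r"
        using \<delta>(1)[of n] by (simp add: W_def G_def real_sqrt_mult)
    qed
    finally show ?thesis by (simp add: power2_eq_square)
  qed
  have lim: "(\<lambda>n. LINT r|lborel. G n r) \<longlonglongrightarrow> (LINT r|lborel. exp s0 * sqrt (max 0 (1 - \<mu> * r\<^sup>2)))"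
  \<comment> \<open>By \<open>X_ge\<close> the rescaled integrand vanishes for
    \<open>|r| > 1\<close>; inside, \<open>\<delta> n \<le> 1\<close> bounds the exponential
    factor.\<close>
  proof (rule integral_dominated_convergence[where w = "\<lambda>r. indicator {-1..1} r *\<^sub>R exp (s0 + 1)"])
    have "set_integrable lborel {-1..1::real} (\<lambda>_. exp (s0 + 1))"
      by (intro borel_integrable_atLeastAtMost' continuous_intros)
    then show "integrable lborel (\<lambda>r::real. indicator {-1..1} r *\<^sub>R exp (s0 + 1))" unfolding set_integrable_def .
    show "G n \<in> borel_measurable lborel" for n unfolding G_def by measurable
    show "(\<lambda>r. exp s0 * sqrt (max 0 (1 - \<mu> * r\<^sup>2))) \<in> borel_measurable lborel" by measurable
    show "AE r in lborel. (\<lambda>n. G n r) \<longlonglongrightarrow> exp s0 * sqrt (max 0 (1 - \<mu> * r\<^sup>2))"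
    proof (intro AE_I2)
      fix r
      have "\<forall>n. \<exists>t. \<bar>t - s0\<bar> \<le> \<bar>\<delta> n * r\<bar> \<and> X (s0 + \<delta> n * r) = rho \<alpha> + X2 t / 2 * (\<delta> n * r)\<^sup>2"
        using X_taylor[of "s0 + \<delta> _ * r"] unfolding X2_def by simp
      then obtain t where t: "\<And>n. \<bar>t n - s0\<bar> \<le> \<bar>\<delta> n * r\<bar>" "\<And>n. X (s0 + \<delta> n * r) = rho \<alpha> + X2 (t n) / 2 * (\<delta> n * r)\<^sup>2"
        by metis
      have "(\<lambda>n. t n - s0) \<longlonglongrightarrow> 0"
      proof (rule Lim_null_comparison)
        show "\<forall>\<^sub>F n in sequentially. norm (t n - s0) \<le> \<bar>\<delta> n * r\<bar>" using t(1) by simp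
        show "(\<lambda>n. \<bar>\<delta> n * r\<bar>) \<longlonglongrightarrow> 0" by (auto intro!: tendsto_eq_intros \<delta>0)
      qed
      then have ts: "t \<longlonglongrightarrow> s0" by (simp add: LIM_zero_iff)
      have X2l: "(\<lambda>n. X2 (t n)) \<longlonglongrightarrow> X2 s0" unfolding X2_def by (intro tendsto_intros ts)
      have eq: "G n r = exp (s0 + \<delta> n * r) * sqrt (max 0 (1 - X2 (t n) / 2 * r\<^sup>2))" for n
        unfolding G_def t(2) using \<delta>(1)[of n] by (simp add: power_mult_distrib)
      have "(\<lambda>n. exp (s0 + \<delta> n * r) * sqrt (max 0 (1 - X2 (t n) / 2 * r\<^sup>2))) \<longlonglongrightarrow> exp (s0 + 0 * r) * sqrt (max 0 (1 - X2 s0 / 2 * r\<^sup>2))"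
        by (intro tendsto_intros \<delta>0 X2l) auto
      then show "(\<lambda>n. G n r) \<longlonglongrightarrow> exp s0 * sqrt (max 0 (1 - \<mu> * r\<^sup>2))"
        unfolding eq \<mu>_def by simp
    qed
    show "AE r in lborel. norm (G n r) \<le> indicator {-1..1} r *\<^sub>R exp (s0 + 1)" for n
    proof (intro AE_I2)
      fix r
      have "2 * r\<^sup>2 \<le> (X (s0 + \<delta> n * r) - rho \<alpha>) / (\<delta> n)\<^sup>2"
        using X_ge[of "s0 + \<delta> n * r"] \<delta>(1)[of n] by (simp add: field_simps power_mult_distrib)
      then have le: "1 - (X (s0 + \<delta> n * r) - rho \<alpha>) / (\<delta> n)\<^sup>2 \<le> 1 - 2 * r\<^sup>2" by simp
      show "norm (G n r) \<le> indicator {-1..1} r *\<^sub>R exp (s0 + 1)"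
      proof (cases "r \<in> {-1..1}")
        case True
        have "\<delta> n * r \<le> 1 * 1" using True \<delta>[of n] by (intro order_trans[OF mult_left_mono[of r 1 "\<delta> n"]]) auto
        moreover have "max 0 (1 - (X (s0 + \<delta> n * r) - rho \<alpha>) / (\<delta> n)\<^sup>2) \<le> 1"
          using le zero_le_power2[of r] by (intro max.boundedI) linarith+
        ultimately have "exp (s0 + \<delta> n * r) * sqrt (max 0 (1 - (X (s0 + \<delta> n * r) - rho \<alpha>) / (\<delta> n)\<^sup>2)) \<le> exp (s0 + 1) * 1"
          by (intro mult_mono) (auto intro: real_sqrt_le_mono[where y = 1, simplified])
        then show ?thesis using True by (simp add: G_def abs_mult)
      next
        case False
        then have "1 < \<bar>r\<bar>" by auto
        then have "1 < r\<^sup>2" using abs_square_le_1[of r] by linarith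
        then have "max 0 (1 - (X (s0 + \<delta> n * r) - rho \<alpha>) / (\<delta> n)\<^sup>2) = 0" using le by simp
        then show ?thesis using False by (simp add: G_def)
      qed
    qed
  qed
  have val: "(LINT r|lborel. exp s0 * sqrt (max 0 (1 - \<mu> * r\<^sup>2))) = exp s0 * (pi / 2 / sqrt \<mu>)"
  proof -
    have "pi / 2 = (LINT r|lborel. sqrt (max 0 (1 - r\<^sup>2)))"
      using integral_semicircle by (simp add: has_bochner_integral_iff)
    also have "\<dots> = sqrt \<mu> * (LINT r|lborel. sqrt (max 0 (1 - (sqrt \<mu> * r)\<^sup>2)))"
      using lborel_integral_real_affine[of "sqrt \<mu>" "\<lambda>r. sqrt (max 0 (1 - r\<^sup>2))" 0] \<mu>0 by simp
    also have "\<dots> = sqrt \<mu> * (LINT r|lborel. sqrt (max 0 (1 - \<mu> * r\<^sup>2)))"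
      using \<mu>0 by (simp add: power_mult_distrib)
    finally have "(LINT r|lborel. sqrt (max 0 (1 - \<mu> * r\<^sup>2))) = pi / 2 / sqrt \<mu>"
      using \<mu>0 by (simp add: field_simps)
    then show ?thesis by simp
  qed
  define \<sigma> where "\<sigma> = (\<lambda>n. ln (1 + (\<delta> n)\<^sup>2 / rho \<alpha>))"
  have dr: "(\<delta> n)\<^sup>2 / rho \<alpha> > 0" for n using \<delta>(1)[of n] rho_pos by simp
  have \<sigma>pos: "\<sigma> n > 0" for n unfolding \<sigma>_def using dr[of n] by simp
  have d2: "(\<lambda>n. (\<delta> n)\<^sup>2 / rho \<alpha>) \<longlonglongrightarrow> 0" using rho_pos by (auto intro!: tendsto_eq_intros \<delta>0)
  have "(\<lambda>n. ln (1 + (\<delta> n)\<^sup>2 / rho \<alpha>)) \<longlonglongrightarrow> ln (1 + 0)" by (intro tendsto_intros d2) auto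
  then have \<sigma>0: "\<sigma> \<longlonglongrightarrow> 0" by (simp add: \<sigma>_def)
  have "((\<lambda>h. (PP (0 + h) - PP 0) / h) \<longlongrightarrow> T1 0) (at 0)" using PP_deriv[of 0] by (simp add: DERIV_def)
  moreover have "filterlim \<sigma> (at 0) sequentially" using \<sigma>0 \<sigma>pos by (auto simp: filterlim_at less_imp_neq[OF \<sigma>pos, symmetric])
  ultimately have "(\<lambda>n. (PP (0 + \<sigma> n) - PP 0) / \<sigma> n) \<longlonglongrightarrow> T1 0" by (rule filterlim_compose)
  then have L1: "(\<lambda>n. TT (\<sigma> n) / \<sigma> n) \<longlonglongrightarrow> T1 0" using \<sigma>pos by (simp add: PP_0 PP_eq less_imp_le)
  have rs: "rho \<alpha> * exp (\<sigma> n) = rho \<alpha> + (\<delta> n)\<^sup>2" for n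
    unfolding \<sigma>_def using dr[of n] rho_pos by (simp add: field_simps add_pos_pos)
  have "((\<lambda>x::real. ln (1 + x) / x) \<longlongrightarrow> 1) (at 0)" by real_asymp
  moreover have "filterlim (\<lambda>n. (\<delta> n)\<^sup>2 / rho \<alpha>) (at 0) sequentially"
    by (rule filterlim_atI[OF d2 always_eventually]) (use dr in \<open>metis less_irrefl\<close>)
  ultimately have "(\<lambda>n. ln (1 + (\<delta> n)\<^sup>2 / rho \<alpha>) / ((\<delta> n)\<^sup>2 / rho \<alpha>)) \<longlonglongrightarrow> 1" by (rule filterlim_compose)
  then have "(\<lambda>n. inverse (\<sigma> n / ((\<delta> n)\<^sup>2 / rho \<alpha>))) \<longlonglongrightarrow> inverse 1" unfolding \<sigma>_def by (rule tendsto_inverse) simp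
  then have L2: "(\<lambda>n. (\<delta> n)\<^sup>2 / rho \<alpha> / \<sigma> n) \<longlonglongrightarrow> 1" by (simp add: mult.commute)
  have eqT: "TT (\<sigma> n) / \<sigma> n = 2 * (1 + \<alpha>) * rho \<alpha> / pi * (LINT r|lborel. G n r) * ((\<delta> n)\<^sup>2 / rho \<alpha> / \<sigma> n)" for n
  proof -
    have "Sfun \<alpha> (rho \<alpha> + (\<delta> n)\<^sup>2) = (\<delta> n)\<^sup>2 * (LINT r|lborel. G n r) / pi"
      using scale[of n] by (simp add: field_simps)
    then show ?thesis unfolding TT_def rs using rho_pos by (simp add: mult_ac)
  qed
  have "(\<lambda>n. 2 * (1 + \<alpha>) * rho \<alpha> / pi * (LINT r|lborel. G n r) * ((\<delta> n)\<^sup>2 / rho \<alpha> / \<sigma> n)) \<longlonglongrightarrow> 2 * (1 + \<alpha>) * rho \<alpha> / pi * (exp s0 * (pi / 2 / sqrt \<mu>)) * 1"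
    by (intro tendsto_intros L2 lim[unfolded val])
  then have T: "T1 0 = 2 * (1 + \<alpha>) * rho \<alpha> / pi * (exp s0 * (pi / 2 / sqrt \<mu>)) * 1"
    using L1 unfolding eqT by (rule LIMSEQ_unique[symmetric])
  have r: "rho \<alpha> = exp (- 2 * s0) * ((1 + \<alpha>) / \<alpha>)"
    using s0_crit \<alpha>_gt1 unfolding rho_eq X_def by (simp add: field_simps)
  have sm: "sqrt \<mu> = sqrt 2 * sqrt (1 + \<alpha>) * exp (- s0)"
  proof -
    have "sqrt (exp (- 2 * s0)) = exp (- s0)" by (rule real_sqrt_unique) (auto simp: power2_eq_square exp_add[symmetric])
    then show ?thesis by (simp only: \<mu> real_sqrt_mult)
  qed
  have e: "exp (- 2 * s0) * exp s0 = exp (- s0)" by (simp add: exp_add[symmetric])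
  have "T1 0 = (1 + \<alpha>) * rho \<alpha> * exp s0 / sqrt \<mu>"
    unfolding T using \<mu>0 by (simp add: field_simps)
  also have "\<dots> = (1 + \<alpha>) * (exp (- 2 * s0) * exp s0) * ((1 + \<alpha>) / \<alpha>) / (sqrt 2 * sqrt (1 + \<alpha>) * exp (- s0))"
    unfolding r sm by (simp only: mult_ac)
  also have "\<dots> = (1 + \<alpha>) * ((1 + \<alpha>) / sqrt (1 + \<alpha>)) / (sqrt 2 * \<alpha>)"
    unfolding e using \<alpha>_gt1 by (simp add: field_simps)
  also have "(1 + \<alpha>) / sqrt (1 + \<alpha>) = sqrt (1 + \<alpha>)" by (rule real_div_sqrt) (use \<alpha>_gt1 in simp)
  finally show ?thesis .
qed

lemma tau_eq: "\<xi> > 0 \<Longrightarrow> tau \<alpha> \<xi> = TT (ln \<xi>)"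
  by (simp add: tau_def TT_def)

text \<open>At \<open>\<xi> = 1\<close> this is a one-sided derivative, supplied by the smooth
  extension \<open>PP\<close>. It is unique because every point of the half line is a limit point of
  it.\<close>

lemma Dtau_eq: assumes "\<xi> \<ge> 1" shows "Dtau \<alpha> \<xi> = T1 (ln \<xi>)"
proof -
  have d: "(tau \<alpha> has_real_derivative T1 (ln \<xi>) / \<xi>) (at \<xi> within {1..})"
  proof (rule has_field_derivative_transform_within[where d = 1])
    have "((\<lambda>x. PP (ln x)) has_real_derivative T1 (ln \<xi>) * (1 / \<xi>)) (at \<xi>)"
      using assms by (intro DERIV_chain'[OF _ PP_deriv]) (auto intro!: derivative_eq_intros)
    then show "((\<lambda>x. PP (ln x)) has_real_derivative T1 (ln \<xi>) / \<xi>) (at \<xi> within {1..})"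
      by (simp add: has_field_derivative_at_within)
    show "PP (ln x) = tau \<alpha> x" if "x \<in> {1..}" for x using that by (simp add: tau_eq PP_eq)
  qed (use assms in auto)
  have "(THE d. (tau \<alpha> has_real_derivative d) (at \<xi> within {1..})) = T1 (ln \<xi>) / \<xi>"
  proof (rule the_equality[where P = "\<lambda>d. (tau \<alpha> has_real_derivative d) (at \<xi> within {1..})", OF d])
    fix d' assume "(tau \<alpha> has_real_derivative d') (at \<xi> within {1..})"
    moreover have "at \<xi> within {1..} \<noteq> bot"
    proof -
      have "at_right \<xi> \<le> at \<xi> within {1..}" by (rule at_le) (use assms in auto)
      then show ?thesis using trivial_limit_at_right_real[of \<xi>] by (auto simp: trivial_limit_def le_filter_def)
    qed
    ultimately show "d' = T1 (ln \<xi>) / \<xi>"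
      using has_field_derivative_unique[of "tau \<alpha>"] d by blast
  qed
  then show ?thesis using assms by (simp add: Dtau_def)
qed

text \<open>\<open>bb\<close> is so large that \<open>r < 0\<close> contributes nonnegatively to the convolution of \<open>kk\<close> with \<open>hb\<close> over the whole line.\<close>

definition bb :: real where "bb = kC / (kc * (1 - ex))"
definition hb :: "real \<Rightarrow> real" where "hb r = exp (- ex * r) * (bb + r)"
definition m1 :: real where "m1 = (LINT t|lborel. kk t * (t * exp (ex * t)))"

section \<open>The barrier and its convolution with the kernel\<close>

lemma bb_ge: "bb \<ge> 2"
proof -
  have "kc \<le> kC" using kC(2)[of 0] kc(2)[of 0] by simp
  moreover have "kc * (2 * (1 - ex)) \<le> kc * 1" using ex_bounds kc(1) by (intro mult_left_mono) auto
  ultimately have "2 * (kc * (1 - ex)) \<le> kC" by (simp add: algebra_simps)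
  then show ?thesis unfolding bb_def using kc(1) ex_bounds by (simp add: pos_le_divide_eq)
qed

lemma kk_moment_integrable: "integrable lborel (\<lambda>t. kk t * (t * exp (b * t)))" "integrable lborel (\<lambda>t. kk t * exp (b * t))" if "\<bar>b\<bar> < 1"
proof -
  have "integrable lborel (\<lambda>t. kk (0 - t) * (t * exp (b * t)))" "integrable lborel (\<lambda>t. kk (0 - t) * exp (b * t))"
    using that by (intro kk_lin_exp_integrable kk_exp_integrable; assumption)+
  then show "integrable lborel (\<lambda>t. kk t * (t * exp (b * t)))" "integrable lborel (\<lambda>t. kk t * exp (b * t))"
    by (simp_all add: kk_even)
qed

lemma kk_laplace': "(LINT t|lborel. kk t * exp (ex * t)) = 1"
  using integral_reflect[of "\<lambda>t. kk t * exp (- ex * t)" 0] kk_laplace by (simp add: kk_even)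

text \<open>As \<open>kk\<close> is even, \<open>2 * m1\<close> is the integral of
  \<open>kk t * t * (e^(ex t) - e^(- ex t))\<close>, which is positive off 0.\<close>

lemma m1_pos: "m1 > 0"
proof -
  have "m1 = (LINT t|lborel. kk (0 - t) * ((0 - t) * exp (ex * (0 - t))))"
    unfolding m1_def by (rule integral_reflect[of "\<lambda>t. kk t * (t * exp (ex * t))" 0, symmetric])
  also have "\<dots> = - (LINT t|lborel. kk t * (t * exp (- ex * t)))" by (simp add: kk_even)
  finally have "2 * m1 = (LINT t|lborel. kk t * (t * exp (ex * t))) - (LINT t|lborel. kk t * (t * exp (- ex * t)))"
    by (simp add: m1_def)
  also have "\<dots> = (LINT t|lborel. kk t * (t * exp (ex * t)) - kk t * (t * exp (- ex * t)))"
    using ex_bounds by (intro Bochner_Integration.integral_diff[symmetric] kk_moment_integrable) auto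
  finally have eq: "2 * m1 = (LINT t|lborel. kk t * (t * exp (ex * t)) - kk t * (t * exp (- ex * t)))" .
  have nn: "kk t * (t * exp (ex * t)) - kk t * (t * exp (- ex * t)) \<ge> 0" and
    ne: "t \<noteq> 0 \<Longrightarrow> kk t * (t * exp (ex * t)) - kk t * (t * exp (- ex * t)) \<noteq> 0" for t
  proof -
    have e: "kk t * (t * exp (ex * t)) - kk t * (t * exp (- ex * t)) = kk t * (t * (exp (ex * t) - exp (- ex * t)))" by (simp add: algebra_simps)
    have pos: "t * (exp (ex * t) - exp (- ex * t)) > 0" if "t \<noteq> 0"
    proof (cases "t > 0")
      case True
      then have "- ex * t < ex * t" using ex_bounds by simp
      then show ?thesis using True by simp
    next
      case False
      then have "- ex * t > ex * t" using ex_bounds that by (simp add: mult_less_0_iff)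
      then show ?thesis using False that by (intro mult_neg_neg) auto
    qed
    have p: "kk t * (t * (exp (ex * t) - exp (- ex * t))) > 0" if "t \<noteq> 0"
      by (rule mult_pos_pos[OF kk_pos pos[OF that]])
    show "t \<noteq> 0 \<Longrightarrow> kk t * (t * exp (ex * t)) - kk t * (t * exp (- ex * t)) \<noteq> 0" unfolding e using p by auto
    show "kk t * (t * exp (ex * t)) - kk t * (t * exp (- ex * t)) \<ge> 0" unfolding e using p by (cases "t = 0") auto
  qed
  have int: "integrable lborel (\<lambda>t. kk t * (t * exp (ex * t)) - kk t * (t * exp (- ex * t)))"
    using ex_bounds by (intro Bochner_Integration.integrable_diff kk_moment_integrable) auto
  have "2 * m1 \<noteq> 0"
  proof
    assume "2 * m1 = 0"
    then have "AE t in lborel. kk t * (t * exp (ex * t)) - kk t * (t * exp (- ex * t)) = 0"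
      unfolding eq using integral_nonneg_eq_0_iff_AE[OF int] nn by auto
    then have "AE t in lborel. t = (0::real)" by eventually_elim (use ne in blast)
    from eventually_conj[OF AE_lborel_singleton[of "0::real"] this] have "AE t::real in lborel. False"
      by (rule eventually_mono) simp
    then have "emeasure lborel (space lborel :: real set) = 0" by (simp only: eventually_False ae_filter_eq_bot_iff)
    then show False by simp
  qed
  moreover have "2 * m1 \<ge> 0" unfolding eq by (intro integral_nonneg_AE) (use nn in auto)
  ultimately show ?thesis by simp
qed

text \<open>Giving up half of the decay rate absorbs the linear factor.\<close>

lemma hb_grows: "grows (- ex / 2) hb"
proof -
  have "\<bar>hb r\<bar> \<le> (bb + 2 / ex) * exp (- ex / 2 * r)" if "r \<ge> 0" for r
  proof -
    have "r \<le> exp (ex / 2 * \<bar>r\<bar>) / (ex / 2)" using abs_le_exp[of "ex / 2" r] ex_bounds that by simp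
    moreover have "bb * 1 \<le> bb * exp (ex / 2 * r)" using bb_ge that ex_bounds by (intro mult_left_mono) auto
    ultimately have "bb + r \<le> (bb + 2 / ex) * exp (ex / 2 * r)" using that by (simp add: algebra_simps)
    then have "exp (- ex * r) * (bb + r) \<le> exp (- ex * r) * ((bb + 2 / ex) * exp (ex / 2 * r))" by (intro mult_left_mono) auto
    also have "\<dots> = (bb + 2 / ex) * exp (- ex / 2 * r)" by (simp add: exp_add[symmetric] mult.left_commute[of "exp _"] field_simps)
    finally show ?thesis using that bb_ge by (simp add: hb_def abs_mult)
  qed
  moreover have "bb + 2 / ex > 0" using bb_ge ex_bounds by (simp add: add_pos_pos)
  ultimately show ?thesis unfolding grows_def hb_def [abs_def] by (auto intro!: exI[of _ "bb + 2 / ex"])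
qed

lemma hb_pos: "r \<ge> 0 \<Longrightarrow> hb r > 0" using bb_ge by (simp add: hb_def)

text \<open>Over the whole line the convolution is exact: the exponential moment 1 reproduces
  \<open>hb\<close>, and the first moment subtracts \<open>m1 * e^(- ex \<sigma>)\<close>. It
  remains to see that the negative half line contributes a nonnegative amount.\<close>

lemma barrier: assumes "\<sigma> \<ge> 0" shows "conv kk hb \<sigma> \<le> hb \<sigma> - m1 * exp (- ex * \<sigma>)"
proof -
  have eb: "\<bar>- ex\<bar> < 1" "\<bar>ex\<bar> < 1" using ex_bounds by auto
  have hbe: "kk (\<sigma> - r) * hb r = bb * (kk (\<sigma> - r) * exp (- ex * r)) + kk (\<sigma> - r) * (r * exp (- ex * r))" for r
    by (simp add: hb_def algebra_simps)
  have int: "integrable lborel (\<lambda>r. kk (\<sigma> - r) * hb r)"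
    unfolding hbe by (intro Bochner_Integration.integrable_add integrable_mult_right kk_exp_integrable kk_lin_exp_integrable eb)
  have full: "(LINT r|lborel. kk (\<sigma> - r) * hb r) = hb \<sigma> - m1 * exp (- ex * \<sigma>)"
  proof -
    have "(LINT r|lborel. kk (\<sigma> - r) * hb r) = (LINT r|lborel. kk (\<sigma> - r) * hb (\<sigma> - (\<sigma> - r)))" by simp
    also have "\<dots> = (LINT t|lborel. kk t * hb (\<sigma> - t))" by (rule integral_reflect[of "\<lambda>t. kk t * hb (\<sigma> - t)"])
    also have "\<dots> = (LINT t|lborel. exp (- ex * \<sigma>) * ((bb + \<sigma>) * (kk t * exp (ex * t)) - kk t * (t * exp (ex * t))))"
    proof (intro Bochner_Integration.integral_cong refl)
      fix t
      have "exp (- ex * (\<sigma> - t)) = exp (- ex * \<sigma>) * exp (ex * t)" by (simp add: exp_add[symmetric] algebra_simps)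
      then show "kk t * hb (\<sigma> - t) = exp (- ex * \<sigma>) * ((bb + \<sigma>) * (kk t * exp (ex * t)) - kk t * (t * exp (ex * t)))"
        unfolding hb_def by (simp add: algebra_simps)
    qed
    also have "\<dots> = exp (- ex * \<sigma>) * ((bb + \<sigma>) * 1 - m1)"
      using kk_moment_integrable[OF eb(2)] by (simp add: kk_laplace' m1_def)
    finally show ?thesis by (simp add: hb_def algebra_simps)
  qed
  have neg: "0 \<le> (LINT r|lborel. indicator {..<0} r * (kk (\<sigma> - r) * hb r))"
  proof -
    define \<beta> where "\<beta> = 1 - ex"
    have \<beta>: "\<beta> > 0" using ex_bounds by (simp add: \<beta>_def)
    \<comment> \<open>For \<open>r < 0\<close> the term \<open>bb\<close> is paired with the lower
      bound of \<open>kk\<close>, the negative term \<open>r\<close> with the upper one. Since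
      \<open>kc * bb = kC / \<beta>\<close>, the reflected minorant \<open>f\<close> has integral
      exactly 0.\<close>
    define f where "f = (\<lambda>r. exp (- \<beta> * r) * (kC / \<beta> - kC * r))"
    define F where "F = (\<lambda>r. exp (- \<beta> * r) * (kC * r / \<beta>))"
    have "set_integrable lborel {0..} f"
      unfolding set_integrable_def
    proof (rule Bochner_Integration.integrable_bound)
      show "integrable lborel (\<lambda>r. (kC / \<beta> + kC / (\<beta> / 2)) * exp (- (\<beta> / 2) * \<bar>r\<bar>))"
        using \<beta> by (intro integrable_mult_right integrable_exp_neg_abs) simp
      show "(\<lambda>r. indicator {0..} r *\<^sub>R f r) \<in> borel_measurable lborel" unfolding f_def by measurable
      have "\<bar>f r\<bar> \<le> (kC / \<beta> + kC / (\<beta> / 2)) * exp (- (\<beta> / 2) * r)" if r: "r \<ge> 0" for r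
      proof -
        have "r \<le> exp (\<beta> / 2 * \<bar>r\<bar>) / (\<beta> / 2)" using abs_le_exp[of "\<beta> / 2" r] \<beta> r by simp
        then have "kC * r \<le> kC * (exp (\<beta> / 2 * r) / (\<beta> / 2))" using r kC(1) by (intro mult_left_mono) auto
        moreover have "kC / \<beta> * 1 \<le> kC / \<beta> * exp (\<beta> / 2 * r)" using kC(1) \<beta> r by (intro mult_left_mono) auto
        moreover have "0 \<le> kC * r" "0 \<le> kC / \<beta>" using kC(1) r \<beta> by auto
        ultimately have "\<bar>kC / \<beta> - kC * r\<bar> \<le> kC / \<beta> * exp (\<beta> / 2 * r) + kC * (exp (\<beta> / 2 * r) / (\<beta> / 2))" by linarith
        also have "\<dots> = (kC / \<beta> + kC / (\<beta> / 2)) * exp (\<beta> / 2 * r)" by (simp add: algebra_simps)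
        finally have "exp (- \<beta> * r) * \<bar>kC / \<beta> - kC * r\<bar> \<le> exp (- \<beta> * r) * ((kC / \<beta> + kC / (\<beta> / 2)) * exp (\<beta> / 2 * r))"
          by (intro mult_left_mono) auto
        also have "\<dots> = (kC / \<beta> + kC / (\<beta> / 2)) * (exp (- \<beta> * r) * exp (\<beta> / 2 * r))" by (simp only: mult_ac)
        also have "exp (- \<beta> * r) * exp (\<beta> / 2 * r) = exp (- (\<beta> / 2) * r)" by (simp add: exp_add[symmetric])
        finally show ?thesis by (simp only: f_def abs_mult abs_exp_cancel)
      qed
      then show "AE r in lborel. norm (indicator {0..} r *\<^sub>R f r) \<le> norm ((kC / \<beta> + kC / (\<beta> / 2)) * exp (- (\<beta> / 2) * \<bar>r\<bar>))"
        using kC(1) \<beta> by (intro AE_I2) (auto simp: indicator_def intro: order_trans[OF _ abs_ge_self])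
    qed
    note fint = this
    have f0: "(LINT r:{0..}|lborel. f r) = 0 - F 0"
    proof (rule half_line_FTC[OF _ fint])
      fix r
      have "(F has_real_derivative (- \<beta> * exp (- \<beta> * r)) * (kC * r / \<beta>) + exp (- \<beta> * r) * (kC / \<beta>)) (at r)"
      proof -
        have "((\<lambda>r. exp (- \<beta> * r)) has_real_derivative - \<beta> * exp (- \<beta> * r)) (at r)"
          "((\<lambda>r. kC * r / \<beta>) has_real_derivative kC / \<beta>) (at r)"
          using \<beta> by (auto intro!: derivative_eq_intros)
        from DERIV_mult[OF this] show ?thesis unfolding F_def by (simp only: mult_ac)
      qed
      moreover have "(- \<beta> * exp (- \<beta> * r)) * (kC * r / \<beta>) + exp (- \<beta> * r) * (kC / \<beta>) = f r"
        using \<beta> unfolding f_def by (simp add: divide_simps) (simp add: algebra_simps)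
      ultimately show "(F has_real_derivative f r) (at r)" by simp
      show "(F \<longlongrightarrow> 0) at_top" unfolding F_def using \<beta> by real_asymp
    qed
    have "0 = exp (- \<sigma>) * (LINT r:{0..}|lborel. f r)" using f0 by (simp add: F_def)
    also have "\<dots> = (LINT r|lborel. exp (- \<sigma>) * (indicator {0..} r * f r))" by (simp add: set_lebesgue_integral_def)
    also have "\<dots> = (LINT r|lborel. exp (- \<sigma>) * (indicator {0..} (0 - r) * f (0 - r)))"
      by (rule integral_reflect[of "\<lambda>r. exp (- \<sigma>) * (indicator {0..} r * f r)" 0, symmetric])
    also have "\<dots> \<le> (LINT r|lborel. indicator {..<0} r * (kk (\<sigma> - r) * hb r))"
    proof (rule integral_mono_AE)
      have "integrable lborel (\<lambda>r. exp (- \<sigma>) * (indicator {0..} r * f r))"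
        using fint by (simp add: set_integrable_def)
      from lborel_integrable_real_affine[OF this, of "-1" 0]
      show "integrable lborel (\<lambda>r. exp (- \<sigma>) * (indicator {0..} (0 - r) * f (0 - r)))" by simp
      show "integrable lborel (\<lambda>r. indicator {..<0} r * (kk (\<sigma> - r) * hb r))"
        using integrable_mult_indicator[OF _ int, of "{..<0}"] by simp
      have "exp (- \<sigma>) * f (- r) \<le> kk (\<sigma> - r) * hb r" if r: "r < 0" for r
      proof -
        have u: "\<bar>\<sigma> - r\<bar> = \<sigma> - r" using r assms by simp
        have 1: "kc * bb = kC / \<beta>" unfolding bb_def \<beta>_def using kc(1) by simp
        have k: "kc * exp (- (\<sigma> - r)) \<le> kk (\<sigma> - r)" "kk (\<sigma> - r) \<le> kC * exp (- (\<sigma> - r))"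
          using kc(2)[of "\<sigma> - r"] kC(2)[of "\<sigma> - r"] unfolding u by auto
        have "exp (- (\<sigma> - r)) * (kc * bb + kC * r) \<le> kk (\<sigma> - r) * (bb + r)"
        proof -
          have "kc * exp (- (\<sigma> - r)) * bb \<le> kk (\<sigma> - r) * bb" using k bb_ge by (intro mult_right_mono) auto
          moreover have "kC * exp (- (\<sigma> - r)) * r \<le> kk (\<sigma> - r) * r" using k r by (intro mult_right_mono_neg) auto
          ultimately show ?thesis by (simp add: algebra_simps)
        qed
        then have "exp (- ex * r) * (exp (- (\<sigma> - r)) * (kC / \<beta> + kC * r)) \<le> exp (- ex * r) * (kk (\<sigma> - r) * (bb + r))"
          unfolding 1 by (intro mult_left_mono) auto
        moreover have "exp (- ex * r) * (exp (- (\<sigma> - r)) * (kC / \<beta> + kC * r)) = exp (- \<sigma>) * f (- r)"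
        proof -
          have "exp (- ex * r) * exp (- (\<sigma> - r)) = exp (- \<sigma>) * exp (- \<beta> * (- r))"
            by (simp add: exp_add[symmetric] \<beta>_def algebra_simps)
          then show ?thesis unfolding f_def by (simp only: mult.assoc[symmetric]) simp
        qed
        moreover have "exp (- ex * r) * (kk (\<sigma> - r) * (bb + r)) = kk (\<sigma> - r) * hb r" by (simp add: hb_def)
        ultimately show ?thesis by (simp only:)
      qed
      then have "r \<noteq> 0 \<Longrightarrow> exp (- \<sigma>) * (indicator {0..} (0 - r) * f (0 - r)) \<le> indicator {..<0} r * (kk (\<sigma> - r) * hb r)" for r
        by (auto simp: indicator_def)
      moreover have "AE r in lborel. r \<noteq> (0::real)" by (rule AE_lborel_singleton)
      ultimately show "AE r in lborel. exp (- \<sigma>) * (indicator {0..} (0 - r) * f (0 - r)) \<le> indicator {..<0} r * (kk (\<sigma> - r) * hb r)"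
        by (auto elim!: eventually_mono)
    qed
    finally show ?thesis .
  qed
  have "(LINT r|lborel. kk (\<sigma> - r) * hb r) = (LINT r|lborel. indicator {..<0} r * (kk (\<sigma> - r) * hb r) + indicator {0..} r *\<^sub>R (kk (\<sigma> - r) * hb r))"
    by (intro Bochner_Integration.integral_cong) (auto simp: indicator_def)
  also have "\<dots> = (LINT r|lborel. indicator {..<0} r * (kk (\<sigma> - r) * hb r)) + conv kk hb \<sigma>"
    unfolding conv_def set_lebesgue_integral_def
    using integrable_mult_indicator[OF _ int, of "{..<0}"] integrable_mult_indicator[OF _ int, of "{0..}"]
    by (intro Bochner_Integration.integral_add) auto
  finally show ?thesis using full neg by linarith
qed

end

section \<open>The profile \<open>l\<close>\<close>

context bae_kernel
begin

lemma ff_at_bot: "(ff \<longlongrightarrow> 0) at_bot"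
proof -
  have lim: "((\<lambda>t::real. complex_of_real (exp t)) \<longlongrightarrow> of_real 0) at_bot"
    by (intro tendsto_of_real exp_at_bot)
  have "((\<lambda>t::real. 1 - of_real (exp t) * cis (- \<theta>)) \<longlongrightarrow> 1 - of_real 0 * cis (- \<theta>)) at_bot"
    by (intro tendsto_diff tendsto_mult tendsto_const lim)
  then have "((\<lambda>t::real. Ln (1 - of_real (exp t) * cis (- \<theta>))) \<longlongrightarrow> Ln 1) at_bot"
    by (intro tendsto_Ln) auto
  then have "((\<lambda>t::real. Im (Ln (1 - of_real (exp t) * cis (- \<theta>))) / pi) \<longlongrightarrow> Im (Ln 1) / pi) at_bot"
    by (intro tendsto_divide tendsto_Im tendsto_const) auto
  then show ?thesis by (simp add: ff_def [abs_def])
qed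

lemma ff_strict_mono: "s < t \<Longrightarrow> ff s < ff t"
  by (rule DERIV_pos_imp_increasing) (use ff_deriv kk_pos in blast)+

lemma ff_mono: "s \<le> t \<Longrightarrow> ff s \<le> ff t"
  using ff_strict_mono[of s t] by (cases "s = t") auto

lemma ff_nonneg: "ff t \<ge> 0"
proof (rule tendsto_upperbound[OF ff_at_bot])
  show "\<forall>\<^sub>F s in at_bot. ff s \<le> ff t" using eventually_le_at_bot[of t] by eventually_elim (rule ff_mono)
qed auto

lemma ff_pos: "ff t > 0"
  using ff_nonneg[of "t - 1"] ff_strict_mono[of "t - 1" t] by simp

text \<open>\<open>kC * e^t - ff t\<close> is nondecreasing and tends to 0 at minus
  infinity.\<close>

lemma ff_le_exp: "ff t \<le> kC * exp t"
proof -
  have "0 \<le> kC * exp t - ff t"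
  proof (rule tendsto_upperbound)
    have "((\<lambda>s::real. kC * exp s - ff s) \<longlongrightarrow> kC * 0 - 0) at_bot" by (intro tendsto_intros ff_at_bot exp_at_bot)
    then show "((\<lambda>s::real. kC * exp s - ff s) \<longlongrightarrow> 0) at_bot" by simp
    show "\<forall>\<^sub>F s in at_bot. kC * exp s - ff s \<le> kC * exp t - ff t"
      using eventually_le_at_bot[of t]
    proof eventually_elim
      case (elim s)
      show ?case
      proof (rule DERIV_nonneg_imp_nondecreasing[OF elim])
        fix x
        have "kk x \<le> kC * exp (- \<bar>x\<bar>)" by (rule kC)
        also have "\<dots> \<le> kC * exp x" using kC(1) by (intro mult_left_mono) auto
        finally have "0 \<le> kC * exp x - kk x" by simp
        moreover have "((\<lambda>s. kC * exp s - ff s) has_real_derivative kC * exp x - kk x) (at x)"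
          by (auto intro!: derivative_eq_intros ff_deriv)
        ultimately show "\<exists>y. ((\<lambda>s. kC * exp s - ff s) has_real_derivative y) (at x) \<and> 0 \<le> y" by blast
      qed
    qed
  qed auto
  then show ?thesis by simp
qed

lemma ff_exp_integrable:
  assumes "grows b \<phi>" "b < 1"
  shows "set_integrable lborel {0..} (\<lambda>r. ff (\<sigma> - r) * \<phi> r)"
    and "((\<lambda>r. ff (\<sigma> - r) * \<phi> r) \<longlongrightarrow> 0) at_top"
proof -
  obtain C where [measurable]: "\<phi> \<in> borel_measurable borel" and C: "C > 0" "\<And>r. r \<ge> 0 \<Longrightarrow> \<bar>\<phi> r\<bar> \<le> C * exp (b * r)"
    using assms(1) unfolding grows_def by blast
  have bd: "\<bar>ff (\<sigma> - r) * \<phi> r\<bar> \<le> kC * C * exp \<sigma> * exp (- (1 - b) * r)" if r: "r \<ge> 0" for r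
  proof -
    have "\<bar>ff (\<sigma> - r)\<bar> * \<bar>\<phi> r\<bar> \<le> (kC * exp (\<sigma> - r)) * (C * exp (b * r))"
      using ff_nonneg[of "\<sigma> - r"] ff_le_exp[of "\<sigma> - r"] C(2)[OF r] kC(1) by (intro mult_mono) auto
    also have "\<dots> = kC * C * (exp (\<sigma> - r) * exp (b * r))" by simp
    also have "exp (\<sigma> - r) * exp (b * r) = exp \<sigma> * exp (- (1 - b) * r)" by (simp add: exp_add[symmetric] algebra_simps)
    finally show ?thesis by (simp add: abs_mult)
  qed
  show "set_integrable lborel {0..} (\<lambda>r. ff (\<sigma> - r) * \<phi> r)"
    unfolding set_integrable_def
  proof (rule Bochner_Integration.integrable_bound)
    show "integrable lborel (\<lambda>r. kC * C * exp \<sigma> * exp (- (1 - b) * \<bar>r\<bar>))"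
      using assms(2) by (intro integrable_mult_right integrable_exp_neg_abs) auto
    show "AE r in lborel. norm (indicator {0..} r *\<^sub>R (ff (\<sigma> - r) * \<phi> r)) \<le> norm (kC * C * exp \<sigma> * exp (- (1 - b) * \<bar>r\<bar>))"
      using bd kC(1) C(1) by (intro AE_I2) (auto simp: indicator_def abs_mult)
  qed measurable
  show "((\<lambda>r. ff (\<sigma> - r) * \<phi> r) \<longlongrightarrow> 0) at_top"
  proof (rule Lim_null_comparison)
    show "\<forall>\<^sub>F r in at_top. norm (ff (\<sigma> - r) * \<phi> r) \<le> kC * C * exp \<sigma> * exp (- (1 - b) * r)"
      using eventually_ge_at_top[of 0] by eventually_elim (use bd in auto)
    have "((\<lambda>r. exp (- (1 - b) * r)) \<longlongrightarrow> 0) at_top" using assms(2) by real_asymp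
    then show "((\<lambda>r. kC * C * exp \<sigma> * exp (- (1 - b) * r)) \<longlongrightarrow> 0) at_top" by (intro tendsto_mult_right_zero)
  qed
qed

end

context bae
begin

text \<open>The coefficient of \<open>D\<tau>\<close> in \<open>l(x; \<omega>_H, p)\<close>; it makes \<open>l(\<omega>_H) = - H\<close>.\<close>

definition gam :: "nat \<Rightarrow> real" where
  "gam H = 2 * \<alpha> / (1 + \<alpha>) * (real H / sqrt (2 * (1 + \<alpha>)))"

text \<open>A sum of separate lower bounds for \<open>p\<close>; among others they let
  \<open>p * T1\<close> dominate the correction in \<open>L1\<close>, keep the cells no longer than
  1, and give \<open>p \<ge> H\<close>.\<close>

definition p1 :: "nat \<Rightarrow> real" where
  "p1 H = 1 + 2 * gam H * Tb / tc + gam H + 2 / tc + real H"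

lemma gam_nonneg: "gam H \<ge> 0" using \<alpha>_gt1 by (simp add: gam_def)

lemma gam_T1_0: "gam H * T1 0 = real H"
proof -
  have 1: "sqrt (2 * (1 + \<alpha>)) = sqrt 2 * sqrt (1 + \<alpha>)" by (simp only: real_sqrt_mult)
  have "2 * \<alpha> / (1 + \<alpha>) * (h / (r * q)) * ((1 + \<alpha>) * q / (r * \<alpha>)) = h * (2 / (r * r))"
    if "q > 0" "r > 0" for h q r :: real
    using that \<alpha>_gt1 by (simp add: divide_simps)
  from this[of "sqrt (1 + \<alpha>)" "sqrt 2" "real H"] show ?thesis
    unfolding gam_def T1_0 1 using \<alpha>_gt1 by simp
qed

end

locale bae_prof = bae +
  fixes p :: real and H :: nat
  assumes p_ge: "p \<ge> p1 H"
begin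

lemma p_bounds: "p \<ge> 1" "p \<ge> 2 * gam H * Tb / tc" "p \<ge> gam H" "p \<ge> 2 / tc" "p \<ge> real H" "p > 0"
proof -
  have "0 \<le> 2 * gam H * Tb / tc" "0 \<le> gam H" "0 \<le> 2 / tc"
    using gam_nonneg[of H] tc(1) Tb_pos by auto
  then show "p \<ge> 1" "p \<ge> 2 * gam H * Tb / tc" "p \<ge> gam H" "p \<ge> 2 / tc" "p \<ge> real H" "p > 0"
    using p_ge unfolding p1_def by linarith+
qed

text \<open>\<open>L \<sigma>\<close> is \<open>l(\<omega>_H e^\<sigma>; \<omega>_H, p)\<close> for \<open>\<sigma> \<ge> 0\<close>.\<close>

definition L :: "real \<Rightarrow> real" where "L \<sigma> = p * PP \<sigma> - gam H * T1 \<sigma>"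
definition L1 :: "real \<Rightarrow> real" where "L1 \<sigma> = p * T1 \<sigma> - gam H * T2 \<sigma>"
definition L2 :: "real \<Rightarrow> real" where "L2 \<sigma> = p * T2 \<sigma> - gam H * T3 \<sigma>"

lemma L_deriv: "(L has_real_derivative L1 \<sigma>) (at \<sigma>)"
  unfolding L_def [abs_def] L1_def by (auto intro!: derivative_eq_intros PP_deriv T1_deriv)

lemma L1_deriv: "(L1 has_real_derivative L2 \<sigma>) (at \<sigma>)"
  unfolding L1_def [abs_def] L2_def by (auto intro!: derivative_eq_intros T1_deriv T2_deriv)

lemma L_meas [measurable]: "L \<in> borel_measurable borel" and L1_meas [measurable]: "L1 \<in> borel_measurable borel"
  by (auto intro!: borel_measurable_continuous_onI DERIV_continuous_on[of UNIV] L_deriv L1_deriv)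

lemma L_0: "L 0 = - real H" by (simp add: L_def PP_0 gam_T1_0)

lemma L1_lower: assumes "\<sigma> \<ge> 0" shows "tc / 2 * p * exp (ex * \<sigma>) \<le> L1 \<sigma>"
proof -
  have "gam H * T2 \<sigma> \<le> gam H * (Tb * exp (ex * \<sigma>))"
    using T_bounds(2)[OF assms] gam_nonneg by (intro mult_left_mono) auto
  also have "\<dots> \<le> (p * tc / 2) * exp (ex * \<sigma>)"
    using p_bounds(2) tc(1) by (simp add: field_simps)
  finally have "gam H * T2 \<sigma> \<le> (p * tc / 2) * exp (ex * \<sigma>)" .
  moreover have "p * (tc * exp (ex * \<sigma>)) \<le> p * T1 \<sigma>" using tc(2)[OF assms] p_bounds by (intro mult_left_mono) auto
  ultimately show ?thesis unfolding L1_def by (simp add: field_simps)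
qed

lemma comb_upper:
  assumes "\<bar>x\<bar> \<le> Tb * e" "\<bar>y\<bar> \<le> Tb * e" shows "\<bar>p * x - gam H * y\<bar> \<le> 2 * Tb * p * e"
proof -
  have "\<bar>p * x\<bar> \<le> p * (Tb * e)" unfolding abs_mult using assms p_bounds by (intro mult_mono) auto
  moreover have "\<bar>gam H * y\<bar> \<le> p * (Tb * e)" unfolding abs_mult using assms p_bounds gam_nonneg[of H] by (intro mult_mono) auto
  moreover have "2 * Tb * p * e = p * (Tb * e) + p * (Tb * e)" by simp
  ultimately show ?thesis by linarith
qed

lemma L1_upper: "\<sigma> \<ge> 0 \<Longrightarrow> \<bar>L1 \<sigma>\<bar> \<le> 2 * Tb * p * exp (ex * \<sigma>)"
  unfolding L1_def by (intro comb_upper T_bounds)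

lemma L1_pos: assumes "\<sigma> \<ge> 0" shows "L1 \<sigma> > 0"
proof -
  have "tc / 2 * p * exp (ex * \<sigma>) > 0" using tc(1) p_bounds by simp
  then show ?thesis using L1_lower[OF assms] by linarith
qed

lemma L2_upper: assumes "\<sigma> \<ge> 0" shows "\<bar>L2 \<sigma>\<bar> \<le> 4 * Tb / tc * L1 \<sigma>"
proof -
  have "\<bar>L2 \<sigma>\<bar> \<le> 2 * Tb * p * exp (ex * \<sigma>)" unfolding L2_def by (intro comb_upper T_bounds assms)
  also have "\<dots> = 4 * Tb / tc * (tc / 2 * p * exp (ex * \<sigma>))" using tc(1) by (simp add: field_simps)
  also have "\<dots> \<le> 4 * Tb / tc * L1 \<sigma>" using L1_lower[OF assms] Tb_pos tc(1) by (intro mult_left_mono) auto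
  finally show ?thesis .
qed

lemma L1_grows: "grows ex L1"
  unfolding grows_def using L1_upper Tb_pos p_bounds by (auto intro!: exI[of _ "2 * Tb * p"])

lemma L_grows: "grows ex L"
proof -
  obtain C where C: "C > 0" "\<And>r. r \<ge> 0 \<Longrightarrow> \<bar>PP r\<bar> \<le> C * exp (ex * r)" using PP_grows unfolding grows_def by blast
  have "\<bar>L r\<bar> \<le> (p * C + gam H * Tb) * exp (ex * r)" if "r \<ge> 0" for r
  proof -
    have "\<bar>p * PP r\<bar> \<le> p * (C * exp (ex * r))" unfolding abs_mult using C(2)[OF that] p_bounds by (intro mult_mono) auto
    moreover have "\<bar>gam H * T1 r\<bar> \<le> gam H * (Tb * exp (ex * r))" unfolding abs_mult using T_bounds(1)[OF that] gam_nonneg[of H] by (intro mult_mono) auto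
    ultimately show ?thesis unfolding L_def by (simp add: distrib_right mult.assoc)
  qed
  moreover have "p * C + gam H * Tb > 0" using C(1) p_bounds gam_nonneg[of H] Tb_pos by (intro add_pos_nonneg) auto
  ultimately show ?thesis unfolding grows_def by auto
qed

lemma conv_add_scale:
  assumes "grows b \<phi>" "grows b \<psi>" "\<bar>b\<bar> < 1"
  shows "conv kk (\<lambda>r. x * \<phi> r - y * \<psi> r) \<sigma> = x * conv kk \<phi> \<sigma> - y * conv kk \<psi> \<sigma>"
proof -
  have i: "set_integrable lborel {0..} (\<lambda>r. kk (\<sigma> - r) * \<phi> r)" "set_integrable lborel {0..} (\<lambda>r. kk (\<sigma> - r) * \<psi> r)"
    using conv_integrable[OF assms(1,3) kk_meas(1) kk_self(1)] conv_integrable[OF assms(2,3) kk_meas(1) kk_self(1)] by auto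
  have "conv kk (\<lambda>r. x * \<phi> r - y * \<psi> r) \<sigma> = (LINT r:{0..}|lborel. x * (kk (\<sigma> - r) * \<phi> r) - y * (kk (\<sigma> - r) * \<psi> r))"
    unfolding conv_def by (simp add: algebra_simps)
  also have "\<dots> = x * conv kk \<phi> \<sigma> - y * conv kk \<psi> \<sigma>"
    unfolding conv_def by (subst set_integral_diff(2)) (auto intro!: set_integrable_mult_right i)
  finally show ?thesis .
qed

lemma conv_L1: "conv kk L1 \<sigma> = L1 \<sigma> + real H * kk \<sigma>"
proof -
  have "conv kk L1 \<sigma> = p * conv kk T1 \<sigma> - gam H * conv kk T2 \<sigma>"
    unfolding L1_def [abs_def] by (rule conv_add_scale[OF T1_grows T2_grows ex_bounds(3)])
  also have "\<dots> = p * T1 \<sigma> - gam H * (T2 \<sigma> - kk \<sigma> * T1 0)" using T1_conv[of \<sigma>] T2_conv[of \<sigma>] by simp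
  also have "\<dots> = L1 \<sigma> + (gam H * T1 0) * kk \<sigma>" by (simp add: L1_def algebra_simps)
  finally show ?thesis by (simp add: gam_T1_0)
qed

text \<open>The integral equation after integration by parts, with density \<open>L1\<close> and
  kernel \<open>ff\<close>. The boundary value \<open>L 0 = - H\<close> acts as if \<open>H\<close>
  roots were missing at \<open>\<sigma> = 0\<close>.\<close>

lemma L_equation:
  assumes "\<sigma> \<ge> 0"
  shows "L \<sigma> = - 2 * p - real H * ff \<sigma> + (LINT r:{0..}|lborel. ff (\<sigma> - r) * L1 r)"
proof -
  have "conv kk L \<sigma> = p * conv kk PP \<sigma> - gam H * conv kk T1 \<sigma>"
    unfolding L_def [abs_def] by (rule conv_add_scale[OF PP_grows T1_grows ex_bounds(3)])
  also have "conv kk PP \<sigma> = conv kk TT \<sigma>" by (rule conv_cong) (simp add: PP_eq)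
  also have "conv kk TT \<sigma> = PP \<sigma> + 2" by (simp add: PP_def)
  also have "conv kk T1 \<sigma> = T1 \<sigma>" by (simp add: T1_conv[symmetric])
  finally have 1: "conv kk L \<sigma> = L \<sigma> + 2 * p" by (simp add: L_def[of \<sigma>] distrib_left)
  have i1: "set_integrable lborel {0..} (\<lambda>r. ff (\<sigma> - r) * L1 r)"
    by (rule ff_exp_integrable(1)[OF L1_grows ex_bounds(2)])
  have i2: "set_integrable lborel {0..} (\<lambda>r. kk (\<sigma> - r) * L r)"
    by (rule conv_integrable[OF L_grows ex_bounds(3) kk_meas(1) kk_self(1)])
  have "(LINT r:{0..}|lborel. ff (\<sigma> - r) * L1 r - kk (\<sigma> - r) * L r) = 0 - ff (\<sigma> - 0) * L 0"
  proof (rule half_line_FTC)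
    fix r :: real
    have "((\<lambda>r. ff (\<sigma> - r)) has_real_derivative kk (\<sigma> - r) * (0 - 1)) (at r)"
      by (rule DERIV_chain'[OF _ ff_deriv]) (auto intro!: derivative_eq_intros)
    then show "((\<lambda>r. ff (\<sigma> - r) * L r) has_real_derivative ff (\<sigma> - r) * L1 r - kk (\<sigma> - r) * L r) (at r)"
      by (auto intro!: derivative_eq_intros L_deriv)
    show "((\<lambda>r. ff (\<sigma> - r) * L r) \<longlongrightarrow> 0) at_top"
      by (rule ff_exp_integrable(2)[OF L_grows ex_bounds(2)])
  qed (rule set_integral_diff(1)[OF i1 i2])
  then have "(LINT r:{0..}|lborel. ff (\<sigma> - r) * L1 r) - conv kk L \<sigma> = ff \<sigma> * real H"
    unfolding set_integral_diff(2)[OF i1 i2] conv_def[symmetric] by (simp add: L_0)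
  then show ?thesis using 1 by (simp add: algebra_simps)
qed

lemma L_strict_mono: assumes "0 \<le> s" "s < t" shows "L s < L t"
proof (rule DERIV_pos_imp_increasing[OF assms(2)])
  fix x assume "s \<le> x" "x \<le> t"
  then show "\<exists>y. (L has_real_derivative y) (at x) \<and> 0 < y" using L_deriv L1_pos[of x] assms by auto
qed

lemma L_mono_iff: "0 \<le> s \<Longrightarrow> 0 \<le> t \<Longrightarrow> L s \<le> L t \<longleftrightarrow> s \<le> t"
  using L_strict_mono[of s t] L_strict_mono[of t s] by (cases s t rule: linorder_cases) auto

lemma L_diff_ge: assumes "0 \<le> s" "s \<le> t" shows "tc / 2 * p * exp (ex * s) * (t - s) \<le> L t - L s"
proof (cases "s = t")
  case False
  then obtain z where z: "s < z" "z < t" "L t - L s = (t - s) * L1 z"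
    using MVT2[of s t L L1] L_deriv assms by auto
  have "tc / 2 * p * exp (ex * s) \<le> tc / 2 * p * exp (ex * z)"
    using z tc(1) p_bounds ex_bounds by (intro mult_left_mono) auto
  also have "\<dots> \<le> L1 z" by (rule L1_lower) (use z assms in auto)
  finally have "tc / 2 * p * exp (ex * s) * (t - s) \<le> L1 z * (t - s)" using assms by (intro mult_right_mono) auto
  then show ?thesis unfolding z(3) by (simp only: mult.commute)
qed auto

lemma L_surj: assumes "y \<ge> - real H" shows "\<exists>\<sigma>\<ge>0. L \<sigma> = y"
proof -
  define t where "t = (y + real H) / (tc / 2 * p)"
  have t: "t \<ge> 0" using assms tc(1) p_bounds by (simp add: t_def)
  have "tc / 2 * p * t = y + real H" using tc(1) p_bounds by (simp add: t_def)
  then have "y \<le> L t" using L_diff_ge[of 0 t] t by (simp add: L_0)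
  moreover have "continuous_on {0..t} L" by (intro DERIV_continuous_on) (auto intro: has_field_derivative_at_within[OF L_deriv])
  ultimately obtain \<sigma> where "0 \<le> \<sigma>" "L \<sigma> = y" using IVT'[of L 0 y t] assms t L_0 by auto
  then show ?thesis by blast
qed

section \<open>Cells of unit mass\<close>

definition Li :: "real \<Rightarrow> real" where "Li y = (SOME \<sigma>. \<sigma> \<ge> 0 \<and> L \<sigma> = y)"

lemma Li: assumes "y \<ge> - real H" shows "Li y \<ge> 0" "L (Li y) = y"
proof -
  have "\<exists>\<sigma>. \<sigma> \<ge> 0 \<and> L \<sigma> = y" using L_surj[OF assms] by auto
  from someI_ex[OF this, folded Li_def] show "Li y \<ge> 0" "L (Li y) = y" by auto
qed

lemma Li_unique: "\<sigma> \<ge> 0 \<Longrightarrow> L \<sigma> = y \<Longrightarrow> y \<ge> - real H \<Longrightarrow> Li y = \<sigma>"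
  using Li[of y] L_mono_iff[of \<sigma> "Li y"] L_mono_iff[of "Li y" \<sigma>] by force

text \<open>The index \<open>n\<close> stands for the integer \<open>k = n - H\<close>. With respect to \<open>L1 dr\<close> every cell \<open>[nd n, nd (n + 1))\<close> has mass 1 and midpoint \<open>md n\<close>.\<close>

definition nd :: "nat \<Rightarrow> real" where "nd n = Li (real n - real H)"
definition md :: "nat \<Rightarrow> real" where "md n = Li (real n - real H + 1 / 2)"

lemma nd: "nd n \<ge> 0" "L (nd n) = real n - real H" unfolding nd_def by (intro Li; simp)+
lemma md: "md n \<ge> 0" "L (md n) = real n - real H + 1 / 2" unfolding md_def by (intro Li; simp)+

lemma nd_0: "nd 0 = 0" unfolding nd_def by (intro Li_unique) (auto simp: L_0)

lemma nd_md: "nd n < md n" "md n < nd (Suc n)"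
  using L_mono_iff[OF md(1) nd(1), of n n] L_mono_iff[OF nd(1) md(1), of "Suc n" n] by (auto simp: nd md)

text \<open>\<open>L\<close> grows by 1 on a cell with slope at least
  \<open>tc / 2 * p * e^(ex r)\<close>; then \<open>p \<ge> 2 / tc\<close> brings the cell within
  reach of the Harnack inequalities.\<close>

lemma cell_length: "nd (Suc n) - nd n \<le> 1" "tc / 2 * p * exp (ex * nd n) * (nd (Suc n) - nd n) \<le> 1"
proof -
  show 2: "tc / 2 * p * exp (ex * nd n) * (nd (Suc n) - nd n) \<le> 1"
    using L_diff_ge[OF nd(1), of n "nd (Suc n)"] nd_md[of n] by (simp add: nd)
  have "1 \<le> tc / 2 * p" using p_bounds(4) tc(1) by (simp add: field_simps)
  then have "1 * 1 \<le> tc / 2 * p * exp (ex * nd n)" using nd(1)[of n] ex_bounds by (intro mult_mono) auto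
  then have "1 * (nd (Suc n) - nd n) \<le> tc / 2 * p * exp (ex * nd n) * (nd (Suc n) - nd n)"
    using nd_md[of n] by (intro mult_right_mono) auto
  then show "nd (Suc n) - nd n \<le> 1" using 2 by simp
qed

definition cell :: "nat \<Rightarrow> real set" where "cell n = {nd n..<nd (Suc n)}"

lemma cell_ge0: "r \<in> cell n \<Longrightarrow> r \<ge> 0" using nd(1)[of n] by (auto simp: cell_def)

lemma cell_dist: "r \<in> cell n \<Longrightarrow> s \<in> cell n \<Longrightarrow> \<bar>r - s\<bar> \<le> nd (Suc n) - nd n"
  by (auto simp: cell_def)

lemma md_cell: "md n \<in> cell n" using nd_md[of n] by (auto simp: cell_def)

lemma cell_sets [measurable, simp]: "cell n \<in> sets borel" by (simp add: cell_def)

lemma nd_unbounded: "\<exists>n. r < nd n"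
proof (cases "r \<ge> 0")
  case True
  obtain n :: nat where "L r + real H < real n" using reals_Archimedean2 by blast
  then show ?thesis using L_mono_iff[OF nd(1) True, of n] by (intro exI[of _ n]) (auto simp: nd)
next
  case False
  then show ?thesis using nd(1)[of 0] by (intro exI[of _ 0]) simp
qed

lemma nd_mono: "m \<le> n \<Longrightarrow> nd m \<le> nd n" using L_mono_iff[OF nd(1) nd(1), of m n] by (simp add: nd)

lemma cells_Union: "(\<Union>n. cell n) = {0..}"
proof (intro equalityI subsetI)
  fix r :: real assume r: "r \<in> {0..}"
  define n where "n = (LEAST n. r < nd n)"
  have n: "r < nd n" unfolding n_def using nd_unbounded[of r] by (rule LeastI_ex)
  then obtain m where m: "n = Suc m" using r nd_0 by (cases n) auto
  have "\<not> r < nd m" using not_less_Least[of m "\<lambda>n. r < nd n"] m by (simp add: n_def)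
  then show "r \<in> (\<Union>n. cell n)" using n m by (auto simp: cell_def intro!: exI[of _ m])
qed (use cell_ge0 in auto)

lemma cells_disjoint: "i \<noteq> j \<Longrightarrow> cell i \<inter> cell j = {}"
proof (induction i j rule: linorder_wlog)
  case (le a b)
  then have "nd (Suc a) \<le> nd b" by (intro nd_mono) auto
  then show ?case by (auto simp: cell_def)
qed auto

lemma cells_sums:
  assumes "set_integrable lborel {0..} (g :: real \<Rightarrow> real)"
  shows "(\<lambda>n. LINT r:cell n|lborel. g r) sums (LINT r:{0..}|lborel. g r)"
proof -
  have U: "(\<Union>N. \<Union>n<N. cell n) = {0..}"
  proof (intro equalityI subsetI)
    fix r :: real assume "r \<in> {0..}"
    then obtain n where "r \<in> cell n" unfolding cells_Union[symmetric] by blast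
    then have "r \<in> (\<Union>n<Suc n. cell n)" by blast
    then show "r \<in> (\<Union>N. \<Union>n<N. cell n)" by blast
  qed (auto dest: cell_ge0)
  have "(\<lambda>N. LINT r:(\<Union>n<N. cell n)|lborel. g r) \<longlonglongrightarrow> (LINT r:(\<Union>N. \<Union>n<N. cell n)|lborel. g r)"
  proof (rule set_integral_cont_up)
    show "set_integrable lborel (\<Union>N. \<Union>n<N. cell n) g" unfolding U by (rule assms)
    show "incseq (\<lambda>N. \<Union>n<N. cell n)" by (intro incseq_SucI UN_mono) auto
  qed measurable
  moreover have "(LINT r:(\<Union>n<N. cell n)|lborel. g r) = (\<Sum>n<N. LINT r:cell n|lborel. g r)" for N
  proof (rule set_integral_finite_Union)
    show "disjoint_family_on cell {..<N}" unfolding disjoint_family_on_def using cells_disjoint by blast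
    show "set_integrable lborel (cell i) g" for i
      by (rule set_integrable_subset[OF assms]) (use nd(1)[of i] in \<open>auto simp: cell_def\<close>)
  qed auto
  ultimately show ?thesis unfolding sums_def U by simp
qed

lemma cell_continuous_integrable: "continuous_on {0..} (g :: real \<Rightarrow> real) \<Longrightarrow> set_integrable lborel (cell n) g"
proof -
  assume g: "continuous_on {0..} g"
  have "set_integrable lborel {nd n..nd (Suc n)} g"
    by (rule borel_integrable_atLeastAtMost'[OF continuous_on_subset[OF g]]) (use nd(1)[of n] in auto)
  then show ?thesis by (rule set_integrable_subset) (auto simp: cell_def)
qed

lemma cell_const: "(LINT r:cell n|lborel. c) = c * (nd (Suc n) - nd n)"
  using nd_md[of n] by (simp add: cell_def set_lebesgue_integral_def)

lemma cell_FTC: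
  assumes "\<And>r. r \<ge> 0 \<Longrightarrow> (F has_real_derivative f r) (at r)" "continuous_on {0..} f"
  shows "(LINT r:cell n|lborel. f r) = F (nd (Suc n)) - F (nd n)"
proof -
  have le: "nd n \<le> nd (Suc n)" using nd_md[of n] by simp
  have si: "set_integrable lborel {nd n..nd (Suc n)} f"
    by (rule borel_integrable_atLeastAtMost'[OF continuous_on_subset[OF assms(2)]]) (use nd(1)[of n] in auto)
  have "(f has_integral (F (nd (Suc n)) - F (nd n))) {nd n..nd (Suc n)}"
    using le assms(1) nd(1)[of n] by (intro fundamental_theorem_of_calculus)
      (auto simp: has_real_derivative_iff_has_vector_derivative[symmetric] intro: has_field_derivative_at_within)
  then have "(LINT r:{nd n..nd (Suc n)}|lborel. f r) = F (nd (Suc n)) - F (nd n)"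
    using si by (simp add: set_borel_integral_eq_integral integral_unique)
  moreover have "(LINT r:cell n|lborel. f r) = (LINT r:{nd n..nd (Suc n)}|lborel. f r)"
    unfolding set_lebesgue_integral_def
  proof (rule integral_cong_AE)
    show "AE r in lborel. indicator (cell n) r *\<^sub>R f r = indicator {nd n..nd (Suc n)} r *\<^sub>R f r"
      using AE_lborel_singleton[of "nd (Suc n)"] by eventually_elim (auto simp: cell_def indicator_def)
    show "(\<lambda>r. indicator {nd n..nd (Suc n)} r *\<^sub>R f r) \<in> borel_measurable lborel"
      using si by (auto simp: set_integrable_def dest: borel_measurable_integrable)
    show "(\<lambda>r. indicator (cell n) r *\<^sub>R f r) \<in> borel_measurable lborel"
    proof -
      have "set_integrable lborel (cell n) f"
        by (rule set_integrable_subset[OF si]) (auto simp: cell_def)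
      from borel_measurable_integrable[OF this[unfolded set_integrable_def]] show ?thesis .
    qed
  qed
  ultimately show ?thesis by simp
qed

lemma L1_cont: "continuous_on A L1"
  by (intro DERIV_continuous_on) (auto intro: has_field_derivative_at_within[OF L1_deriv])
lemma L_cont: "continuous_on A L"
  by (intro DERIV_continuous_on) (auto intro: has_field_derivative_at_within[OF L_deriv])

lemma cell_mass: "(LINT r:cell n|lborel. L1 r) = 1"
  using cell_FTC[OF L_deriv L1_cont, of n] by (simp add: nd)

text \<open>In the variable \<open>L\<close> a cell is an interval of length 1 centred at the value
  at \<open>md n\<close>. This vanishing first moment makes the midpoint rule second order.\<close>

lemma cell_mass1: "(LINT r:cell n|lborel. (L r - (real n - real H + 1 / 2)) * L1 r) = 0"
proof -
  let ?m = "real n - real H + 1 / 2"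
  have "(LINT r:cell n|lborel. (L r - ?m) * L1 r) = (L (nd (Suc n)) - ?m)\<^sup>2 / 2 - (L (nd n) - ?m)\<^sup>2 / 2"
    by (rule cell_FTC) (auto intro!: derivative_eq_intros L_deriv continuous_intros L_cont L1_cont)
  also have "\<dots> = 0" unfolding nd(2) by (simp add: power2_eq_square algebra_simps)
  finally show ?thesis .
qed

lemma L1_harnack: assumes "0 \<le> r" "0 \<le> s" "\<bar>r - s\<bar> \<le> 1" shows "L1 r \<le> 4 * Tb / tc * exp 1 * L1 s"
proof -
  have "L1 r \<le> 2 * Tb * p * exp (ex * r)" using L1_upper[OF assms(1)] by simp
  also have "\<dots> \<le> 2 * Tb * p * (exp 1 * exp (ex * s))"
  proof -
    have "ex * r \<le> 1 + ex * s"
    proof -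
      have "ex * (r - s) \<le> 1 * 1" using ex_bounds assms(3) by (intro order_trans[OF mult_left_mono[of "r - s" 1 ex]]) auto
      then show ?thesis by (simp add: algebra_simps)
    qed
    then show ?thesis using Tb_pos p_bounds by (intro mult_left_mono) (auto simp: exp_add[symmetric])
  qed
  also have "\<dots> = 4 * Tb / tc * exp 1 * (tc / 2 * p * exp (ex * s))" using tc(1) by (simp add: field_simps)
  also have "\<dots> \<le> 4 * Tb / tc * exp 1 * L1 s" using L1_lower[OF assms(2)] Tb_pos tc(1) by (intro mult_left_mono) auto
  finally show ?thesis .
qed

end

context bae
begin

definition cM :: real where "cM = 4 * Tb / tc"
definition K1 :: real where "K1 = cM * exp 1"
definition Ch :: real where "Ch = bb + 2 / ex"
definition \<kappa> :: real where "\<kappa> = (LINT t|lborel. kk t)"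

lemma cM_pos: "cM > 0" using Tb_pos tc(1) by (simp add: cM_def)
lemma K1_pos: "K1 > 0" using cM_pos by (simp add: K1_def)
lemma Ch_pos: "Ch > 0" using bb_ge ex_bounds by (simp add: Ch_def add_pos_pos)

lemma hb_le: assumes "r \<ge> 0" shows "hb r \<le> Ch"
proof -
  have "exp (- ex * r) * bb \<le> 1 * bb" using bb_ge ex_bounds assms by (intro mult_right_mono) auto
  moreover have "exp (- ex * r) * r \<le> 2 / ex"
  proof -
    have "r \<le> exp (ex * \<bar>r\<bar>) / ex" using abs_le_exp[of ex r] ex_bounds assms by simp
    then have "exp (- ex * r) * r \<le> exp (- ex * r) * (exp (ex * r) / ex)" using assms by (intro mult_left_mono) auto
    also have "\<dots> = 1 / ex" by (simp add: exp_minus)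
    also have "\<dots> \<le> 2 / ex" using ex_bounds by (intro divide_right_mono) auto
    finally show ?thesis .
  qed
  ultimately show ?thesis by (simp add: hb_def Ch_def distrib_left)
qed

lemma hb_harnack: assumes "r \<ge> 0" "s \<ge> 0" "\<bar>r - s\<bar> \<le> 1" shows "hb r \<le> 2 * exp 1 * hb s"
proof -
  have "ex * (s - r) \<le> 1 * 1" using ex_bounds assms(3) by (intro order_trans[OF mult_left_mono[of "s - r" 1 ex]]) auto
  then have "exp (- ex * r) \<le> exp 1 * exp (- ex * s)" by (simp add: exp_add[symmetric] algebra_simps)
  moreover have "bb + r \<le> 2 * (bb + s)"
  proof -
    have "r \<le> s + 1" using assms(3) by (simp add: abs_le_iff)
    then show ?thesis using assms(2) bb_ge by simp
  qed
  ultimately have "exp (- ex * r) * (bb + r) \<le> (exp 1 * exp (- ex * s)) * (2 * (bb + s))"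
    using assms bb_ge by (intro mult_mono) auto
  then show ?thesis unfolding hb_def by (simp only: mult_ac)
qed

lemma hb_deriv: "(hb has_real_derivative - ex * hb r + exp (- ex * r)) (at r)"
  unfolding hb_def [abs_def] by (auto intro!: derivative_eq_intros simp: algebra_simps)

lemma hb_deriv_le: assumes "r \<ge> 0" shows "\<bar>- ex * hb r + exp (- ex * r)\<bar> \<le> 2 * hb r"
proof -
  have "exp (- ex * r) * 1 \<le> exp (- ex * r) * (bb + r)" using bb_ge assms by (intro mult_left_mono) auto
  then have "exp (- ex * r) \<le> hb r" by (simp add: hb_def)
  moreover have "ex * hb r \<le> 1 * hb r" "0 \<le> ex * hb r" using ex_bounds hb_pos[OF assms] by (auto intro!: mult_right_mono)
  moreover have "exp (- ex * r) > 0" by simp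
  ultimately show ?thesis using hb_pos[OF assms] by (intro abs_leI) linarith+
qed

lemma full_exp_integral: "(LINT r|lborel. kk (\<sigma> - r) * exp (- ex * r)) = exp (- ex * \<sigma>)"
proof -
  have "(LINT r|lborel. kk (\<sigma> - r) * exp (- ex * r)) = (LINT r|lborel. kk (\<sigma> - r) * exp (- ex * (\<sigma> - (\<sigma> - r))))" by simp
  also have "\<dots> = (LINT t|lborel. kk t * exp (- ex * (\<sigma> - t)))"
    by (rule integral_reflect[of "\<lambda>t. kk t * exp (- ex * (\<sigma> - t))"])
  also have "\<dots> = (LINT t|lborel. exp (- ex * \<sigma>) * (kk t * exp (ex * t)))"
    by (intro Bochner_Integration.integral_cong refl) (simp add: exp_add[symmetric] algebra_simps)
  finally show ?thesis by (simp add: kk_laplace')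
qed

lemma half_exp:
  shows "set_integrable lborel {0..} (\<lambda>r. kk (\<sigma> - r) * exp (- ex * r))"
    and "(LINT r:{0..}|lborel. kk (\<sigma> - r) * exp (- ex * r)) \<le> exp (- ex * \<sigma>)"
proof -
  have i: "integrable lborel (\<lambda>r. kk (\<sigma> - r) * exp (- ex * r))" using ex_bounds by (intro kk_exp_integrable) auto
  show s: "set_integrable lborel {0..} (\<lambda>r. kk (\<sigma> - r) * exp (- ex * r))"
    using integrable_mult_indicator[OF _ i, of "{0..}"] by (simp add: set_integrable_def)
  have "(LINT r:{0..}|lborel. kk (\<sigma> - r) * exp (- ex * r)) \<le> (LINT r|lborel. kk (\<sigma> - r) * exp (- ex * r))"
    unfolding set_lebesgue_integral_def
    by (rule integral_mono[OF s[unfolded set_integrable_def] i]) (use kk_pos in \<open>auto simp: indicator_def less_imp_le\<close>)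
  then show "(LINT r:{0..}|lborel. kk (\<sigma> - r) * exp (- ex * r)) \<le> exp (- ex * \<sigma>)" unfolding full_exp_integral .
qed

lemma half_kk:
  shows "set_integrable lborel {0..} (\<lambda>r. kk (\<sigma> - r))" and "(LINT r:{0..}|lborel. kk (\<sigma> - r)) \<le> \<kappa>"
proof -
  have i: "integrable lborel (\<lambda>r. kk (\<sigma> - r))" using kk_exp_integrable[of 0 \<sigma>] by simp
  show s: "set_integrable lborel {0..} (\<lambda>r. kk (\<sigma> - r))"
    using integrable_mult_indicator[OF _ i, of "{0..}"] by (simp add: set_integrable_def)
  have "(LINT r:{0..}|lborel. kk (\<sigma> - r)) \<le> (LINT r|lborel. kk (\<sigma> - r))"
    unfolding set_lebesgue_integral_def
    by (rule integral_mono[OF s[unfolded set_integrable_def] i]) (use kk_pos in \<open>auto simp: indicator_def less_imp_le\<close>)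
  then show "(LINT r:{0..}|lborel. kk (\<sigma> - r)) \<le> \<kappa>" using integral_reflect[of kk \<sigma>] by (simp add: \<kappa>_def)
qed

lemma \<kappa>_nonneg: "\<kappa> \<ge> 0" unfolding \<kappa>_def using kk_pos by (intro integral_nonneg_AE) (auto simp: less_imp_le)

end

section \<open>The midpoint rule for the density \<open>L1\<close>\<close>

context bae_prof
begin

text \<open>Cells have length at most 1, so on a cell the node value and the average of such a
  weight agree up to the factor \<open>M\<close>.\<close>

definition harnack :: "real \<Rightarrow> (real \<Rightarrow> real) \<Rightarrow> bool" where
  "harnack M w \<longleftrightarrow> continuous_on {0..} w \<and> (\<forall>r\<ge>0. w r \<ge> 0) \<and>
     (\<forall>r\<ge>0. \<forall>s\<ge>0. \<bar>r - s\<bar> \<le> 1 \<longrightarrow> w r \<le> M * w s)"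

lemma harnackD:
  assumes "harnack M w"
  shows "continuous_on {0..} w" "r \<ge> 0 \<Longrightarrow> w r \<ge> 0"
    "r \<ge> 0 \<Longrightarrow> s \<ge> 0 \<Longrightarrow> \<bar>r - s\<bar> \<le> 1 \<Longrightarrow> w r \<le> M * w s"
  using assms by (auto simp: harnack_def)

lemma harnack_mult:
  assumes "harnack M w" "harnack M' w'" "M \<ge> 0" shows "harnack (M * M') (\<lambda>r. w r * w' r)"
  unfolding harnack_def
proof (intro conjI allI impI)
  show "continuous_on {0..} (\<lambda>r. w r * w' r)" using assms by (intro continuous_intros harnackD)
  fix r :: real assume r: "r \<ge> 0"
  then show "w r * w' r \<ge> 0" using assms harnackD(2) by simp
  fix s :: real assume s: "s \<ge> 0" "\<bar>r - s\<bar> \<le> 1"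
  have "w r * w' r \<le> (M * w s) * (M' * w' s)"
    using harnackD(3)[OF assms(1) r s] harnackD(3)[OF assms(2) r s] harnackD(2)[OF assms(1) r] harnackD(2)[OF assms(2) r]
    by (intro mult_mono) (auto intro: order_trans)
  then show "w r * w' r \<le> M * M' * (w s * w' s)" by (simp add: mult_ac)
qed

lemma harnack_cmult: "harnack M w \<Longrightarrow> c \<ge> 0 \<Longrightarrow> harnack M (\<lambda>r. c * w r)"
  unfolding harnack_def by (auto intro!: continuous_intros simp: mult.left_commute[of M] mult_left_mono)

lemma kk_cont: "continuous_on A kk"
  by (intro DERIV_continuous_on) (auto intro: has_field_derivative_at_within[OF kk_deriv])

lemma harnack_kk: "harnack kM (\<lambda>r. kk (\<sigma> - r))"
  unfolding harnack_def using kk_pos kk_harnack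
  by (auto intro!: continuous_on_compose2[OF kk_cont[of UNIV]] continuous_intros simp: less_imp_le)

lemma hb_cont: "continuous_on A hb" unfolding hb_def [abs_def] by (intro continuous_intros)

text \<open>The barrier as a displacement of roots: they have density \<open>L1\<close>, so a sum of
  \<open>kk * E0\<close> over the nodes approximates \<open>conv kk hb\<close>.\<close>

definition E0 :: "real \<Rightarrow> real" where "E0 r = hb r / L1 r"

lemma L1_harnack': "0 \<le> r \<Longrightarrow> 0 \<le> s \<Longrightarrow> \<bar>r - s\<bar> \<le> 1 \<Longrightarrow> L1 r \<le> K1 * L1 s"
  using L1_harnack by (simp add: K1_def cM_def)

lemma E0_pos: "r \<ge> 0 \<Longrightarrow> E0 r > 0" using hb_pos L1_pos by (simp add: E0_def)

lemma inv_L1: assumes "r \<ge> 0" shows "1 / L1 r \<le> 2 / (tc * p) * exp (- ex * r)"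
proof -
  have "1 / L1 r \<le> 1 / (tc / 2 * p * exp (ex * r))"
    using L1_lower[OF assms] tc(1) p_bounds L1_pos[OF assms] by (intro divide_left_mono) auto
  also have "\<dots> = 2 / (tc * p) * exp (- ex * r)" by (simp add: exp_minus field_simps)
  finally show ?thesis .
qed

lemma E0_le: assumes "r \<ge> 0" shows "E0 r \<le> 2 / (tc * p) * exp (- ex * r) * hb r"
  using mult_right_mono[OF inv_L1[OF assms], of "hb r"] hb_pos[OF assms] by (simp add: E0_def)

lemma E0_le': assumes "r \<ge> 0" shows "E0 r \<le> 2 * Ch / (tc * p) * exp (- ex * r)"
proof -
  have "2 / (tc * p) * exp (- ex * r) * hb r \<le> 2 / (tc * p) * exp (- ex * r) * Ch"
    using hb_le[OF assms] tc(1) p_bounds by (intro mult_left_mono) auto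
  then show ?thesis using E0_le[OF assms] by (simp add: mult_ac)
qed

lemma harnack_E0: "harnack (2 * exp 1 * K1) E0"
  unfolding harnack_def
proof (intro conjI allI impI)
  show "continuous_on {0..} E0" unfolding E0_def [abs_def]
    using L1_pos by (intro continuous_intros hb_cont L1_cont) force
  fix r :: real assume r: "r \<ge> 0"
  then show "0 \<le> E0 r" using E0_pos by (simp add: less_imp_le)
  fix s :: real assume s: "s \<ge> 0" "\<bar>r - s\<bar> \<le> 1"
  have "L1 s \<le> K1 * L1 r" using L1_harnack'[of s r] r s by (simp add: abs_minus_commute)
  then have "1 / L1 r \<le> K1 / L1 s" using L1_pos[OF r] L1_pos[OF s(1)] by (simp add: field_simps)
  then have "hb r * (1 / L1 r) \<le> (2 * exp 1 * hb s) * (K1 / L1 s)"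
    using hb_harnack[OF r s] hb_pos[OF r] hb_pos[OF s(1)] L1_pos[OF r] by (intro mult_mono) auto
  then show "E0 r \<le> 2 * exp 1 * K1 * E0 s" by (simp add: E0_def mult_ac)
qed

lemma cell_len_pos: "nd (Suc n) - nd n > 0" using nd_md[of n] by simp

lemma cell_close: "r \<in> cell n \<Longrightarrow> s \<in> cell n \<Longrightarrow> \<bar>r - s\<bar> \<le> 1"
  using cell_dist cell_length(1) order_trans by blast

lemma harnack_L1_prod_int: "harnack M w \<Longrightarrow> set_integrable lborel (cell n) (\<lambda>r. w r * L1 r)"
  by (intro cell_continuous_integrable continuous_intros harnackD L1_cont)

lemma cell_value_le:
  assumes "harnack M w" shows "w (md n) \<le> M * (LINT r:cell n|lborel. w r * L1 r)"
proof -
  have "w (md n) = w (md n) * (LINT r:cell n|lborel. L1 r)" by (simp add: cell_mass)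
  also have "\<dots> = (LINT r:cell n|lborel. w (md n) * L1 r)" by simp
  also have "\<dots> \<le> (LINT r:cell n|lborel. M * (w r * L1 r))"
  proof (rule set_integral_mono)
    show "set_integrable lborel (cell n) (\<lambda>r. w (md n) * L1 r)" by (intro cell_continuous_integrable continuous_intros L1_cont)
    show "set_integrable lborel (cell n) (\<lambda>r. M * (w r * L1 r))" by (intro set_integrable_mult_right harnack_L1_prod_int[OF assms])
    fix r assume r: "r \<in> cell n"
    show "w (md n) * L1 r \<le> M * (w r * L1 r)"
      using harnackD(3)[OF assms md(1) cell_ge0[OF r] cell_close[OF md_cell r]] L1_pos[OF cell_ge0[OF r]]
      by (simp add: mult.assoc[symmetric] mult_right_mono)
  qed
  also have "\<dots> = M * (LINT r:cell n|lborel. w r * L1 r)" by simp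
  finally show ?thesis .
qed

lemma cell_len_bound:
  assumes "harnack M w" shows "w (md n) * (nd (Suc n) - nd n) \<le> M * (LINT r:cell n|lborel. w r)"
proof -
  have "w (md n) * (nd (Suc n) - nd n) = (LINT r:cell n|lborel. w (md n))" by (simp add: cell_const)
  also have "\<dots> \<le> (LINT r:cell n|lborel. M * w r)"
  proof (rule set_integral_mono)
    show "set_integrable lborel (cell n) (\<lambda>r. w (md n))" by (intro cell_continuous_integrable continuous_intros)
    show "set_integrable lborel (cell n) (\<lambda>r. M * w r)" by (intro set_integrable_mult_right cell_continuous_integrable harnackD[OF assms])
  qed (use harnackD(3)[OF assms md(1) cell_ge0 cell_close[OF md_cell]] in auto)
  also have "\<dots> = M * (LINT r:cell n|lborel. w r)" by simp
  finally show ?thesis .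
qed

lemma cell_osc:
  assumes "continuous_on {0..} g" "\<And>r. r \<in> cell n \<Longrightarrow> \<bar>g r\<bar> \<le> b"
  shows "\<bar>LINT r:cell n|lborel. g r * L1 r\<bar> \<le> b"
proof -
  have i: "set_integrable lborel (cell n) (\<lambda>r. g r * L1 r)" by (intro cell_continuous_integrable continuous_intros L1_cont assms)
  have ib: "set_integrable lborel (cell n) (\<lambda>r. c * L1 r)" for c by (intro cell_continuous_integrable continuous_intros L1_cont)
  have up: "(LINT r:cell n|lborel. g r * L1 r) \<le> (LINT r:cell n|lborel. b * L1 r)"
    using assms(2) L1_pos[OF cell_ge0] by (intro set_integral_mono i ib mult_right_mono) (auto simp: abs_le_iff less_imp_le)
  have lo: "(LINT r:cell n|lborel. - b * L1 r) \<le> (LINT r:cell n|lborel. g r * L1 r)"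
    using assms(2) L1_pos[OF cell_ge0] by (intro set_integral_mono i ib mult_right_mono) (auto simp: abs_le_iff less_imp_le minus_le_iff)
  have mm: "(LINT r:cell n|lborel. c * L1 r) = c" for c by (simp add: cell_mass)
  show ?thesis using up[unfolded mm] lo[unfolded mm] by linarith
qed

lemma cell_mvt:
  assumes d: "\<And>r. r \<ge> 0 \<Longrightarrow> (g has_real_derivative g' r) (at r)" and b: "\<And>r. r \<in> cell n \<Longrightarrow> \<bar>g' r\<bar> \<le> b" and r: "r \<in> cell n"
  shows "\<bar>g r - g (md n)\<bar> \<le> b * (nd (Suc n) - nd n)"
proof -
  have b0: "b \<ge> 0" using b[OF r] by simp
  have "norm (g r - g (md n)) \<le> b * norm (r - md n)"
  proof (rule field_differentiable_bound[where S = "cell n" and f' = g'])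
    show "convex (cell n)" by (simp add: cell_def)
    show "(g has_real_derivative g' z) (at z within cell n)" if "z \<in> cell n" for z
      using d[OF cell_ge0[OF that]] by (rule has_field_derivative_at_within)
  qed (use b r md_cell in auto)
  also have "\<dots> \<le> b * (nd (Suc n) - nd n)"
    using cell_dist[OF r md_cell] b0 by (intro mult_left_mono) auto
  finally show ?thesis by simp
qed

lemma deriv_cont: "(\<And>r. r \<ge> 0 \<Longrightarrow> (g has_real_derivative g' r) (at r)) \<Longrightarrow> continuous_on {0..} g"
  by (rule DERIV_continuous_on[where D = g']) (auto intro: has_field_derivative_at_within)

text \<open>The cell has mass 1, so the error is at most the oscillation of \<open>\<phi>\<close>,
  that is derivative times length; the length turns into an integral over the cell.\<close>

lemma cell_first_order:
  assumes d: "\<And>r. r \<ge> 0 \<Longrightarrow> (\<phi> has_real_derivative \<phi>' r) (at r)" and w: "harnack M w"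
    and le: "\<And>r. r \<ge> 0 \<Longrightarrow> \<bar>\<phi>' r\<bar> \<le> w r" and M: "M \<ge> 0"
  shows "\<bar>\<phi> (md n) - (LINT r:cell n|lborel. \<phi> r * L1 r)\<bar> \<le> M * M * (LINT r:cell n|lborel. w r)"
proof -
  let ?l = "nd (Suc n) - nd n"
  have osc: "\<bar>\<phi> r - \<phi> (md n)\<bar> \<le> M * w (md n) * ?l" if "r \<in> cell n" for r
    by (rule cell_mvt[OF d _ that])
      (auto intro: order_trans[OF le[OF cell_ge0] harnackD(3)[OF w cell_ge0 md(1) cell_close[OF _ md_cell]]])
  have c: "continuous_on {0..} \<phi>" by (rule deriv_cont[OF d])
  have "(LINT r:cell n|lborel. \<phi> r * L1 r) - \<phi> (md n) = (LINT r:cell n|lborel. \<phi> r * L1 r) - (LINT r:cell n|lborel. \<phi> (md n) * L1 r)"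
    by (simp add: cell_mass)
  also have "\<dots> = (LINT r:cell n|lborel. (\<phi> r - \<phi> (md n)) * L1 r)"
    unfolding left_diff_distrib by (intro set_integral_diff(2)[symmetric] cell_continuous_integrable continuous_intros c L1_cont)
  finally have "\<bar>\<phi> (md n) - (LINT r:cell n|lborel. \<phi> r * L1 r)\<bar> = \<bar>LINT r:cell n|lborel. (\<phi> r - \<phi> (md n)) * L1 r\<bar>"
    by linarith
  also have "\<dots> \<le> M * w (md n) * ?l" by (rule cell_osc) (intro continuous_intros c, rule osc)
  also have "\<dots> \<le> M * (M * (LINT r:cell n|lborel. w r))"
    using mult_left_mono[OF cell_len_bound[OF w] M] by (simp only: mult.assoc)
  finally show ?thesis by (simp only: mult.assoc)
qed

text \<open>Subtracting the multiple \<open>b * L\<close> that matches \<open>\<phi>'\<close> at the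
  node costs nothing, the first moment being 0, and makes the derivative of \<open>\<psi>\<close>
  vanish there. The oscillation is then quadratic in the length: one length is at most
  \<open>K1 / L1 (md n)\<close>, whence the factor \<open>e^(- ex r) / p\<close>, and the other
  becomes an integral.\<close>

lemma cell_second_order:
  assumes d: "\<And>r. r \<ge> 0 \<Longrightarrow> (\<phi> has_real_derivative \<phi>' r) (at r)" and d': "\<And>r. r \<ge> 0 \<Longrightarrow> (\<phi>' has_real_derivative \<phi>'' r) (at r)"
    and w: "harnack M w" and le: "\<And>r. r \<ge> 0 \<Longrightarrow> \<bar>\<phi>' r\<bar> \<le> w r" and le': "\<And>r. r \<ge> 0 \<Longrightarrow> \<bar>\<phi>'' r\<bar> \<le> w r" and M: "M \<ge> 0"
  shows "\<bar>\<phi> (md n) - (LINT r:cell n|lborel. \<phi> r * L1 r)\<bar>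
     \<le> (M + cM * K1) * K1 * (M * K1) * (2 / (tc * p)) * (LINT r:cell n|lborel. w r * exp (- ex * r))"
proof -
  let ?l = "nd (Suc n) - nd n"
  define b where "b = \<phi>' (md n) / L1 (md n)"
  define \<psi> where "\<psi> = (\<lambda>r. \<phi> r - b * L r)"
  have Lm: "L1 (md n) > 0" by (rule L1_pos[OF md(1)])
  have dp: "(\<psi> has_real_derivative \<phi>' r - b * L1 r) (at r)" if "r \<ge> 0" for r
    unfolding \<psi>_def using that by (auto intro!: derivative_eq_intros d L_deriv)
  have dpp: "((\<lambda>r. \<phi>' r - b * L1 r) has_real_derivative \<phi>'' r - b * L2 r) (at r)" if "r \<ge> 0" for r
    using that by (auto intro!: derivative_eq_intros d' L1_deriv)
  define D where "D = (M + cM * K1) * w (md n)"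
  have wm: "w (md n) \<ge> 0" by (rule harnackD(2)[OF w md(1)])
  have D0: "D \<ge> 0" using wm M cM_pos K1_pos by (simp add: D_def)
  have bpp: "\<bar>\<phi>'' r - b * L2 r\<bar> \<le> D" if r: "r \<in> cell n" for r
  proof -
    have r0: "r \<ge> 0" by (rule cell_ge0[OF r])
    have "\<bar>\<phi>'' r\<bar> \<le> M * w (md n)"
      using le'[OF r0] harnackD(3)[OF w r0 md(1) cell_close[OF r md_cell]] by simp
    moreover have "\<bar>b * L2 r\<bar> \<le> (w (md n) / L1 (md n)) * (cM * (K1 * L1 (md n)))"
    proof -
      have "\<bar>L2 r\<bar> \<le> cM * L1 r" using L2_upper[OF r0] by (simp add: cM_def)
      also have "\<dots> \<le> cM * (K1 * L1 (md n))" using cM_pos L1_harnack'[OF r0 md(1) cell_close[OF r md_cell]] by (intro mult_left_mono) auto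
      finally have "\<bar>L2 r\<bar> \<le> cM * (K1 * L1 (md n))" .
      moreover have "\<bar>b\<bar> \<le> w (md n) / L1 (md n)" unfolding b_def using le[OF md(1)] Lm by (simp add: divide_right_mono)
      ultimately show ?thesis unfolding abs_mult using wm Lm by (intro mult_mono) auto
    qed
    moreover have "(w (md n) / L1 (md n)) * (cM * (K1 * L1 (md n))) = cM * K1 * w (md n)" using Lm by (simp add: field_simps)
    ultimately show ?thesis unfolding D_def distrib_right by linarith
  qed
  have bp: "\<bar>\<phi>' r - b * L1 r\<bar> \<le> D * ?l" if r: "r \<in> cell n" for r
    using cell_mvt[OF dpp bpp r] Lm by (simp add: b_def)
  have osc: "\<bar>\<psi> r - \<psi> (md n)\<bar> \<le> D * ?l * ?l" if r: "r \<in> cell n" for r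
    by (rule cell_mvt[OF dp bp r])
  have c: "continuous_on {0..} \<phi>" by (rule deriv_cont[OF d])
  have c': "continuous_on {0..} (\<lambda>r. \<psi> r - \<psi> (md n))" unfolding \<psi>_def by (intro continuous_intros c L_cont)
  have "(LINT r:cell n|lborel. (\<psi> r - \<psi> (md n)) * L1 r)
      = (LINT r:cell n|lborel. (\<phi> r * L1 r - \<phi> (md n) * L1 r) - b * ((L r - (real n - real H + 1 / 2)) * L1 r))"
    unfolding \<psi>_def md(2) by (simp add: algebra_simps)
  also have "\<dots> = (LINT r:cell n|lborel. \<phi> r * L1 r - \<phi> (md n) * L1 r) - (LINT r:cell n|lborel. b * ((L r - (real n - real H + 1 / 2)) * L1 r))"
    by (intro set_integral_diff(2) cell_continuous_integrable continuous_intros c L1_cont L_cont)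
  also have "(LINT r:cell n|lborel. b * ((L r - (real n - real H + 1 / 2)) * L1 r)) = 0"
    by (simp only: set_integral_mult_right cell_mass1)
  also have "(LINT r:cell n|lborel. \<phi> r * L1 r - \<phi> (md n) * L1 r) = (LINT r:cell n|lborel. \<phi> r * L1 r) - (LINT r:cell n|lborel. \<phi> (md n) * L1 r)"
    by (intro set_integral_diff(2) cell_continuous_integrable continuous_intros c L1_cont)
  also have "(LINT r:cell n|lborel. \<phi> (md n) * L1 r) = \<phi> (md n)" by (simp add: cell_mass)
  finally have "\<bar>\<phi> (md n) - (LINT r:cell n|lborel. \<phi> r * L1 r)\<bar> = \<bar>LINT r:cell n|lborel. (\<psi> r - \<psi> (md n)) * L1 r\<bar>"
    by linarith
  also have "\<dots> \<le> D * ?l * ?l" by (rule cell_osc[OF c' osc])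
  also have "\<dots> \<le> D * ?l * (K1 / L1 (md n))"
  proof (rule mult_left_mono)
    have "(L1 (md n) / K1) * ?l = (LINT r:cell n|lborel. L1 (md n) / K1)" by (simp add: cell_const)
    also have "\<dots> \<le> (LINT r:cell n|lborel. L1 r)"
    proof (rule set_integral_mono)
      fix r assume r: "r \<in> cell n"
      show "L1 (md n) / K1 \<le> L1 r"
        using L1_harnack'[OF md(1) cell_ge0[OF r] cell_close[OF md_cell r]] K1_pos by (simp add: pos_divide_le_eq mult.commute)
    qed (intro cell_continuous_integrable continuous_intros L1_cont)+
    finally show "?l \<le> K1 / L1 (md n)" using Lm K1_pos by (simp add: cell_mass field_simps)
    show "0 \<le> D * ?l" using D0 cell_len_pos[of n] by simp
  qed
  also have "\<dots> = (M + cM * K1) * K1 * ((w (md n) / L1 (md n)) * ?l)" by (simp add: D_def)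
  also have "\<dots> \<le> (M + cM * K1) * K1 * ((M * K1) * (2 / (tc * p)) * (LINT r:cell n|lborel. w r * exp (- ex * r)))"
  proof (rule mult_left_mono)
    have "(w (md n) / L1 (md n)) * ?l = (LINT r:cell n|lborel. w (md n) / L1 (md n))" by (simp add: cell_const)
    also have "\<dots> \<le> (LINT r:cell n|lborel. (M * K1) * (2 / (tc * p)) * (w r * exp (- ex * r)))"
    proof (rule set_integral_mono)
      fix r assume r: "r \<in> cell n"
      have r0: "r \<ge> 0" by (rule cell_ge0[OF r])
      have "L1 r \<le> K1 * L1 (md n)" by (rule L1_harnack'[OF r0 md(1) cell_close[OF r md_cell]])
      then have "1 / L1 (md n) \<le> K1 * (1 / L1 r)" using Lm L1_pos[OF r0] by (simp add: field_simps)
      also have "\<dots> \<le> K1 * (2 / (tc * p) * exp (- ex * r))" using inv_L1[OF r0] K1_pos by (intro mult_left_mono) auto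
      finally have "w (md n) * (1 / L1 (md n)) \<le> (M * w r) * (K1 * (2 / (tc * p) * exp (- ex * r)))"
        using harnackD(3)[OF w md(1) r0 cell_close[OF md_cell r]] wm Lm by (intro mult_mono) (auto intro: order_trans)
      then show "w (md n) / L1 (md n) \<le> (M * K1) * (2 / (tc * p)) * (w r * exp (- ex * r))" by (simp add: mult_ac)
    qed (intro cell_continuous_integrable continuous_intros harnackD[OF w])+
    also have "\<dots> = (M * K1) * (2 / (tc * p)) * (LINT r:cell n|lborel. w r * exp (- ex * r))" by (simp only: set_integral_mult_right)
    finally show "(w (md n) / L1 (md n)) * ?l \<le> (M * K1) * (2 / (tc * p)) * (LINT r:cell n|lborel. w r * exp (- ex * r))" .
    show "0 \<le> (M + cM * K1) * K1" using M cM_pos K1_pos by simp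
  qed
  finally show ?thesis by (simp only: mult.assoc)
qed

lemma sum_integral_compare:
  fixes g v :: "real \<Rightarrow> real" and a :: "nat \<Rightarrow> real"
  assumes g: "set_integrable lborel {0..} g" and v: "set_integrable lborel {0..} v"
    and le: "\<And>n. \<bar>a n - (LINT r:cell n|lborel. g r)\<bar> \<le> C * (LINT r:cell n|lborel. v r)"
  shows "summable a" "\<bar>suminf a - (LINT r:{0..}|lborel. g r)\<bar> \<le> C * (LINT r:{0..}|lborel. v r)"
proof -
  let ?d = "\<lambda>n. a n - (LINT r:cell n|lborel. g r)"
  have sv: "(\<lambda>n. C * (LINT r:cell n|lborel. v r)) sums (C * (LINT r:{0..}|lborel. v r))"
    by (rule sums_mult[OF cells_sums[OF v]])
  have sd: "summable ?d"
    by (rule summable_comparison_test'[OF sums_summable[OF sv]]) (use le in simp)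
  have sg: "(\<lambda>n. LINT r:cell n|lborel. g r) sums (LINT r:{0..}|lborel. g r)" by (rule cells_sums[OF g])
  have "(\<lambda>n. ?d n + (LINT r:cell n|lborel. g r)) sums (suminf ?d + (LINT r:{0..}|lborel. g r))"
    by (intro sums_add summable_sums sd sg)
  then have sa: "a sums (suminf ?d + (LINT r:{0..}|lborel. g r))" by simp
  then show "summable a" by (rule sums_summable)
  have "\<bar>suminf ?d\<bar> \<le> C * (LINT r:{0..}|lborel. v r)"
  proof -
    have "\<bar>suminf ?d\<bar> \<le> (\<Sum>n. \<bar>?d n\<bar>)"
      using le by (intro summable_rabs summable_comparison_test'[OF sums_summable[OF sv]]) auto
    also have "\<dots> \<le> (\<Sum>n. C * (LINT r:cell n|lborel. v r))"
      using le by (intro suminf_le sums_summable[OF sv] summable_comparison_test'[OF sums_summable[OF sv]]) auto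
    also have "\<dots> = C * (LINT r:{0..}|lborel. v r)" by (rule sums_unique[OF sv, symmetric])
    finally show ?thesis .
  qed
  then show "\<bar>suminf a - (LINT r:{0..}|lborel. g r)\<bar> \<le> C * (LINT r:{0..}|lborel. v r)"
    using sums_unique[OF sa] by simp
qed

lemma node_sum_le:
  assumes w: "harnack M w" and int: "set_integrable lborel {0..} (\<lambda>r. w r * L1 r)"
  shows "summable (\<lambda>n. w (md n))" "(\<Sum>n. w (md n)) \<le> M * (LINT r:{0..}|lborel. w r * L1 r)"
proof -
  have s: "(\<lambda>n. M * (LINT r:cell n|lborel. w r * L1 r)) sums (M * (LINT r:{0..}|lborel. w r * L1 r))"
    by (intro sums_mult cells_sums int)
  show 1: "summable (\<lambda>n. w (md n))"
    by (rule summable_comparison_test'[OF sums_summable[OF s]]) (use cell_value_le[OF w] harnackD(2)[OF w md(1)] in auto)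
  show "(\<Sum>n. w (md n)) \<le> M * (LINT r:{0..}|lborel. w r * L1 r)"
    using suminf_le[OF cell_value_le[OF w] 1 sums_summable[OF s]] sums_unique[OF s] by simp
qed

end

context bae
begin

definition ME :: real where "ME = 2 * exp 1 * K1"
definition CR :: real where "CR = (kM + cM * K1) * K1 * (kM * K1) * (2 / tc) * (1 + kD)"
definition CK :: real where "CK = kM * kM * ((1 + kD) * \<kappa>)"
definition CE :: real where "CE = (kM * ME) * (kM * ME) * ((kD + (2 + cM)) * (2 * Ch / tc))"
definition CQ :: real where "CQ = kM * (ME * ME) * (2 * Ch * Ch / tc)"

end

context bae_kernel
begin

lemma ff_taylor:
  assumes "\<bar>h\<bar> \<le> 1" shows "\<bar>ff (d + h) - ff d - kk d * h\<bar> \<le> kD * kM * (kk d * h\<^sup>2)"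
proof (cases "h = 0")
  case False
  define diff where "diff = (\<lambda>n::nat. if n = 0 then ff else if n = 1 then kk else kk1)"
  have "\<exists>x. (if d + h < d then d + h < x \<and> x < d else d < x \<and> x < d + h) \<and>
      ff (d + h) = (\<Sum>m<2. (diff m d / fact m) * (d + h - d)^m) + (diff 2 x / fact 2) * (d + h - d)^2"
    using False ff_deriv kk_deriv
    by (intro Taylor[where a = "d - \<bar>h\<bar>" and b = "d + \<bar>h\<bar>"])
      (auto simp: diff_def less_2_cases_iff)
  then obtain x where x: "if d + h < d then d + h < x \<and> x < d else d < x \<and> x < d + h"
    "ff (d + h) = (\<Sum>m<2. (diff m d / fact m) * (d + h - d)^m) + (diff 2 x / fact 2) * (d + h - d)^2" by blast
  have eq: "ff (d + h) = ff d + kk d * h + kk1 x / 2 * h\<^sup>2" using x(2) by (simp add: diff_def numeral_2_eq_2)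
  have "\<bar>x - d\<bar> \<le> 1" using x(1) assms by (auto split: if_splits)
  then have "\<bar>kk1 x\<bar> \<le> kD * (kM * kk d)"
    by (intro order_trans[OF kD(2)[of x] mult_left_mono[OF kk_harnack]] less_imp_le[OF kD(1)])
  then have "\<bar>kk1 x / 2 * h\<^sup>2\<bar> \<le> kD * (kM * kk d) * h\<^sup>2"
    unfolding abs_mult by (intro mult_mono) auto
  then show ?thesis unfolding eq by (simp add: mult.assoc)
qed auto

lemma ff_lip: assumes "0 \<le> h" "h \<le> 1" shows "ff (d + h) - ff d \<le> kM * kk d * h"
proof (cases "h = 0")
  case False
  then obtain z where z: "d < z" "z < d + h" "ff (d + h) - ff d = (d + h - d) * kk z"
    using MVT2[of d "d + h" ff kk] ff_deriv assms by auto
  have "kk z \<le> kM * kk d" by (rule kk_harnack) (use z assms in auto)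
  then show ?thesis unfolding z(3) using assms by (simp add: mult.commute mult_left_mono)
qed auto

end

context bae_prof
begin

section \<open>Sums over the approximate roots\<close>

lemma dominated_conv_integral:
  assumes c: "continuous_on {0..} (g :: real \<Rightarrow> real)" and b: "\<And>r. r \<ge> 0 \<Longrightarrow> \<bar>g r\<bar> \<le> C * (kk (\<sigma> - r) * exp (- ex * r))"
  shows "set_integrable lborel {0..} g" "\<bar>LINT r:{0..}|lborel. g r\<bar> \<le> C * exp (- ex * \<sigma>)"
proof -
  have "C * (kk (\<sigma> - 0) * exp (- ex * 0)) \<ge> 0" using order_trans[OF abs_ge_zero b[of 0]] by simp
  then have C0: "C \<ge> 0" using kk_pos[of \<sigma>] by (simp add: zero_le_mult_iff)
  have i: "set_integrable lborel {0..} (\<lambda>r. C * (kk (\<sigma> - r) * exp (- ex * r)))" by (intro set_integrable_mult_right half_exp)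
  have m: "(\<lambda>r. indicator {0..} r *\<^sub>R g r) \<in> borel_measurable lborel"
    using borel_measurable_continuous_on_indicator[OF _ c] by simp
  show s: "set_integrable lborel {0..} g"
    unfolding set_integrable_def
    by (rule Bochner_Integration.integrable_bound[OF i[unfolded set_integrable_def] m])
      (use b in \<open>auto simp: indicator_def intro: order_trans[OF _ abs_ge_self]\<close>)
  have "(LINT r:{0..}|lborel. g r) \<le> (LINT r:{0..}|lborel. C * (kk (\<sigma> - r) * exp (- ex * r)))"
    by (intro set_integral_mono s i) (use b in \<open>auto simp: abs_le_iff\<close>)
  moreover have "(LINT r:{0..}|lborel. - g r) \<le> (LINT r:{0..}|lborel. C * (kk (\<sigma> - r) * exp (- ex * r)))"
    using s by (intro set_integral_mono i) (use b in \<open>auto simp: abs_le_iff set_integrable_def\<close>)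
  moreover have "(LINT r:{0..}|lborel. - g r) = - (LINT r:{0..}|lborel. g r)" by (simp add: set_lebesgue_integral_def)
  moreover have "(LINT r:{0..}|lborel. C * (kk (\<sigma> - r) * exp (- ex * r))) \<le> C * exp (- ex * \<sigma>)"
    unfolding set_integral_mult_right using half_exp(2) C0 by (rule mult_left_mono)
  ultimately show "\<bar>LINT r:{0..}|lborel. g r\<bar> \<le> C * exp (- ex * \<sigma>)" by linarith
qed

lemma kk_shift_cont: "continuous_on A (\<lambda>r. kk (\<sigma> - r))"
  by (intro continuous_on_compose2[OF kk_cont[of UNIV]] continuous_intros) auto

lemma kk_shift_deriv: "((\<lambda>r. kk (\<sigma> - r)) has_real_derivative - kk1 (\<sigma> - r)) (at r)"
proof -
  have "((\<lambda>r. kk (\<sigma> - r)) has_real_derivative kk1 (\<sigma> - r) * (0 - 1)) (at r)"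
    by (rule DERIV_chain'[OF _ kk_deriv]) (auto intro!: derivative_eq_intros)
  then show ?thesis by simp
qed

lemma ff_shift_deriv: "((\<lambda>r. ff (\<sigma> - r)) has_real_derivative - kk (\<sigma> - r)) (at r)"
proof -
  have "((\<lambda>r. ff (\<sigma> - r)) has_real_derivative kk (\<sigma> - r) * (0 - 1)) (at r)"
    by (rule DERIV_chain'[OF _ ff_deriv]) (auto intro!: derivative_eq_intros)
  then show ?thesis by simp
qed

text \<open>Second-order rule for \<open>ff (\<sigma> - r)\<close>. The error weight
  \<open>kk (\<sigma> - r) * e^(- ex r)\<close> integrates to at most
  \<open>e^(- ex \<sigma>)\<close>, because the exponential moment of \<open>kk\<close> is
  1.\<close>

lemma midpoint_sum:
  shows "summable (\<lambda>n. ff (\<sigma> - md n))"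
    and "\<bar>(\<Sum>n. ff (\<sigma> - md n)) - (LINT r:{0..}|lborel. ff (\<sigma> - r) * L1 r)\<bar> \<le> CR / p * exp (- ex * \<sigma>)"
proof -
  define C where "C = (kM + cM * K1) * K1 * (kM * K1) * (2 / (tc * p))"
  have C0: "C \<ge> 0" using kM_ge1 cM_pos K1_pos tc(1) p_bounds by (simp add: C_def)
  let ?w = "\<lambda>r. (1 + kD) * kk (\<sigma> - r)"
  let ?v = "\<lambda>r. ?w r * exp (- ex * r)"
  have v: "set_integrable lborel {0..} ?v" "\<bar>LINT r:{0..}|lborel. ?v r\<bar> \<le> (1 + kD) * exp (- ex * \<sigma>)"
    by (rule dominated_conv_integral; use kk_pos kD(1) in \<open>auto intro!: continuous_intros kk_shift_cont simp: abs_mult less_imp_le\<close>)+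
  have b: "\<bar>ff (\<sigma> - md n) - (LINT r:cell n|lborel. ff (\<sigma> - r) * L1 r)\<bar> \<le> C * (LINT r:cell n|lborel. ?v r)" for n
    unfolding C_def
  proof (rule cell_second_order[where \<phi> = "\<lambda>r. ff (\<sigma> - r)" and \<phi>' = "\<lambda>r. - kk (\<sigma> - r)" and \<phi>'' = "\<lambda>r. kk1 (\<sigma> - r)"])
    show "((\<lambda>r. - kk (\<sigma> - r)) has_real_derivative kk1 (\<sigma> - r)) (at r)" for r
      by (auto intro!: derivative_eq_intros kk_shift_deriv)
    show "harnack kM ?w" using kD(1) by (intro harnack_cmult harnack_kk) auto
    show "\<bar>- kk (\<sigma> - r)\<bar> \<le> ?w r" for r using kk_self(1) by simp
  qed (use ff_shift_deriv kk_self(2) kM_ge1 in auto)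
  have g: "set_integrable lborel {0..} (\<lambda>r. ff (\<sigma> - r) * L1 r)" by (rule ff_exp_integrable(1)[OF L1_grows ex_bounds(2)])
  show "summable (\<lambda>n. ff (\<sigma> - md n))" by (rule sum_integral_compare(1)[OF g v(1) b])
  have "\<bar>(\<Sum>n. ff (\<sigma> - md n)) - (LINT r:{0..}|lborel. ff (\<sigma> - r) * L1 r)\<bar> \<le> C * (LINT r:{0..}|lborel. ?v r)"
    by (rule sum_integral_compare(2)[OF g v(1) b])
  also have "\<dots> \<le> C * ((1 + kD) * exp (- ex * \<sigma>))" using v(2) C0 by (intro mult_left_mono) auto
  also have "\<dots> = CR / p * exp (- ex * \<sigma>)" by (simp add: C_def CR_def)
  finally show "\<bar>(\<Sum>n. ff (\<sigma> - md n)) - (LINT r:{0..}|lborel. ff (\<sigma> - r) * L1 r)\<bar> \<le> CR / p * exp (- ex * \<sigma>)" .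
qed

lemma kkL1_int: "set_integrable lborel {0..} (\<lambda>r. kk (\<sigma> - r) * L1 r)"
  by (rule conv_integrable[OF L1_grows ex_bounds(3) kk_meas(1) kk_self(1)])

lemma kernel_sum_le:
  shows "summable (\<lambda>n. kk (\<sigma> - md n))" "(\<Sum>n. kk (\<sigma> - md n)) \<le> kM * (L1 \<sigma> + real H * kk \<sigma>)"
  using node_sum_le[OF harnack_kk kkL1_int, of \<sigma>] conv_L1[of \<sigma>] by (auto simp: conv_def)

text \<open>A bounded error is small against \<open>L1\<close>, which is of order \<open>p\<close>,
  so the first-order rule is enough.\<close>

lemma kernel_sum: "\<bar>(\<Sum>n. kk (\<sigma> - md n)) - (L1 \<sigma> + real H * kk \<sigma>)\<bar> \<le> CK"
proof -
  let ?w = "\<lambda>r. (1 + kD) * kk (\<sigma> - r)"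
  have v: "set_integrable lborel {0..} ?w" by (intro set_integrable_mult_right half_kk)
  have b: "\<bar>kk (\<sigma> - md n) - (LINT r:cell n|lborel. kk (\<sigma> - r) * L1 r)\<bar> \<le> kM * kM * (LINT r:cell n|lborel. ?w r)" for n
  proof (rule cell_first_order[where \<phi> = "\<lambda>r. kk (\<sigma> - r)" and \<phi>' = "\<lambda>r. - kk1 (\<sigma> - r)"])
    show "harnack kM ?w" using kD(1) by (intro harnack_cmult harnack_kk) auto
    show "\<bar>- kk1 (\<sigma> - r)\<bar> \<le> ?w r" for r using kk_self(2) by simp
  qed (use kk_shift_deriv kM_ge1 in auto)
  have "\<bar>(\<Sum>n. kk (\<sigma> - md n)) - (LINT r:{0..}|lborel. kk (\<sigma> - r) * L1 r)\<bar> \<le> kM * kM * (LINT r:{0..}|lborel. ?w r)"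
    by (rule sum_integral_compare(2)[OF kkL1_int v b])
  also have "(LINT r:{0..}|lborel. ?w r) \<le> (1 + kD) * \<kappa>"
    unfolding set_integral_mult_right using half_kk(2) kD(1) by (intro mult_left_mono) auto
  finally show ?thesis using kM_ge1 conv_L1[of \<sigma>] unfolding CK_def conv_def by (simp add: mult_left_mono)
qed

lemma E0_deriv: assumes "r \<ge> 0"
  shows "(E0 has_real_derivative (- ex * hb r + exp (- ex * r)) / L1 r - E0 r * (L2 r / L1 r)) (at r)"
proof -
  have "L1 r > 0" by (rule L1_pos[OF assms])
  then show ?thesis unfolding E0_def [abs_def]
    by (auto intro!: derivative_eq_intros hb_deriv L1_deriv simp: field_simps power2_eq_square)
qed

lemma E0_deriv_le: assumes "r \<ge> 0"
  shows "\<bar>(- ex * hb r + exp (- ex * r)) / L1 r - E0 r * (L2 r / L1 r)\<bar> \<le> (2 + cM) * E0 r"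
proof -
  have l: "L1 r > 0" by (rule L1_pos[OF assms])
  have "\<bar>(- ex * hb r + exp (- ex * r)) / L1 r\<bar> \<le> 2 * E0 r"
    unfolding E0_def using hb_deriv_le[OF assms] l by (simp add: divide_right_mono)
  moreover have "\<bar>E0 r * (L2 r / L1 r)\<bar> \<le> E0 r * cM"
  proof -
    have "\<bar>L2 r / L1 r\<bar> \<le> cM" using L2_upper[OF assms] l by (simp add: cM_def field_simps)
    then show ?thesis unfolding abs_mult using E0_pos[OF assms] by (intro mult_mono) auto
  qed
  moreover have "(2 + cM) * E0 r = 2 * E0 r + E0 r * cM" by (simp add: algebra_simps)
  moreover note abs_triangle_ineq4[of "(- ex * hb r + exp (- ex * r)) / L1 r" "E0 r * (L2 r / L1 r)"]
  ultimately show ?thesis by linarith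
qed

lemma kkE0_le: assumes "r \<ge> 0" shows "kk (\<sigma> - r) * E0 r \<le> 2 * Ch / (tc * p) * (kk (\<sigma> - r) * exp (- ex * r))"
  using mult_left_mono[OF E0_le'[OF assms], of "kk (\<sigma> - r)"] kk_pos[of "\<sigma> - r"] by (simp add: mult_ac)

lemma E0_cont: "continuous_on {0..} E0" by (rule harnackD(1)[OF harnack_E0])

text \<open>\<open>E0 * L1 = hb\<close> identifies the integral. \<open>E0\<close> is itself of
  order \<open>1 / p\<close>, so the first-order rule already gives the precision required.\<close>

lemma barrier_sum:
  shows "summable (\<lambda>n. kk (\<sigma> - md n) * E0 (md n))"
    and "\<bar>(\<Sum>n. kk (\<sigma> - md n) * E0 (md n)) - conv kk hb \<sigma>\<bar> \<le> CE / p * exp (- ex * \<sigma>)"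
proof -
  let ?k = "kD + (2 + cM)"
  have k0: "?k \<ge> 0" using kD(1) cM_pos by simp
  let ?w = "\<lambda>r. ?k * (kk (\<sigma> - r) * E0 r)"
  have ME0: "ME \<ge> 0" using K1_pos by (simp add: ME_def)
  have wc: "continuous_on {0..} ?w" by (intro continuous_intros kk_shift_cont E0_cont)
  have wb: "\<bar>?w r\<bar> \<le> ?k * (2 * Ch / (tc * p)) * (kk (\<sigma> - r) * exp (- ex * r))" if r: "r \<ge> 0" for r
    using mult_left_mono[OF kkE0_le[OF r] k0] k0 kk_pos[of "\<sigma> - r"] E0_pos[OF r] by (simp add: abs_mult mult.assoc)
  note v = dominated_conv_integral[OF wc wb]
  have h: "harnack (kM * ME) ?w"
    using k0 kM_ge1 by (intro harnack_cmult harnack_mult harnack_kk harnack_E0[folded ME_def]) auto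
  have b: "\<bar>kk (\<sigma> - md n) * E0 (md n) - (LINT r:cell n|lborel. (kk (\<sigma> - r) * E0 r) * L1 r)\<bar> \<le> (kM * ME) * (kM * ME) * (LINT r:cell n|lborel. ?w r)" for n
  proof (rule cell_first_order[where \<phi> = "\<lambda>r. kk (\<sigma> - r) * E0 r" and \<phi>' = "\<lambda>r. - kk1 (\<sigma> - r) * E0 r + kk (\<sigma> - r) * ((- ex * hb r + exp (- ex * r)) / L1 r - E0 r * (L2 r / L1 r))", OF _ h])
    fix r :: real assume r: "r \<ge> 0"
    show "((\<lambda>r. kk (\<sigma> - r) * E0 r) has_real_derivative - kk1 (\<sigma> - r) * E0 r + kk (\<sigma> - r) * ((- ex * hb r + exp (- ex * r)) / L1 r - E0 r * (L2 r / L1 r))) (at r)"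
      using DERIV_mult[OF kk_shift_deriv E0_deriv[OF r]] by (simp add: mult.commute add.commute)
    have "\<bar>- kk1 (\<sigma> - r) * E0 r\<bar> \<le> (kD * kk (\<sigma> - r)) * E0 r"
      unfolding abs_mult using kD(2)[of "\<sigma> - r"] E0_pos[OF r] kk_pos[of "\<sigma> - r"] kD(1) by (intro mult_mono) auto
    moreover have "\<bar>kk (\<sigma> - r) * ((- ex * hb r + exp (- ex * r)) / L1 r - E0 r * (L2 r / L1 r))\<bar> \<le> kk (\<sigma> - r) * ((2 + cM) * E0 r)"
      unfolding abs_mult[of "kk (\<sigma> - r)"] using E0_deriv_le[OF r] kk_pos[of "\<sigma> - r"] by (intro mult_mono) auto
    moreover have "?w r = (kD * kk (\<sigma> - r)) * E0 r + kk (\<sigma> - r) * ((2 + cM) * E0 r)" by (simp add: algebra_simps)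
    ultimately show "\<bar>- kk1 (\<sigma> - r) * E0 r + kk (\<sigma> - r) * ((- ex * hb r + exp (- ex * r)) / L1 r - E0 r * (L2 r / L1 r))\<bar> \<le> ?w r"
      by linarith
  qed (use kM_ge1 ME0 in auto)
  have hbE: "(kk (\<sigma> - r) * E0 r) * L1 r = kk (\<sigma> - r) * hb r" if "r \<ge> 0" for r
    using L1_pos[OF that] by (simp add: E0_def)
  have hbg: "\<bar>- ex / 2\<bar> < 1" using ex_bounds by simp
  have g: "set_integrable lborel {0..} (\<lambda>r. (kk (\<sigma> - r) * E0 r) * L1 r)"
    using conv_integrable[OF hb_grows hbg kk_meas(1) kk_self(1), of \<sigma>]
    by (rule set_integrable_cong[THEN iffD1, rotated -1]) (auto simp: hbE)
  have gv: "(LINT r:{0..}|lborel. (kk (\<sigma> - r) * E0 r) * L1 r) = conv kk hb \<sigma>"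
    unfolding conv_def by (intro set_lebesgue_integral_cong) (auto simp: hbE)
  show "summable (\<lambda>n. kk (\<sigma> - md n) * E0 (md n))" by (rule sum_integral_compare(1)[OF g v(1) b])
  have "\<bar>(\<Sum>n. kk (\<sigma> - md n) * E0 (md n)) - conv kk hb \<sigma>\<bar> \<le> (kM * ME) * (kM * ME) * (LINT r:{0..}|lborel. ?w r)"
    using sum_integral_compare(2)[OF g v(1) b] unfolding gv .
  also have "\<dots> \<le> (kM * ME) * (kM * ME) * (?k * (2 * Ch / (tc * p)) * exp (- ex * \<sigma>))"
    using v(2) kM_ge1 ME0 by (intro mult_left_mono) auto
  also have "\<dots> = CE / p * exp (- ex * \<sigma>)" by (simp add: CE_def)
  finally show "\<bar>(\<Sum>n. kk (\<sigma> - md n) * E0 (md n)) - conv kk hb \<sigma>\<bar> \<le> CE / p * exp (- ex * \<sigma>)" .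
qed

text \<open>Two factors \<open>E0\<close> against a density of order \<open>p\<close> leave one
  factor \<open>1 / p\<close>.\<close>

lemma barrier_square_sum:
  shows "summable (\<lambda>n. kk (\<sigma> - md n) * (E0 (md n) * E0 (md n)))"
    and "(\<Sum>n. kk (\<sigma> - md n) * (E0 (md n) * E0 (md n))) \<le> CQ / p * exp (- ex * \<sigma>)"
proof -
  let ?w = "\<lambda>r. kk (\<sigma> - r) * (E0 r * E0 r)"
  have ME0: "ME \<ge> 0" using K1_pos by (simp add: ME_def)
  have h: "harnack (kM * (ME * ME)) ?w"
    using kM_ge1 ME0 by (intro harnack_mult harnack_kk harnack_E0[folded ME_def]) auto
  have bnd: "\<bar>?w r * L1 r\<bar> \<le> Ch * (2 * Ch / (tc * p)) * (kk (\<sigma> - r) * exp (- ex * r))" if r: "r \<ge> 0" for r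
  proof -
    have "?w r * L1 r = (kk (\<sigma> - r) * E0 r) * hb r" using L1_pos[OF r] by (simp add: E0_def)
    also have "\<dots> \<le> (2 * Ch / (tc * p) * (kk (\<sigma> - r) * exp (- ex * r))) * Ch"
      by (rule mult_mono[OF kkE0_le[OF r] hb_le[OF r]])
        (use hb_pos[OF r] kk_pos[of "\<sigma> - r"] Ch_pos tc(1) p_bounds(6) in auto)
    finally have "?w r * L1 r \<le> Ch * (2 * Ch / (tc * p)) * (kk (\<sigma> - r) * exp (- ex * r))" by (simp add: mult_ac)
    moreover have "?w r * L1 r \<ge> 0" using kk_pos[of "\<sigma> - r"] L1_pos[OF r] by simp
    ultimately show ?thesis by simp
  qed
  have c: "continuous_on {0..} (\<lambda>r. ?w r * L1 r)" by (intro continuous_intros kk_shift_cont E0_cont L1_cont)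
  note i = dominated_conv_integral[OF c bnd]
  show "summable (\<lambda>n. kk (\<sigma> - md n) * (E0 (md n) * E0 (md n)))" by (rule node_sum_le(1)[OF h i(1)])
  have "(\<Sum>n. kk (\<sigma> - md n) * (E0 (md n) * E0 (md n))) \<le> kM * (ME * ME) * (LINT r:{0..}|lborel. ?w r * L1 r)"
    by (rule node_sum_le(2)[OF h i(1)])
  also have "\<dots> \<le> kM * (ME * ME) * (Ch * (2 * Ch / (tc * p)) * exp (- ex * \<sigma>))"
    using i(2) kM_ge1 ME0 by (intro mult_left_mono) auto
  also have "\<dots> = CQ / p * exp (- ex * \<sigma>)" by (simp add: CQ_def)
  finally show "(\<Sum>n. kk (\<sigma> - md n) * (E0 (md n) * E0 (md n))) \<le> CQ / p * exp (- ex * \<sigma>)" .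
qed

end

context bae
begin

definition CS :: "nat \<Rightarrow> real" where "CS H = (CK + real H * kC) * (2 * Ch / tc) + CE"
definition CR2 :: "nat \<Rightarrow> nat \<Rightarrow> real" where
  "CR2 H Nm = CR + real H * ((real Nm + 1) * (2 / tc) * (kM * kM * kC))"
definition CQ2 :: "nat \<Rightarrow> real" where
  "CQ2 H = (2 * Ch / tc)\<^sup>2 * (kM * (2 * Tb + real H * kC)) + CQ"
text \<open>Amplitude of the barrier. Its linear gain \<open>Bc * m1 / 2 = 2 * CR2\<close> pays once
  for the residual and once for the quadratic error.\<close>

definition Bc :: "nat \<Rightarrow> nat \<Rightarrow> real" where "Bc H Nm = 4 * CR2 H Nm / m1"
text \<open>The summands after \<open>p1\<close> ensure, in this order: half of the barrier gain
  survives, the nodes of the holes lie in \<open>[0, 1]\<close>, the displacements are at most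
  \<open>1 / 2\<close>, and the quadratic error stays below the residual bound.\<close>

definition p2 :: "nat \<Rightarrow> nat \<Rightarrow> real" where
  "p2 H Nm = p1 H + 2 * CS H / m1 + (real Nm + 1) * (2 / tc) + 4 * Bc H Nm * Ch / tc
     + kD * kM * CQ2 H * (Bc H Nm)\<^sup>2 / CR2 H Nm"

lemma ME_pos: "ME > 0" using K1_pos by (simp add: ME_def)

lemma consts_pos: "CR > 0" "CK \<ge> 0" "CE \<ge> 0" "CQ \<ge> 0" "CS H \<ge> 0" "CR2 H Nm > 0" "CQ2 H \<ge> 0" "Bc H Nm > 0"
proof -
  have M: "kM > 0" using kM_ge1 by simp
  show CR: "CR > 0" unfolding CR_def using M cM_pos K1_pos tc(1) kD(1) by (intro mult_pos_pos add_pos_pos) auto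
  show CK: "CK \<ge> 0" unfolding CK_def using M kD(1) \<kappa>_nonneg by (intro mult_nonneg_nonneg) auto
  show CE: "CE \<ge> 0" unfolding CE_def using M ME_pos kD(1) cM_pos Ch_pos tc(1) by (intro mult_nonneg_nonneg divide_nonneg_nonneg) auto
  show CQ: "CQ \<ge> 0" unfolding CQ_def using M ME_pos Ch_pos tc(1) by (intro mult_nonneg_nonneg divide_nonneg_nonneg) auto
  show "CS H \<ge> 0" unfolding CS_def using CK CE kC(1) Ch_pos tc(1) by (intro add_nonneg_nonneg mult_nonneg_nonneg divide_nonneg_nonneg) auto
  show C2: "CR2 H Nm > 0" unfolding CR2_def using CR M kC(1) tc(1) by (intro add_pos_nonneg mult_nonneg_nonneg) auto
  show "CQ2 H \<ge> 0" unfolding CQ2_def using CQ M kC(1) Tb_pos by (intro add_nonneg_nonneg mult_nonneg_nonneg) auto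
  show "Bc H Nm > 0" unfolding Bc_def using C2 m1_pos by simp
qed

lemma p2_ge_p1: "p2 H Nm \<ge> p1 H"
  and p2_parts: "p2 H Nm \<ge> 2 * CS H / m1" "p2 H Nm \<ge> (real Nm + 1) * (2 / tc)" "p2 H Nm \<ge> 4 * Bc H Nm * Ch / tc"
    "p2 H Nm \<ge> kD * kM * CQ2 H * (Bc H Nm)\<^sup>2 / CR2 H Nm"
proof -
  have "0 \<le> p1 H" unfolding p1_def using gam_nonneg[of H] Tb_pos tc(1) by (intro add_nonneg_nonneg divide_nonneg_nonneg mult_nonneg_nonneg) auto
  moreover have "0 \<le> 2 * CS H / m1" using consts_pos(5)[of H] m1_pos by simp
  moreover have "0 \<le> (real Nm + 1) * (2 / tc)" using tc(1) by simp
  moreover have "0 \<le> 4 * Bc H Nm * Ch / tc" using consts_pos(8)[of H Nm] Ch_pos tc(1) by simp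
  moreover have "0 \<le> kD * kM * CQ2 H * (Bc H Nm)\<^sup>2 / CR2 H Nm"
    using kD(1) kM_ge1 consts_pos(6)[of H Nm] consts_pos(7)[of H] by (intro divide_nonneg_nonneg mult_nonneg_nonneg) auto
  ultimately show "p2 H Nm \<ge> p1 H" "p2 H Nm \<ge> 2 * CS H / m1" "p2 H Nm \<ge> (real Nm + 1) * (2 / tc)" "p2 H Nm \<ge> 4 * Bc H Nm * Ch / tc"
    "p2 H Nm \<ge> kD * kM * CQ2 H * (Bc H Nm)\<^sup>2 / CR2 H Nm"
    unfolding p2_def by linarith+
qed

end

section \<open>Perron's method\<close>

text \<open>\<open>Hs\<close> holds the indices \<open>n = k + H\<close> of the holes \<open>k \<ge> - H\<close>.\<close>

locale bae_sol = bae_prof +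
  fixes Hs :: "nat set" and Nm :: nat
  assumes Hs: "finite Hs" "card Hs = H" "Hs \<subseteq> {..<Nm}" and p_ge2: "p \<ge> p2 H Nm"
begin

lemma p2_bounds: "p \<ge> 2 * CS H / m1" "p \<ge> (real Nm + 1) * (2 / tc)" "p \<ge> 4 * Bc H Nm * Ch / tc"
    "p \<ge> kD * kM * CQ2 H * (Bc H Nm)\<^sup>2 / CR2 H Nm"
  by (rule order_trans[OF p2_parts(1) p_ge2] order_trans[OF p2_parts(2) p_ge2]
      order_trans[OF p2_parts(3) p_ge2] order_trans[OF p2_parts(4) p_ge2])+

section \<open>Gain, residual and quadratic error of the barrier\<close>

definition cc :: "nat \<Rightarrow> real" where "cc n = (if n \<in> Hs then 0 else 1)"

lemma cc: "cc n \<ge> 0" "cc n \<le> 1" "\<bar>cc n\<bar> \<le> 1" by (auto simp: cc_def)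

lemma weighted_suminf:
  assumes "summable x" shows "summable (\<lambda>n. cc n * x n)" "(\<Sum>n. cc n * x n) = suminf x - sum x Hs"
proof -
  have "(\<lambda>n. x n - (if n \<in> Hs then x n else 0)) sums (suminf x - sum x Hs)"
    by (intro sums_diff summable_sums assms sums_If_finite_set Hs)
  moreover have "(\<lambda>n. x n - (if n \<in> Hs then x n else 0)) = (\<lambda>n. cc n * x n)" by (auto simp: cc_def)
  ultimately have "(\<lambda>n. cc n * x n) sums (suminf x - sum x Hs)" by simp
  then show "summable (\<lambda>n. cc n * x n)" "(\<Sum>n. cc n * x n) = suminf x - sum x Hs"
    by (auto simp: sums_iff)
qed

text \<open>\<open>E0 \<sigma>\<close> times the kernel sum is close to
  \<open>E0 \<sigma> * L1 \<sigma> = hb \<sigma>\<close>, while the sum of \<open>kk * E0\<close> is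
  close to \<open>conv kk hb\<close>, which is smaller by \<open>m1 * e^(- ex \<sigma>)\<close>. All
  errors and the \<open>H\<close> hole terms together cost at most half of this.\<close>

lemma barrier_gain:
  assumes s: "\<sigma> \<ge> 0"
  shows "summable (\<lambda>n. cc n * (kk (\<sigma> - md n) * (E0 \<sigma> - E0 (md n))))"
    and "m1 / 2 * exp (- ex * \<sigma>) \<le> (\<Sum>n. cc n * (kk (\<sigma> - md n) * (E0 \<sigma> - E0 (md n))))"
proof -
  let ?a = "\<lambda>n. kk (\<sigma> - md n)" and ?b = "\<lambda>n. kk (\<sigma> - md n) * E0 (md n)"
  let ?x = "\<lambda>n. ?a n * (E0 \<sigma> - E0 (md n))"
  have x: "?x n = E0 \<sigma> * ?a n - ?b n" for n by (simp add: algebra_simps)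
  have sx: "?x sums (E0 \<sigma> * suminf ?a - suminf ?b)"
    unfolding x by (intro sums_diff sums_mult summable_sums kernel_sum_le barrier_sum)
  note cs = weighted_suminf[OF sums_summable[OF sx]]
  show "summable (\<lambda>n. cc n * ?x n)" by (rule cs(1))
  have E0p: "E0 \<sigma> > 0" by (rule E0_pos[OF s])
  have h: "sum ?x Hs \<le> real H * (kC * E0 \<sigma>)"
  proof -
    have "?x n \<le> kC * E0 \<sigma>" for n
    proof -
      have "?x n \<le> ?a n * E0 \<sigma>" unfolding x using kk_pos[of "\<sigma> - md n"] E0_pos[OF md(1)[of n]] by (simp add: mult.commute)
      also have "?a n \<le> kC * 1"
        by (rule order_trans[OF kC(2)]) (use kC(1) in \<open>auto intro!: mult_left_mono\<close>)
      then have "?a n * E0 \<sigma> \<le> kC * E0 \<sigma>" using E0p by (intro mult_right_mono) auto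
      finally show ?thesis .
    qed
    then have "sum ?x Hs \<le> real (card Hs) * (kC * E0 \<sigma>)" by (intro sum_bounded_above) auto
    then show ?thesis by (simp add: Hs)
  qed
  define e where "e = exp (- ex * \<sigma>)"
  \<comment> \<open>The surplus \<open>H * kk \<sigma>\<close> in \<open>kernel_sum\<close> is
    nonnegative and is dropped.\<close>
  have k1: "E0 \<sigma> * (L1 \<sigma> - CK) \<le> E0 \<sigma> * suminf ?a"
    using kernel_sum[of \<sigma>] kk_pos[of \<sigma>] E0p by (intro mult_left_mono) (auto simp: abs_le_iff intro: order_trans[of _ "L1 \<sigma> + real H * kk \<sigma> - CK"])
  have k2: "suminf ?b \<le> hb \<sigma> - m1 * e + CE / p * e"
    using barrier_sum(2)[of \<sigma>] barrier[OF s] unfolding e_def by linarith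
  have k3: "E0 \<sigma> * L1 \<sigma> = hb \<sigma>" using L1_pos[OF s] by (simp add: E0_def)
  have E0e: "E0 \<sigma> \<le> 2 * Ch / tc / p * e" using E0_le'[OF s] by (simp add: e_def)
  have "(CK + real H * kC) * E0 \<sigma> \<le> (CK + real H * kC) * (2 * Ch / tc / p * e)"
    using E0e consts_pos(2) kC(1) by (intro mult_left_mono) auto
  then have k4: "(CK + real H * kC) * E0 \<sigma> + CE / p * e \<le> CS H / p * e"
    by (simp add: CS_def add_divide_distrib distrib_right)
  have k5: "CS H / p \<le> m1 / 2" using p2_bounds(1) m1_pos p_bounds(6) by (simp add: field_simps)
  have "CS H / p * e \<le> m1 / 2 * e" using k5 by (intro mult_right_mono) (auto simp: e_def)
  then have "m1 / 2 * e \<le> m1 * e - CS H / p * e" by linarith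
  also have "\<dots> \<le> m1 * e - ((CK + real H * kC) * E0 \<sigma> + CE / p * e)" using k4 by simp
  also have "\<dots> \<le> (E0 \<sigma> * suminf ?a - suminf ?b) - sum ?x Hs"
    using k1 k2 k3 h by (simp add: algebra_simps)
  also have "\<dots> = (\<Sum>n. cc n * ?x n)" using cs(2) sums_unique[OF sx] by simp
  finally show "m1 / 2 * exp (- ex * \<sigma>) \<le> (\<Sum>n. cc n * ?x n)" by (simp only: e_def)
qed

lemma md_small: assumes "n \<in> Hs" shows "md n \<le> (real Nm + 1) * (2 / tc) / p" "md n \<le> 1"
proof -
  have "tc / 2 * p * exp (ex * 0) * (md n - 0) \<le> L (md n) - L 0" by (rule L_diff_ge) (use md in auto)
  also have "\<dots> = real n + 1 / 2" by (simp add: md L_0)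
  also have "\<dots> \<le> real Nm + 1" using assms Hs(3) by auto
  finally show 1: "md n \<le> (real Nm + 1) * (2 / tc) / p" using tc(1) p_bounds(6) by (simp add: field_simps)
  show "md n \<le> 1" using 1 p2_bounds(2) p_bounds(6) by (intro order_trans[OF 1]) (simp only: pos_divide_le_eq mult_1)
qed

text \<open>The profile misses \<open>H\<close> roots at 0, the sum misses those at the nodes of the
  holes. As \<open>card Hs = H\<close> and these nodes are \<open>O(1 / p)\<close> from 0,
  exchanging them costs no more than the order of the midpoint error.\<close>

lemma residual_bound:
  assumes s: "\<sigma> \<ge> 0"
  shows "\<bar>- 2 * p + (\<Sum>n. cc n * ff (\<sigma> - md n)) - L \<sigma>\<bar> \<le> CR2 H Nm / p * exp (- ex * \<sigma>)"
proof -
  have one: "\<bar>ff \<sigma> - ff (\<sigma> - md n)\<bar> \<le> (real Nm + 1) * (2 / tc) / p * (kM * kM * kC * exp (- ex * \<sigma>))" if n: "n \<in> Hs" for n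
  proof -
    have "kk (\<sigma> - md n) \<le> kM * kk \<sigma>" by (rule kk_harnack) (use md(1)[of n] md_small(2)[OF n] in auto)
    also have "\<dots> \<le> kM * (kC * exp (- ex * \<sigma>))"
    proof (rule mult_left_mono)
      have "ex * \<sigma> \<le> 1 * \<sigma>" using ex_bounds s by (intro mult_right_mono) auto
      then have "kC * exp (- \<bar>\<sigma>\<bar>) \<le> kC * exp (- ex * \<sigma>)" using kC(1) s by (intro mult_left_mono) auto
      then show "kk \<sigma> \<le> kC * exp (- ex * \<sigma>)" using kC(2)[of \<sigma>] by linarith
    qed (use kM_ge1 in simp)
    finally have k: "kM * kk (\<sigma> - md n) \<le> kM * (kM * (kC * exp (- ex * \<sigma>)))" using kM_ge1 by (intro mult_left_mono) auto
    have "ff \<sigma> - ff (\<sigma> - md n) \<le> kM * kk (\<sigma> - md n) * md n"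
      using ff_lip[OF md(1) md_small(2)[OF n], of "\<sigma> - md n"] by simp
    also have "\<dots> \<le> (kM * (kM * (kC * exp (- ex * \<sigma>)))) * ((real Nm + 1) * (2 / tc) / p)"
      using k md_small(1)[OF n] md(1)[of n] kM_ge1 kk_pos[of "\<sigma> - md n"] kC(1) by (intro mult_mono) auto
    finally have "ff \<sigma> - ff (\<sigma> - md n) \<le> (real Nm + 1) * (2 / tc) / p * (kM * kM * kC * exp (- ex * \<sigma>))" by (simp only: mult_ac)
    moreover have "ff (\<sigma> - md n) \<le> ff \<sigma>" by (rule ff_mono) (use md(1)[of n] in simp)
    ultimately show ?thesis by simp
  qed
  have "\<bar>\<Sum>n\<in>Hs. ff \<sigma> - ff (\<sigma> - md n)\<bar> \<le> (\<Sum>n\<in>Hs. \<bar>ff \<sigma> - ff (\<sigma> - md n)\<bar>)" by (rule sum_abs)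
  also have "\<dots> \<le> real (card Hs) * ((real Nm + 1) * (2 / tc) / p * (kM * kM * kC * exp (- ex * \<sigma>)))"
    using one by (intro sum_bounded_above) auto
  finally have h: "\<bar>real H * ff \<sigma> - (\<Sum>n\<in>Hs. ff (\<sigma> - md n))\<bar> \<le> real H * ((real Nm + 1) * (2 / tc) / p * (kM * kM * kC * exp (- ex * \<sigma>)))"
    by (simp add: sum_subtractf Hs)
  have "- 2 * p + (\<Sum>n. cc n * ff (\<sigma> - md n)) - L \<sigma>
     = ((\<Sum>n. ff (\<sigma> - md n)) - (LINT r:{0..}|lborel. ff (\<sigma> - r) * L1 r)) + (real H * ff \<sigma> - (\<Sum>n\<in>Hs. ff (\<sigma> - md n)))"
    unfolding weighted_suminf(2)[OF midpoint_sum(1)] L_equation[OF s] by simp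
  then have "\<bar>- 2 * p + (\<Sum>n. cc n * ff (\<sigma> - md n)) - L \<sigma>\<bar> \<le> CR / p * exp (- ex * \<sigma>)
      + real H * ((real Nm + 1) * (2 / tc) / p * (kM * kM * kC * exp (- ex * \<sigma>)))"
    using midpoint_sum(2)[of \<sigma>] h by linarith
  also have "\<dots> = CR2 H Nm / p * exp (- ex * \<sigma>)"
    using p_bounds(6) tc(1) by (simp add: CR2_def field_simps)
  finally show ?thesis .
qed

text \<open>\<open>(a - b)^2 \<le> a^2 + b^2\<close> for positive \<open>a\<close>,
  \<open>b\<close>. In the first part the kernel sum, of order \<open>p * e^(ex \<sigma>)\<close>,
  cancels one of the two factors \<open>e^(- ex \<sigma>) / p\<close>.\<close>

lemma quadratic_error:
  assumes s: "\<sigma> \<ge> 0"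
  shows "summable (\<lambda>n. kk (\<sigma> - md n) * (E0 \<sigma> - E0 (md n))\<^sup>2)"
    and "(\<Sum>n. kk (\<sigma> - md n) * (E0 \<sigma> - E0 (md n))\<^sup>2) \<le> CQ2 H / p * exp (- ex * \<sigma>)"
proof -
  let ?y = "\<lambda>n. E0 \<sigma> * E0 \<sigma> * kk (\<sigma> - md n) + kk (\<sigma> - md n) * (E0 (md n) * E0 (md n))"
  have E0p: "E0 \<sigma> > 0" by (rule E0_pos[OF s])
  have le: "kk (\<sigma> - md n) * (E0 \<sigma> - E0 (md n))\<^sup>2 \<le> ?y n" for n
  proof -
    have "(E0 \<sigma> - E0 (md n))\<^sup>2 \<le> E0 \<sigma> * E0 \<sigma> + E0 (md n) * E0 (md n)"
      using mult_pos_pos[OF E0p E0_pos[OF md(1)[of n]]] by (simp add: power2_eq_square algebra_simps)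
    from mult_left_mono[OF this, of "kk (\<sigma> - md n)"] show ?thesis using kk_pos[of "\<sigma> - md n"] by (simp add: algebra_simps)
  qed
  have sy: "?y sums (E0 \<sigma> * E0 \<sigma> * (\<Sum>n. kk (\<sigma> - md n)) + (\<Sum>n. kk (\<sigma> - md n) * (E0 (md n) * E0 (md n))))"
    by (intro sums_add sums_mult summable_sums kernel_sum_le barrier_square_sum)
  show sm: "summable (\<lambda>n. kk (\<sigma> - md n) * (E0 \<sigma> - E0 (md n))\<^sup>2)"
    by (rule summable_comparison_test'[OF sums_summable[OF sy], of 0]) (use le kk_pos in \<open>auto simp: abs_mult less_imp_le\<close>)
  have "(\<Sum>n. kk (\<sigma> - md n) * (E0 \<sigma> - E0 (md n))\<^sup>2) \<le> suminf ?y"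
    by (rule suminf_le[OF le sm sums_summable[OF sy]])
  also have "\<dots> = E0 \<sigma> * E0 \<sigma> * (\<Sum>n. kk (\<sigma> - md n)) + (\<Sum>n. kk (\<sigma> - md n) * (E0 (md n) * E0 (md n)))"
    by (rule sums_unique[OF sy, symmetric])
  also have "E0 \<sigma> * E0 \<sigma> * (\<Sum>n. kk (\<sigma> - md n)) \<le> (2 * Ch / tc)\<^sup>2 * (kM * (2 * Tb + real H * kC)) / p * exp (- ex * \<sigma>)"
  proof -
    have u: "(\<Sum>n. kk (\<sigma> - md n)) \<le> kM * ((2 * Tb + real H * kC) * p * exp (ex * \<sigma>))"
    proof (rule order_trans[OF kernel_sum_le(2)], rule mult_left_mono)
      have "kk \<sigma> \<le> kC * 1" by (rule order_trans[OF kC(2)]) (use kC(1) in \<open>auto intro!: mult_left_mono\<close>)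
      also have "\<dots> \<le> kC * (p * exp (ex * \<sigma>))"
      proof (rule mult_left_mono)
        have "1 * 1 \<le> p * exp (ex * \<sigma>)" using p_bounds(1) s ex_bounds by (intro mult_mono) auto
        then show "1 \<le> p * exp (ex * \<sigma>)" by simp
      qed (use kC(1) in simp)
      finally have "real H * kk \<sigma> \<le> real H * (kC * (p * exp (ex * \<sigma>)))" by (intro mult_left_mono) auto
      moreover have "L1 \<sigma> \<le> 2 * Tb * p * exp (ex * \<sigma>)" using L1_upper[OF s] by simp
      ultimately show "L1 \<sigma> + real H * kk \<sigma> \<le> (2 * Tb + real H * kC) * p * exp (ex * \<sigma>)" by (simp add: algebra_simps)
    qed (use kM_ge1 in simp)
    have "E0 \<sigma> * E0 \<sigma> * (\<Sum>n. kk (\<sigma> - md n)) \<le> ((2 * Ch / tc / p * exp (- ex * \<sigma>)) * (2 * Ch / tc / p * exp (- ex * \<sigma>))) * (kM * ((2 * Tb + real H * kC) * p * exp (ex * \<sigma>)))"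
      using E0_le'[OF s] E0p u suminf_nonneg[OF kernel_sum_le(1)[of \<sigma>]] kk_pos Ch_pos tc(1) p_bounds(6)
      by (intro mult_mono) (auto simp: less_imp_le)
    also have "\<dots> = (2 * Ch / tc)\<^sup>2 * (kM * (2 * Tb + real H * kC)) * ((p / (p * p)) * (exp (- ex * \<sigma>) * (exp (- ex * \<sigma>) * exp (ex * \<sigma>))))"
      by (simp add: power2_eq_square mult_ac)
    also have "exp (- ex * \<sigma>) * exp (ex * \<sigma>) = 1" by (simp add: exp_add[symmetric])
    finally show ?thesis using p_bounds(6) by simp
  qed
  finally show "(\<Sum>n. kk (\<sigma> - md n) * (E0 \<sigma> - E0 (md n))\<^sup>2) \<le> CQ2 H / p * exp (- ex * \<sigma>)"
    using barrier_square_sum(2)[of \<sigma>] by (simp add: CQ2_def add_divide_distrib distrib_right)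
qed

text \<open>Half-width of the corridor around the nodes. \<open>E0\<close> contributes a second
  factor \<open>1 / p\<close>, so the width is of order \<open>p^(-2)\<close>.\<close>

definition ee :: "nat \<Rightarrow> real" where "ee n = Bc H Nm / p * E0 (md n)"

lemma E0_small: "\<sigma> \<ge> 0 \<Longrightarrow> Bc H Nm / p * E0 \<sigma> \<le> 1 / 2"
proof -
  assume s: "\<sigma> \<ge> 0"
  have B: "Bc H Nm / p \<le> Bc H Nm" using consts_pos(8)[of H Nm] p_bounds(1) by (simp add: divide_le_eq)
  have "E0 \<sigma> \<le> 2 * Ch / (tc * p) * 1"
    using s ex_bounds Ch_pos tc(1) p_bounds(6) by (intro order_trans[OF E0_le'[OF s]] mult_left_mono) auto
  then have "Bc H Nm / p * E0 \<sigma> \<le> Bc H Nm * (2 * Ch / (tc * p))"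
    using B E0_pos[OF s] consts_pos(8)[of H Nm] by (intro mult_mono) auto
  also have "\<dots> \<le> 1 / 2"
    using p2_bounds(3) tc(1) p_bounds(6) by (simp add: field_simps)
  finally show ?thesis .
qed

lemma ee: "ee n > 0" "ee n \<le> 1 / 2"
  unfolding ee_def using E0_small[OF md(1)] E0_pos[OF md(1)] consts_pos(8)[of H Nm] p_bounds(6) by auto

section \<open>Sub-solutions, super-solutions and their order\<close>

definition near :: "(nat \<Rightarrow> real) \<Rightarrow> bool" where "near t \<longleftrightarrow> (\<forall>n. \<bar>t n - md n\<bar> \<le> ee n)"

lemma near_dist: "near t \<Longrightarrow> \<bar>t n - md n\<bar> \<le> 1"
proof -
  assume "near t"
  then have "\<bar>t n - md n\<bar> \<le> ee n" by (simp add: near_def)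
  then show ?thesis using ee(2)[of n] by linarith
qed

lemma near_summable:
  assumes "near t"
  shows "summable (\<lambda>n. cc n * ff (s - t n))" "summable (\<lambda>n. kk (s - t n))"
    "(\<Sum>n. kk (s - t n)) \<le> kM * (\<Sum>n. kk (s - md n))"
proof -
  have 1: "norm (cc n * ff (s - t n)) \<le> ff (s + 1 - md n)" for n
  proof -
    have "cc n * ff (s - t n) \<le> 1 * ff (s + 1 - md n)"
      using near_dist[OF assms, of n] cc[of n] ff_nonneg[of "s - t n"] by (intro mult_mono ff_mono) auto
    then show ?thesis using cc[of n] ff_nonneg[of "s - t n"] by (simp add: abs_mult)
  qed
  show "summable (\<lambda>n. cc n * ff (s - t n))"
    by (rule summable_comparison_test'[OF midpoint_sum(1)[of "s + 1"]]) (rule 1)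
  have 2: "kk (s - t n) \<le> kM * kk (s - md n)" for n
    by (rule kk_harnack) (use near_dist[OF assms, of n] in simp)
  show sm: "summable (\<lambda>n. kk (s - t n))"
    by (rule summable_comparison_test'[OF summable_mult[OF kernel_sum_le(1)[of s], of kM], of 0]) (use 2 kk_pos in \<open>auto simp: less_imp_le\<close>)
  show "(\<Sum>n. kk (s - t n)) \<le> kM * (\<Sum>n. kk (s - md n))"
    unfolding suminf_mult[OF kernel_sum_le(1), symmetric] by (intro suminf_le 2 sm summable_mult kernel_sum_le)
qed

text \<open>The associated function of the configuration \<open>t\<close>, on the logarithmic scale.
  Evaluation point and configuration are separate arguments because \<open>zz\<close> is
  nondecreasing in \<open>s\<close> and nonincreasing in every \<open>t n\<close>.\<close>

definition zz :: "(nat \<Rightarrow> real) \<Rightarrow> real \<Rightarrow> real" where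
  "zz t s = - 2 * p + (\<Sum>n. cc n * ff (s - t n))"

lemma zz_mono: assumes "near t" "s \<le> s'" shows "zz t s \<le> zz t s'"
  unfolding zz_def using assms cc
  by (intro add_left_mono suminf_le near_summable mult_left_mono ff_mono) auto

lemma zz_antimono: assumes "near t" "near t'" "\<And>n. t n \<le> t' n" shows "zz t' s \<le> zz t s"
  unfolding zz_def using assms cc
  by (intro add_left_mono suminf_le near_summable mult_left_mono ff_mono) auto

text \<open>Continuity in the evaluation point, the regularity that the passage to the supremum
  uses.\<close>

lemma zz_lip: assumes "near t" shows "\<exists>C>0. \<forall>h. \<bar>h\<bar> \<le> 1 \<longrightarrow> \<bar>zz t (s + h) - zz t s\<bar> \<le> C * \<bar>h\<bar>"
proof -
  define C where "C = (1 + kD * kM) * (\<Sum>n. kk (s - t n))"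
  have sp: "(\<Sum>n. kk (s - t n)) > 0" using kk_pos by (intro suminf_pos near_summable(2)[OF assms]) auto
  have Cp: "C > 0" unfolding C_def using sp kD(1) kM_ge1 by (intro mult_pos_pos add_pos_pos) auto
  have "\<bar>zz t (s + h) - zz t s\<bar> \<le> C * \<bar>h\<bar>" if h: "\<bar>h\<bar> \<le> 1" for h
  proof -
    have le: "\<bar>cc n * ff (s + h - t n) - cc n * ff (s - t n)\<bar> \<le> (1 + kD * kM) * \<bar>h\<bar> * kk (s - t n)" for n
    proof -
      have "\<bar>ff (s - t n + h) - ff (s - t n) - kk (s - t n) * h\<bar> \<le> kD * kM * (kk (s - t n) * h\<^sup>2)" by (rule ff_taylor[OF h])
      moreover have "kk (s - t n) * h\<^sup>2 \<le> kk (s - t n) * \<bar>h\<bar>"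
      proof (rule mult_left_mono)
        have "\<bar>h\<bar> * \<bar>h\<bar> \<le> 1 * \<bar>h\<bar>" using h by (intro mult_right_mono) auto
        then show "h\<^sup>2 \<le> \<bar>h\<bar>" by (simp add: power2_eq_square)
      qed (use kk_pos in \<open>simp add: less_imp_le\<close>)
      then have "kD * kM * (kk (s - t n) * h\<^sup>2) \<le> kD * kM * (kk (s - t n) * \<bar>h\<bar>)" by (rule mult_left_mono) (use kD(1) kM_ge1 in auto)
      ultimately have "\<bar>ff (s - t n + h) - ff (s - t n)\<bar> \<le> \<bar>kk (s - t n) * h\<bar> + kD * kM * (kk (s - t n) * \<bar>h\<bar>)" by linarith
      also have "\<bar>kk (s - t n) * h\<bar> = kk (s - t n) * \<bar>h\<bar>" using kk_pos[of "s - t n"] by (simp add: abs_mult)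
      finally have d: "\<bar>ff (s + h - t n) - ff (s - t n)\<bar> \<le> (1 + kD * kM) * \<bar>h\<bar> * kk (s - t n)" by (simp add: algebra_simps)
      have "\<bar>cc n * ff (s + h - t n) - cc n * ff (s - t n)\<bar> = cc n * \<bar>ff (s + h - t n) - ff (s - t n)\<bar>"
        using cc[of n] by (simp add: right_diff_distrib[symmetric] abs_mult)
      also have "\<dots> \<le> 1 * \<bar>ff (s + h - t n) - ff (s - t n)\<bar>" using cc[of n] by (intro mult_right_mono) auto
      finally show ?thesis using d by simp
    qed
    have s1: "summable (\<lambda>n. (1 + kD * kM) * \<bar>h\<bar> * kk (s - t n))" by (intro summable_mult near_summable(2)[OF assms])
    have s2: "summable (\<lambda>n. \<bar>cc n * ff (s + h - t n) - cc n * ff (s - t n)\<bar>)"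
      by (rule summable_comparison_test'[OF s1, of 0]) (use le in auto)
    have "zz t (s + h) - zz t s = (\<Sum>n. cc n * ff (s + h - t n) - cc n * ff (s - t n))"
      unfolding zz_def by (subst suminf_diff[symmetric]) (auto intro: near_summable[OF assms])
    then have "\<bar>zz t (s + h) - zz t s\<bar> \<le> (\<Sum>n. \<bar>cc n * ff (s + h - t n) - cc n * ff (s - t n)\<bar>)"
      using summable_rabs[OF s2] by simp
    also have "\<dots> \<le> (\<Sum>n. (1 + kD * kM) * \<bar>h\<bar> * kk (s - t n))" by (rule suminf_le[OF le s2 s1])
    also have "\<dots> = C * \<bar>h\<bar>" by (subst suminf_mult[OF near_summable(2)[OF assms]]) (simp add: C_def)
    finally show ?thesis .
  qed
  then show ?thesis using Cp by blast
qed

text \<open>Displacing all nodes by \<open>sg * ee\<close> changes the arguments by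
  \<open>sg * b * (E0 (md m) - E0 (md n))\<close> with \<open>b = Bc H Nm / p\<close>, so the linear
  term is exactly the sum estimated in \<open>barrier_gain\<close>.\<close>

lemma perturbation_bound:
  fixes sg :: real
  assumes sg: "sg = 1 \<or> sg = -1"
  shows "\<bar>zz (\<lambda>n. md n + sg * ee n) (md m + sg * ee m) - (- 2 * p + (\<Sum>n. cc n * ff (md m - md n)))
      - sg * (Bc H Nm / p * (\<Sum>n. cc n * (kk (md m - md n) * (E0 (md m) - E0 (md n)))))\<bar>
      \<le> kD * kM * ((Bc H Nm / p)\<^sup>2 * (CQ2 H / p * exp (- ex * md m)))"
proof -
  define b where "b = Bc H Nm / p"
  have b0: "b \<ge> 0" using consts_pos(8)[of H Nm] p_bounds(6) by (simp add: b_def)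
  define \<delta> where "\<delta> = (\<lambda>n. E0 (md m) - E0 (md n))"
  have arg: "(md m + sg * ee m) - (md n + sg * ee n) = (md m - md n) + sg * (b * \<delta> n)" for n
    by (simp add: ee_def b_def \<delta>_def algebra_simps)
  have small: "\<bar>sg * (b * \<delta> n)\<bar> \<le> 1" for n
  proof -
    have "b * \<delta> n = ee m - ee n" by (simp add: ee_def b_def \<delta>_def algebra_simps)
    then have "\<bar>b * \<delta> n\<bar> \<le> 1" using ee[of m] ee[of n] by simp
    then show ?thesis using sg by auto
  qed
  have sg2: "sg\<^sup>2 = 1" using sg by auto
  define A where "A = (\<lambda>n. cc n * ff ((md m - md n) + sg * (b * \<delta> n)))"
  define F where "F = (\<lambda>n. cc n * ff (md m - md n))"
  define K where "K = (\<lambda>n. cc n * (kk (md m - md n) * \<delta> n))"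
  define Q where "Q = (\<lambda>n. kk (md m - md n) * (\<delta> n)\<^sup>2)"
  have nr: "near (\<lambda>n. md n + sg * ee n)" using sg ee by (auto simp: near_def abs_mult less_imp_le)
  have sA: "summable A" using near_summable(1)[OF nr, of "md m + sg * ee m"] by (simp add: arg A_def)
  have sF: "summable F" unfolding F_def by (rule weighted_suminf(1)[OF midpoint_sum(1)])
  have sK: "summable K" unfolding K_def \<delta>_def by (rule barrier_gain(1)[OF md(1)])
  have sQ: "summable Q" unfolding Q_def \<delta>_def by (rule quadratic_error(1)[OF md(1)])
  have le: "\<bar>A n - F n - sg * b * K n\<bar> \<le> kD * kM * b\<^sup>2 * Q n" for n
  proof -
    have "\<bar>ff ((md m - md n) + sg * (b * \<delta> n)) - ff (md m - md n) - kk (md m - md n) * (sg * (b * \<delta> n))\<bar>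
        \<le> kD * kM * (kk (md m - md n) * (sg * (b * \<delta> n))\<^sup>2)" by (rule ff_taylor[OF small])
    also have "(sg * (b * \<delta> n))\<^sup>2 = b\<^sup>2 * (\<delta> n)\<^sup>2" by (simp add: power_mult_distrib sg2)
    finally have t: "\<bar>ff ((md m - md n) + sg * (b * \<delta> n)) - ff (md m - md n) - kk (md m - md n) * (sg * (b * \<delta> n))\<bar>
        \<le> kD * kM * b\<^sup>2 * Q n" by (simp add: Q_def mult_ac)
    have "A n - F n - sg * b * K n = cc n * (ff ((md m - md n) + sg * (b * \<delta> n)) - ff (md m - md n) - kk (md m - md n) * (sg * (b * \<delta> n)))"
      by (simp add: A_def F_def K_def algebra_simps)
    then have "\<bar>A n - F n - sg * b * K n\<bar> = cc n * \<bar>ff ((md m - md n) + sg * (b * \<delta> n)) - ff (md m - md n) - kk (md m - md n) * (sg * (b * \<delta> n))\<bar>"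
      using cc[of n] by (simp only: abs_mult)
    also have "\<dots> \<le> 1 * (kD * kM * b\<^sup>2 * Q n)" using t cc[of n] by (intro mult_mono) auto
    finally show ?thesis by simp
  qed
  have sD: "(\<lambda>n. A n - F n - sg * b * K n) sums (suminf A - suminf F - sg * b * suminf K)"
    by (intro sums_diff sums_mult summable_sums sA sF sK)
  have s1: "summable (\<lambda>n. kD * kM * b\<^sup>2 * Q n)" by (intro summable_mult sQ)
  have s2: "summable (\<lambda>n. \<bar>A n - F n - sg * b * K n\<bar>)"
    by (rule summable_comparison_test'[OF s1, of 0]) (use le in auto)
  have "\<bar>suminf A - suminf F - sg * b * suminf K\<bar> \<le> (\<Sum>n. \<bar>A n - F n - sg * b * K n\<bar>)"
    using summable_rabs[OF s2] sums_unique[OF sD] by simp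
  also have "\<dots> \<le> (\<Sum>n. kD * kM * b\<^sup>2 * Q n)" by (rule suminf_le[OF le s2 s1])
  also have "\<dots> = kD * kM * b\<^sup>2 * suminf Q" by (rule suminf_mult[OF sQ])
  also have "\<dots> \<le> kD * kM * b\<^sup>2 * (CQ2 H / p * exp (- ex * md m))"
    using quadratic_error(2)[OF md(1), of m] kD(1) kM_ge1 unfolding Q_def \<delta>_def by (intro mult_left_mono) auto
  finally have "\<bar>suminf A - suminf F - sg * b * suminf K\<bar> \<le> kD * kM * b\<^sup>2 * (CQ2 H / p * exp (- ex * md m))" .
  moreover have "zz (\<lambda>n. md n + sg * ee n) (md m + sg * ee m) = - 2 * p + suminf A"
    unfolding zz_def arg A_def ..
  ultimately show ?thesis
    unfolding b_def[symmetric] F_def K_def \<delta>_def by (simp add: mult.assoc)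
qed

lemma barrier_dominates: "CR2 H Nm / p * x + kD * kM * ((Bc H Nm / p)\<^sup>2 * (CQ2 H / p * x)) \<le> Bc H Nm / p * (m1 / 2 * x)" if "x \<ge> 0"
proof -
  define B R Q where "B = Bc H Nm" and "R = CR2 H Nm" and "Q = kD * kM * CQ2 H"
  have R: "R > 0" unfolding R_def by (rule consts_pos)
  have "Q * B\<^sup>2 \<le> p * R" using p2_bounds(4) R by (simp add: B_def R_def Q_def pos_divide_le_eq)
  also have "\<dots> \<le> p * (p * R)" using p_bounds(1) R by (simp add: mult_left_mono)
  finally have "Q * B\<^sup>2 / p\<^sup>2 \<le> R" using p_bounds(6) by (simp add: pos_divide_le_eq power2_eq_square mult_ac)
  then have "R + Q * B\<^sup>2 / p\<^sup>2 \<le> B * (m1 / 2)" using m1_pos R by (simp add: B_def Bc_def R_def)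
  then have "(x / p) * (R + Q * B\<^sup>2 / p\<^sup>2) \<le> (x / p) * (B * (m1 / 2))" using that p_bounds(6) by (intro mult_left_mono) auto
  then show ?thesis by (simp add: B_def[symmetric] R_def[symmetric] Q_def power_divide algebra_simps)
qed

lemma super_solution: "zz (\<lambda>n. md n + ee n) (md m + ee m) \<ge> L (md m)"
  and sub_solution: "zz (\<lambda>n. md n - ee n) (md m - ee m) \<le> L (md m)"
proof -
  define x where "x = exp (- ex * md m)"
  define S where "S = (\<Sum>n. cc n * (kk (md m - md n) * (E0 (md m) - E0 (md n))))"
  define R where "R = - 2 * p + (\<Sum>n. cc n * ff (md m - md n))"
  have S: "Bc H Nm / p * (m1 / 2 * x) \<le> Bc H Nm / p * S"
    unfolding S_def x_def using barrier_gain(2)[OF md(1), of m] consts_pos(8)[of H Nm] p_bounds(6) by (intro mult_left_mono) auto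
  have R: "\<bar>R - L (md m)\<bar> \<le> CR2 H Nm / p * x" unfolding R_def x_def by (rule residual_bound[OF md(1)])
  have M: "CR2 H Nm / p * x + kD * kM * ((Bc H Nm / p)\<^sup>2 * (CQ2 H / p * x)) \<le> Bc H Nm / p * (m1 / 2 * x)"
    by (rule barrier_dominates) (simp add: x_def)
  have "\<bar>zz (\<lambda>n. md n + ee n) (md m + ee m) - R - Bc H Nm / p * S\<bar> \<le> kD * kM * ((Bc H Nm / p)\<^sup>2 * (CQ2 H / p * x))"
    using perturbation_bound[of 1 m] by (simp add: S_def R_def x_def)
  then show "zz (\<lambda>n. md n + ee n) (md m + ee m) \<ge> L (md m)" using S R M by linarith
  have "\<bar>zz (\<lambda>n. md n - ee n) (md m - ee m) - R + Bc H Nm / p * S\<bar> \<le> kD * kM * ((Bc H Nm / p)\<^sup>2 * (CQ2 H / p * x))"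
    using perturbation_bound[of "-1" m] by (simp add: S_def R_def x_def)
  then show "zz (\<lambda>n. md n - ee n) (md m - ee m) \<le> L (md m)" using S R M by linarith
qed

text \<open>\<open>zz t (t m)\<close> does not decrease in \<open>t m\<close> and does not increase
  in the other \<open>t n\<close>. Hence the supremum of sub-solutions is a sub-solution, and a
  coordinate with strict inequality could still be raised.\<close>

lemma perron_solution: "\<exists>t. near t \<and> (\<forall>m. zz t (t m) = real m - real H + 1 / 2)"
proof -
  define v where "v = (\<lambda>m::nat. L (md m))"
  define S where "S = {t. near t \<and> (\<forall>m. zz t (t m) \<le> v m)}"
  have lo: "(\<lambda>n. md n - ee n) \<in> S" using sub_solution ee by (auto simp: S_def near_def v_def less_imp_le)
  define T where "T = (\<lambda>n. Sup ((\<lambda>t. t n) ` S))"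
  have bd: "t n \<le> md n + ee n" "md n - ee n \<le> t n" if "near t" for t n
    using that unfolding near_def by (auto simp: abs_le_iff dest!: spec[of _ n])
  have bdd: "bdd_above ((\<lambda>t. t n) ` S)" for n
    using bd(1) by (intro bdd_aboveI[of _ "md n + ee n"]) (auto simp: S_def)
  have up: "t n \<le> T n" if "t \<in> S" for t n
    unfolding T_def by (rule cSup_upper[OF _ bdd]) (use that in auto)
  have Tle: "T n \<le> md n + ee n" for n
    unfolding T_def using lo bd(1) by (intro cSup_least) (auto simp: S_def)
  have Tge: "md n - ee n \<le> T n" for n using up[OF lo, of n] by simp
  have nT: "near T" using Tle Tge by (auto simp: near_def abs_le_iff algebra_simps)
  have nhi: "near (\<lambda>n. md n + ee n)" using ee by (auto simp: near_def less_imp_le)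
  have le: "zz T (T m) \<le> v m" for m
  proof (rule ccontr)
    assume "\<not> zz T (T m) \<le> v m"
    then have gap: "zz T (T m) - v m > 0" by simp
    obtain C where C: "C > 0" "\<And>h. \<bar>h\<bar> \<le> 1 \<Longrightarrow> \<bar>zz T (T m + h) - zz T (T m)\<bar> \<le> C * \<bar>h\<bar>"
      using zz_lip[OF nT] by blast
    define d where "d = min 1 ((zz T (T m) - v m) / (2 * C))"
    have d: "d > 0" "d \<le> 1" "C * d \<le> (zz T (T m) - v m) / 2"
    proof -
      show "d > 0" "d \<le> 1" using gap C(1) by (auto simp: d_def)
      have "d \<le> (zz T (T m) - v m) / (2 * C)" by (simp add: d_def)
      then show "C * d \<le> (zz T (T m) - v m) / 2" using C(1) by (simp add: field_simps)
    qed
    have "\<exists>t\<in>S. T m - d < t m"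
    proof (rule ccontr)
      assume "\<not> (\<exists>t\<in>S. T m - d < t m)"
      then have "T m \<le> T m - d" unfolding T_def using lo by (intro cSup_least) (auto simp: not_less T_def[symmetric])
      then show False using d by simp
    qed
    then obtain t where t: "t \<in> S" "T m - d < t m" by blast
    have tn: "near t" "zz t (t m) \<le> v m" using t(1) by (auto simp: S_def)
    have "zz T (T m - d) \<le> zz T (t m)" by (rule zz_mono[OF nT]) (use t in simp)
    also have "\<dots> \<le> zz t (t m)" by (rule zz_antimono[OF tn(1) nT]) (rule up[OF t(1)])
    also have "\<dots> \<le> v m" by (rule tn)
    finally have "zz T (T m + (- d)) \<le> v m" by simp
    moreover have "\<bar>zz T (T m + (- d)) - zz T (T m)\<bar> \<le> C * \<bar>- d\<bar>" by (rule C(2)) (use d in simp)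
    ultimately show False using d gap by (simp add: abs_le_iff)
  qed
  have ge: "zz T (T m) \<ge> v m" for m
  proof (rule ccontr)
    assume "\<not> zz T (T m) \<ge> v m"
    then have gap: "v m - zz T (T m) > 0" by simp
    \<comment> \<open>On the upper edge of the corridor the super-solution already forces the
      reverse inequality, so a coordinate with a gap has room to move.\<close>
    have lt: "T m < md m + ee m"
    proof (rule ccontr)
      assume "\<not> T m < md m + ee m"
      then have eq: "T m = md m + ee m" using Tle[of m] by simp
      have "v m \<le> zz (\<lambda>n. md n + ee n) (md m + ee m)" unfolding v_def by (rule super_solution)
      also have "\<dots> \<le> zz T (md m + ee m)" by (rule zz_antimono[OF nT nhi Tle])
      finally show False using gap eq by simp
    qed
    obtain C where C: "C > 0" "\<And>h. \<bar>h\<bar> \<le> 1 \<Longrightarrow> \<bar>zz T (T m + h) - zz T (T m)\<bar> \<le> C * \<bar>h\<bar>"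
      using zz_lip[OF nT] by blast
    define d where "d = min (min 1 ((v m - zz T (T m)) / C)) (md m + ee m - T m)"
    have d: "d > 0" "d \<le> 1" "C * d \<le> v m - zz T (T m)" "T m + d \<le> md m + ee m"
    proof -
      show "d > 0" "d \<le> 1" "T m + d \<le> md m + ee m" using gap C(1) lt by (auto simp: d_def)
      have "d \<le> (v m - zz T (T m)) / C" by (simp add: d_def)
      then show "C * d \<le> v m - zz T (T m)" using C(1) by (simp add: field_simps)
    qed
    define T' where "T' = T(m := T m + d)"
    have T'ge: "T n \<le> T' n" for n using d by (simp add: T'_def)
    have nT': "near T'"
    proof -
      have "\<bar>T' n - md n\<bar> \<le> ee n" for n
        using Tle[of n] Tge[of n] d by (cases "n = m") (auto simp: T'_def abs_le_iff)
      then show ?thesis by (simp add: near_def)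
    qed
    \<comment> \<open>Raising coordinate \<open>m\<close> can only lower the values at the other
      \<open>j\<close>; for \<open>j = m\<close> the choice of \<open>d\<close> keeps the Lipschitz
      increase within the gap.\<close>
    have "zz T' (T' j) \<le> v j" for j
    proof (cases "j = m")
      case True
      have "zz T' (T m + d) \<le> zz T (T m + d)" by (rule zz_antimono[OF nT nT' T'ge])
      also have "\<dots> \<le> v m" using C(2)[of d] d by (simp add: abs_le_iff)
      finally show ?thesis using True by (simp add: T'_def)
    next
      case False
      have "zz T' (T j) \<le> zz T (T j)" by (rule zz_antimono[OF nT nT' T'ge])
      then show ?thesis using False le[of j] by (simp add: T'_def)
    qed
    then have "T' \<in> S" using nT' by (simp add: S_def)
    from up[OF this, of m] show False using d by (simp add: T'_def)
  qed
  have "zz T (T m) = real m - real H + 1 / 2" for m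
    using le[of m] ge[of m] by (simp add: v_def md)
  then show ?thesis using nT by blast
qed

end

section \<open>Canonical products of order less than one\<close>

text \<open>The cofactor is \<open>- a\<close> times the difference quotient of \<open>Q\<close> at
  \<open>a\<close>. Its value there is \<open>- a * deriv Q a\<close>, nonzero as the zero is
  simple, so \<open>a\<close> is used up and the other zeros stay simple.\<close>

lemma entire_simple_zero_factor:
  fixes Q :: "complex \<Rightarrow> complex"
  assumes hol: "Q holomorphic_on UNIV" and simple: "\<And>z. Q z = 0 \<Longrightarrow> deriv Q z \<noteq> 0"
    and a: "Q a = 0" "a \<noteq> 0"
  obtains E where "E holomorphic_on UNIV" "\<And>z. Q z = (1 - z / a) * E z"
    "\<And>z. E z = 0 \<longleftrightarrow> Q z = 0 \<and> z \<noteq> a" "\<And>z. E z = 0 \<Longrightarrow> deriv E z \<noteq> 0"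
proof -
  define h where "h z = (if z = a then deriv Q a else (Q z - Q a) / (z - a))" for z
  define E where "E z = - a * h z" for z
  have holh: "h holomorphic_on UNIV" unfolding h_def by (rule pole_lemma_open[OF hol]) auto
  then have holE: "E holomorphic_on UNIV" unfolding E_def by (intro holomorphic_intros)
  have fac: "Q z = (1 - z / a) * E z" for z
  proof (cases "z = a")
    case False
    then have "(1 - z / a) * (- a * (Q z / (z - a))) = Q z" using a(2) by (simp add: field_simps)
    then show ?thesis using False a by (simp add: E_def h_def)
  qed (use a in auto)
  have ze: "E z = 0 \<longleftrightarrow> Q z = 0 \<and> z \<noteq> a" for z
    using a simple[OF a(1)] by (auto simp: E_def h_def)
  have dv: "deriv E z \<noteq> 0" if "E z = 0" for z
  proof -
    have "(E has_field_derivative deriv E z) (at z)" by (rule holomorphic_derivI[OF holE]) auto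
    then have "((\<lambda>z. (1 - z / a) * E z) has_field_derivative (1 - z / a) * deriv E z) (at z)"
      by (auto intro!: derivative_eq_intros simp: that a)
    moreover have "(\<lambda>z. (1 - z / a) * E z) = Q" using fac by auto
    ultimately have "deriv Q z = (1 - z / a) * deriv E z" using DERIV_imp_deriv by simp
    then show ?thesis using simple[of z] that ze[of z] by auto
  qed
  show ?thesis by (rule that[OF holE fac ze dv])
qed

lemma entire_simple_zeros_factor:
  fixes Q :: "complex \<Rightarrow> complex" and a :: "nat \<Rightarrow> complex"
  assumes hol: "Q holomorphic_on UNIV" and simple: "\<And>z. Q z = 0 \<Longrightarrow> deriv Q z \<noteq> 0"
    and a: "\<And>n. Q (a n) = 0" "\<And>n. a n \<noteq> 0" "inj a"
  shows "\<exists>E. E holomorphic_on UNIV \<and> (\<forall>z. Q z = (\<Prod>n<N. 1 - z / a n) * E z) \<and>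
    (\<forall>z. E z = 0 \<longleftrightarrow> Q z = 0 \<and> z \<notin> a ` {..<N}) \<and> (\<forall>z. E z = 0 \<longrightarrow> deriv E z \<noteq> 0)"
proof (induction N)
  case 0 then show ?case using assms by (intro exI[of _ Q]) auto
next
  case (Suc N)
  then obtain E where E: "E holomorphic_on UNIV" "\<And>z. Q z = (\<Prod>n<N. 1 - z / a n) * E z"
    "\<And>z. E z = 0 \<longleftrightarrow> Q z = 0 \<and> z \<notin> a ` {..<N}" "\<And>z. E z = 0 \<Longrightarrow> deriv E z \<noteq> 0" by blast
  have "E (a N) = 0" using E(3)[of "a N"] a by (auto dest: injD)
  then obtain F where F: "F holomorphic_on UNIV" "\<And>z. E z = (1 - z / a N) * F z"
    "\<And>z. F z = 0 \<longleftrightarrow> E z = 0 \<and> z \<noteq> a N" "\<And>z. F z = 0 \<Longrightarrow> deriv F z \<noteq> 0"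
    using entire_simple_zero_factor[OF E(1,4) _ a(2), of N] by metis
  show ?case
  proof (intro exI[of _ F] conjI allI impI)
    show "Q z = (\<Prod>n<Suc N. 1 - z / a n) * F z" for z using E(2)[of z] F(2)[of z] by simp
    show "F z = 0 \<longleftrightarrow> Q z = 0 \<and> z \<notin> a ` {..<Suc N}" for z using E(3)[of z] F(3)[of z] by (auto simp: lessThan_Suc)
  qed (use F(1,4) in auto)
qed

text \<open>Borel--Caratheodory, from the Schwarz lemma for \<open>g / (2M - g)\<close>.\<close>
lemma norm_le_of_Re_le:
  fixes g :: "complex \<Rightarrow> complex"
  assumes hol: "g holomorphic_on ball 0 R" and g0: "g 0 = 0" and M: "M > 0"
    and le: "\<And>z. norm z < R \<Longrightarrow> Re (g z) < M" and z: "norm z < R"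
  shows "norm (g z) \<le> 2 * M * norm z / (R - norm z)"
proof -
  have R: "R > 0" using z norm_ge_zero[of z] by linarith
  define f where "f w = g (of_real R * w) / (2 * of_real M - g (of_real R * w))" for w
  have ball: "of_real R * w \<in> ball 0 R" if "norm w < 1" for w :: complex
    using that R by (simp add: norm_mult)
  have nz: "2 * of_real M - g (of_real R * w) \<noteq> 0" if "norm w < 1" for w
  proof
    assume "2 * of_real M - g (of_real R * w) = 0"
    then have "Re (2 * of_real M - g (of_real R * w)) = 0" by simp
    then show False using le[of "of_real R * w"] ball[OF that] M by (simp add: norm_mult)
  qed
  have h1: "(\<lambda>w. g (of_real R * w)) holomorphic_on ball 0 1"
    by (rule holomorphic_on_compose_gen[OF _ hol, unfolded o_def]) (use ball in \<open>auto intro!: holomorphic_intros\<close>)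
  have holf: "f holomorphic_on ball 0 1" unfolding f_def
    by (intro holomorphic_intros h1) (use nz in auto)
  have f1: "norm (f w) < 1" if w: "norm w < 1" for w
  proof -
    let ?g = "g (of_real R * w)"
    have "Re ?g < M" using le ball[OF w] by simp
    then have "0 < 4 * M * (M - Re ?g)" using M by simp
    then have "(Re ?g)\<^sup>2 < (2 * M - Re ?g)\<^sup>2" by (simp add: power2_eq_square algebra_simps)
    then have "(norm ?g)\<^sup>2 < (norm (2 * of_real M - ?g))\<^sup>2" by (simp add: cmod_power2)
    then have "norm ?g < norm (2 * of_real M - ?g)" by (rule power_less_imp_less_base) auto
    then show ?thesis using nz[OF w] by (simp add: f_def norm_divide)
  qed
  let ?w = "z / of_real R"
  have w: "norm ?w < 1" using z R by (simp add: norm_divide)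
  have "norm (f ?w) \<le> norm ?w" by (rule Schwarz_Lemma(1)[OF holf _ f1 w]) (simp_all add: f_def g0)
  moreover have eq: "of_real R * ?w = z" using R by simp
  ultimately have "norm (g z) / norm (2 * of_real M - g z) \<le> norm z / R" using R by (simp add: f_def norm_divide)
  then have "norm (g z) * R \<le> norm z * norm (2 * of_real M - g z)"
    using nz[OF w] R unfolding eq by (simp add: divide_simps)
  also have "\<dots> \<le> norm z * (2 * M + norm (g z))"
    using norm_triangle_ineq4[of "2 * of_real M" "g z"] M by (intro mult_left_mono) (simp_all add: norm_mult)
  finally have "norm (g z) * (R - norm z) \<le> 2 * M * norm z" by (simp add: algebra_simps)
  then show ?thesis using z by (simp add: field_simps)
qed

section \<open>The phase of a single factor\<close>

context bae_kernel
begin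

text \<open>\<open>ff\<close> on the original scale \<open>x = e^t\<close>; it also covers
  \<open>x = 0\<close>, where the branch of \<open>z\<close> is normalised.\<close>

definition FF :: "real \<Rightarrow> real" where "FF x = Im (Ln (1 - of_real x * cis (- \<theta>))) / pi"

lemma FF_0 [simp]: "FF 0 = 0"
  by (simp add: FF_def)

lemma FF_eq_ff: "x > 0 \<Longrightarrow> FF x = ff (ln x)"
  by (simp add: FF_def ff_def)

lemma FF_nonneg: "x \<ge> 0 \<Longrightarrow> FF x \<ge> 0"
  using ff_nonneg[of "ln x"] by (cases "x = 0") (auto simp: FF_eq_ff)

lemma FF_le: "x \<ge> 0 \<Longrightarrow> FF x \<le> kC * x"
  using ff_le_exp[of "ln x"] by (cases "x = 0") (auto simp: FF_eq_ff)

lemma FF_strict_mono: "0 \<le> x \<Longrightarrow> x < y \<Longrightarrow> FF x < FF y"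
  using ff_strict_mono[of "ln x" "ln y"] ff_pos[of "ln y"] by (cases "x = 0") (auto simp: FF_eq_ff)

lemma FF_arg_notin: "1 - of_real x * cis (- \<theta>) \<notin> \<real>\<^sub>\<le>\<^sub>0"
  using sin_pos by (cases "x = 0") (auto simp: complex_nonpos_Reals_iff)

lemma FF_arg_nonzero: "1 - of_real x * cis (- \<theta>) \<noteq> 0" "1 - of_real x * cis \<theta> \<noteq> 0"
proof -
  show 1: "1 - of_real x * cis (- \<theta>) \<noteq> 0" using FF_arg_notin[of x] by (metis complex_nonpos_Reals_iff zero_complex.sel order_refl)
  have "1 - of_real x * cis \<theta> = cnj (1 - of_real x * cis (- \<theta>))" by (simp add: cis_cnj)
  then show "1 - of_real x * cis \<theta> \<noteq> 0" using 1 complex_cnj_zero_iff by metis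
qed

lemma FF_cont: "continuous_on A FF"
proof -
  have "continuous_on A (\<lambda>x. Im (Ln (1 - of_real x * cis (- \<theta>))) / pi)"
    by (intro continuous_intros) (use FF_arg_notin in auto)
  then show ?thesis by (simp add: FF_def[abs_def])
qed

text \<open>Numerator and denominator are complex conjugates, so the quotient has modulus 1 and
  twice the argument of the numerator.\<close>

lemma FF_phase:
  "(1 - of_real x * cis (- \<theta>)) / (1 - of_real x * cis \<theta>) = exp (2 * pi * \<i> * of_real (FF x))"
proof -
  define w where "w = 1 - of_real x * cis (- \<theta>)"
  have w: "w \<noteq> 0" unfolding w_def by (rule FF_arg_nonzero)
  have c: "1 - of_real x * cis \<theta> = cnj w" by (simp add: w_def cis_cnj)
  have "w / cnj w = exp (Ln w) / exp (cnj (Ln w))" using w by (simp add: exp_cnj[symmetric])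
  also have "\<dots> = exp (Ln w - cnj (Ln w))" by (simp add: exp_diff)
  also have "Ln w - cnj (Ln w) = 2 * pi * \<i> * of_real (FF x)"
    by (simp add: complex_diff_cnj FF_def w_def[symmetric])
  finally show ?thesis unfolding c w_def[symmetric] .
qed

end

text \<open>Indices start at 0, so \<open>Suc n\<close> counts the roots up to \<open>y n\<close>,
  and the last assumption is the normalisation sampled at the roots.\<close>

locale bae_zeros = bae +
  fixes y :: "nat \<Rightarrow> real"
  assumes y_pos: "y n > 0" and y_mono: "strict_mono y"
    and y_lim: "(\<lambda>n. real (Suc n) / y n powr ex) \<longlonglongrightarrow> 1"
begin

lemma y_nz [simp]: "y n \<noteq> 0"
  using y_pos[of n] by simp

lemma y_powr_ge: "\<forall>\<^sub>F n in sequentially. real (Suc n) / 2 \<le> y n powr ex"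
proof -
  have "\<forall>\<^sub>F n in sequentially. real (Suc n) / y n powr ex < 2" using order_tendstoD(2)[OF y_lim, of 2] by simp
  then show ?thesis
  proof eventually_elim
    case (elim n)
    then show ?case using y_pos[of n] by (simp add: divide_less_eq powr_gt_zero)
  qed
qed

lemma y_at_top: "filterlim y at_top sequentially"
proof (rule filterlim_at_top_mono)
  have "1 / ex > 0" using ex_bounds by simp
  then show "filterlim (\<lambda>n. (real (Suc n) / 2) powr (1 / ex)) at_top sequentially" by real_asymp
  show "\<forall>\<^sub>F n in sequentially. (real (Suc n) / 2) powr (1 / ex) \<le> y n"
    using y_powr_ge
  proof eventually_elim
    case (elim n)
    have "(real (Suc n) / 2) powr (1 / ex) \<le> (y n powr ex) powr (1 / ex)"
      using elim ex_bounds by (intro powr_mono2) auto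
    also have "\<dots> = y n" using ex_bounds y_pos[of n] by (simp add: powr_powr)
    finally show ?case .
  qed
qed

lemma y_summable:
  assumes "\<mu> > ex" shows "summable (\<lambda>n. y n powr (- \<mu>))"
proof (rule summable_comparison_test_ev)
  have ex: "ex > 0" using ex_bounds by simp
  have "- (\<mu> / ex) < -1" using assms ex by simp
  then have "summable (\<lambda>n. real (Suc n) powr (- (\<mu> / ex)))"
    using summable_real_powr_iff summable_Suc_iff[of "\<lambda>n. real n powr (- (\<mu> / ex))"] by simp
  then show "summable (\<lambda>n. (1/2) powr (- (\<mu> / ex)) * real (Suc n) powr (- (\<mu> / ex)))" by (rule summable_mult)
  show "\<forall>\<^sub>F n in sequentially. norm (y n powr (- \<mu>)) \<le> (1/2) powr (- (\<mu> / ex)) * real (Suc n) powr (- (\<mu> / ex))"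
    using y_powr_ge
  proof eventually_elim
    case (elim n)
    have "y n powr (- \<mu>) = (y n powr ex) powr (- (\<mu> / ex))" using ex by (simp add: powr_powr)
    also have "\<dots> \<le> (real (Suc n) / 2) powr (- (\<mu> / ex))"
      using elim assms ex by (intro powr_mono2') auto
    also have "\<dots> = (1/2 * real (Suc n)) powr (- (\<mu> / ex))" by simp
    also have "\<dots> = (1/2) powr (- (\<mu> / ex)) * real (Suc n) powr (- (\<mu> / ex))" by (rule powr_mult)
    finally show ?case by simp
  qed
qed

lemma y_summable_inv: "summable (\<lambda>n. 1 / y n)"
  using y_summable[of 1] ex_bounds y_pos by (simp add: powr_minus_divide less_imp_le)

definition PQ :: "complex \<Rightarrow> complex" where "PQ z = (\<Prod>n. 1 - z / of_real (y n))"

text \<open>Genus 0: the exponent \<open>ex\<close> is below 1, so the sum of \<open>1 / y n\<close>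
  converges.\<close>

interpretation W: weierstrass_product "\<lambda>n. of_real (y n)" "\<lambda>_. 0"
proof
  show "filterlim (\<lambda>n. complex_of_real (y n)) at_infinity sequentially"
    using y_at_top by (intro filterlim_norm_at_top_imp_at_infinity) (use y_at_top y_pos in \<open>simp add: abs_of_pos\<close>)
  show "summable (\<lambda>n. (r / norm (complex_of_real (y n))) ^ Suc 0)" for r
    using summable_mult[OF y_summable_inv, of r] y_pos by (simp add: less_imp_le)
qed auto

lemma PQ_eq_W: "PQ = W.f"
  by (simp add: PQ_def W.f_def weierstrass_factor_def fun_eq_iff)

lemma PQ_tendsto: "(\<lambda>N. \<Prod>n<N. 1 - z / of_real (y n)) \<longlonglongrightarrow> PQ z"
  using has_prod_imp_tendsto'[OF W.has_prod[of z]] by (simp add: PQ_eq_W weierstrass_factor_def)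

lemma PQ_holomorphic: "PQ holomorphic_on A"
  unfolding PQ_eq_W by (rule W.holomorphic)

lemma PQ_zero_iff: "PQ z = 0 \<longleftrightarrow> (\<exists>n. z = of_real (y n))"
  unfolding PQ_eq_W W.zero by auto

lemma PQ_0: "PQ 0 = 1"
  by (simp add: PQ_def)

lemma PQ_simple: assumes "PQ z = 0" shows "deriv PQ z \<noteq> 0"
proof -
  obtain n where n: "z = of_real (y n)" using assms PQ_zero_iff by auto
  have "(\<lambda>n. complex_of_real (y n)) -` {z} = {n}"
    using strict_mono_eq[OF y_mono] by (auto simp: n)
  then have zo: "zorder PQ z = 1" unfolding PQ_eq_W W.zorder by simp
  obtain r where r: "r > 0" "zor_poly PQ z holomorphic_on cball z r"
      "\<forall>w\<in>cball z r. PQ w = zor_poly PQ z w * (w - z) \<and> zor_poly PQ z w \<noteq> 0"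
    using zorder_exist_zero[OF PQ_holomorphic[of UNIV], of z] PQ_0 zo by (auto simp: exI[of _ 0])
  define g where "g = zor_poly PQ z"
  have gd: "(g has_field_derivative deriv g z) (at z)"
    by (rule holomorphic_derivI[of _ "ball z r"]) (use r in \<open>auto simp: g_def intro: holomorphic_on_subset\<close>)
  have "((\<lambda>w. g w * (w - z)) has_field_derivative g z) (at z)"
    by (auto intro!: derivative_eq_intros gd)
  then have "(PQ has_field_derivative g z) (at z)"
    by (rule has_field_derivative_transform_within_open[of _ _ _ "ball z r"]) (use r in \<open>auto simp: g_def\<close>)
  then show ?thesis using r by (auto simp: g_def DERIV_imp_deriv)
qed

end

lemma ln_add_one_le_powr:
  fixes t \<mu> :: real assumes "0 \<le> t" "0 < \<mu>" "\<mu> \<le> 1" shows "1 + t \<le> exp (2 / \<mu> * t powr \<mu>)"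
proof (cases "t \<le> 1")
  case True
  have "t \<le> t powr \<mu>" using assms True powr_mono'[of \<mu> 1 t] by simp
  also have "\<dots> \<le> 2 / \<mu> * t powr \<mu>" using mult_right_mono[of 1 "2 / \<mu>" "t powr \<mu>"] assms by (simp add: field_simps)
  finally show ?thesis using exp_ge_add_one_self[of t] by (meson exp_le_cancel_iff order_trans)
next
  case False
  have "ln (1 + t) \<le> (1 + t) powr \<mu> / \<mu>" using False assms by (intro ln_powr_bound) auto
  also have "\<dots> \<le> (2 * t) powr \<mu> / \<mu>" using False assms by (intro divide_right_mono powr_mono2) auto
  also have "\<dots> = 2 powr \<mu> * t powr \<mu> / \<mu>" by (simp add: powr_mult)
  also have "\<dots> \<le> 2 powr 1 * t powr \<mu> / \<mu>" using assms by (intro divide_right_mono mult_right_mono powr_mono) auto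
  finally have "ln (1 + t) \<le> 2 / \<mu> * t powr \<mu>" by simp
  then show ?thesis using False by (subst ln_le_cancel_iff[symmetric]) auto
qed

context bae
begin

lemma rot_eq: "rot \<alpha> = cis th" "cnj (rot \<alpha>) = cis (- th)"
  by (simp_all add: rot_def th_def cis_conv_exp exp_cnj)

end

context bae_zeros
begin

text \<open>Each factor obeys \<open>1 + t \<le> exp (2 / \<mu> * t powr \<mu>)\<close>, and the sum
  of \<open>y n powr (- \<mu>)\<close> converges as soon as \<open>\<mu> > ex\<close>.\<close>

lemma PQ_upper:
  assumes "\<mu> > ex" "\<mu> \<le> 1" shows "norm (PQ z) \<le> exp (2 / \<mu> * (\<Sum>n. y n powr (- \<mu>)) * norm z powr \<mu>)"
proof (rule tendsto_upperbound[OF tendsto_norm[OF PQ_tendsto]])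
  have \<mu>: "\<mu> > 0" using assms ex_bounds by simp
  note sm = y_summable[OF assms(1)]
  have le: "norm (1 - z / of_real (y n)) \<le> exp (2 / \<mu> * norm z powr \<mu> * y n powr (- \<mu>))" for n
  proof -
    have "norm (1 - z / of_real (y n)) \<le> 1 + norm z / y n"
      using norm_triangle_ineq4[of 1 "z / of_real (y n)"] y_pos[of n] by (simp add: norm_divide)
    also have "\<dots> \<le> exp (2 / \<mu> * (norm z / y n) powr \<mu>)"
      using y_pos[of n] assms \<mu> by (intro ln_add_one_le_powr) auto
    also have "(norm z / y n) powr \<mu> = norm z powr \<mu> * y n powr (- \<mu>)"
      using y_pos[of n] by (simp add: powr_divide powr_minus_divide)
    finally show ?thesis by (simp add: mult_ac)
  qed
  show "\<forall>\<^sub>F N in sequentially. norm (\<Prod>n<N. 1 - z / of_real (y n)) \<le> exp (2 / \<mu> * (\<Sum>n. y n powr (- \<mu>)) * norm z powr \<mu>)"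
  proof (intro always_eventually allI)
    fix N
    have "norm (\<Prod>n<N. 1 - z / of_real (y n)) = (\<Prod>n<N. norm (1 - z / of_real (y n)))" by (simp add: prod_norm)
    also have "\<dots> \<le> (\<Prod>n<N. exp (2 / \<mu> * norm z powr \<mu> * y n powr (- \<mu>)))"
      by (rule prod_mono) (use le in auto)
    also have "\<dots> = exp (2 / \<mu> * norm z powr \<mu> * (\<Sum>n<N. y n powr (- \<mu>)))"
      by (simp add: exp_sum sum_distrib_left)
    also have "\<dots> \<le> exp (2 / \<mu> * norm z powr \<mu> * (\<Sum>n. y n powr (- \<mu>)))"
      using \<mu> by (intro iffD2[OF exp_le_cancel_iff] mult_left_mono sum_le_suminf[OF sm]) auto
    finally show "norm (\<Prod>n<N. 1 - z / of_real (y n)) \<le> exp (2 / \<mu> * (\<Sum>n. y n powr (- \<mu>)) * norm z powr \<mu>)"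
      by (simp add: mult_ac)
  qed
qed auto

text \<open>On the negative axis every factor is at least 1, and those of the \<open>Suc n\<close>
  roots up to \<open>y n\<close> are at least 2.\<close>

lemma PQ_lower: "2 ^ Suc n \<le> norm (PQ (- of_real (y n)))"
proof (rule tendsto_lowerbound[OF tendsto_norm[OF PQ_tendsto]])
  show "\<forall>\<^sub>F N in sequentially. 2 ^ Suc n \<le> norm (\<Prod>k<N. 1 - - of_real (y n) / complex_of_real (y k))"
    using eventually_ge_at_top[of "Suc n"]
  proof eventually_elim
    case (elim N)
    have sub: "{..<N} \<inter> {k. k \<le> n} = {..<Suc n}" using elim by auto
    have "2 ^ Suc n = (\<Prod>k<N. if k \<le> n then 2 else 1 :: real)"
      by (simp only: prod.If_cases finite_lessThan sub) simp
    also have "\<dots> \<le> (\<Prod>k<N. norm (1 - - of_real (y n) / complex_of_real (y k)))"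
    proof (rule prod_mono, intro conjI)
      fix k
      have "1 - - of_real (y n) / complex_of_real (y k) = of_real (1 + y n / y k)" by simp
      then have eq: "norm (1 - - of_real (y n) / complex_of_real (y k)) = 1 + y n / y k"
        using y_pos by (simp only: norm_of_real) (simp add: add_nonneg_nonneg less_imp_le)
      show "(if k \<le> n then 2 else 1) \<le> norm (1 - - of_real (y n) / complex_of_real (y k))"
        unfolding eq using y_pos[of k] y_pos[of n] strict_mono_less_eq[OF y_mono, of k n] by (simp add: field_simps)
    qed auto
    finally show ?case by (simp add: prod_norm)
  qed
qed auto

text \<open>For the lower bound: growth of order \<open>\<mu> < ex\<close> would force
  \<open>Suc n * ln 2 \<le> y n powr \<mu>\<close>, against the counting law.\<close>

lemma PQ_order: "entire_of_order PQ ((1 + \<alpha>) / (2 * \<alpha>))"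
  unfolding entire_of_order_def ex_def[symmetric]
proof (intro conjI allI impI PQ_holomorphic)
  fix \<mu> assume \<mu>: "\<mu> > ex"
  obtain m where m: "ex < m" "m < min \<mu> 1" using dense[of ex "min \<mu> 1"] \<mu> ex_bounds by auto
  define K where "K = 2 / m * (\<Sum>n. y n powr (- m))"
  have d: "\<mu> - m > 0" using m by simp
  have "filterlim (\<lambda>r::real. r powr (\<mu> - m)) at_top at_top" using d by real_asymp
  then have "\<forall>\<^sub>F r in at_top. K \<le> r powr (\<mu> - m)" by (simp add: filterlim_at_top)
  then show "\<forall>\<^sub>F r in at_top. \<forall>z. norm z = r \<longrightarrow> norm (PQ z) \<le> exp (r powr \<mu>)"
    using eventually_gt_at_top[of 0]
  proof eventually_elim
    case (elim r)
    show ?case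
    proof (intro allI impI)
      fix z :: complex assume z: "norm z = r"
      have "norm (PQ z) \<le> exp (K * r powr m)" using PQ_upper[of m z] m unfolding K_def z by simp
      also have "K * r powr m \<le> r powr (\<mu> - m) * r powr m" using elim by (intro mult_right_mono) auto
      also have "\<dots> = r powr \<mu>" by (simp add: powr_add[symmetric])
      finally show "norm (PQ z) \<le> exp (r powr \<mu>)" by simp
    qed
  qed
next
  fix \<mu> assume \<mu>: "\<mu> < ex"
  show "\<not> (\<forall>\<^sub>F r in at_top. \<forall>z. norm z = r \<longrightarrow> norm (PQ z) \<le> exp (r powr \<mu>))"
  proof
    assume "\<forall>\<^sub>F r in at_top. \<forall>z. norm z = r \<longrightarrow> norm (PQ z) \<le> exp (r powr \<mu>)"
    then have "\<forall>\<^sub>F n in sequentially. \<forall>z. norm z = y n \<longrightarrow> norm (PQ z) \<le> exp (y n powr \<mu>)"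
      using y_at_top by (auto simp: filterlim_iff)
    then have "\<forall>\<^sub>F n in sequentially. real (Suc n) / y n powr ex \<le> y n powr (- (ex - \<mu>)) / ln 2"
    proof eventually_elim
      case (elim n)
      have "norm (PQ (- of_real (y n))) \<le> exp (y n powr \<mu>)" using elim y_pos[of n] by (simp add: less_imp_le)
      then have "2 ^ Suc n \<le> exp (y n powr \<mu>)" using PQ_lower[of n] by linarith
      then have "ln (2 ^ Suc n) \<le> ln (exp (y n powr \<mu>))" by (subst ln_le_cancel_iff) simp_all
      then have "real (Suc n) * ln 2 \<le> y n powr \<mu>" by (simp add: ln_realpow del: power_Suc)
      then have "real (Suc n) * ln 2 / y n powr ex \<le> y n powr \<mu> / y n powr ex" by (intro divide_right_mono) auto
      also have "\<dots> = y n powr (- (ex - \<mu>))" by (simp add: powr_diff[symmetric])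
      finally show ?case by (simp add: field_simps)
    qed
    moreover have "(\<lambda>n. y n powr (- (ex - \<mu>)) / ln 2) \<longlonglongrightarrow> 0 / ln 2"
    proof (intro tendsto_divide tendsto_const)
      have "((\<lambda>r::real. r powr (- (ex - \<mu>))) \<longlongrightarrow> 0) at_top" using \<mu> by (intro tendsto_neg_powr filterlim_ident) auto
      then show "(\<lambda>n. y n powr (- (ex - \<mu>))) \<longlonglongrightarrow> 0" by (rule filterlim_compose[OF _ y_at_top])
    qed auto
    ultimately have "(1::real) \<le> 0 / ln 2" by (intro tendsto_le[OF _ _ y_lim]) auto
    then show False by simp
  qed
qed

section \<open>The associated function of a canonical product\<close>

lemma FF_summable: assumes "x \<ge> 0" shows "summable (\<lambda>n. FF (x / y n))"
proof (rule summable_comparison_test')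
  show "summable (\<lambda>n. kC * x * (1 / y n))" by (rule summable_mult[OF y_summable_inv])
  show "norm (FF (x / y n)) \<le> kC * x * (1 / y n)" for n
    using FF_le[of "x / y n"] FF_nonneg[of "x / y n"] assms y_pos[of n] by simp
qed

definition ZZ :: "real \<Rightarrow> real" where "ZZ x = (\<Sum>n. FF (x / y n))"

lemma ZZ_0: "ZZ 0 = 0"
  by (simp add: ZZ_def)

lemma ZZ_strict_mono: assumes "0 \<le> x" "x < x'" shows "ZZ x < ZZ x'"
proof -
  have "0 < (\<Sum>n. FF (x' / y n) - FF (x / y n))"
    using assms y_pos by (intro suminf_pos summable_diff FF_summable) (auto intro!: FF_strict_mono divide_strict_right_mono divide_nonneg_pos)
  then show ?thesis using assms by (simp add: ZZ_def suminf_diff[symmetric] FF_summable)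
qed

lemma ZZ_cont: "continuous_on {0..} ZZ"
proof -
  have "continuous_on {0..R} ZZ" for R
  proof (rule uniform_limit_theorem)
    show "uniform_limit {0..R} (\<lambda>N x. \<Sum>n<N. FF (x / y n)) ZZ sequentially"
      unfolding ZZ_def[abs_def]
    proof (rule Weierstrass_m_test)
      show "summable (\<lambda>n. kC * R * (1 / y n))" by (rule summable_mult[OF y_summable_inv])
      show "norm (FF (x / y n)) \<le> kC * R * (1 / y n)" if x: "x \<in> {0..R}" for n x
      proof -
        have "norm (FF (x / y n)) \<le> kC * (x / y n)"
          using FF_le[of "x / y n"] FF_nonneg[of "x / y n"] x y_pos[of n] by simp
        also have "\<dots> \<le> kC * (R / y n)" using x y_pos[of n] kC(1) by (intro mult_left_mono divide_right_mono) auto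
        finally show ?thesis by simp
      qed
    qed
    show "\<forall>\<^sub>F N in sequentially. continuous_on {0..R} (\<lambda>x. \<Sum>n<N. FF (x / y n))"
      by (intro always_eventually allI continuous_on_sum continuous_on_compose2[OF FF_cont[of UNIV]] continuous_intros) auto
  qed auto
  then have c: "continuous_on {0..R} ZZ" for R by blast
  have "continuous (at x within {0..}) ZZ" if "x \<ge> 0" for x
  proof -
    have "continuous (at x within {0..x+1}) ZZ"
      using c[of "x + 1"] that by (simp add: continuous_on_eq_continuous_within)
    moreover have "at x within {0..} = at x within {0..x+1}"
      by (rule at_within_nhd[of x "{x-1<..<x+1}"]) auto
    ultimately show ?thesis by simp
  qed
  then show ?thesis by (simp add: continuous_on_eq_continuous_within)
qed

lemma PQ_rot_nonzero: "PQ (of_real x * rot \<alpha>) \<noteq> 0" "PQ (of_real x * cnj (rot \<alpha>)) \<noteq> 0"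
  unfolding PQ_zero_iff rot_eq using sin_pos y_pos by (auto simp: complex_eq_iff)

lemma PQ_phase:
  assumes "x \<ge> 0"
  shows "PQ (of_real x * cnj (rot \<alpha>)) / PQ (of_real x * rot \<alpha>) = exp (2 * pi * \<i> * of_real (ZZ x))"
proof (rule LIMSEQ_unique)
  have "(\<lambda>N. (\<Prod>n<N. 1 - of_real x * cnj (rot \<alpha>) / of_real (y n)) / (\<Prod>n<N. 1 - of_real x * rot \<alpha> / of_real (y n)))
     \<longlonglongrightarrow> PQ (of_real x * cnj (rot \<alpha>)) / PQ (of_real x * rot \<alpha>)"
    by (intro tendsto_divide PQ_tendsto PQ_rot_nonzero)
  moreover have "(\<Prod>n<N. 1 - of_real x * cnj (rot \<alpha>) / of_real (y n)) / (\<Prod>n<N. 1 - of_real x * rot \<alpha> / of_real (y n))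
      = exp (2 * pi * \<i> * of_real (\<Sum>n<N. FF (x / y n)))" for N
  proof -
    have "(1 - of_real x * cnj (rot \<alpha>) / of_real (y n)) / (1 - of_real x * rot \<alpha> / of_real (y n)) = exp (2 * pi * \<i> * of_real (FF (x / y n)))" for n
      using FF_phase[of "x / y n"] by (simp add: rot_eq cis_cnj)
    then show ?thesis
      by (simp add: prod_dividef[symmetric] exp_sum[symmetric] sum_distrib_left[symmetric])
  qed
  ultimately show "(\<lambda>N. exp (2 * pi * \<i> * of_real (\<Sum>n<N. FF (x / y n)))) \<longlonglongrightarrow> PQ (of_real x * cnj (rot \<alpha>)) / PQ (of_real x * rot \<alpha>)" by simp
  have "(\<lambda>N. \<Sum>n<N. FF (x / y n)) \<longlonglongrightarrow> ZZ x" unfolding ZZ_def by (rule summable_LIMSEQ[OF FF_summable[OF assms]])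
  then show "(\<lambda>N. exp (2 * pi * \<i> * of_real (\<Sum>n<N. FF (x / y n)))) \<longlonglongrightarrow> exp (2 * pi * \<i> * of_real (ZZ x))"
    by (intro tendsto_intros)
qed

text \<open>The definite description in \<open>zfun\<close> needs uniqueness: two branches differ by
  a continuous integer-valued function that vanishes at 0.\<close>

lemma zfun_PQ: "zfun \<alpha> p PQ = (\<lambda>x. if x < 0 then 0 else - 2 * p + ZZ x)"
  unfolding zfun_def
proof (rule the_equality)
  show "continuous_on {0..} (\<lambda>x. if x < 0 then 0 else - 2 * p + ZZ x) \<and> (if (0::real) < 0 then 0 else - 2 * p + ZZ 0) = - 2 * p \<and>
    (\<forall>x<0. (if x < 0 then 0 else - 2 * p + ZZ x) = 0) \<and>
    (\<forall>x\<ge>0. PQ (of_real x * rot \<alpha>) \<noteq> 0 \<and> exp (2 * pi * \<i> * of_real ((if x < 0 then 0 else - 2 * p + ZZ x) + 2 * p)) =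
         PQ (of_real x * cnj (rot \<alpha>)) / PQ (of_real x * rot \<alpha>))"
  proof (intro conjI allI impI PQ_rot_nonzero)
    have "continuous_on {0..} (\<lambda>x. - 2 * p + ZZ x)" by (intro continuous_intros ZZ_cont)
    then show "continuous_on {0..} (\<lambda>x. if x < 0 then 0 else - 2 * p + ZZ x)"
      by (rule continuous_on_eq) auto
  qed (auto simp: ZZ_0 PQ_phase)
next
  fix z assume z: "continuous_on {0..} z \<and> z 0 = - 2 * p \<and> (\<forall>x<0. z x = 0) \<and>
      (\<forall>x\<ge>0. PQ (of_real x * rot \<alpha>) \<noteq> 0 \<and> exp (2 * pi * \<i> * of_real (z x + 2 * p)) =
           PQ (of_real x * cnj (rot \<alpha>)) / PQ (of_real x * rot \<alpha>))"
  define d where "d x = z x + 2 * p - ZZ x" for x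
  have int: "d x \<in> \<int>" if "x \<ge> 0" for x
  proof -
    have "exp (2 * pi * \<i> * of_real (z x + 2 * p)) = exp (2 * pi * \<i> * of_real (ZZ x))" using z PQ_phase[OF that] that by metis
    then have "exp (2 * pi * \<i> * of_real (z x + 2 * p) - 2 * pi * \<i> * of_real (ZZ x)) = 1" by (simp add: exp_diff)
    then obtain k :: int where k: "Im (2 * pi * \<i> * of_real (z x + 2 * p) - 2 * pi * \<i> * of_real (ZZ x)) = of_int (2 * k) * pi" unfolding exp_eq_1 by blast
    then have "2 * pi * d x = 2 * pi * of_int k" by (simp add: d_def algebra_simps)
    then have "d x = of_int k" by simp
    then show ?thesis by simp
  qed
  have "d constant_on {0..}"
  proof (rule continuous_discrete_range_constant)
    show "continuous_on {0..} d" unfolding d_def by (intro continuous_intros ZZ_cont) (use z in auto)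
    fix x :: real assume x: "x \<in> {0..}"
    show "\<exists>e>0. \<forall>y. y \<in> {0..} \<and> d y \<noteq> d x \<longrightarrow> e \<le> norm (d y - d x)"
    proof (intro exI[of _ 1] conjI allI impI)
      fix y assume y: "y \<in> {0..} \<and> d y \<noteq> d x"
      have "d y - d x \<in> \<int>" "d y - d x \<noteq> 0" using int x y by auto
      then show "1 \<le> norm (d y - d x)" using Ints_nonzero_abs_ge1[of "d y - d x"] by simp
    qed simp
  qed (simp add: is_interval_connected is_interval_ci)
  then have dx: "d x = d 0" if "x \<ge> 0" for x using that unfolding constant_on_def by (metis atLeast_iff order_refl)
  have d0: "d 0 = 0" using z by (simp add: d_def ZZ_0)
  have "z x = - 2 * p + ZZ x" if "x \<ge> 0" for x using dx[OF that] d0 unfolding d_def by linarith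
  then show "z = (\<lambda>x. if x < 0 then 0 else - 2 * p + ZZ x)" using z by (auto simp: fun_eq_iff not_less)
qed

text \<open>At \<open>y N\<close> the first \<open>Suc N\<close> terms of the series are at least
  \<open>FF 1 > 0\<close>, so \<open>ZZ\<close> is unbounded.\<close>

lemma ZZ_surj: assumes "v \<ge> 0" obtains x where "x \<ge> 0" "ZZ x = v"
proof -
  have FF1: "FF 1 > 0" using FF_strict_mono[of 0 1] by simp
  obtain N :: nat where N: "v / FF 1 \<le> real N" using real_arch_simple by blast
  have "v \<le> real (Suc N) * FF 1" using N FF1 by (simp add: divide_le_eq algebra_simps)
  also have "\<dots> = (\<Sum>n<Suc N. FF 1)" by simp
  also have "\<dots> \<le> (\<Sum>n<Suc N. FF (y N / y n))"
  proof (rule sum_mono)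
    fix n assume "n \<in> {..<Suc N}"
    then have "1 \<le> y N / y n" using strict_mono_less_eq[OF y_mono, of n N] y_pos[of n] by (simp add: le_divide_eq)
    then show "FF 1 \<le> FF (y N / y n)" using FF_strict_mono[of 1 "y N / y n"] by (cases "y N / y n = 1") auto
  qed
  also have "\<dots> \<le> ZZ (y N)" unfolding ZZ_def
    using y_pos by (intro sum_le_suminf FF_summable) (auto intro!: FF_nonneg divide_nonneg_pos simp: less_imp_le)
  finally have "v \<le> ZZ (y N)" .
  moreover have "continuous_on {0..y N} ZZ" by (rule continuous_on_subset[OF ZZ_cont]) auto
  ultimately obtain x where "0 \<le> x" "x \<le> y N" "ZZ x = v"
    using IVT'[of ZZ 0 v "y N"] assms y_pos[of N] by (auto simp: ZZ_0)
  then show ?thesis using that by blast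
qed

lemma xk_eq: assumes "x \<ge> 0" "- 2 * p + ZZ x = real_of_int k + 1 / 2" shows "xk \<alpha> p PQ k = x"
  unfolding xk_def zfun_PQ
proof (rule the_equality)
  fix x' assume x': "0 \<le> x' \<and> (if x' < 0 then 0 else - 2 * p + ZZ x') = real_of_int k + 1 / 2"
  then have "ZZ x' = ZZ x" using assms by auto
  then show "x' = x" using ZZ_strict_mono[of x x'] ZZ_strict_mono[of x' x] x' assms by (cases x x' rule: linorder_cases) auto
qed (use assms in auto)

text \<open>By \<open>PQ_phase\<close> the BAE quotient at a root is
  \<open>e^(2 pi i (ZZ - 2 p))\<close>, equal to \<open>-1\<close> exactly when the exponent is a
  half-integer multiple of \<open>2 pi i\<close>.\<close>

lemma bae_solution_PQ_iff:
  "bae_solution \<alpha> p PQ \<longleftrightarrow> (\<forall>n. \<exists>k::int. - 2 * p + ZZ (y n) = real_of_int k + 1 / 2)"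
proof -
  have "exp (- complex_of_real (4 * pi * p) * \<i>) * PQ (of_real (y n) * cnj (rot \<alpha>)) / PQ (of_real (y n) * rot \<alpha>) = -1
      \<longleftrightarrow> (\<exists>k::int. - 2 * p + ZZ (y n) = real_of_int k + 1 / 2)" for n
  proof -
    have "exp (- complex_of_real (4 * pi * p) * \<i>) * PQ (of_real (y n) * cnj (rot \<alpha>)) / PQ (of_real (y n) * rot \<alpha>)
        = exp (- complex_of_real (4 * pi * p) * \<i>) * exp (2 * pi * \<i> * of_real (ZZ (y n)))"
      using PQ_phase[of "y n"] y_pos[of n] by (simp add: times_divide_eq_right[symmetric] del: times_divide_eq_right)
    also have "\<dots> = exp (\<i> * pi * of_real (2 * (ZZ (y n) - 2 * p)))"
      by (simp add: exp_add[symmetric] algebra_simps)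
    finally have A: "exp (- complex_of_real (4 * pi * p) * \<i>) * PQ (of_real (y n) * cnj (rot \<alpha>)) / PQ (of_real (y n) * rot \<alpha>)
        = exp (\<i> * pi * of_real (2 * (ZZ (y n) - 2 * p)))" .
    have "exp (\<i> * pi * of_real (2 * (ZZ (y n) - 2 * p))) = -1 \<longleftrightarrow> exp (\<i> * pi * of_real (2 * (ZZ (y n) - 2 * p))) = exp (\<i> * pi)" by simp
    also have "\<dots> \<longleftrightarrow> (\<exists>k::int. \<i> * pi * of_real (2 * (ZZ (y n) - 2 * p)) = \<i> * pi + of_int (2 * k) * pi * \<i>)"
      unfolding exp_eq by (simp add: mult_ac)
    also have "\<dots> \<longleftrightarrow> (\<exists>k::int. - 2 * p + ZZ (y n) = real_of_int k + 1 / 2)"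
    proof (intro ex_cong1)
      fix k :: int
      have "\<i> * pi * of_real (2 * (ZZ (y n) - 2 * p)) = \<i> * pi + of_int (2 * k) * pi * \<i>
          \<longleftrightarrow> pi * (2 * (ZZ (y n) - 2 * p)) = pi * (1 + 2 * of_int k)"
        by (simp add: complex_eq_iff algebra_simps)
      also have "\<dots> \<longleftrightarrow> - 2 * p + ZZ (y n) = real_of_int k + 1 / 2"
        by (subst mult_cancel_left) (auto simp: field_simps)
      finally show "\<i> * pi * of_real (2 * (ZZ (y n) - 2 * p)) = \<i> * pi + of_int (2 * k) * pi * \<i>
         \<longleftrightarrow> - 2 * p + ZZ (y n) = real_of_int k + 1 / 2" .
    qed
    finally show ?thesis unfolding A .
  qed
  moreover have "bae_solution \<alpha> p PQ \<longleftrightarrow> (\<forall>n. exp (- complex_of_real (4 * pi * p) * \<i>) * PQ (of_real (y n) * cnj (rot \<alpha>)) / PQ (of_real (y n) * rot \<alpha>) = -1)"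
    unfolding bae_solution_def using PQ_order PQ_simple PQ_zero_iff by auto
  ultimately show ?thesis by simp
qed

lemma holes_PQ:
  assumes kf: "\<And>n. - 2 * p + ZZ (y n) = real_of_int (kf n) + 1 / 2"
  shows "holes \<alpha> p PQ = Zp p - range kf" "range kf \<subseteq> Zp p"
proof -
  have ZZn: "ZZ x \<ge> 0" if "x \<ge> 0" for x
    using ZZ_strict_mono[of 0 x] that by (cases "x = 0") (auto simp: ZZ_0)
  show sub: "range kf \<subseteq> Zp p"
  proof
    fix k assume "k \<in> range kf"
    then obtain n where "k = kf n" by auto
    then show "k \<in> Zp p" using kf[of n] ZZn[of "y n"] y_pos[of n] by (simp add: Zp_def)
  qed
  have "PQ (of_real (xk \<alpha> p PQ k)) = 0 \<longleftrightarrow> k \<in> range kf" if k: "k \<in> Zp p" for k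
  proof
    assume "k \<in> range kf"
    then obtain n where "k = kf n" by auto
    then have "xk \<alpha> p PQ k = y n" using xk_eq[OF _ kf[of n]] y_pos[of n] by simp
    then show "PQ (of_real (xk \<alpha> p PQ k)) = 0" using PQ_zero_iff by auto
  next
    assume z: "PQ (of_real (xk \<alpha> p PQ k)) = 0"
    have "real_of_int k + 1 / 2 + 2 * p \<ge> 0" using k by (simp add: Zp_def)
    then obtain x where x: "x \<ge> 0" "ZZ x = real_of_int k + 1 / 2 + 2 * p" by (rule ZZ_surj)
    have "xk \<alpha> p PQ k = x" by (rule xk_eq) (use x in auto)
    then obtain n where "x = y n" using z PQ_zero_iff by auto
    then have "real_of_int k = real_of_int (kf n)" using x kf[of n] by simp
    then show "k \<in> range kf" by simp
  qed
  then show "holes \<alpha> p PQ = Zp p - range kf" unfolding holes_def by auto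
qed

lemma purely_real_PQ: "purely_real PQ"
  unfolding purely_real_def PQ_zero_iff using y_pos by auto

lemma nzeros_PQ: "nzeros PQ x = card {n. y n \<le> x}"
proof -
  have "{t::real. 0 \<le> t \<and> t \<le> x \<and> PQ (of_real t) = 0} = y ` {n. y n \<le> x}"
    using y_pos by (auto simp: PQ_zero_iff less_imp_le)
  then show ?thesis unfolding nzeros_def
    using strict_mono_imp_inj_on[OF y_mono, of "{n. y n \<le> x}"] by (simp add: card_image)
qed

lemma normalised_PQ: "normalised \<alpha> PQ"
proof -
  define N where "N x = card {n. y n \<le> x}" for x
  have fin: "finite {n. y n \<le> x}" for x
  proof -
    have "\<forall>\<^sub>F n in sequentially. x < y n" using y_at_top by (simp add: filterlim_at_top_dense)
    then have "finite {n. \<not> x < y n}" by (simp add: eventually_cofinite cofinite_eq_sequentially[symmetric])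
    then show ?thesis by (simp add: not_less)
  qed
  have eq: "{n. y n \<le> x} = {..<N x}" for x
  proof -
    have down: "m \<in> {n. y n \<le> x}" if "n \<in> {n. y n \<le> x}" "m \<le> n" for m n
      using that strict_mono_less_eq[OF y_mono, of m n] by auto
    have "{..<card {n. y n \<le> x}} = {n. y n \<le> x}"
    proof (rule card_subset_eq[OF fin])
      show "{..<card {n. y n \<le> x}} \<subseteq> {n. y n \<le> x}"
      proof
        fix m assume m: "m \<in> {..<card {n. y n \<le> x}}"
        show "m \<in> {n. y n \<le> x}"
        proof (rule ccontr)
          assume "m \<notin> {n. y n \<le> x}"
          then have "{n. y n \<le> x} \<subseteq> {..<m}" using down by (metis lessThan_iff not_le subsetI)
          then have "card {n. y n \<le> x} \<le> m" using card_mono[of "{..<m}"] by fastforce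
          then show False using m by simp
        qed
      qed
    qed simp
    then show ?thesis by (simp add: N_def)
  qed
  have mem: "y n \<le> x \<longleftrightarrow> n < N x" for n x using eq[of x] by auto
  have Ntop: "filterlim N at_top at_top"
    unfolding filterlim_at_top
  proof
    fix k
    show "\<forall>\<^sub>F x in at_top. k \<le> N x" using eventually_ge_at_top[of "y k"]
      by eventually_elim (use mem less_imp_le in blast)
  qed
  \<comment> \<open>With \<open>n = N x\<close>, \<open>y (n - 1)\<close> is the last root up to
    \<open>x\<close> and \<open>y n\<close> the first one beyond; \<open>u\<close> and
    \<open>l\<close> evaluate the count at these two.\<close>
  define u where "u n = real n / y (n - 1) powr ex" for n
  define l where "l n = real n / real (Suc n) * (real (Suc n) / y n powr ex)" for n
  have "(\<lambda>n. u (Suc n)) \<longlonglongrightarrow> 1" using y_lim by (simp add: u_def)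
  then have u: "u \<longlonglongrightarrow> 1" by (rule LIMSEQ_imp_Suc)
  have "(\<lambda>n. real n / real (Suc n) * (real (Suc n) / y n powr ex)) \<longlonglongrightarrow> 1 * 1"
    by (intro tendsto_mult y_lim LIMSEQ_n_over_Suc_n)
  then have l: "l \<longlonglongrightarrow> 1" by (simp add: l_def[abs_def])
  have "((\<lambda>x. real (N x) / x powr ex) \<longlongrightarrow> 1) at_top"
  proof (rule tendsto_sandwich)
    show "((\<lambda>x. l (N x)) \<longlongrightarrow> 1) at_top" by (rule filterlim_compose[OF l Ntop])
    show "((\<lambda>x. u (N x)) \<longlongrightarrow> 1) at_top" by (rule filterlim_compose[OF u Ntop])
    show "\<forall>\<^sub>F x in at_top. l (N x) \<le> real (N x) / x powr ex"
      using eventually_gt_at_top[of 0]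
    proof eventually_elim
      case (elim x)
      have "x \<le> y (N x)" using mem[of "N x" x] by simp
      then have "x powr ex \<le> y (N x) powr ex" using elim ex_bounds by (intro powr_mono2) auto
      then have "real (N x) / y (N x) powr ex \<le> real (N x) / x powr ex" using elim by (intro divide_left_mono) auto
      then show ?case by (simp add: l_def)
    qed
    show "\<forall>\<^sub>F x in at_top. real (N x) / x powr ex \<le> u (N x)"
      using eventually_ge_at_top[of "y 0"]
    proof eventually_elim
      case (elim x)
      then have "N x > 0" using mem by blast
      then have "y (N x - 1) \<le> x" using mem by simp
      then have "y (N x - 1) powr ex \<le> x powr ex" using y_pos ex_bounds by (intro powr_mono2) (auto simp: less_imp_le)
      then show ?case unfolding u_def using y_pos elim by (intro divide_left_mono) (auto intro!: mult_pos_pos simp: powr_gt_zero)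
    qed
  qed
  then have "((\<lambda>x. x powr (- ex) * real (nzeros PQ x)) \<longlongrightarrow> 1) at_top"
    by (simp add: nzeros_PQ N_def[symmetric] powr_minus_divide)
  then show ?thesis unfolding normalised_def ex_def using PQ_0 by simp
qed

text \<open>Write \<open>Q = P_N E_N\<close> with \<open>P_N\<close> a partial product. As \<open>\<bar>1 - z / y_n\<bar> \<ge> 1\<close> on \<open>\<bar>z\<bar> = 2 y_N\<close>, the bound of \<open>Q\<close> there
  passes to \<open>E_N\<close>, which has no zeros in \<open>\<bar>z\<bar> < y_N\<close>; Borel--Caratheodory then gives \<open>E_N \<longlonglongrightarrow> 1\<close>.\<close>

lemma hadamard_PQ:
  fixes Q :: "complex \<Rightarrow> complex"
  assumes ord: "entire_of_order Q ((1 + \<alpha>) / (2 * \<alpha>))" and simple: "\<And>z. Q z = 0 \<Longrightarrow> deriv Q z \<noteq> 0"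
    and Q0: "Q 0 = 1" and zeros: "\<And>z. Q z = 0 \<longleftrightarrow> (\<exists>n. z = of_real (y n))"
  shows "Q = PQ"
proof
  fix z :: complex
  obtain \<mu> where \<mu>: "ex < \<mu>" "\<mu> < 1" using dense[of ex 1] ex_bounds by auto
  have hol: "Q holomorphic_on UNIV" using ord by (simp add: entire_of_order_def)
  have "\<forall>\<^sub>F r in at_top. \<forall>z. norm z = r \<longrightarrow> norm (Q z) \<le> exp (r powr \<mu>)"
    using ord \<mu> by (simp add: entire_of_order_def ex_def)
  then obtain r0 where r0: "\<And>w. norm w \<ge> r0 \<Longrightarrow> norm (Q w) \<le> exp (norm w powr \<mu>)"
    unfolding eventually_at_top_linorder by blast
  \<comment> \<open>The Borel-Caratheodory bound with \<open>M = (2 R) powr \<mu> + 1\<close>; it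
    tends to 0 because \<open>\<mu> < 1\<close>.\<close>
  define B where "B R = 2 * ((2 * R) powr \<mu> + 1) * norm z / (R - norm z)" for R :: real
  have key: "\<exists>v. Q z = (\<Prod>n<N. 1 - z / of_real (y n)) * exp v \<and> norm v \<le> B (y N)"
    if N: "norm z < y N" "r0 \<le> y N" for N
  proof -
    let ?R = "y N"
    note R = y_pos[of N]
    obtain E where E: "E holomorphic_on UNIV" "\<And>w. Q w = (\<Prod>n<N. 1 - w / of_real (y n)) * E w"
      "\<And>w. E w = 0 \<longleftrightarrow> Q w = 0 \<and> w \<notin> (\<lambda>n. of_real (y n)) ` {..<N}"
    proof -
      have "inj (\<lambda>n. complex_of_real (y n))" using strict_mono_eq[OF y_mono] by (auto simp: inj_def)
      moreover have "Q (of_real (y n)) = 0" "complex_of_real (y n) \<noteq> 0" for n using zeros by auto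
      ultimately have "\<exists>E. E holomorphic_on UNIV \<and> (\<forall>z. Q z = (\<Prod>n<N. 1 - z / of_real (y n)) * E z) \<and>
        (\<forall>z. E z = 0 \<longleftrightarrow> Q z = 0 \<and> z \<notin> (\<lambda>n. of_real (y n)) ` {..<N}) \<and> (\<forall>z. E z = 0 \<longrightarrow> deriv E z \<noteq> 0)"
        by (intro entire_simple_zeros_factor[OF hol simple])
      then show ?thesis using that by blast
    qed
    have Enz: "E w \<noteq> 0" if w: "norm w < ?R" for w
    proof
      assume "E w = 0"
      then obtain n where n: "w = of_real (y n)" "n \<ge> N" using E(3) zeros by (metis image_eqI lessThan_iff not_le)
      then have "y N \<le> norm w" using strict_mono_less_eq[OF y_mono, of N n] y_pos[of n] by simp
      then show False using w by simp
    qed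
    have Ebd: "norm (E w) \<le> exp ((2 * ?R) powr \<mu>)" if w: "norm w < ?R" for w
    proof (rule maximum_modulus_frontier[of E "ball 0 (2 * ?R)"])
      show "E holomorphic_on interior (ball 0 (2 * ?R))" by (rule holomorphic_on_subset[OF E(1)]) auto
      show "continuous_on (closure (ball 0 (2 * ?R))) E"
        by (rule holomorphic_on_imp_continuous_on[OF holomorphic_on_subset[OF E(1)]]) auto
      show "w \<in> ball 0 (2 * ?R)" using w R by simp
      fix u assume "u \<in> frontier (ball (0::complex) (2 * ?R))"
      then have u: "norm u = 2 * ?R" using R by (simp add: frontier_ball)
      have "1 \<le> (\<Prod>n<N. norm (1 - u / of_real (y n)))"
      proof (rule prod_ge_1)
        fix n assume "n \<in> {..<N}"
        then have "y n \<le> ?R" using strict_mono_less_eq[OF y_mono, of n N] by simp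
        then have "1 \<le> norm u / y n - 1" using u y_pos[of n] by (simp add: field_simps)
        also have "\<dots> = norm (u / of_real (y n)) - norm (1::complex)" using y_pos[of n] by (simp add: norm_divide)
        also have "\<dots> \<le> norm (1 - u / of_real (y n))" by (metis norm_minus_commute norm_triangle_ineq2)
        finally show "1 \<le> norm (1 - u / of_real (y n))" .
      qed
      then have "1 * norm (E u) \<le> (\<Prod>n<N. norm (1 - u / of_real (y n))) * norm (E u)" by (intro mult_right_mono) auto
      also have "\<dots> = norm (Q u)" unfolding E(2)[of u] by (simp add: norm_mult prod_norm)
      also have "\<dots> \<le> exp ((2 * ?R) powr \<mu>)" using r0[of u] u N R by simp
      finally show "norm (E u) \<le> exp ((2 * ?R) powr \<mu>)" by simp
    qed auto
    have E0: "E 0 = 1" using E(2)[of 0] Q0 by simp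
    obtain g0 where g0: "g0 holomorphic_on ball 0 ?R" "\<And>w. w \<in> ball 0 ?R \<Longrightarrow> exp (g0 w) = E w"
      by (rule holomorphic_logarithm_exists[of "ball 0 ?R" E 0])
        (use R Enz in \<open>auto intro: holomorphic_on_subset[OF E(1)]\<close>)
    \<comment> \<open>A logarithm vanishing at 0, as \<open>norm_le_of_Re_le\<close> requires;
      \<open>E 0 = 1\<close> makes the subtraction harmless.\<close>
    define g where "g w = g0 w - g0 0" for w
    have g: "g holomorphic_on ball 0 ?R" unfolding g_def by (intro holomorphic_intros g0)
    have eg: "exp (g w) = E w" if "norm w < ?R" for w
      using g0(2)[of w] g0(2)[of 0] that R by (simp add: g_def exp_diff E0)
    have "norm (g z) \<le> 2 * ((2 * ?R) powr \<mu> + 1) * norm z / (?R - norm z)"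
    proof (rule norm_le_of_Re_le[OF g])
      fix w :: complex assume w: "norm w < ?R"
      have "exp (Re (g w)) \<le> exp ((2 * ?R) powr \<mu>)" using Ebd[OF w] eg[OF w] by (metis norm_exp_eq_Re)
      then show "Re (g w) < (2 * ?R) powr \<mu> + 1" by simp
    qed (use N in \<open>auto simp: g_def add_nonneg_pos\<close>)
    then show ?thesis using E(2)[of z] eg[of z] N by (intro exI[of _ "g z"]) (simp add: B_def)
  qed
  define v where "v N = (SOME v. Q z = (\<Prod>n<N. 1 - z / of_real (y n)) * exp v \<and> norm v \<le> B (y N))" for N
  have v: "Q z = (\<Prod>n<N. 1 - z / of_real (y n)) * exp (v N) \<and> norm (v N) \<le> B (y N)"
    if "norm z < y N" "r0 \<le> y N" for N
    unfolding v_def by (rule someI_ex[OF key[OF that]])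
  have ev: "\<forall>\<^sub>F N in sequentially. norm z < y N \<and> r0 \<le> y N"
  proof (rule eventually_conj)
    show "\<forall>\<^sub>F N in sequentially. norm z < y N" using y_at_top by (simp add: filterlim_at_top_dense)
    show "\<forall>\<^sub>F N in sequentially. r0 \<le> y N" using y_at_top by (simp add: filterlim_at_top)
  qed
  have "(B \<longlongrightarrow> 0) at_top" unfolding B_def using \<mu> ex_bounds by real_asymp
  then have "(\<lambda>N. B (y N)) \<longlonglongrightarrow> 0" by (rule filterlim_compose[OF _ y_at_top])
  then have "v \<longlonglongrightarrow> 0"
    by (rule Lim_null_comparison[rotated]) (use ev v in \<open>auto elim: eventually_mono\<close>)
  then have "(\<lambda>N. (\<Prod>n<N. 1 - z / of_real (y n)) * exp (v N)) \<longlonglongrightarrow> PQ z * exp 0"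
    by (intro tendsto_mult PQ_tendsto tendsto_exp)
  moreover have "\<forall>\<^sub>F N in sequentially. (\<Prod>n<N. 1 - z / of_real (y n)) * exp (v N) = Q z"
    using ev by eventually_elim (use v in auto)
  ultimately have "(\<lambda>N::nat. Q z) \<longlonglongrightarrow> PQ z" by (simp add: tendsto_cong)
  then show "Q z = PQ z" by (simp add: LIMSEQ_const_iff)
qed

end

section \<open>Uniqueness\<close>

text \<open>The rank \<open>r t\<close>, the number of elements below \<open>t\<close>, maps
  \<open>T\<close> bijectively onto the naturals; \<open>y\<close> is its inverse.\<close>

lemma locally_finite_enumeration:
  fixes T :: "real set"
  assumes fin: "\<And>x. finite {t \<in> T. t \<le> x}" and inf: "infinite T"
  obtains y :: "nat \<Rightarrow> real" where "strict_mono y" "range y = T"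
proof -
  define r where "r t = card {s \<in> T. s < t}" for t
  have fin': "finite {s \<in> T. s < t}" for t by (rule finite_subset[OF _ fin[of t]]) auto
  have r_less: "r s < r t" if "s \<in> T" "s < t" for s t
    unfolding r_def by (rule psubset_card_mono[OF fin']) (use that in auto)
  have inj: "inj_on r T"
  proof (rule inj_onI)
    fix s t assume "s \<in> T" "t \<in> T" "r s = r t"
    then show "s = t" using r_less[of s t] r_less[of t s] by (cases s t rule: linorder_cases) auto
  qed
  have surj: "r ` T = UNIV"
  proof -
    have "n \<in> r ` T" for n
    proof -
      have "infinite (r ` T)" using inf inj finite_imageD by blast
      then have "\<exists>k>n. k \<in> r ` T" unfolding infinite_nat_iff_unbounded by (rule spec)
      then obtain t where t: "t \<in> T" "n < r t" by blast
      have "{..<r t} = r ` {s \<in> T. s < t}"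
      proof (rule card_subset_eq[symmetric])
        show "r ` {s \<in> T. s < t} \<subseteq> {..<r t}" using r_less by auto
        have "inj_on r {s \<in> T. s < t}" by (rule inj_on_subset[OF inj]) auto
        then show "card (r ` {s \<in> T. s < t}) = card {..<r t}" unfolding card_lessThan by (subst card_image) (simp_all add: r_def)
      qed simp
      then have "n \<in> r ` {s \<in> T. s < t}" using t(2) by blast
      then show ?thesis by auto
    qed
    then show ?thesis by auto
  qed
  define y where "y = inv_into T r"
  have yT: "y n \<in> T" and ry: "r (y n) = n" for n
    unfolding y_def using surj by (auto intro: inv_into_into f_inv_into_f)
  have "strict_mono y"
  proof (rule strict_monoI)
    fix m n :: nat assume mn: "m < n"
    show "y m < y n"
    proof (rule ccontr)
      assume "\<not> y m < y n"
      then have "y n = y m \<or> y n < y m" by auto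
      then show False using r_less[OF yT, of n "y m"] ry[of m] ry[of n] mn by auto
    qed
  qed
  moreover have "range y = T"
  proof
    show "T \<subseteq> range y"
    proof
      fix t assume "t \<in> T"
      then have "y (r t) = t" unfolding y_def by (rule inv_into_f_f[OF inj])
      then show "t \<in> range y" by (metis rangeI)
    qed
    show "range y \<subseteq> T" using yT by blast
  qed
  ultimately show ?thesis by (rule that)
qed

lemma strict_mono_range_unique:
  fixes f g :: "nat \<Rightarrow> 'a :: linorder"
  assumes f: "strict_mono f" and g: "strict_mono g" and eq: "range f = range g"
  shows "f = g"
proof
  fix n show "f n = g n"
  proof (induction n rule: less_induct)
    case (less n)
    have "f n \<in> range g" "g n \<in> range f" using eq by auto
    then obtain m k where m: "f n = g m" and k: "g n = f k" by auto
    have "n \<le> m"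
    proof (rule ccontr)
      assume "\<not> n \<le> m"
      then have "g m = f m" "f m < f n" using less[of m] strict_monoD[OF f, of m n] by auto
      then show False using m by simp
    qed
    moreover have "n \<le> k"
    proof (rule ccontr)
      assume "\<not> n \<le> k"
      then have "f k = g k" "g k < g n" using less[of k] strict_monoD[OF g, of k n] by auto
      then show False using k by simp
    qed
    ultimately have "g n \<le> g m" "f n \<le> f k" using f g by (simp_all add: strict_mono_less_eq)
    then show ?case unfolding m[symmetric] k[symmetric] by (rule antisym[rotated])
  qed
qed

context bae
begin

text \<open>Normalisation makes the zero set infinite and locally finite; its increasing enumeration
  inherits the counting law, and \<open>hadamard_PQ\<close> applies.\<close>

lemma solution_zeros:
  assumes sol: "bae_solution \<alpha> p Q" and real: "purely_real Q" and norm: "normalised \<alpha> Q"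
  obtains y where "bae_zeros \<alpha> y" "Q = bae_zeros.PQ y"
proof -
  define T where "T = {t::real. Q (of_real t) = 0}"
  have Tpos: "t > 0" if "t \<in> T" for t
  proof -
    have "Q (of_real t) = 0" using that by (simp add: T_def)
    then have "0 < Re (complex_of_real t)" using real unfolding purely_real_def by blast
    then show ?thesis by simp
  qed
  have nz: "nzeros Q x = card {t \<in> T. t \<le> x}" for x
  proof -
    have "{t. 0 \<le> t \<and> t \<le> x \<and> Q (of_real t) = 0} = {t \<in> T. t \<le> x}" using Tpos by (auto simp: T_def less_imp_le)
    then show ?thesis by (simp add: nzeros_def)
  qed
  have lim: "((\<lambda>x. x powr (- ex) * real (nzeros Q x)) \<longlongrightarrow> 1) at_top"
    using norm by (simp add: normalised_def ex_def)
  have "\<forall>\<^sub>F x in at_top. 1 / 2 < x powr (- ex) * real (nzeros Q x)"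
    using order_tendstoD(1)[OF lim, of "1/2"] by simp
  then have low: "\<forall>\<^sub>F x in at_top. x powr ex / 2 < real (nzeros Q x)"
    using eventually_gt_at_top[of 0]
  proof eventually_elim
    case (elim x)
    have "1 / 2 * x powr ex < x powr (- ex) * real (nzeros Q x) * x powr ex"
      using elim by (intro mult_strict_right_mono) auto
    then show ?case using elim by (simp add: powr_minus field_simps)
  qed
  have fin: "finite {t \<in> T. t \<le> x}" for x
  proof -
    have "\<forall>\<^sub>F x' in at_top. x \<le> x' \<and> x' powr ex / 2 < real (nzeros Q x')"
      using low eventually_ge_at_top[of x] by eventually_elim auto
    then obtain x' where x': "x \<le> x'" "x' powr ex / 2 < real (nzeros Q x')"
      by (auto dest: eventually_happens)
    have "0 \<le> x' powr ex / 2" by simp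
    \<comment> \<open>The cardinality of an infinite set is 0 by convention, so a positive count
      proves finiteness.\<close>
    then have "card {t \<in> T. t \<le> x'} > 0" using x'(2) nz by (metis of_nat_0_less_iff order_le_less_trans)
    then have "finite {t \<in> T. t \<le> x'}" by (rule card_ge_0_finite)
    then show ?thesis by (rule rev_finite_subset) (use x' in auto)
  qed
  have inf: "infinite T"
  proof
    assume f: "finite T"
    have "filterlim (\<lambda>x::real. x powr ex / 2) at_top at_top" using ex_bounds by real_asymp
    then have "\<forall>\<^sub>F x in at_top. real (card T) \<le> x powr ex / 2" by (simp add: filterlim_at_top)
    with low have "\<forall>\<^sub>F x::real in at_top. False"
    proof eventually_elim
      case (elim x)
      have "nzeros Q x \<le> card T" unfolding nz by (rule card_mono[OF f]) auto
      then show ?case using elim by simp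
    qed
    then show False by simp
  qed
  obtain y :: "nat \<Rightarrow> real" where y: "strict_mono y" "range y = T" by (rule locally_finite_enumeration[OF fin inf])
  have top: "filterlim y at_top sequentially"
    unfolding filterlim_at_top
  proof
    fix x
    have "finite (y -` {t \<in> T. t \<le> x})" by (rule finite_vimageI[OF fin strict_mono_imp_inj_on[OF y(1)]])
    then have "finite {n. \<not> x < y n}" by (rule rev_finite_subset) (use y(2) in auto)
    then have "\<forall>\<^sub>F n in sequentially. x < y n" by (simp add: eventually_cofinite cofinite_eq_sequentially[symmetric])
    then show "\<forall>\<^sub>F n in sequentially. x \<le> y n" by eventually_elim simp
  qed
  have cnt: "nzeros Q (y n) = Suc n" for n
  proof -
    have "{t \<in> T. t \<le> y n} = y ` {..n}" unfolding y(2)[symmetric] using strict_mono_less_eq[OF y(1)] by auto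
    then show ?thesis unfolding nz using strict_mono_imp_inj_on[OF y(1), of "{..n}"] by (simp add: card_image)
  qed
  have "(\<lambda>n. y n powr (- ex) * real (nzeros Q (y n))) \<longlonglongrightarrow> 1" by (rule filterlim_compose[OF lim top])
  then have yl: "(\<lambda>n. real (Suc n) / y n powr ex) \<longlonglongrightarrow> 1" by (simp add: cnt powr_minus_divide)
  have z: "bae_zeros \<alpha> y" by unfold_locales (use y yl Tpos in auto)
  interpret Z: bae_zeros \<alpha> y by (rule z)
  have "Q = Z.PQ"
  proof (rule Z.hadamard_PQ)
    show "Q z = 0 \<longleftrightarrow> (\<exists>n. z = of_real (y n))" for z
    proof
      assume q: "Q z = 0"
      then have "Im z = 0" using real by (simp add: purely_real_def)
      then have "z = of_real (Re z)" by (simp add: complex_eq_iff)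
      moreover from this have "Re z \<in> T" using q unfolding T_def by simp
      then obtain n where "Re z = y n" using y(2) by blast
      ultimately show "\<exists>n. z = of_real (y n)" by auto
    next
      assume "\<exists>n. z = of_real (y n)"
      then obtain n where n: "z = of_real (y n)" by blast
      have "y n \<in> T" using y(2) by blast
      then show "Q z = 0" unfolding T_def n by simp
    qed
  qed (use sol norm in \<open>auto simp: bae_solution_def normalised_def\<close>)
  then show ?thesis by (rule that[OF z])
qed

lemma zeros_le:
  assumes "bae_zeros \<alpha> y" "bae_zeros \<alpha> y'"
    and eq: "\<And>n. bae_zeros.ZZ \<alpha> y (y n) = bae_zeros.ZZ \<alpha> y' (y' n)"
  shows "y n \<le> y' n"
proof (rule ccontr)
  interpret A: bae_zeros \<alpha> y by fact
  interpret B: bae_zeros \<alpha> y' by fact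
  define d where "d n = ln (y n) - ln (y' n)" for n
  assume "\<not> y n \<le> y' n"
  then have dn: "d n > 0" using A.y_pos[of n] B.y_pos[of n] by (simp add: d_def)
  have d0: "d \<longlonglongrightarrow> 0"
  proof -
    have "(\<lambda>n. (ln (real (Suc n) / y' n powr ex) - ln (real (Suc n) / y n powr ex)) / ex) \<longlonglongrightarrow> (ln 1 - ln 1) / ex"
      using ex_bounds by (intro tendsto_intros A.y_lim B.y_lim) auto
    moreover have "(ln (real (Suc n) / y' n powr ex) - ln (real (Suc n) / y n powr ex)) / ex = d n" for n
      using A.y_pos[of n] B.y_pos[of n] ex_bounds by (simp add: ln_div ln_powr d_def field_simps)
    ultimately show ?thesis by simp
  qed
  obtain m where m: "d m > 0" "\<And>k. d k \<le> d m"
  proof -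
    have "\<forall>\<^sub>F k in sequentially. d k < d n" by (rule order_tendstoD(2)[OF d0 dn])
    then obtain K where K: "\<And>k. k \<ge> K \<Longrightarrow> d k < d n" by (auto simp: eventually_sequentially)
    let ?S = "d ` {..max K n}"
    have "Max ?S \<in> ?S" by (rule Max_in) auto
    then obtain m where m: "Max ?S = d m" by blast
    have mx: "d k \<le> d m" if "k \<le> max K n" for k unfolding m[symmetric] by (rule Max_ge) (use that in auto)
    have "d k \<le> d m" for k
    proof (cases "k \<le> K")
      case False
      then have "d k < d n" using K by simp
      then show ?thesis using mx[of n] by simp
    qed (use mx in simp)
    moreover have "d m > 0" using dn mx[of n] by simp
    ultimately show ?thesis using that by blast
  qed
  \<comment> \<open>Where \<open>d\<close> is maximal, each term for \<open>y\<close> dominates the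
    one for \<open>y'\<close>. Both series have the same sum, so all terms agree, and strictness of
    \<open>ff\<close> then gives \<open>d k = d m\<close>.\<close>
  have le: "FF (y' m / y' k) \<le> FF (y m / y k)" "FF (y' m / y' k) = FF (y m / y k) \<Longrightarrow> d k = d m" for k
  proof -
    have ge: "ln (y' m / y' k) \<le> ln (y m / y k)" using m(2)[of k] A.y_pos B.y_pos by (simp add: ln_div d_def)
    have pos: "y m / y k > 0" "y' m / y' k > 0" using A.y_pos B.y_pos by auto
    show "FF (y' m / y' k) \<le> FF (y m / y k)" using ge pos by (simp add: FF_eq_ff ff_mono)
    assume "FF (y' m / y' k) = FF (y m / y k)"
    then have "\<not> ln (y' m / y' k) < ln (y m / y k)"
      unfolding FF_eq_ff[OF pos(1)] FF_eq_ff[OF pos(2)] using ff_strict_mono[of "ln (y' m / y' k)" "ln (y m / y k)"] by linarith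
    then have "ln (y' m / y' k) = ln (y m / y k)" using ge by linarith
    then show "d k = d m" using A.y_pos B.y_pos by (simp add: ln_div d_def)
  qed
  have sm: "summable (\<lambda>k. FF (y m / y k) - FF (y' m / y' k))"
    using A.y_pos B.y_pos by (intro summable_diff A.FF_summable B.FF_summable) (auto simp: less_imp_le)
  have "(\<Sum>k. FF (y m / y k) - FF (y' m / y' k)) = A.ZZ (y m) - B.ZZ (y' m)"
    unfolding A.ZZ_def B.ZZ_def
    using A.y_pos B.y_pos by (intro suminf_diff[symmetric] A.FF_summable B.FF_summable) (auto simp: less_imp_le)
  then have "(\<Sum>k. FF (y m / y k) - FF (y' m / y' k)) = 0" using eq[of m] by simp
  then have "FF (y m / y k) - FF (y' m / y' k) = 0" for k
    using suminf_eq_zero_iff[OF sm] le(1) by simp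
  then have "d k = d m" for k using le(2)[of k] by simp
  then have "d \<longlonglongrightarrow> d m" by (intro tendsto_eventually always_eventually allI)
  then have "d m = 0" using d0 LIMSEQ_unique by blast
  then show False using m by simp
qed

text \<open>The quantum numbers increase strictly along the roots, hence are determined by their
  range, the complement of the holes in \<open>Zp p\<close>. The roots can thus be compared index by
  index, and \<open>zeros_le\<close> is used in both directions.\<close>

lemma solution_unique:
  assumes "bae_solution \<alpha> p Q" "purely_real Q" "normalised \<alpha> Q"
    and "bae_solution \<alpha> p Q'" "purely_real Q'" "normalised \<alpha> Q'"
    and holes: "holes \<alpha> p Q = holes \<alpha> p Q'"
  shows "Q = Q'"
proof -
  obtain y where y: "bae_zeros \<alpha> y" "Q = bae_zeros.PQ y" by (rule solution_zeros[OF assms(1-3)])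
  obtain y' where y': "bae_zeros \<alpha> y'" "Q' = bae_zeros.PQ y'" by (rule solution_zeros[OF assms(4-6)])
  interpret A: bae_zeros \<alpha> y by fact
  interpret B: bae_zeros \<alpha> y' by fact
  obtain k where k: "\<And>n. - 2 * p + A.ZZ (y n) = real_of_int (k n) + 1 / 2"
    using assms(1) unfolding y(2) A.bae_solution_PQ_iff by metis
  obtain k' where k': "\<And>n. - 2 * p + B.ZZ (y' n) = real_of_int (k' n) + 1 / 2"
    using assms(4) unfolding y'(2) B.bae_solution_PQ_iff by metis
  have sk: "strict_mono k"
  proof (rule strict_monoI)
    fix m n :: nat assume "m < n"
    then have "A.ZZ (y m) < A.ZZ (y n)" using strict_monoD[OF A.y_mono] A.y_pos[of m] by (intro A.ZZ_strict_mono) auto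
    then show "k m < k n" using k[of m] k[of n] by simp
  qed
  have sk': "strict_mono k'"
  proof (rule strict_monoI)
    fix m n :: nat assume "m < n"
    then have "B.ZZ (y' m) < B.ZZ (y' n)" using strict_monoD[OF B.y_mono] B.y_pos[of m] by (intro B.ZZ_strict_mono) auto
    then show "k' m < k' n" using k'[of m] k'[of n] by simp
  qed
  have "range k = range k'"
  proof -
    have "Zp p - range k = Zp p - range k'" using holes unfolding y(2) y'(2) A.holes_PQ(1)[OF k] B.holes_PQ(1)[OF k'] .
    then show ?thesis using A.holes_PQ(2)[OF k] B.holes_PQ(2)[OF k'] by blast
  qed
  then have "k = k'" by (rule strict_mono_range_unique[OF sk sk'])
  then have eq: "A.ZZ (y n) = B.ZZ (y' n)" for n using k[of n] k'[of n] by simp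
  have "y n = y' n" for n using zeros_le[OF y(1) y'(1) eq, of n] zeros_le[OF y'(1) y(1) eq[symmetric], of n] by simp
  then have "y = y'" by auto
  then show ?thesis using y y' by simp
qed

lemma inverse_ex: "2 * \<alpha> / (1 + \<alpha>) = 1 / ex"
  using \<alpha>_gt1 by (simp add: ex_def)

lemma gam_eq: "real H / sqrt (2 * (1 + \<alpha>)) = ex * gam H"
  using ex_bounds unfolding gam_def inverse_ex by simp

lemma omegaH_eq: "omegaH \<alpha> p H = Aconst \<alpha> * (p - ex * gam H) powr (1 / ex)"
  unfolding omegaH_def gam_eq inverse_ex ..

end

section \<open>Existence and localisation of the roots\<close>

context bae_prof
begin

definition om :: real where "om = omegaH \<alpha> p H"

lemma ex_gam_less: "ex * gam H < p"
proof (cases "gam H = 0")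
  case False
  then have "ex * gam H < 1 * gam H" using gam_nonneg[of H] ex_bounds by (intro mult_strict_right_mono) auto
  then show ?thesis using p_bounds by simp
qed (use p_bounds in simp)

lemma om_pos: "om > 0"
  using Aconst_pos ex_gam_less by (simp add: om_def omegaH_eq)

lemma om_powr: "(om / Aconst \<alpha>) powr ex = p - ex * gam H"
  using Aconst_pos ex_gam_less ex_bounds by (simp add: om_def omegaH_eq powr_powr)

lemma om_powr': "om powr ex = cT * (p - ex * gam H)"
  unfolding om_powr[symmetric] cT_def using om_pos Aconst_pos by (simp add: powr_divide)

lemma lfun_eq: assumes "\<sigma> \<ge> 0" shows "lfun \<alpha> om p (om * exp \<sigma>) = L \<sigma>"
proof -
  have "2 * \<alpha> / (1 + \<alpha>) * (p - (om / Aconst \<alpha>) powr ((1 + \<alpha>) / (2 * \<alpha>))) = gam H"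
    unfolding ex_def[symmetric] om_powr inverse_ex using ex_bounds by simp
  then show ?thesis unfolding lfun_def L_def
    using om_pos assms by (simp add: tau_eq Dtau_eq PP_eq)
qed

lemma xhat_eq: "xhat \<alpha> p H (int n - int H) = om * exp (md n)"
  unfolding xhat_def om_def[symmetric]
proof (rule the_equality)
  show "om \<le> om * exp (md n) \<and> lfun \<alpha> om p (om * exp (md n)) = real_of_int (int n - int H) + 1 / 2"
    using om_pos md[of n] by (simp add: lfun_eq)
  fix x assume x: "om \<le> x \<and> lfun \<alpha> om p x = real_of_int (int n - int H) + 1 / 2"
  define s where "s = ln (x / om)"
  have xs: "x = om * exp s" "s \<ge> 0" using x om_pos by (auto simp: s_def)
  then have "L s = L (md n)" using x lfun_eq[of s] md[of n] by simp
  then have "s = md n" using L_mono_iff[OF xs(2) md(1)[of n]] L_mono_iff[OF md(1)[of n] xs(2)] by linarith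
  then show "x = om * exp (md n)" using xs by simp
qed

lemma md_at_top: "filterlim md at_top sequentially"
  unfolding filterlim_at_top
proof
  fix s
  obtain N :: nat where N: "L (max 0 s) + real H \<le> real N" using real_arch_simple by blast
  have "s \<le> md n" if "n \<ge> N" for n
  proof -
    have "L (max 0 s) \<le> L (md n)" using N that by (simp add: md)
    then show ?thesis using L_mono_iff[of "max 0 s" "md n"] md(1)[of n] by simp
  qed
  then show "\<forall>\<^sub>F n in sequentially. s \<le> md n" by (auto simp: eventually_sequentially)
qed

lemma L_tendsto: "((\<lambda>\<sigma>. L \<sigma> * exp (- ex * \<sigma>)) \<longlongrightarrow> cT * (p - ex * gam H)) at_top"
proof -
  have "((\<lambda>\<sigma>. p * (TT \<sigma> * exp (- ex * \<sigma>)) - gam H * (T1 \<sigma> * exp (- ex * \<sigma>))) \<longlongrightarrow> p * cT - gam H * (ex * cT)) at_top"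
    by (intro tendsto_intros TT_tendsto T1_tendsto)
  also have "p * cT - gam H * (ex * cT) = cT * (p - ex * gam H)" by (simp add: algebra_simps)
  finally show ?thesis
  proof (rule Lim_transform_eventually)
    show "\<forall>\<^sub>F \<sigma> in at_top. p * (TT \<sigma> * exp (- ex * \<sigma>)) - gam H * (T1 \<sigma> * exp (- ex * \<sigma>)) = L \<sigma> * exp (- ex * \<sigma>)"
      using eventually_ge_at_top[of 0] by eventually_elim (simp add: L_def PP_eq algebra_simps)
  qed
qed

text \<open>The leading coefficient \<open>cT * (p - ex * gam H)\<close> of \<open>L\<close> equals
  \<open>om powr ex\<close>: this is why \<open>\<omega>_H\<close> is the scale on which the profile
  is normalised.\<close>

lemma md_tendsto: "(\<lambda>n. real n / (om * exp (md n)) powr ex) \<longlonglongrightarrow> 1"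
proof -
  define c where "c = cT * (p - ex * gam H)"
  have c: "c > 0" using cT_pos ex_gam_less by (simp add: c_def)
  have e: "((\<lambda>\<sigma>. exp (- ex * \<sigma>)) \<longlongrightarrow> 0) at_top" using ex_bounds by real_asymp
  have "((\<lambda>\<sigma>. (L \<sigma> * exp (- ex * \<sigma>) + (real H - 1 / 2) * exp (- ex * \<sigma>)) / c)
      \<longlongrightarrow> (c + (real H - 1 / 2) * 0) / c) at_top"
    using c by (intro tendsto_intros L_tendsto[folded c_def] e) auto
  then have "((\<lambda>\<sigma>. (L \<sigma> + real H - 1 / 2) * exp (- ex * \<sigma>) / c) \<longlongrightarrow> 1) at_top"
    using c by (simp add: algebra_simps)
  from filterlim_compose[OF this md_at_top]
  have "(\<lambda>n. real n * exp (- ex * md n) / c) \<longlonglongrightarrow> 1" by (simp add: md)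
  moreover have "real n * exp (- ex * md n) / c = real n / (om * exp (md n)) powr ex" for n
    using om_pos by (simp add: powr_mult om_powr' c_def[symmetric] exp_powr_real exp_minus field_simps)
  ultimately show ?thesis by simp
qed

end

context bae_sol
begin

definition ts :: "nat \<Rightarrow> real" where
  "ts = (SOME t. near t \<and> (\<forall>m. zz t (t m) = real m - real H + 1 / 2))"

lemma ts: "near ts" "zz ts (ts m) = real m - real H + 1 / 2"
  using someI_ex[OF perron_solution, folded ts_def] by auto

lemma ts_strict_mono: assumes "m < n" shows "ts m < ts n"
proof (rule ccontr)
  assume "\<not> ts m < ts n"
  then have "zz ts (ts n) \<le> zz ts (ts m)" by (intro zz_mono ts) auto
  then show False using assms by (simp add: ts)
qed

lemma ts_near: "\<bar>ts n - md n\<bar> \<le> ee n"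
  using ts(1) by (simp add: near_def)

lemma ee_le: "ee n \<le> 2 * Bc H Nm / (tc * p\<^sup>2) * (exp (- ex * md n) * hb (md n))"
proof -
  have "ee n \<le> Bc H Nm / p * (2 / (tc * p) * exp (- ex * md n) * hb (md n))"
    unfolding ee_def using consts_pos(8)[of H Nm] p_bounds by (intro mult_left_mono E0_le md) auto
  then show ?thesis by (simp add: power2_eq_square mult_ac)
qed

lemma ee_tendsto: "ee \<longlonglongrightarrow> 0"
proof (rule Lim_null_comparison)
  define K where "K = Bc H Nm / p * (2 * Ch / (tc * p))"
  have "((\<lambda>\<sigma>. K * exp (- ex * \<sigma>)) \<longlongrightarrow> 0) at_top" using ex_bounds by real_asymp
  from filterlim_compose[OF this md_at_top] show "(\<lambda>n. K * exp (- ex * md n)) \<longlonglongrightarrow> 0" .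
  show "\<forall>\<^sub>F n in sequentially. norm (ee n) \<le> K * exp (- ex * md n)"
  proof (intro always_eventually allI)
    fix n
    have "ee n \<le> Bc H Nm / p * (2 * Ch / (tc * p) * exp (- ex * md n))"
      unfolding ee_def using consts_pos(8)[of H Nm] p_bounds by (intro mult_left_mono E0_le' md) auto
    then show "norm (ee n) \<le> K * exp (- ex * md n)" using ee(1)[of n] by (simp add: K_def)
  qed
qed

lemma ts_tendsto: "(\<lambda>n. real n / (om * exp (ts n)) powr ex) \<longlonglongrightarrow> 1"
proof -
  have "(\<lambda>n. md n - ts n) \<longlonglongrightarrow> 0"
    by (rule Lim_null_comparison[OF _ ee_tendsto]) (use ts_near in \<open>auto simp: abs_minus_commute\<close>)
  then have "(\<lambda>n. exp (ex * (md n - ts n)) * (real n / (om * exp (md n)) powr ex)) \<longlonglongrightarrow> exp (ex * 0) * 1"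
    by (intro tendsto_intros md_tendsto)
  moreover have "exp (ex * (md n - ts n)) * (real n / (om * exp (md n)) powr ex) = real n / (om * exp (ts n)) powr ex" for n
    using om_pos by (simp add: powr_mult exp_powr_real exp_diff right_diff_distrib mult_ac)
  ultimately show ?thesis by simp
qed

text \<open>Enumeration of the indices of actual roots. Skipping \<open>H\<close> holes shifts the
  index by at most \<open>H\<close>, which does not affect the counting law.\<close>

definition rk :: "nat \<Rightarrow> nat" where "rk = enumerate (UNIV - Hs)"

lemma infinite_nonhole: "infinite (UNIV - Hs)"
  using Hs(1) by (simp add: Diff_infinite_finite)

lemma rk_range: "range rk = UNIV - Hs" and rk_mono: "strict_mono rk"
  unfolding rk_def by (rule range_enumerate[OF infinite_nonhole] strict_mono_enumerate[OF infinite_nonhole])+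

lemma rk_ge: "j \<le> rk j"
  unfolding rk_def by (rule le_enumerate[OF infinite_nonhole])

lemma rk_le: "rk j \<le> j + H"
proof -
  have "{..<rk j} \<subseteq> rk ` {..<j} \<union> Hs"
  proof
    fix m assume m: "m \<in> {..<rk j}"
    show "m \<in> rk ` {..<j} \<union> Hs"
    proof (cases "m \<in> Hs")
      case False
      then have "m \<in> range rk" using rk_range by auto
      then obtain i where i: "m = rk i" by auto
      then have "i < j" using m strict_mono_less[OF rk_mono] by simp
      then show ?thesis using i by auto
    qed simp
  qed
  then have "card {..<rk j} \<le> card (rk ` {..<j} \<union> Hs)" using Hs(1) by (intro card_mono) auto
  also have "\<dots> \<le> card (rk ` {..<j}) + card Hs" by (rule card_Un_le)
  also have "\<dots> \<le> j + H" using card_image_le[of "{..<j}" rk] Hs(2) by simp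
  finally show ?thesis by simp
qed

definition ys :: "nat \<Rightarrow> real" where "ys j = om * exp (ts (rk j))"

lemma bae_zeros_ys: "bae_zeros \<alpha> ys"
proof unfold_locales
  show "ys n > 0" for n using om_pos by (simp add: ys_def)
  show "strict_mono ys"
    using om_pos ts_strict_mono strict_monoD[OF rk_mono] by (intro strict_monoI) (simp add: ys_def)
  define D where "D n = (om * exp (ts n)) powr ex" for n
  have Dp: "D n > 0" for n using om_pos by (simp add: D_def)
  have nD: "(\<lambda>n. real n / D n) \<longlonglongrightarrow> 1" using ts_tendsto by (simp add: D_def)
  have "(\<lambda>n. real n / D n * (1 / real n)) \<longlonglongrightarrow> 1 * 0" by (intro tendsto_mult nD lim_const_over_n)
  then have "(\<lambda>n. 1 / D n) \<longlonglongrightarrow> 1 * 0"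
    by (rule Lim_transform_eventually) (use eventually_gt_at_top[of 0] in \<open>eventually_elim; simp\<close>)
  then have iD: "(\<lambda>n. 1 / D n) \<longlonglongrightarrow> 0" by simp
  have rtop: "filterlim rk at_top sequentially" by (rule filterlim_subseq[OF rk_mono])
  have "(\<lambda>j. (real (Suc j) - real (rk j)) / D (rk j)) \<longlonglongrightarrow> 0"
  proof (rule Lim_null_comparison)
    have "(\<lambda>j. (real H + 1) * (1 / D (rk j))) \<longlonglongrightarrow> (real H + 1) * 0"
      by (intro tendsto_intros filterlim_compose[OF iD rtop])
    then show "(\<lambda>j. (real H + 1) * (1 / D (rk j))) \<longlonglongrightarrow> 0" by simp
    have "\<bar>real (Suc j) - real (rk j)\<bar> \<le> real H + 1" for j using rk_ge[of j] rk_le[of j] by linarith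
    then show "\<forall>\<^sub>F j in sequentially. norm ((real (Suc j) - real (rk j)) / D (rk j)) \<le> (real H + 1) * (1 / D (rk j))"
      using Dp by (simp add: divide_right_mono less_imp_le)
  qed
  then have "(\<lambda>j. (real (Suc j) - real (rk j)) / D (rk j) + real (rk j) / D (rk j)) \<longlonglongrightarrow> 0 + 1"
    by (intro tendsto_add filterlim_compose[OF nD rtop])
  moreover have "(real (Suc j) - real (rk j)) / D (rk j) + real (rk j) / D (rk j) = real (Suc j) / ys j powr ex" for j
    by (simp add: ys_def D_def add_divide_distrib[symmetric])
  ultimately show "(\<lambda>n. real (Suc n) / ys n powr ex) \<longlonglongrightarrow> 1" by simp
qed

sublocale S: bae_zeros \<alpha> ys by (rule bae_zeros_ys)

lemma ZZ_ys: "- 2 * p + S.ZZ (om * exp s) = zz ts s"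
proof -
  have "S.ZZ (om * exp s) = (\<Sum>j. cc (rk j) * ff (s - ts (rk j)))"
    unfolding S.ZZ_def
  proof (rule suminf_cong)
    fix j
    have "rk j \<notin> Hs" using rk_range by auto
    moreover have "om * exp s / ys j = exp (s - ts (rk j))" using om_pos by (simp add: ys_def exp_diff)
    ultimately show "FF (om * exp s / ys j) = cc (rk j) * ff (s - ts (rk j))" by (simp add: cc_def FF_eq_ff)
  qed
  also have "\<dots> = (\<Sum>n. cc n * ff (s - ts n))"
    by (rule suminf_mono_reindex[OF rk_mono]) (auto simp: cc_def rk_range)
  finally show ?thesis by (simp add: zz_def)
qed

lemma ZZ_ys_quantised: "- 2 * p + S.ZZ (ys j) = real_of_int (int (rk j) - int H) + 1 / 2"
  unfolding ys_def ZZ_ys ts by simp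

lemma PQ_ys_solution:
  "bae_solution \<alpha> p S.PQ" "purely_real S.PQ" "normalised \<alpha> S.PQ"
  "holes \<alpha> p S.PQ = Zp p - {int n - int H | n. n \<notin> Hs}"
proof -
  show "bae_solution \<alpha> p S.PQ" unfolding S.bae_solution_PQ_iff using ZZ_ys_quantised by blast
  have "range (\<lambda>j. int (rk j) - int H) = (\<lambda>n. int n - int H) ` range rk" by auto
  also have "\<dots> = {int n - int H | n. n \<notin> Hs}" unfolding rk_range by auto
  finally show "holes \<alpha> p S.PQ = Zp p - {int n - int H | n. n \<notin> Hs}"
    using S.holes_PQ(1)[OF ZZ_ys_quantised] by simp
qed (rule S.purely_real_PQ S.normalised_PQ)+

lemma xk_ys: assumes "n \<notin> Hs" shows "xk \<alpha> p S.PQ (int n - int H) = om * exp (ts n)"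
proof -
  have "n \<in> range rk" using assms rk_range by auto
  then obtain j where j: "n = rk j" by auto
  have "xk \<alpha> p S.PQ (int (rk j) - int H) = ys j"
    by (rule S.xk_eq[OF _ ZZ_ys_quantised]) (use S.y_pos[of j] in simp)
  then show ?thesis by (simp add: j ys_def)
qed

end

section \<open>Precision of the roots\<close>

lemma exp_taylor_bound: fixes w :: real shows "\<bar>exp w - 1 - w\<bar> \<le> w\<^sup>2 * exp \<bar>w\<bar>"
proof -
  obtain t where t: "\<bar>t\<bar> \<le> \<bar>w\<bar>" "exp w = (\<Sum>m<2. w ^ m / fact m) + exp t / fact 2 * w ^ 2"
    using Maclaurin_exp_le[of w 2] by blast
  then have "\<bar>exp w - 1 - w\<bar> = exp t / 2 * w\<^sup>2" by (simp add: numeral_2_eq_2)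
  also have "\<dots> \<le> exp \<bar>w\<bar> * w\<^sup>2"
  proof (intro mult_right_mono)
    have "exp t \<le> exp \<bar>w\<bar>" using t(1) by simp
    then show "exp t / 2 \<le> exp \<bar>w\<bar>" using exp_gt_zero[of t] by linarith
  qed simp
  finally show ?thesis by (simp add: mult.commute)
qed

text \<open>The function \<open>C\<close> of the estimate. The logarithm comes from the linear
  factor of the barrier; the constant branch keeps the function bounded and covers negative
  \<open>k\<close>.\<close>

definition decay :: "real \<Rightarrow> real" where
  "decay y = (if y < 1 then 1 else y powr (-2) * (1 + ln y))"

lemma decay_bounds: "0 \<le> decay y" "decay y \<le> 1"
proof -
  show "0 \<le> decay y" by (simp add: decay_def)
  show "decay y \<le> 1"
  proof (cases "y < 1")
    case False
    then have "y powr (-2) * (1 + ln y) \<le> y powr (-2) * y powr 1"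
      using ln_add_one_self_le_self2[of "y - 1"] by (intro mult_left_mono) auto
    also have "\<dots> = y powr (-2 + 1)" by (rule powr_add[symmetric])
    also have "\<dots> \<le> y powr 0" using False by (intro powr_mono) auto
    also have "\<dots> = 1" using False by simp
    finally show ?thesis using False by (simp add: decay_def)
  qed (simp add: decay_def)
qed

lemma decay_bigo: assumes "\<epsilon> > 0" shows "decay \<in> O[at_top](\<lambda>y. y powr (-2 + \<epsilon>))"
proof -
  have "(\<lambda>y::real. y powr (-2) * (1 + ln y)) \<in> O[at_top](\<lambda>y. y powr (-2 + \<epsilon>))"
    using assms by real_asymp
  moreover have "\<forall>\<^sub>F y in at_top. decay y = y powr (-2) * (1 + ln y)"
    using eventually_ge_at_top[of 1] by eventually_elim (simp add: decay_def)
  ultimately show ?thesis by (subst landau_o.big.in_cong)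
qed

context bae
begin

definition Kd :: real where "Kd = Ch + cT\<^sup>2 * (bb + (\<bar>ln cT\<bar> + 1) / ex)"

lemma Kd_pos: "Kd > 0"
  unfolding Kd_def using Ch_pos bb_ge ex_bounds by (intro add_pos_nonneg mult_nonneg_nonneg add_nonneg_nonneg) auto

text \<open>The left side is \<open>e^(-2 ex \<sigma>) * (bb + \<sigma>)\<close>, and
  \<open>e^(ex \<sigma>)\<close> is at least \<open>y / cT\<close>: up to constants this is
  \<open>y^(-2) * (1 + ln y)\<close>.\<close>

lemma hb_decay:
  assumes s: "\<sigma> \<ge> 0" and y: "y \<le> cT * exp (ex * \<sigma>)"
  shows "exp (- ex * \<sigma>) * hb \<sigma> \<le> Kd * decay y"
proof (cases "y < 1")
  case True
  have "exp (- ex * \<sigma>) * hb \<sigma> \<le> 1 * Ch" using hb_le[OF s] hb_pos[OF s] s ex_bounds by (intro mult_mono) auto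
  also have "\<dots> \<le> Kd" unfolding Kd_def using bb_ge ex_bounds by simp
  finally show ?thesis using True by (simp add: decay_def)
next
  case False
  \<comment> \<open>\<open>v \<ge> 1\<close> measures how far \<open>cT * e^(ex \<sigma>)\<close>
    exceeds \<open>y\<close>. The exponentials carry \<open>v^(-2)\<close>, which pays for the
    \<open>v^2\<close> in the bound of \<open>bb + \<sigma>\<close>.\<close>
  define v where "v = cT * exp (ex * \<sigma>) / y"
  define K where "K = bb + (\<bar>ln cT\<bar> + 1) / ex"
  have yp: "y > 0" "ln y \<ge> 0" using False by auto
  have v1: "v \<ge> 1" using y yp by (simp add: v_def)
  have "ln v = ln cT + ex * \<sigma> - ln y" using cT_pos yp by (simp add: v_def ln_div ln_mult)
  then have "ex * \<sigma> = ln v + ln y - ln cT" by simp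
  then have "ex * \<sigma> \<le> v + ln y + \<bar>ln cT\<bar>" using ln_le_minus_one[of v] v1 by linarith
  also have "\<dots> \<le> v\<^sup>2 * (1 + ln y + \<bar>ln cT\<bar>)"
  proof -
    have "1 * (ln y + \<bar>ln cT\<bar>) \<le> v\<^sup>2 * (ln y + \<bar>ln cT\<bar>)" using v1 yp by (intro mult_right_mono) (auto simp: one_le_power)
    moreover have "v \<le> v\<^sup>2" using v1 by (simp add: power2_eq_square)
    ultimately show ?thesis by (simp add: algebra_simps)
  qed
  also have "\<dots> \<le> v\<^sup>2 * ((\<bar>ln cT\<bar> + 1) * (1 + ln y))"
    using yp by (intro mult_left_mono) (auto simp: algebra_simps)
  finally have "\<sigma> \<le> v\<^sup>2 * ((\<bar>ln cT\<bar> + 1) / ex * (1 + ln y))" using ex_bounds by (simp add: field_simps)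
  moreover have "bb * 1 \<le> v\<^sup>2 * (bb * (1 + ln y))"
  proof -
    have "1 * bb \<le> v\<^sup>2 * bb" using v1 bb_ge by (intro mult_right_mono) (auto simp: one_le_power)
    also have "\<dots> * 1 \<le> v\<^sup>2 * bb * (1 + ln y)" using yp bb_ge by (intro mult_left_mono) auto
    finally show ?thesis by (simp add: mult_ac)
  qed
  ultimately have b: "bb + \<sigma> \<le> v\<^sup>2 * (K * (1 + ln y))" by (simp add: K_def algebra_simps)
  have e: "exp (- ex * \<sigma>) = cT / (y * v)" using yp cT_pos by (simp add: v_def exp_minus field_simps)
  have "exp (- ex * \<sigma>) * hb \<sigma> = (cT / (y * v))\<^sup>2 * (bb + \<sigma>)" unfolding hb_def e by (simp add: power2_eq_square)
  also have "\<dots> \<le> (cT / (y * v))\<^sup>2 * (v\<^sup>2 * (K * (1 + ln y)))" by (intro mult_left_mono b) auto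
  also have "\<dots> = cT\<^sup>2 * K * (y powr (-2) * (1 + ln y))"
    using yp v1 by (simp add: power_divide power_mult_distrib powr_minus_divide field_simps)
  also have "\<dots> \<le> Kd * (y powr (-2) * (1 + ln y))"
    unfolding Kd_def K_def using Ch_pos yp by (intro mult_right_mono) auto
  finally show ?thesis using False by (simp add: decay_def)
qed

definition md_const :: "nat \<Rightarrow> real" where "md_const n = (real n + 1 / 2) * (2 / tc)"
definition md_err :: "nat \<Rightarrow> nat \<Rightarrow> real" where
  "md_err H n = 8 * Tb\<^sup>2 / tc * exp (md_const n) * (md_const n)\<^sup>2 + gam H * Tb * md_const n"
definition log_err :: "nat \<Rightarrow> nat \<Rightarrow> nat \<Rightarrow> real" where
  "log_err H Nm n = 2 * (gam H)\<^sup>2 + 2 * Bc H Nm * Ch / tc + md_err H n / T1 0"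
definition log_size :: "nat \<Rightarrow> nat \<Rightarrow> nat \<Rightarrow> real" where
  "log_size H Nm n = \<bar>real n - real H + 1 / 2\<bar> / T1 0 + log_err H Nm n"
definition root_err :: "nat \<Rightarrow> nat \<Rightarrow> nat \<Rightarrow> real" where
  "root_err H Nm n = Aconst \<alpha> * ((log_size H Nm n)\<^sup>2 * exp (log_size H Nm n) + log_err H Nm n)"

lemma T1_0_pos: "T1 0 > 0"
  using tc(2)[of 0] tc(1) by simp

lemma gam_div: "gam H = real H / T1 0"
  using gam_T1_0[of H] T1_0_pos by (simp add: field_simps)

end

context bae_prof
begin

lemma md_le: "md n \<le> md_const n / p"
proof -
  have "tc / 2 * p * exp (ex * 0) * (md n - 0) \<le> L (md n) - L 0" by (rule L_diff_ge) (use md in auto)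
  also have "\<dots> = real n + 1 / 2" by (simp add: md L_0)
  finally show ?thesis using tc(1) p_bounds(6) by (simp add: md_const_def field_simps)
qed

lemma md_const_pos: "md_const n > 0"
  using tc(1) by (simp add: md_const_def)

text \<open>Taylor expansion of \<open>L\<close> at 0, with
  \<open>L1 0 = p * T1 0 - gam H * T2 0\<close>. The second term is bounded in \<open>p\<close>, so
  it moves the node only at order \<open>p^(-2)\<close>.\<close>

lemma md_expansion: "\<bar>md n - (real n + 1 / 2) / (p * T1 0)\<bar> \<le> md_err H n / T1 0 / p\<^sup>2"
proof -
  have p: "p > 0" "p \<ge> 1" by (rule p_bounds)+
  have m0: "md n \<ge> 0" by (rule md)
  have m1: "md n \<le> md_const n" using md_le[of n] p md_const_pos[of n] by (smt (verit, best) divide_le_eq mult_left_le mult_le_cancel_left1)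
  define K2 where "K2 = 8 * Tb\<^sup>2 / tc * exp (md_const n)"
  have L2b: "\<bar>L2 z\<bar> \<le> K2 * p" if z: "0 \<le> z" "z \<le> md n" for z
  proof -
    have "\<bar>L2 z\<bar> \<le> 4 * Tb / tc * L1 z" by (rule L2_upper[OF z(1)])
    also have "\<dots> \<le> 4 * Tb / tc * (2 * Tb * p * exp (md_const n))"
    proof (rule mult_left_mono)
      have "ex * z \<le> 1 * md_const n" using z m1 ex_bounds by (intro mult_mono) auto
      then have "2 * Tb * p * exp (ex * z) \<le> 2 * Tb * p * exp (md_const n)" using Tb_pos p by (intro mult_left_mono) auto
      then show "L1 z \<le> 2 * Tb * p * exp (md_const n)" using L1_upper[OF z(1)] by simp
    qed (use Tb_pos tc(1) in simp)
    finally show ?thesis by (simp add: K2_def power2_eq_square mult_ac)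
  qed
  have lin: "\<bar>real n + 1 / 2 - md n * L1 0\<bar> \<le> K2 * p * (md n)\<^sup>2"
  proof (cases "md n = 0")
    case True
    then show ?thesis using md(2)[of n] L_0 by simp
  next
    case False
    obtain z where z: "0 < z" "z < md n" "L (md n) - L 0 = (md n - 0) * L1 z"
      using MVT2[of 0 "md n" L L1] L_deriv False m0 by auto
    obtain z' where z': "0 < z'" "z' < z" "L1 z - L1 0 = (z - 0) * L2 z'"
      using MVT2[of 0 z L1 L2] L1_deriv z by auto
    have "real n + 1 / 2 - md n * L1 0 = md n * (z * L2 z')" using z z' by (simp add: md L_0 algebra_simps)
    then have "\<bar>real n + 1 / 2 - md n * L1 0\<bar> = md n * (z * \<bar>L2 z'\<bar>)" using z by (simp add: abs_mult)
    also have "\<dots> \<le> md n * (md n * (K2 * p))" using z z' L2b[of z'] m0 by (intro mult_left_mono mult_mono) auto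
    finally show ?thesis by (simp add: power2_eq_square mult_ac)
  qed
  have K2n: "K2 \<ge> 0" using tc(1) by (simp add: K2_def)
  have "(md n)\<^sup>2 \<le> (md_const n / p)\<^sup>2" using md_le m0 by (intro power_mono) auto
  then have "K2 * p * (md n)\<^sup>2 \<le> K2 * p * (md_const n / p)\<^sup>2" using K2n p by (intro mult_left_mono) auto
  then have 1: "\<bar>real n + 1 / 2 - md n * L1 0\<bar> \<le> K2 * (md_const n)\<^sup>2 / p" using lin p by (simp add: power2_eq_square)
  have "\<bar>md n * (gam H * T2 0)\<bar> = md n * (gam H * \<bar>T2 0\<bar>)" using m0 gam_nonneg[of H] by (simp add: abs_mult)
  also have "\<dots> \<le> md_const n / p * (gam H * Tb)"
    using md_le m0 gam_nonneg[of H] T_bounds(2)[of 0] md_const_pos[of n] p by (intro mult_mono mult_left_mono mult_nonneg_nonneg) auto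
  finally have 2: "\<bar>md n * (gam H * T2 0)\<bar> \<le> gam H * Tb * md_const n / p" by (simp add: mult_ac)
  have "real n + 1 / 2 - md n * (p * T1 0) = (real n + 1 / 2 - md n * L1 0) - md n * (gam H * T2 0)"
    by (simp add: L1_def algebra_simps)
  then have 3: "\<bar>real n + 1 / 2 - md n * (p * T1 0)\<bar> \<le> md_err H n / p"
    using 1 2 by (simp add: md_err_def K2_def add_divide_distrib)
  have pT: "p * T1 0 > 0" using p T1_0_pos by simp
  have "\<bar>md n - (real n + 1 / 2) / (p * T1 0)\<bar> = \<bar>real n + 1 / 2 - md n * (p * T1 0)\<bar> / (p * T1 0)"
  proof -
    have "md n - (real n + 1 / 2) / (p * T1 0) = - ((real n + 1 / 2 - md n * (p * T1 0)) / (p * T1 0))"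
    proof -
      have "m - a / c = - ((a - m * c) / c)" if "c > 0" for m a c :: real using that by (simp add: field_simps)
      then show ?thesis using pT .
    qed
    then show ?thesis using pT by (simp only: abs_minus_cancel abs_divide abs_of_pos)
  qed
  also have "\<dots> \<le> md_err H n / p / (p * T1 0)" using 3 pT by (intro divide_right_mono) auto
  finally show ?thesis by (simp add: power2_eq_square mult_ac)
qed

end

context bae_sol
begin

text \<open>The ratio is \<open>e^(ts n - md n)\<close>, and the corridor carries the factor
  \<open>p^(-2)\<close>. The decay follows with \<open>y = k / p\<close>, because
  \<open>k + 1 / 2 = L (md n) \<le> p * cT * e^(ex * md n)\<close>.\<close>

lemma root_ratio:
  assumes "n \<notin> Hs"
  shows "\<bar>xk \<alpha> p S.PQ (int n - int H) / xhat \<alpha> p H (int n - int H) - 1\<bar>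
    \<le> 4 * Bc H Nm * Kd / tc * decay (real_of_int (int n - int H) / p) * p powr (-2)"
proof -
  define u where "u = ts n - md n"
  have u: "\<bar>u\<bar> \<le> ee n" "\<bar>u\<bar> \<le> 1 / 2" using ts_near[of n] ee(2)[of n] by (auto simp: u_def)
  have "xk \<alpha> p S.PQ (int n - int H) / xhat \<alpha> p H (int n - int H) = exp u"
    unfolding xk_ys[OF assms] xhat_eq u_def exp_diff using om_pos by simp
  moreover have "\<bar>exp u - 1\<bar> \<le> 2 * \<bar>u\<bar>"
  proof -
    have "1 + u \<le> exp u" by (rule exp_ge_add_one_self)
    moreover have "exp u \<le> 1 + 2 * \<bar>u\<bar>" using exp_bound_lemma[of u] u by simp
    ultimately show ?thesis by linarith
  qed
  moreover have "ee n \<le> 2 * Bc H Nm / (tc * p\<^sup>2) * (Kd * decay (real_of_int (int n - int H) / p))"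
  proof (rule order_trans[OF ee_le mult_left_mono[OF hb_decay]])
    have "real n - real H + 1 / 2 \<le> p * TT (md n)"
    proof -
      have "0 \<le> gam H * T1 (md n)" using T1_nonneg[OF md(1)] gam_nonneg by (intro mult_nonneg_nonneg)
      then show ?thesis using md[of n] unfolding L_def by (simp add: PP_eq)
    qed
    also have "\<dots> \<le> p * (cT * exp (ex * md n))" using TT_le p_bounds by (intro mult_left_mono) auto
    finally show "real_of_int (int n - int H) / p \<le> cT * exp (ex * md n)" using p_bounds(6) by (simp add: divide_le_eq mult_ac)
  qed (use md consts_pos(8)[of H Nm] tc(1) in auto)
  ultimately have "\<bar>xk \<alpha> p S.PQ (int n - int H) / xhat \<alpha> p H (int n - int H) - 1\<bar>
     \<le> 2 * (2 * Bc H Nm / (tc * p\<^sup>2) * (Kd * decay (real_of_int (int n - int H) / p)))" using u by linarith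
  also have "\<dots> = 4 * Bc H Nm * Kd / tc * decay (real_of_int (int n - int H) / p) * p powr (-2)"
    using p_bounds(6) by (simp add: powr_minus_divide)
  finally show ?thesis .
qed

text \<open>In the logarithm the prefactor \<open>\<omega>_H\<close> contributes
  \<open>- gam H / p = - H / (p * T1 0)\<close> and the node
  \<open>(n + 1 / 2) / (p * T1 0)\<close>; together only \<open>k = n - H\<close> remains.
  Everything else is of order \<open>p^(-2)\<close>.\<close>

lemma root_expansion:
  assumes n: "n \<notin> Hs" and p2g: "p \<ge> 2 * gam H"
  shows "\<bar>xk \<alpha> p S.PQ (int n - int H) * p powr (- (1 / ex))
      - Aconst \<alpha> * (1 + (real n - real H + 1 / 2) / (p * T1 0))\<bar> \<le> root_err H Nm n * p powr (-2)"
proof -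
  have p: "p > 0" "p \<ge> 1" by (rule p_bounds)+
  define g where "g = ex * gam H"
  have g0: "g \<ge> 0" "g \<le> gam H" using gam_nonneg[of H] ex_bounds mult_right_mono[of ex 1 "gam H"] by (auto simp: g_def)
  define v where "v = (real n - real H + 1 / 2) / (p * T1 0)"
  define w where "w = ln (1 - g / p) / ex + ts n"
  have gp: "g / p \<le> 1 / 2" using g0 p2g p by (simp add: divide_le_eq)
  have "xk \<alpha> p S.PQ (int n - int H) * p powr (- (1 / ex)) = Aconst \<alpha> * ((p - g) powr (1 / ex) / p powr (1 / ex) * exp (ts n))"
    unfolding xk_ys[OF n] om_def omegaH_eq g_def by (simp add: powr_minus_divide)
  also have "(p - g) powr (1 / ex) / p powr (1 / ex) = (1 - g / p) powr (1 / ex)"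
  proof -
    have "1 - g / p = (p - g) / p" using p by (simp add: field_simps)
    then show ?thesis by (simp only: powr_divide)
  qed
  also have "\<dots> * exp (ts n) = exp w"
  proof -
    have "q powr (1 / ex) * exp c = exp (ln q / ex + c)" if "q > 0" for q c using that by (simp add: powr_def exp_add)
    moreover have "1 - g / p > 0" using gp by linarith
    ultimately show ?thesis unfolding w_def .
  qed
  finally have main: "xk \<alpha> p S.PQ (int n - int H) * p powr (- (1 / ex)) = Aconst \<alpha> * exp w" .
  have a: "\<bar>ln (1 - g / p) / ex + gam H / p\<bar> \<le> 2 * (gam H)\<^sup>2 / p\<^sup>2"
  proof -
    have "\<bar>ln (1 + - (g / p)) - - (g / p)\<bar> \<le> 2 * (- (g / p))\<^sup>2"
      using gp g0 p by (intro abs_ln_one_plus_x_minus_x_bound) auto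
    then have b: "\<bar>ln (1 - g / p) + g / p\<bar> \<le> 2 * (g / p)\<^sup>2" by simp
    have "ln (1 - g / p) / ex + gam H / p = (ln (1 - g / p) + g / p) / ex"
      using ex_bounds by (simp add: g_def field_simps)
    then have "\<bar>ln (1 - g / p) / ex + gam H / p\<bar> = \<bar>ln (1 - g / p) + g / p\<bar> / ex" using ex_bounds by (simp add: abs_divide)
    also have "\<dots> \<le> 2 * (g / p)\<^sup>2 / ex" using b ex_bounds by (intro divide_right_mono) auto
    also have "\<dots> = ex * (2 * (gam H)\<^sup>2 / p\<^sup>2)" using ex_bounds by (simp add: g_def power2_eq_square)
    also have "\<dots> \<le> 1 * (2 * (gam H)\<^sup>2 / p\<^sup>2)" using ex_bounds by (intro mult_right_mono) auto
    finally show ?thesis by simp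
  qed
  have b: "\<bar>ts n - md n\<bar> \<le> 2 * Bc H Nm * Ch / tc / p\<^sup>2"
  proof -
    have "exp (- ex * md n) * hb (md n) \<le> 1 * Ch"
      using hb_le[OF md(1)[of n]] hb_pos[OF md(1)[of n]] md(1)[of n] ex_bounds by (intro mult_mono) auto
    then have "2 * Bc H Nm / (tc * p\<^sup>2) * (exp (- ex * md n) * hb (md n)) \<le> 2 * Bc H Nm / (tc * p\<^sup>2) * (1 * Ch)"
      using consts_pos(8)[of H Nm] tc(1) by (intro mult_left_mono) auto
    then show ?thesis using ts_near[of n] ee_le[of n] by (simp add: field_simps)
  qed
  have vexp: "v = (real n + 1 / 2) / (p * T1 0) - gam H / p"
    using p T1_0_pos by (simp add: v_def gam_div field_simps)
  have "w - v = (ln (1 - g / p) / ex + gam H / p) + (ts n - md n) + (md n - (real n + 1 / 2) / (p * T1 0))"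
    by (simp add: w_def vexp)
  moreover have "\<bar>x + y + z\<bar> \<le> a + b + c" if "\<bar>x\<bar> \<le> a" "\<bar>y\<bar> \<le> b" "\<bar>z\<bar> \<le> c" for x y z a b c :: real
    using that by linarith
  ultimately have "\<bar>w - v\<bar> \<le> 2 * (gam H)\<^sup>2 / p\<^sup>2 + 2 * Bc H Nm * Ch / tc / p\<^sup>2 + md_err H n / T1 0 / p\<^sup>2"
    using a b md_expansion[of n] by presburger
  then have wv: "\<bar>w - v\<bar> \<le> log_err H Nm n / p\<^sup>2" by (simp add: log_err_def add_divide_distrib)
  have Dn: "log_err H Nm n \<ge> 0" unfolding log_err_def md_err_def
    using consts_pos(8)[of H Nm] Ch_pos tc(1) T1_0_pos gam_nonneg[of H] Tb_pos md_const_pos[of n]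
    by (intro add_nonneg_nonneg divide_nonneg_nonneg mult_nonneg_nonneg) auto
  have "\<bar>v\<bar> = \<bar>real n - real H + 1 / 2\<bar> / T1 0 / p" using p T1_0_pos by (simp add: v_def abs_divide)
  moreover have "log_err H Nm n / p\<^sup>2 \<le> log_err H Nm n / p"
  proof -
    have "p \<le> p\<^sup>2" using p by (simp add: power2_eq_square)
    then show ?thesis using Dn p by (intro divide_left_mono) auto
  qed
  ultimately have w: "\<bar>w\<bar> \<le> log_size H Nm n / p" using wv by (simp add: log_size_def add_divide_distrib)
  have W0: "log_size H Nm n \<ge> 0" using Dn T1_0_pos by (simp add: log_size_def)
  then have w': "\<bar>w\<bar> \<le> log_size H Nm n" using w p by (smt (verit, best) divide_le_eq mult_left_le mult_le_cancel_left1)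
  have "\<bar>w\<bar>\<^sup>2 \<le> (log_size H Nm n / p)\<^sup>2" using w by (intro power_mono) auto
  then have "w\<^sup>2 * exp \<bar>w\<bar> \<le> (log_size H Nm n / p)\<^sup>2 * exp (log_size H Nm n)" using w' by (intro mult_mono) auto
  then have "\<bar>exp w - 1 - w\<bar> \<le> (log_size H Nm n)\<^sup>2 * exp (log_size H Nm n) / p\<^sup>2" using exp_taylor_bound[of w] by (simp add: power_divide)
  then have "\<bar>exp w - (1 + v)\<bar> \<le> (log_size H Nm n)\<^sup>2 * exp (log_size H Nm n) / p\<^sup>2 + log_err H Nm n / p\<^sup>2" using wv by linarith
  then have "Aconst \<alpha> * \<bar>exp w - (1 + v)\<bar> \<le> Aconst \<alpha> * (((log_size H Nm n)\<^sup>2 * exp (log_size H Nm n) + log_err H Nm n) / p\<^sup>2)"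
    using Aconst_pos by (intro mult_left_mono) (auto simp: add_divide_distrib)
  then have "\<bar>Aconst \<alpha> * exp w - Aconst \<alpha> * (1 + v)\<bar> \<le> root_err H Nm n * p powr (-2)"
    using Aconst_pos p by (simp add: right_diff_distrib[symmetric] abs_mult root_err_def powr_minus_divide)
  then show ?thesis unfolding main v_def .
qed

end

text \<open>\<open>H_[\<nu>]\<close> consists of the \<open>k < - H\<close> and the \<open>n - H\<close> with \<open>n\<close> in this set; list positions start at 0, so \<open>l - 1\<close> is \<open>i\<close>.\<close>

definition hole_indices :: "nat list \<Rightarrow> nat set" where
  "hole_indices \<nu> = {\<nu> ! i + i | i. i < length \<nu>}"

text \<open>The parts are nondecreasing, so \<open>\<nu> ! i + i\<close> increases strictly. Having
  exactly \<open>H\<close> holes is what lets them match the value \<open>L 0 = - H\<close>.\<close>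

lemma hole_indices_card:
  assumes "sorted \<nu>" shows "finite (hole_indices \<nu>)" "card (hole_indices \<nu>) = length \<nu>"
proof -
  have eq: "hole_indices \<nu> = (\<lambda>i. \<nu> ! i + i) ` {..<length \<nu>}" by (auto simp: hole_indices_def)
  have "inj_on (\<lambda>i. \<nu> ! i + i) {..<length \<nu>}"
  proof (rule linorder_inj_onI')
    fix i j assume "i \<in> {..<length \<nu>}" "j \<in> {..<length \<nu>}" "i < j"
    then have "\<nu> ! i \<le> \<nu> ! j" using assms by (intro sorted_nth_mono) auto
    then show "\<nu> ! i + i \<noteq> \<nu> ! j + j" using \<open>i < j\<close> by linarith
  qed
  then show "finite (hole_indices \<nu>)" "card (hole_indices \<nu>) = length \<nu>" unfolding eq by (simp_all add: card_image)
qed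

text \<open>\<open>p \<ge> H\<close> places every \<open>k \<ge> - H\<close> in \<open>Zp p\<close>,
  so the shift by \<open>H\<close> identifies these integers with the naturals.\<close>

lemma Hnu_eq:
  assumes "p \<ge> real (length \<nu>)"
  shows "Hnu p \<nu> = Zp p - {int n - int (length \<nu>) | n. n \<notin> hole_indices \<nu>}" (is "?A = ?B")
    and "Zp p - Hnu p \<nu> = {int n - int (length \<nu>) | n. n \<notin> hole_indices \<nu>}" (is "_ = ?C")
proof -
  let ?H = "length \<nu>"
  have Zp: "int n - int ?H \<in> Zp p" for n using assms by (simp add: Zp_def)
  show 1: "?A = ?B"
  proof (intro set_eqI iffI)
    fix k assume "k \<in> ?A"
    then consider "k \<in> Zp p" "k < - int ?H" | i where "i < ?H" "k = - int ?H + int (\<nu> ! i) + int i"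
      unfolding Hnu_def by auto
    then show "k \<in> ?B"
    proof cases
      case 2
      then have k: "k = int (\<nu> ! i + i) - int ?H" by simp
      have "\<nu> ! i + i \<in> hole_indices \<nu>" using 2 by (auto simp: hole_indices_def)
      then have "n \<in> hole_indices \<nu>" if "k = int n - int ?H" for n
        using that k by (metis diff_add_cancel of_nat_eq_iff)
      then show ?thesis using Zp[of "\<nu> ! i + i"] k by blast
    qed auto
  next
    fix k assume k: "k \<in> ?B"
    show "k \<in> ?A"
    proof (cases "k < - int ?H")
      case False
      then have eq: "k = int (nat (k + int ?H)) - int ?H" by simp
      then have "nat (k + int ?H) \<in> hole_indices \<nu>" using k by blast
      then obtain i where "i < ?H" "nat (k + int ?H) = \<nu> ! i + i" by (auto simp: hole_indices_def)
      then show ?thesis using eq unfolding Hnu_def by auto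
    qed (use k in \<open>auto simp: Hnu_def\<close>)
  qed
  show "Zp p - Hnu p \<nu> = ?C" unfolding 1 using Zp by auto
qed

text \<open>Threshold and constants are quantified before \<open>p\<close>: they depend on
  \<open>\<alpha>\<close>, \<open>H\<close> and a bound \<open>Nm\<close> for the hole indices,
  while the construction is carried out anew for each \<open>p\<close>.\<close>

lemma (in bae) solution_exists:
  fixes \<nu> :: "nat list"
  assumes "sorted \<nu>"
  shows "\<exists>p0>0. \<exists>M>0. \<exists>C :: nat \<Rightarrow> real. \<forall>p\<ge>p0. real (length \<nu>) \<le> p \<and> (\<exists>Q.
    bae_solution \<alpha> p Q \<and> purely_real Q \<and> normalised \<alpha> Q \<and> holes \<alpha> p Q = Hnu p \<nu> \<and>
    (\<forall>n. n \<notin> hole_indices \<nu> \<longrightarrow>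
      \<bar>xk \<alpha> p Q (int n - int (length \<nu>)) / xhat \<alpha> p (length \<nu>) (int n - int (length \<nu>)) - 1\<bar>
        \<le> M * decay (real_of_int (int n - int (length \<nu>)) / p) * p powr (-2) \<and>
      \<bar>xk \<alpha> p Q (int n - int (length \<nu>)) * p powr (- (1 / ex))
        - Aconst \<alpha> * (1 + (real n - real (length \<nu>) + 1 / 2) / (p * T1 0))\<bar> \<le> C n * p powr (-2)))"
proof -
  define H where "H = length \<nu>"
  define Hs where "Hs = hole_indices \<nu>"
  have Hs: "finite Hs" "card Hs = H" using hole_indices_card[OF assms] by (simp_all add: Hs_def H_def)
  obtain Nm where Nm: "Hs \<subseteq> {..<Nm}" using Hs(1) finite_nat_iff_bounded by blast
  define p0 where "p0 = p2 H Nm + 2 * gam H"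
  have main: "real H \<le> p \<and> (\<exists>Q.
    bae_solution \<alpha> p Q \<and> purely_real Q \<and> normalised \<alpha> Q \<and> holes \<alpha> p Q = Hnu p \<nu> \<and>
    (\<forall>n. n \<notin> Hs \<longrightarrow>
      \<bar>xk \<alpha> p Q (int n - int H) / xhat \<alpha> p H (int n - int H) - 1\<bar>
        \<le> 4 * Bc H Nm * Kd / tc * decay (real_of_int (int n - int H) / p) * p powr (-2) \<and>
      \<bar>xk \<alpha> p Q (int n - int H) * p powr (- (1 / ex))
        - Aconst \<alpha> * (1 + (real n - real H + 1 / 2) / (p * T1 0))\<bar> \<le> root_err H Nm n * p powr (-2)))"
    if p: "p \<ge> p0" for p
  proof -
    have 1: "p \<ge> p2 H Nm" using p gam_nonneg[of H] by (simp add: p0_def)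
    have 2: "p1 H \<le> p" using 1 p2_ge_p1[of H Nm] by linarith
    have p1n: "p2 H Nm \<ge> 0" using p2_ge_p1[of H Nm] gam_nonneg[of H] Tb_pos tc(1)
      unfolding p1_def by (smt (verit) divide_nonneg_pos mult_nonneg_nonneg of_nat_0_le_iff)
    interpret bae_sol \<alpha> p H Hs Nm by unfold_locales (use 1 2 Hs Nm in auto)
    have pH: "real H \<le> p" by (rule p_bounds)
    have "p \<ge> 2 * gam H" using p p1n by (simp add: p0_def)
    note root_ratio root_expansion[OF _ this]
    moreover have "holes \<alpha> p S.PQ = Hnu p \<nu>"
      using PQ_ys_solution(4) Hnu_eq(1)[of \<nu> p] pH by (simp add: H_def Hs_def)
    ultimately show ?thesis using pH PQ_ys_solution(1-3) by blast
  qed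
  have "p2 H Nm \<ge> 1" using p2_ge_p1[of H Nm] gam_nonneg[of H] Tb_pos tc(1)
    unfolding p1_def by (smt (verit) divide_nonneg_pos mult_nonneg_nonneg of_nat_0_le_iff)
  then have "p0 > 0" using gam_nonneg[of H] by (simp add: p0_def)
  moreover have "4 * Bc H Nm * Kd / tc > 0" using consts_pos(8)[of H Nm] Kd_pos tc(1) by simp
  ultimately show ?thesis using main unfolding H_def Hs_def by blast
qed

theorem theorem5p8:
  fixes \<alpha> :: real and N :: nat and \<nu> :: "nat list"
  assumes "\<alpha> > 1" and "is_partition N \<nu>"
  shows "\<exists>p0>0. \<exists>Qf :: real \<Rightarrow> complex \<Rightarrow> complex.
    (\<forall>p\<ge>p0. bae_solution \<alpha> p (Qf p) \<and> purely_real (Qf p) \<and> normalised \<alpha> (Qf p)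
        \<and> holes \<alpha> p (Qf p) = Hnu p \<nu>
        \<and> (\<forall>Q. bae_solution \<alpha> p Q \<and> purely_real Q \<and> normalised \<alpha> Q
               \<and> holes \<alpha> p Q = Hnu p \<nu> \<longrightarrow> Q = Qf p)) \<and>
    (\<exists>C :: real \<Rightarrow> real. \<exists>M>0. (\<forall>y. 0 \<le> C y) \<and> bounded (range C) \<and>
        (\<forall>\<epsilon>>0. C \<in> O[at_top](\<lambda>y. y powr (-2 + \<epsilon>))) \<and>
        (\<forall>p\<ge>p0. \<forall>k \<in> Zp p - Hnu p \<nu>.
           \<bar>xk \<alpha> p (Qf p) k / xhat \<alpha> p (length \<nu>) k - 1\<bar>
             \<le> M * C (real_of_int k / p) * p powr (-2))) \<and>
    (\<forall>k::int. \<exists>Ck. \<forall>p\<ge>p0. k \<in> Zp p - Hnu p \<nu> \<longrightarrow>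
        \<bar>xk \<alpha> p (Qf p) k * p powr (- (2 * \<alpha> / (1 + \<alpha>)))
          - Aconst \<alpha> * (1 + sqrt 2 * \<alpha> / (1 + \<alpha>) powr (3 / 2) * (real_of_int k + 1 / 2) / p)\<bar>
          \<le> Ck * p powr (-2))"
proof -
  interpret bae \<alpha> by unfold_locales (rule assms(1))
  have sorted: "sorted \<nu>" using assms(2) by (simp add: is_partition_def)
  let ?H = "length \<nu>"
  \<comment> \<open>One predicate for existence and both estimates, so that a single choice
    \<open>Qf p\<close> satisfies all of them.\<close>
  define good where "good p M C Q \<longleftrightarrow> bae_solution \<alpha> p Q \<and> purely_real Q \<and> normalised \<alpha> Q \<and> holes \<alpha> p Q = Hnu p \<nu> \<and>
    (\<forall>n. n \<notin> hole_indices \<nu> \<longrightarrow>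
      \<bar>xk \<alpha> p Q (int n - int ?H) / xhat \<alpha> p ?H (int n - int ?H) - 1\<bar>
        \<le> M * decay (real_of_int (int n - int ?H) / p) * p powr (-2) \<and>
      \<bar>xk \<alpha> p Q (int n - int ?H) * p powr (- (1 / ex))
        - Aconst \<alpha> * (1 + (real n - real ?H + 1 / 2) / (p * T1 0))\<bar> \<le> C n * p powr (-2))"
    for p M and C :: "nat \<Rightarrow> real" and Q
  obtain p0 M and C :: "nat \<Rightarrow> real" where p0: "p0 > 0" and M: "M > 0"
    and ex: "\<And>p. p \<ge> p0 \<Longrightarrow> real ?H \<le> p" "\<And>p. p \<ge> p0 \<Longrightarrow> \<exists>Q. good p M C Q"
    using solution_exists[OF sorted] unfolding good_def by blast
  define Qf where "Qf p = (SOME Q. good p M C Q)" for p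
  have Qf: "good p M C (Qf p)" if "p \<ge> p0" for p
    unfolding Qf_def by (rule someI_ex[OF ex(2)[OF that]])
  have index: "\<exists>n. n \<notin> hole_indices \<nu> \<and> k = int n - int ?H" if "p \<ge> p0" "k \<in> Zp p - Hnu p \<nu>" for p k
    using that(2) unfolding Hnu_eq(2)[OF ex(1)[OF that(1)]] by blast
  \<comment> \<open>The coefficient in (ii) is the reciprocal of the slope of \<open>\<tau>\<close>
    at the bottom of the well.\<close>
  have T1_inv: "1 / T1 0 = sqrt 2 * \<alpha> / (1 + \<alpha>) powr (3 / 2)"
  proof -
    have "(1 + \<alpha>) powr (3 / 2) = (1 + \<alpha>) powr 1 * (1 + \<alpha>) powr (1 / 2)" by (subst powr_add[symmetric]) simp
    then show ?thesis using assms(1) by (simp add: T1_0 powr_half_sqrt)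
  qed
  show ?thesis
  proof (intro exI conjI allI impI ballI)
    show "p0 > 0" "M > 0" by (rule p0 M)+
    fix p assume p: "p \<ge> p0"
    show "bae_solution \<alpha> p (Qf p)" "purely_real (Qf p)" "normalised \<alpha> (Qf p)" "holes \<alpha> p (Qf p) = Hnu p \<nu>"
      using Qf[OF p] by (simp_all add: good_def)
    fix Q assume "bae_solution \<alpha> p Q \<and> purely_real Q \<and> normalised \<alpha> Q \<and> holes \<alpha> p Q = Hnu p \<nu>"
    then show "Q = Qf p" using Qf[OF p] unfolding good_def by (intro solution_unique[of p]) auto
  next
    show "0 \<le> decay y" for y by (rule decay_bounds)
    show "bounded (range decay)"
      by (rule boundedI[of _ 1]) (use decay_bounds in auto)
    show "decay \<in> O[at_top](\<lambda>y. y powr (-2 + \<epsilon>))" if "\<epsilon> > 0" for \<epsilon> by (rule decay_bigo[OF that])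
    fix p k assume p: "p \<ge> p0" and k: "k \<in> Zp p - Hnu p \<nu>"
    obtain n where "n \<notin> hole_indices \<nu>" "k = int n - int ?H" using index[OF p k] by blast
    then show "\<bar>xk \<alpha> p (Qf p) k / xhat \<alpha> p ?H k - 1\<bar> \<le> M * decay (real_of_int k / p) * p powr (-2)"
      using Qf[OF p] by (simp add: good_def)
  next
    fix k :: int and p assume p: "p \<ge> p0" and k: "k \<in> Zp p - Hnu p \<nu>"
    obtain n where n: "n \<notin> hole_indices \<nu>" "k = int n - int ?H" using index[OF p k] by blast
    have "\<bar>xk \<alpha> p (Qf p) k * p powr (- (1 / local.ex)) - Aconst \<alpha> * (1 + (real n - real ?H + 1 / 2) / (p * T1 0))\<bar> \<le> C n * p powr (-2)"
      using Qf[OF p] n by (simp add: good_def)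
    moreover have "(real n - real ?H + 1 / 2) / (p * T1 0) = 1 / T1 0 * (real_of_int k + 1 / 2) / p"
      by (simp add: n)
    \<comment> \<open>Expressing \<open>n\<close> through \<open>k\<close> lets the constant for
      \<open>k\<close> be chosen before \<open>p\<close>.\<close>
    moreover have "n = nat (k + int ?H)" using n by simp
    ultimately show "\<bar>xk \<alpha> p (Qf p) k * p powr (- (2 * \<alpha> / (1 + \<alpha>)))
          - Aconst \<alpha> * (1 + sqrt 2 * \<alpha> / (1 + \<alpha>) powr (3 / 2) * (real_of_int k + 1 / 2) / p)\<bar>
          \<le> C (nat (k + int ?H)) * p powr (-2)"
      by (simp only: inverse_ex T1_inv)
  qed
qed

end
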